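(* Let $f\in C_c^\infty(\mathbb{R})$ be even and real-valued, and let $\Phi\in C_c^\infty(0,\infty)$ be real-valued. Fix $\lambda>1$ and set $K=X^{\lambda}$. Then, as $X\to\infty$, $$\frac{\mathrm{Var}(\psi_{K,X})}{C_f X^{1-\lambda}} = C_\Phi\log X + C'_\Phi + \pi^2\,\tilde\Phi\!\left(\tfrac12\right)^2 + o(1).$$ Moreover, under the Generalized Riemann Hypothesis, the error term $o(1)$ can be improved to $O_\Phi(X^{-\epsilon})$ for some $\epsilon>0$ (depending on $\lambda$).
   Context: Work in the Gaussian integers $\mathbb{Z}[i]$. For a nonzero ideal $\mathfrak a=\langle\alpha\rangle$, its norm is $N(\mathfrak a)=\alpha\bar\alpha$, and $\theta_{\mathfrak a}\in[0,\pi/2)$ denotes the argument of the (unique) generator $\alpha$ of $\mathfrak a$ whose argument lies in $[0,\pi/2)$. The von Mangoldt function on ideals is $\Lambda(\mathfrak a)=\log N(\mathfrak p)$ if $\mathfrak a=\mathfrak p^r$ for a prime ideal $\mathfrak p$ and $r\ge1$, and $\Lambda(\mathfrak a)=0$ otherwise. For $K\gg1$ define the $\pi/2$-periodic function $F_K(\theta)=\sum_{k\in\mathbb{Z}} f\!\left(\frac{K}{\pi/2}\left(\theta-\frac{\pi}{2}k\right)\right)$. The Mellin transform is $\tilde\Phi(s)=\int_0^\infty\Phi(x)x^{s-1}\,dx$. Define $$\psi_{K,X}(\theta)=\sum_{\mathfrak a\neq 0}\Phi\!\left(\frac{N(\mathfrak a)}{X}\right)\Lambda(\mathfrak a)F_K(\theta_{\mathfrak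 a}-\theta),$$ the sum over all nonzero ideals of $\mathbb{Z}[i]$, its mean $\langle\psi_{K,X}\rangle=\frac{1}{\pi/2}\int_0^{\pi/2}\psi_{K,X}(\theta)\,d\theta$, and $\mathrm{Var}(\psi_{K,X})=\frac{1}{\pi/2}\int_0^{\pi/2}\left|\psi_{K,X}(\theta)-\langle\psi_{K,X}\rangle\right|^2d\theta$. Constants: $C_f=\frac{1}{4\pi^2}\int_{\mathbb{R}}f(y)^2\,dy$, $C_\Phi=4\pi^2\int_0^\infty\Phi(u)^2\,du$, and $C'_\Phi=4\pi^2\int_0^\infty \log x\,\Phi(x)^2\,dx$. *)

theory Defs
  imports
    "HOL-Analysis.Analysis"
    "HOL-Algebra.Ideal_Product"
    "HOL-Library.Landau_Symbols"
begin

definition gauss_ring :: "complex ring" where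
  "gauss_ring =
     \<lparr>carrier = {z. Re z \<in> \<int> \<and> Im z \<in> \<int>}, mult = (*), one = 1, zero = 0, add = (+)\<rparr>"

definition gauss_ideals :: "complex set set" where
  "gauss_ideals = {I. ideal I gauss_ring \<and> I \<noteq> {\<zero>\<^bsub>gauss_ring\<^esub>}}"

definition ideal_gen :: "complex set \<Rightarrow> complex" where
  "ideal_gen I =
     (THE \<alpha>. \<alpha> \<in> carrier gauss_ring \<and> I = PIdl\<^bsub>gauss_ring\<^esub> \<alpha> \<and> 0 \<le> Arg \<alpha> \<and> Arg \<alpha> < pi / 2)"

definition ideal_angle :: "complex set \<Rightarrow> real" where
  "ideal_angle I = Arg (ideal_gen I)"

text \<open>The product \<open>\<alpha> * cnj \<alpha>\<close> is a nonnegative real; \<open>Re\<close> only changes its type.\<close>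

definition ideal_norm :: "complex set \<Rightarrow> real" where
  "ideal_norm I = Re (ideal_gen I * cnj (ideal_gen I))"

text \<open>Powers are taken in the monoid of ideals under ideal multiplication.\<close>

definition is_power_of_prime :: "complex set \<Rightarrow> complex set \<Rightarrow> bool" where
  "is_power_of_prime I P \<longleftrightarrow>
     P \<in> gauss_ideals \<and> primeideal P gauss_ring \<and>
     (\<exists>r::nat. 1 \<le> r \<and> I = P [^]\<^bsub>ideals_set gauss_ring\<^esub> r)"

definition von_mangoldt :: "complex set \<Rightarrow> real" where
  "von_mangoldt I =
     (if \<exists>P. is_power_of_prime I P then ln (ideal_norm (THE P. is_power_of_prime I P)) else 0)"

definition smooth :: "(real \<Rightarrow> real) \<Rightarrow> bool" where
  "smooth g \<longleftrightarrow> (\<forall>n x. (deriv ^^ n) g differentiable (at x))"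

definition support :: "(real \<Rightarrow> real) \<Rightarrow> real set" where
  "support g = closure {x. g x \<noteq> 0}"

text \<open>For \<open>S\<close> open, the members of \<open>test_functions S\<close> are the smooth functions on \<open>S\<close> with
  compact support in \<open>S\<close>, extended by zero to the whole line.\<close>

definition test_functions :: "real set \<Rightarrow> (real \<Rightarrow> real) set" where
  "test_functions S = {g. smooth g \<and> compact (support g) \<and> support g \<subseteq> S}"

definition sector_weight :: "(real \<Rightarrow> real) \<Rightarrow> real \<Rightarrow> real \<Rightarrow> real" where
  "sector_weight f K \<theta> = (\<Sum>\<^sub>\<infinity>k\<in>(UNIV :: int set). f (K / (pi / 2) * (\<theta> - pi / 2 * of_int k)))"

definition psi ::
  "(real \<Rightarrow> real) \<Rightarrow> (real \<Rightarrow> real) \<Rightarrow> real \<Rightarrow> real \<Rightarrow> real \<Rightarrow> real" where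
  "psi f \<Phi> K X \<theta> =
     (\<Sum>\<^sub>\<infinity>I\<in>gauss_ideals.
        \<Phi> (ideal_norm I / X) * von_mangoldt I * sector_weight f K (ideal_angle I - \<theta>))"

definition psi_mean :: "(real \<Rightarrow> real) \<Rightarrow> (real \<Rightarrow> real) \<Rightarrow> real \<Rightarrow> real \<Rightarrow> real" where
  "psi_mean f \<Phi> K X = 1 / (pi / 2) * (LINT \<theta>:{0..pi / 2}|lborel. psi f \<Phi> K X \<theta>)"

definition psi_var :: "(real \<Rightarrow> real) \<Rightarrow> (real \<Rightarrow> real) \<Rightarrow> real \<Rightarrow> real \<Rightarrow> real" where
  "psi_var f \<Phi> K X =
     1 / (pi / 2) *
       (LINT \<theta>:{0..pi / 2}|lborel. \<bar>psi f \<Phi> K X \<theta> - psi_mean f \<Phi> K X\<bar>\<^sup>2)"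

definition mellin :: "(real \<Rightarrow> real) \<Rightarrow> real \<Rightarrow> real" where
  "mellin \<Phi> s = (LINT x:{0<..}|lborel. \<Phi> x * x powr (s - 1))"

definition C_angle :: "(real \<Rightarrow> real) \<Rightarrow> real" where
  "C_angle f = 1 / (4 * pi\<^sup>2) * (LINT y|lborel. (f y)\<^sup>2)"

definition C_norm :: "(real \<Rightarrow> real) \<Rightarrow> real" where
  "C_norm \<Phi> = 4 * pi\<^sup>2 * (LINT u:{0<..}|lborel. (\<Phi> u)\<^sup>2)"

definition C_norm' :: "(real \<Rightarrow> real) \<Rightarrow> real" where
  "C_norm' \<Phi> = 4 * pi\<^sup>2 * (LINT x:{0<..}|lborel. ln x * (\<Phi> x)\<^sup>2)"

definition hecke_char :: "int \<Rightarrow> complex set \<Rightarrow> complex" where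
  "hecke_char k I = (ideal_gen I / cnj (ideal_gen I)) powi (2 * k)"

definition hecke_series :: "int \<Rightarrow> complex \<Rightarrow> complex" where
  "hecke_series k s =
     (\<Sum>\<^sub>\<infinity>I\<in>gauss_ideals. hecke_char k I * complex_of_real (ideal_norm I) powr (- s))"

text \<open>\<open>hecke_L k\<close> is the analytic continuation of the Hecke \<open>L\<close>-series from \<open>Re s > 1\<close> to
  \<open>Re s > 0\<close> (minus the point \<open>1\<close>, where the series for \<open>k = 0\<close>, the Dedekind zeta function, has
  its pole). By the identity theorem the choice is unique on this connected set, which contains
  the critical strip.\<close>

definition hecke_L :: "int \<Rightarrow> complex \<Rightarrow> complex" where
  "hecke_L k =
     (SOME L. L holomorphic_on ({s. 0 < Re s} - {1}) \<and>
              (\<forall>s. 1 < Re s \<longrightarrow> L s = hecke_series k s))"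

definition GRH :: bool where
  "GRH \<longleftrightarrow>
     (\<forall>k s. 0 < Re s \<and> Re s < 1 \<and> hecke_L k s = 0 \<longrightarrow> Re s = 1 / 2)"

end

theory Submission
  imports Defs "HOL-Probability.Probability" "HOL-Complex_Analysis.Complex_Analysis" "HOL-Number_Theory.Number_Theory"
begin

text \<open>Two ideals of norm at most \<open>b * X\<close> with different angles have angles at distance at least
  \<open>1 / (b * X)\<close>. Since \<open>K = X powr l\<close> with \<open>l > 1\<close>, the corresponding translates of the sector
  weight are eventually disjoint, and the second moment of \<open>psi\<close> is \<open>1 / K\<close> times the integral of
  \<open>f\<^sup>2\<close> times the sum of the products of weights over all pairs of prime powers with equal angles;
  the square of the mean is of smaller order. A power of a split prime shares its angle with no other
  prime power, so the split primes contribute the sum of the squared weights, which produces the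
  terms \<open>C_norm\<close> and \<open>C_norm'\<close>. The inert primes and the even powers of \<open>1 + \<i>\<close> all have angle \<open>0\<close>;
  they contribute the square of one sum, whose main term is half the Mellin transform at \<open>1 / 2\<close> times
  the square root of \<open>X\<close>. Both sums reduce to smoothly weighted sums over rational primes twisted by
  the character modulo 4, which Laplace inversion expresses through the logarithmic derivatives of the
  zeta function and of the L-function on the line \<open>Re s = 1\<close>, or on \<open>Re s = 3 / 4\<close> under the Riemann
  hypothesis.\<close>

subsection \<open>Smooth compactly supported functions and their Laplace transforms\<close>

text \<open>Smoothness of the weight makes its Laplace transform decay faster than every power on
  vertical lines. The logarithmic derivatives are therefore needed only up to polynomial growth, and
  no zeros are counted. The squared weight of a split prime contains (log p)^2, which is y + (log p
  - y) times a single log p, where y = log X. The factor y demands an error o(1/y) relative to the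
  main term. One integration by parts on Re s = 1 followed by the Riemann-Lebesgue lemma supplies
  it, at the price of polynomial bounds for the derivative of the logarithmic derivative, hence of a
  quantitative lower bound on that line. The lower bound is proved for the product of zeta and the
  L-function, because only the product has a logarithmic derivative with nonnegative coefficients.
  Up to a nonzero constant this product is also the Dedekind zeta function with its pole removed,
  which is how the hypothesis reaches the rational sums. The constant arises because the two
  functions are compared through their logarithmic derivatives, prime by prime.\<close>

coinductive infdiff :: "(real \<Rightarrow> real) \<Rightarrow> bool" where
  "(\<And>x. (f has_real_derivative f' x) (at x)) \<Longrightarrow> infdiff f' \<Longrightarrow> infdiff f"

text \<open>The radius \<open>R\<close> is carried along because the pole at 1 contributes its exact
  main term only for arguments \<open>y\<close> beyond it
  (\<open>vertical_integral_pole\<close>).\<close>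

definition bump :: "real \<Rightarrow> (real \<Rightarrow> real) \<Rightarrow> bool" where
  "bump R f \<longleftrightarrow> infdiff f \<and> 0 < R \<and> (\<forall>x. R \<le> \<bar>x\<bar> \<longrightarrow> f x = 0)"

lemma infdiff_derivative: "infdiff f \<Longrightarrow> \<exists>f'. (\<forall>x. (f has_real_derivative f' x) (at x)) \<and> infdiff f'"
  by (subst (asm) infdiff.simps) blast

lemma bump_mono: "bump R f \<Longrightarrow> R \<le> R' \<Longrightarrow> bump R' f"
  by (auto simp: bump_def)

text \<open>Around a point with |x| >= R + 1 the function is zero on a whole neighbourhood, so its
  derivative there is that of a constant. This is why the radius grows by one.\<close>

lemma bump_derivative:
  assumes "bump R f"
  obtains f' where "\<And>x. (f has_real_derivative f' x) (at x)" "bump (R + 1) f'"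
proof -
  from assms have "infdiff f" by (simp add: bump_def)
  then obtain f' where f': "\<And>x. (f has_real_derivative f' x) (at x)" "infdiff f'" using infdiff_derivative by blast
  have "f' x = 0" if x: "R + 1 \<le> \<bar>x\<bar>" for x
  proof -
    have "((\<lambda>_. 0) has_real_derivative f' x) (at x)"
    proof (rule DERIV_cong_ev[THEN iffD1, OF refl _ refl f'(1)])
      have "open {y. R < \<bar>y\<bar>}" by (intro open_Collect_less continuous_intros)
      then show "\<forall>\<^sub>F y in nhds x. f y = 0"
        using x assms by (intro eventually_mono[OF eventually_nhds_in_open[of "{y. R < \<bar>y\<bar>}"]])
          (auto simp: bump_def)
    qed
    then show ?thesis using DERIV_unique[OF _ DERIV_const] by blast
  qed
  then show ?thesis using assms f' by (intro that[of f']) (auto simp: bump_def)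
qed

lemma bump_continuous: "bump R f \<Longrightarrow> continuous_on A f"
  by (metis bump_derivative DERIV_isCont continuous_at_imp_continuous_on)

text \<open>The coinductive form of smoothness turns any set closed under differentiation into an
  invariant, so no induction on the order of a derivative occurs.\<close>

lemma infdiff_coinduct_set:
  assumes "f \<in> S"
    and "\<And>f. f \<in> S \<Longrightarrow> \<exists>f' \<in> S. \<forall>x. (f has_real_derivative f' x) (at x)"
  shows "infdiff f"
  using assms(1)
proof (coinduction arbitrary: f)
  case infdiff
  then obtain f' where "f' \<in> S" "\<forall>x. (f has_real_derivative f' x) (at x)" using assms(2) by blast
  then show ?case by (intro exI[of _ f] exI[of _ f']) simp
qed

text \<open>An algebra whose generators have their derivatives in it consists of smooth functions; this
  replaces the Leibniz and chain rules for higher derivatives.\<close>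

inductive_set algebra_closure :: "(real \<Rightarrow> real) set \<Rightarrow> (real \<Rightarrow> real) set" for G where
  gen: "f \<in> G \<Longrightarrow> f \<in> algebra_closure G"
| add: "f \<in> algebra_closure G \<Longrightarrow> g \<in> algebra_closure G \<Longrightarrow> (\<lambda>x. f x + g x) \<in> algebra_closure G"
| mult: "f \<in> algebra_closure G \<Longrightarrow> g \<in> algebra_closure G \<Longrightarrow> (\<lambda>x. f x * g x) \<in> algebra_closure G"

lemma algebra_closure_derivative:
  assumes "f \<in> algebra_closure G"
    and G: "\<And>f. f \<in> G \<Longrightarrow> \<exists>f' \<in> algebra_closure G. \<forall>x. (f has_real_derivative f' x) (at x)"
  shows "\<exists>f' \<in> algebra_closure G. \<forall>x. (f has_real_derivative f' x) (at x)"
  using assms(1)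
proof induction
  case (add f g)
  then obtain f' g' where d: "f' \<in> algebra_closure G" "g' \<in> algebra_closure G"
    "\<forall>x. (f has_real_derivative f' x) (at x)" "\<forall>x. (g has_real_derivative g' x) (at x)" by blast
  then show ?case by (intro bexI[of _ "\<lambda>x. f' x + g' x"] algebra_closure.add allI DERIV_add) auto
next
  case (mult f g)
  then obtain f' g' where d: "f' \<in> algebra_closure G" "g' \<in> algebra_closure G"
    "\<forall>x. (f has_real_derivative f' x) (at x)" "\<forall>x. (g has_real_derivative g' x) (at x)" by blast
  then show ?case
    by (intro bexI[of _ "\<lambda>x. f' x * g x + g' x * f x"] algebra_closure.add algebra_closure.mult allI DERIV_mult mult.hyps) auto
qed (use G in blast)

lemma infdiff_algebra_closure:
  assumes "f \<in> algebra_closure G"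
    and "\<And>f. f \<in> G \<Longrightarrow> \<exists>f' \<in> algebra_closure G. \<forall>x. (f has_real_derivative f' x) (at x)"
  shows "infdiff f"
  using assms(1) by (rule infdiff_coinduct_set) (rule algebra_closure_derivative[OF _ assms(2)])

text \<open>All smooth functions together serve as generators: their derivatives are generators
  again, and sums and products lie in the generated algebra.\<close>

lemma infdiff_add_mult:
  assumes "infdiff f" "infdiff g"
  shows "infdiff (\<lambda>x. f x + g x)" "infdiff (\<lambda>x. f x * g x)"
proof -
  have "infdiff h" if "h \<in> algebra_closure (Collect infdiff)" for h
    using that by (rule infdiff_algebra_closure) (use infdiff_derivative in \<open>blast intro: algebra_closure.gen\<close>)
  then show "infdiff (\<lambda>x. f x + g x)" "infdiff (\<lambda>x. f x * g x)"
    using assms by (simp_all add: algebra_closure.intros)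
qed

lemma infdiff_const: "infdiff (\<lambda>_. c)"
  by (rule infdiff_coinduct_set[of _ "range (\<lambda>c _. c)"]) (auto intro!: exI[of _ 0])

lemma infdiff_id: "infdiff (\<lambda>x. x)"
  by (rule infdiff.intros[of _ "\<lambda>_. 1"]) (auto intro: infdiff_const)

lemma bump_mult_id: "bump R f \<Longrightarrow> bump R (\<lambda>x. x * f x)"
  by (simp add: bump_def infdiff_add_mult infdiff_id)

text \<open>With the positive sign in the exponent this is the Mellin transform of f(log x), by x =
  exp u.\<close>

definition laplace :: "(real \<Rightarrow> real) \<Rightarrow> complex \<Rightarrow> complex" where
  "laplace f s = (LINT u|lborel. of_real (f u) * exp (s * of_real u))"

lemma laplace_integrable:
  assumes "bump R f"
  shows "integrable lborel (\<lambda>u. of_real (f u) * exp (s * of_real u))"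
    and "laplace f s = integral {-R..R} (\<lambda>u. of_real (f u) * exp (s * of_real u))"
proof -
  let ?g = "\<lambda>u. complex_of_real (f u) * exp (s * of_real u)"
  have eq: "indicat_real {-R..R} u *\<^sub>R ?g u = ?g u" for u
    using assms by (auto simp: bump_def indicator_def)
  have si: "set_integrable lborel {-R..R} ?g"
    using assms by (intro borel_integrable_atLeastAtMost' continuous_intros bump_continuous) auto
  then show "integrable lborel ?g" unfolding set_integrable_def eq .
  show "laplace f s = integral {-R..R} ?g"
    unfolding laplace_def using set_borel_integral_eq_integral(2)[OF si]
    by (simp only: set_lebesgue_integral_def eq)
qed

lemma laplace_derivative:
  assumes "bump R f"
  shows "(laplace f has_field_derivative laplace (\<lambda>u. u * f u) s) (at s)"
proof -
  have "((\<lambda>s. integral (cbox (-R) R) (\<lambda>u. complex_of_real (f u) * exp (s * of_real u))) has_field_derivative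
      integral (cbox (-R) R) (\<lambda>u. of_real (f u) * (of_real u * exp (s * of_real u)))) (at s within UNIV)"
  proof (rule leibniz_rule_field_derivative)
    fix x :: complex
    show "(\<lambda>u. of_real (f u) * exp (x * of_real u)) integrable_on cbox (-R) R"
      by (intro integrable_continuous continuous_intros bump_continuous[OF assms])
    show "((\<lambda>x. of_real (f t) * exp (x * of_real t)) has_field_derivative
        of_real (f t) * (of_real t * exp (x * of_real t))) (at x within UNIV)" for t
      by (auto intro!: derivative_eq_intros)
    show "continuous_on (UNIV \<times> cbox (- R) R) (\<lambda>(x, t). complex_of_real (f t) * (of_real t * exp (x * of_real t)))"
      unfolding case_prod_beta
      by (intro continuous_intros continuous_on_compose2[OF bump_continuous[OF assms, of UNIV]]) auto
  qed auto
  then show ?thesis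
    using laplace_integrable(2)[OF assms] laplace_integrable(2)[OF bump_mult_id[OF assms]]
    by (simp add: fun_eq_iff ac_simps cong: DERIV_cong_ev) (simp add: laplace_integrable(2)[OF assms, abs_def] mult_ac)
qed

lemma laplace_by_parts:
  assumes "bump R f" and f': "\<And>x. (f has_real_derivative f' x) (at x)" "bump (R + 1) f'"
  shows "s * laplace f s = - laplace f' s"
proof -
  let ?R = "R + 1"
  have b: "bump ?R f" using assms(1) bump_mono by force
  have "((\<lambda>u. of_real (f' u) * exp (s * of_real u) + s * (of_real (f u) * exp (s * of_real u))) has_integral
      of_real (f ?R) * exp (s * of_real ?R) - of_real (f (- ?R)) * exp (s * of_real (- ?R))) {- ?R..?R}"
  proof (rule fundamental_theorem_of_calculus)
    show "- ?R \<le> ?R" using assms by (auto simp: bump_def)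
    fix x assume "x \<in> {- ?R..?R}"
    show "((\<lambda>u. of_real (f u) * exp (s * of_real u)) has_vector_derivative
      of_real (f' x) * exp (s * of_real x) + s * (of_real (f x) * exp (s * of_real x))) (at x within {- ?R..?R})"
      by (rule has_vector_derivative_at_within)
        (auto simp: f'(1) intro!: derivative_eq_intros has_vector_derivative_real_field
           has_vector_derivative_of_real[OF f'(1)])
  qed
  moreover have "f ?R = 0" "f (- ?R) = 0" using b by (auto simp: bump_def)
  ultimately have "integral {- ?R..?R} (\<lambda>u. of_real (f' u) * exp (s * of_real u) + s * (of_real (f u) * exp (s * of_real u))) = 0"
    by (auto dest: integral_unique)
  moreover have "(\<lambda>u. of_real (f' u) * exp (s * of_real u)) integrable_on {- ?R..?R}"
    "(\<lambda>u. s * (of_real (f u) * exp (s * of_real u))) integrable_on {- ?R..?R}"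
    by (intro integrable_continuous_real continuous_intros bump_continuous[OF b] bump_continuous[OF f'(2)])+
  ultimately have "laplace f' s + s * laplace f s = 0"
    unfolding laplace_integrable(2)[OF f'(2)] laplace_integrable(2)[OF b] by (subst (asm) integral_add) auto
  then show ?thesis by (simp add: eq_neg_iff_add_eq_0 add.commute)
qed

text \<open>Each integration by parts trades a factor s for a derivative of \<open>f\<close>, which
  is again a bump of larger radius; hence the induction generalises over \<open>f\<close> and
  \<open>R\<close>. The base case holds because the support is compact and Re s is bounded.\<close>

lemma laplace_decay_norm:
  assumes "bump R f"
  shows "\<exists>C. \<forall>s. \<bar>Re s\<bar> \<le> B \<longrightarrow> norm s ^ n * norm (laplace f s) \<le> C"
  using assms
proof (induction n arbitrary: R f)
  case 0
  have R: "0 < R" using 0 by (auto simp: bump_def)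
  have "compact (f ` {-R..R})" using bump_continuous[OF 0] by (intro compact_continuous_image) auto
  then obtain M where M: "\<And>u. u \<in> {-R..R} \<Longrightarrow> \<bar>f u\<bar> \<le> M"
    by (metis (no_types, lifting) bounded_iff compact_imp_bounded imageI real_norm_def)
  have "norm (laplace f s) \<le> M * exp (\<bar>B\<bar> * R) * (2 * R)" if "\<bar>Re s\<bar> \<le> B" for s
  proof -
    have "norm (integral (cbox (-R) R) (\<lambda>u. of_real (f u) * exp (s * of_real u))) \<le> M * exp (\<bar>B\<bar> * R) * measure lborel (cbox (-R) R)"
    proof (rule integrable_bound)
      show "0 \<le> M * exp (\<bar>B\<bar> * R)" using M[of 0] R by auto
      show "(\<lambda>u. complex_of_real (f u) * exp (s * of_real u)) integrable_on cbox (-R) R"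
        by (intro integrable_continuous continuous_intros bump_continuous[OF 0])
      fix u assume u: "u \<in> cbox (-R) R"
      have "Re s * u \<le> \<bar>Re s\<bar> * \<bar>u\<bar>" by (metis abs_ge_self abs_mult)
      also have "\<dots> \<le> \<bar>B\<bar> * R" using that u by (intro mult_mono) auto
      finally show "norm (complex_of_real (f u) * exp (s * of_real u)) \<le> M * exp (\<bar>B\<bar> * R)"
        using M[of u] u by (auto simp: norm_mult intro!: mult_mono)
    qed
    then show ?thesis using R by (simp add: laplace_integrable(2)[OF 0])
  qed
  then show ?case by auto
next
  case (Suc n)
  obtain f' where f': "\<And>x. (f has_real_derivative f' x) (at x)" "bump (R + 1) f'"
    using bump_derivative[OF Suc.prems] by blast
  obtain C where "\<forall>s. \<bar>Re s\<bar> \<le> B \<longrightarrow> norm s ^ n * norm (laplace f' s) \<le> C"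
    using Suc.IH[OF f'(2)] by blast
  moreover have "norm s * norm (laplace f s) = norm (laplace f' s)" for s
    using laplace_by_parts[OF Suc.prems f'] by (metis norm_mult norm_minus_cancel)
  ultimately show ?case by (intro exI[of _ C]) (metis (no_types, lifting) mult.assoc mult.left_commute mult.commute power_Suc)
qed

lemma laplace_decay:
  assumes "bump R f"
  obtains C where "\<And>s. \<bar>Re s\<bar> \<le> B \<Longrightarrow> norm (laplace f s) \<le> C / (1 + \<bar>Im s\<bar>) ^ n"
proof -
  obtain C0 where C0: "\<forall>s. \<bar>Re s\<bar> \<le> B \<longrightarrow> norm s ^ 0 * norm (laplace f s) \<le> C0"
    using laplace_decay_norm[OF assms] by blast
  obtain C1 where C1: "\<forall>s. \<bar>Re s\<bar> \<le> B \<longrightarrow> norm s ^ n * norm (laplace f s) \<le> C1"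
    using laplace_decay_norm[OF assms] by blast
  show ?thesis
  proof (rule that)
    fix s :: complex assume s: "\<bar>Re s\<bar> \<le> B"
    \<comment> \<open>The bound with exponent 0 controls small s, the one with exponent n large s.
      Passing from |s| to 1 + |Im s| costs the factor 2^n.\<close>
    have "(1 + \<bar>Im s\<bar>) ^ n \<le> (2 * max 1 (norm s)) ^ n"
      using abs_Im_le_cmod[of s] by (intro power_mono) auto
    also have "\<dots> \<le> 2 ^ n * (1 + norm s ^ n)"
      by (auto simp: power_mult_distrib max_def)
    finally have "(1 + \<bar>Im s\<bar>) ^ n * norm (laplace f s) \<le> 2 ^ n * (1 + norm s ^ n) * norm (laplace f s)"
      by (intro mult_right_mono) auto
    also have "\<dots> = 2 ^ n * (norm (laplace f s) + norm s ^ n * norm (laplace f s))" by (simp add: algebra_simps)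
    also have "\<dots> \<le> 2 ^ n * (C0 + C1)" using C0 C1 s by (intro mult_left_mono add_mono) auto
    finally show "norm (laplace f s) \<le> (2 ^ n * (C0 + C1)) / (1 + \<bar>Im s\<bar>) ^ n"
      by (simp add: field_simps)
  qed
qed

section \<open>Integrability on vertical lines and inversion of the transform\<close>

lemma integrable_inverse_quadratic: "integrable lborel (\<lambda>t::real. 1 / (1 + \<bar>t\<bar>)\<^sup>2)"
proof (rule Bochner_Integration.integrable_bound)
  have "set_integrable lborel (einterval (-\<infinity>) \<infinity>) (\<lambda>x::real. inverse (1 + x\<^sup>2))"
    using integrable_inverse_1_plus_square by simp
  then show "integrable lborel (\<lambda>x::real. inverse (1 + x\<^sup>2))"
    by (simp add: set_integrable_def einterval_def)
  show "AE t in lborel. norm (1 / (1 + \<bar>t\<bar>)\<^sup>2) \<le> norm (inverse (1 + (t::real)\<^sup>2))"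
  proof (rule AE_I2)
    fix t :: real
    have "1 + t\<^sup>2 \<le> (1 + \<bar>t\<bar>)\<^sup>2" by (simp add: power2_sum)
    moreover have "0 < 1 + t\<^sup>2" by (simp add: add_pos_nonneg)
    ultimately show "norm (1 / (1 + \<bar>t\<bar>)\<^sup>2) \<le> norm (inverse (1 + t\<^sup>2))"
      by (simp add: inverse_eq_divide frac_le)
  qed
qed auto

lemma continuous_decay_integrable:
  fixes h :: "real \<Rightarrow> complex"
  assumes "continuous_on UNIV h" "\<And>t. norm (h t) \<le> C / (1 + \<bar>t\<bar>)\<^sup>2"
  shows "integrable lborel h"
proof (rule Bochner_Integration.integrable_bound)
  show "integrable lborel (\<lambda>t. C * (1 / (1 + \<bar>t\<bar>)\<^sup>2))"
    by (intro integrable_mult_right integrable_inverse_quadratic)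
  show "h \<in> borel_measurable lborel" using assms by (simp add: borel_measurable_continuous_onI)
  have "norm (h t) \<le> norm (C * (1 / (1 + \<bar>t\<bar>)\<^sup>2))" for t by (rule order_trans[OF assms(2)]) (simp add: divide_right_mono)
  then show "AE t in lborel. norm (h t) \<le> norm (C * (1 / (1 + \<bar>t\<bar>)\<^sup>2))" by auto
qed

lemma laplace_continuous: "bump R f \<Longrightarrow> continuous_on A (laplace f)"
  by (meson DERIV_isCont laplace_derivative continuous_at_imp_continuous_on)

lemma laplace_vertical_integrable:
  assumes "bump R f" shows "integrable lborel (\<lambda>t. laplace f (Complex c t))"
proof -
  obtain C where "\<And>s. \<bar>Re s\<bar> \<le> \<bar>c\<bar> \<Longrightarrow> norm (laplace f s) \<le> C / (1 + \<bar>Im s\<bar>) ^ 2"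
    using laplace_decay[OF assms] by blast
  then have "norm (laplace f (Complex c t)) \<le> C / (1 + \<bar>t\<bar>) ^ 2" for t
    by (metis abs_ge_self complex.sel order_refl)
  then show ?thesis
    by (intro continuous_decay_integrable[of _ C] continuous_on_compose2[OF laplace_continuous[OF assms, of UNIV]])
      (auto simp: Complex_eq intro!: continuous_intros)
qed

text \<open>The characteristic function of the standard normal law says that the Gaussian is its own
  Fourier transform. Rescaling by \<open>e\<close> turns a wide Gaussian factor into a narrow
  density of width \<open>e\<close>.\<close>

lemma has_bochner_integral_fourier_gaussian:
  fixes w e :: real
  assumes "e > 0"
  shows "integrable lborel (\<lambda>t. exp (\<i> * of_real (t * w)) * of_real (std_normal_density (e * t)))"
    and "(LINT t|lborel. exp (\<i> * of_real (t * w)) * of_real (std_normal_density (e * t))) =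
      of_real (sqrt (2 * pi) / e * std_normal_density (w / e))"
proof -
  have i0: "integrable lborel std_normal_density"
    using integrable_std_normal_moment[of 0] by simp
  have i1: "integrable lborel (\<lambda>x. complex_of_real (std_normal_density x))" using i0 by simp
  have int0: "integrable lborel (\<lambda>x. exp (\<i> * of_real (x * v)) * complex_of_real (std_normal_density x))" for v :: real
    by (rule Bochner_Integration.integrable_bound[OF i1]) (auto simp: norm_mult)
  have "(LINT x|lborel. exp (\<i> * of_real (x * v)) * complex_of_real (std_normal_density x)) = of_real (exp (- (v\<^sup>2) / 2))" for v :: real
  proof -
    have "char std_normal_distribution v = (LINT x|lborel. std_normal_density x *\<^sub>R exp (\<i> * of_real (v * x)))"
      unfolding char_def by (subst integral_density) auto
    then show ?thesis by (simp add: char_std_normal_distribution scaleR_conv_of_real mult.commute)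
  qed
  note this[of "w / e"]
  moreover have "std_normal_density (w / e) = exp (- ((w / e)\<^sup>2) / 2) / sqrt (2 * pi)"
    by (simp add: std_normal_density_def)
  moreover have "(LINT x|lborel. exp (\<i> * of_real (x * (w / e))) * complex_of_real (std_normal_density x)) =
    e *\<^sub>R (LINT t|lborel. exp (\<i> * of_real (t * w)) * of_real (std_normal_density (e * t)))"
    using lborel_integral_real_affine[of e "\<lambda>x. exp (\<i> * of_real (x * (w / e))) * complex_of_real (std_normal_density x)" 0] assms
    by simp
  ultimately show "(LINT t|lborel. exp (\<i> * of_real (t * w)) * of_real (std_normal_density (e * t))) =
      of_real (sqrt (2 * pi) / e * std_normal_density (w / e))"
    using assms by (simp add: scaleR_conv_of_real field_simps)
  show "integrable lborel (\<lambda>t. exp (\<i> * of_real (t * w)) * of_real (std_normal_density (e * t)))"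
    using lborel_integrable_real_affine[OF int0[of "w / e"], of e 0] assms by simp
qed

text \<open>Damping \<open>h\<close> by \<open>std_normal_density (e n * t)\<close> legitimises
  Fubini and turns the integral into an average of \<open>g\<close> around \<open>v\<close> at scale
  \<open>e n\<close>. As \<open>e n\<close> tends to 0 the average tends to \<open>g v\<close>,
  while the damping factor tends to \<open>std_normal_density 0\<close>. Comparing the two limits
  gives two factors sqrt(2 pi), hence 2 pi.\<close>

lemma fourier_inversion:
  fixes g :: "real \<Rightarrow> complex"
  assumes cont: "continuous_on UNIV g" and supp: "\<And>u. R \<le> \<bar>u\<bar> \<Longrightarrow> g u = 0"
  defines "h \<equiv> \<lambda>t. LINT u|lborel. g u * exp (\<i> * of_real (t * u))"
  assumes int: "integrable lborel h"
  shows "(LINT t|lborel. h t * exp (- (\<i> * of_real (t * v)))) = of_real (2 * pi) * g v"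
proof -
  define e :: "nat \<Rightarrow> real" where "e n = inverse (real (Suc n))" for n
  have e: "e n > 0" for n by (simp add: e_def)
  have e0: "e \<longlonglongrightarrow> 0" unfolding e_def by (rule LIMSEQ_inverse_real_of_nat)
  have ig: "integrable lborel g"
  proof -
    have "indicat_real {-R..R} u *\<^sub>R g u = g u" for u using supp[of u] by (auto simp: indicator_def)
    then show ?thesis
      using borel_integrable_compact[of "{-R..R}" g] continuous_on_subset[OF cont] by simp
  qed
  have [measurable]: "g \<in> borel_measurable borel" using cont by (rule borel_measurable_continuous_onI)
  obtain M where M: "\<And>u. norm (g u) \<le> M"
  proof -
    have "compact (g ` {-R..R})" using cont by (intro compact_continuous_image) (auto intro: continuous_on_subset)
    then obtain M where "\<And>u. u \<in> {-R..R} \<Longrightarrow> norm (g u) \<le> M"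
      by (metis (no_types, lifting) bounded_iff compact_imp_bounded imageI)
    then have "norm (g u) \<le> max M 0" for u 
    proof (cases "\<bar>u\<bar> \<le> R")
      case True
      then have "norm (g u) \<le> M" by (intro \<open>\<And>u. u \<in> {-R..R} \<Longrightarrow> norm (g u) \<le> M\<close>) auto
      then show ?thesis by simp
    qed (use supp[of u] in simp)
    then show ?thesis by (rule that)
  qed
  have i0: "integrable lborel std_normal_density"
    using integrable_std_normal_moment[of 0] by simp
  have inn: "integrable lborel (\<lambda>x. std_normal_density (e n * x))" for n
    using lborel_integrable_real_affine[OF i0, of "e n" 0] e[of n] by simp
  define J where "J n = (LINT t|lborel. h t * exp (- (\<i> * of_real (t * v))) * of_real (std_normal_density (e n * t)))" for n
  have J: "J n = of_real (sqrt (2 * pi)) * (LINT x|lborel. g (v + e n * x) * of_real (std_normal_density x))" for n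
  proof -
    let ?F = "\<lambda>t u. g u * exp (\<i> * of_real (t * (u - v))) * of_real (std_normal_density (e n * t))"
    have intF: "integrable (lborel \<Otimes>\<^sub>M lborel) (case_prod ?F)"
    proof (rule lborel_pair.Fubini_integrable)
      have "norm (?F t u) = norm (g u) * std_normal_density (e n * t)" for t u
        by (simp add: norm_mult)
      then have "(\<lambda>t. LINT u|lborel. norm (case_prod ?F (t, u))) = (\<lambda>t. (LINT u|lborel. norm (g u)) * std_normal_density (e n * t))"
        by simp
      then show "integrable lborel (\<lambda>t. LINT u|lborel. norm (case_prod ?F (t, u)))"
        using inn by simp
      have "integrable lborel (\<lambda>u. ?F t u)" for t
        by (rule Bochner_Integration.integrable_bound[OF integrable_norm[OF integrable_mult_right[OF ig, of "of_real (std_normal_density (e n * t))"]]])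
          (auto simp: norm_mult)
      then show "AE t in lborel. integrable lborel (\<lambda>u. case_prod ?F (t, u))" by simp
    qed measurable
    have "J n = (LINT t|lborel. LINT u|lborel. ?F t u)"
      unfolding J_def
    proof (rule Bochner_Integration.integral_cong[OF refl])
      fix t
      have "h t * exp (- (\<i> * of_real (t * v))) * of_real (std_normal_density (e n * t)) =
        (LINT u|lborel. g u * exp (\<i> * of_real (t * u)) * (exp (- (\<i> * of_real (t * v))) * of_real (std_normal_density (e n * t))))"
        unfolding h_def integral_mult_left_zero by (simp only: mult.assoc)
      also have "\<dots> = (LINT u|lborel. ?F t u)"
        by (intro Bochner_Integration.integral_cong refl) (simp add: algebra_simps exp_diff exp_minus divide_inverse)
      finally show "h t * exp (- (\<i> * of_real (t * v))) * of_real (std_normal_density (e n * t)) = (LINT u|lborel. ?F t u)" .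
    qed
    also have "\<dots> = (LINT u|lborel. LINT t|lborel. ?F t u)"
      by (rule lborel_pair.Fubini_integral[OF intF, symmetric])
    also have "\<dots> = (LINT u|lborel. g u * of_real (sqrt (2 * pi) / e n * std_normal_density ((u - v) / e n)))"
      by (simp add: mult.assoc has_bochner_integral_fourier_gaussian(2)[OF e] del: of_real_mult of_real_divide)
    also have "\<dots> = e n *\<^sub>R (LINT x|lborel. g (v + e n * x) * of_real (sqrt (2 * pi) / e n * std_normal_density x))"
      using e[of n] by (subst lborel_integral_real_affine[of "e n" _ v]) (simp_all add: less_imp_neq[symmetric])
    also have "\<dots> = of_real (sqrt (2 * pi)) * (LINT x|lborel. g (v + e n * x) * of_real (std_normal_density x))"
      using e[of n] by (simp add: scaleR_conv_of_real integral_mult_right_zero[symmetric] field_simps del: integral_mult_right_zero)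
    finally show ?thesis .
  qed
  have "(\<lambda>n. LINT x|lborel. g (v + e n * x) * of_real (std_normal_density x)) \<longlonglongrightarrow> (LINT x|lborel. g v * of_real (std_normal_density x))"
  proof (rule integral_dominated_convergence[where w="\<lambda>x. M * std_normal_density x"])
    show "integrable lborel (\<lambda>x. M * std_normal_density x)" using i0 by simp
    have "(\<lambda>n. g (v + e n * x) * of_real (std_normal_density x)) \<longlonglongrightarrow> g (v + 0 * x) * of_real (std_normal_density x)" for x
      by (intro tendsto_intros isCont_tendsto_compose[OF _ tendsto_add[OF tendsto_const tendsto_mult[OF e0 tendsto_const]]])
        (use cont in \<open>auto simp: continuous_on_eq_continuous_at\<close>)
    then show "AE x in lborel. (\<lambda>n. g (v + e n * x) * of_real (std_normal_density x)) \<longlonglongrightarrow> g v * of_real (std_normal_density x)"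
      by simp
    show "AE x in lborel. norm (g (v + e n * x) * of_real (std_normal_density x)) \<le> M * std_normal_density x" for n
      by (rule AE_I2) (auto simp: norm_mult intro!: mult_right_mono M)
  qed measurable
  moreover have "(LINT x|lborel. complex_of_real (std_normal_density x)) = 1"
    using integral_std_normal_moment_even[of 0] by simp
  ultimately have lim1: "J \<longlonglongrightarrow> of_real (sqrt (2 * pi)) * g v"
    unfolding J[abs_def] by (auto intro!: tendsto_intros)
  have [measurable]: "h \<in> borel_measurable borel" using int by (simp add: borel_measurable_integrable)
  have "J \<longlonglongrightarrow> (LINT t|lborel. h t * exp (- (\<i> * of_real (t * v))) * of_real (std_normal_density 0))"
    unfolding J_def
  proof (rule integral_dominated_convergence[where w="\<lambda>t. norm (h t)"])
    show "integrable lborel (\<lambda>t. norm (h t))" using int by simp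
    have "(\<lambda>n. std_normal_density (e n * t)) \<longlonglongrightarrow> std_normal_density (0 * t)" for t
      unfolding std_normal_density_def by (intro tendsto_intros e0) auto
    then show "AE t in lborel. (\<lambda>n. h t * exp (- (\<i> * of_real (t * v))) * of_real (std_normal_density (e n * t)))
        \<longlonglongrightarrow> h t * exp (- (\<i> * of_real (t * v))) * of_real (std_normal_density 0)"
      by (auto intro!: tendsto_intros)
    have le1: "std_normal_density x \<le> 1" for x
    proof -
      have "exp (- x\<^sup>2 / 2) \<le> 1" "1 \<le> sqrt (2 * pi)" using pi_ge_two by (auto)
      then have "exp (- x\<^sup>2 / 2) \<le> sqrt (2 * pi)" by (rule order_trans)
      then show ?thesis unfolding std_normal_density_def by (simp add: field_simps)
    qed
    show "AE t in lborel. norm (h t * exp (- (\<i> * of_real (t * v))) * of_real (std_normal_density (e n * t))) \<le> norm (h t)" for n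
      by (rule AE_I2) (auto simp: norm_mult intro!: mult_left_le le1)
  qed measurable
  with lim1 have "of_real (sqrt (2 * pi)) * g v = (LINT t|lborel. h t * exp (- (\<i> * of_real (t * v)))) * of_real (std_normal_density 0)"
    by (intro LIMSEQ_unique) auto
  moreover have "complex_of_real (std_normal_density 0) = 1 / of_real (sqrt (2 * pi))" by (simp add: std_normal_density_def)
  ultimately have "(LINT t|lborel. h t * exp (- (\<i> * of_real (t * v)))) = complex_of_real (sqrt (2 * pi)) * complex_of_real (sqrt (2 * pi)) * g v"
    by (simp add: field_simps)
  also have "complex_of_real (sqrt (2 * pi)) * complex_of_real (sqrt (2 * pi)) = of_real (2 * pi)"
    by (simp flip: of_real_mult)
  finally show ?thesis .
qed

lemma laplace_inversion:
  assumes "bump R f"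
  shows "(LINT t|lborel. laplace f (Complex c t) * exp (- Complex c t * of_real v)) = of_real (2 * pi) * of_real (f v)"
proof -
  have eq: "(LINT u|lborel. of_real (f u) * exp (of_real (c * u)) * exp (\<i> * of_real (t * u))) = laplace f (Complex c t)" for t
    unfolding laplace_def by (intro Bochner_Integration.integral_cong refl)
      (simp add: Complex_eq algebra_simps exp_add)
  \<comment> \<open>Fourier inversion for f(u) exp(c u): the extra exponential moves the line of
    integration from Re s = 0 to Re s = c.\<close>
  have "(LINT t|lborel. (LINT u|lborel. of_real (f u) * exp (of_real (c * u)) * exp (\<i> * of_real (t * u))) * exp (- (\<i> * of_real (t * v))))
      = of_real (2 * pi) * (of_real (f v) * exp (of_real (c * v)))"
    by (rule fourier_inversion[where R=R])
      (use assms laplace_vertical_integrable[OF assms] in \<open>auto simp: eq[simplified] bump_def intro!: continuous_intros bump_continuous[OF assms]\<close>)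
  then have "(LINT t|lborel. laplace f (Complex c t) * exp (- (\<i> * of_real (t * v)))) * exp (- of_real (c * v))
      = of_real (2 * pi) * of_real (f v)"
    unfolding eq by (simp add: exp_minus field_simps)
  moreover have "(LINT t|lborel. laplace f (Complex c t) * exp (- (\<i> * of_real (t * v)))) * exp (- of_real (c * v))
    = (LINT t|lborel. laplace f (Complex c t) * exp (- Complex c t * of_real v))"
    unfolding integral_mult_left_zero[symmetric]
    by (intro Bochner_Integration.integral_cong refl) (simp add: Complex_eq mult.assoc exp_add[symmetric] algebra_simps)
  ultimately show ?thesis by simp
qed

subsection \<open>Dirichlet series and vertical integrals\<close>

text \<open>With \<open>l\<close> a logarithm the terms are b n^(-s). Free choice of the index set
  lets positive integers, Gaussian integers and prime powers share one theory.\<close>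

definition dseries :: "'i set \<Rightarrow> ('i \<Rightarrow> real) \<Rightarrow> ('i \<Rightarrow> real) \<Rightarrow> complex \<Rightarrow> complex" where
  "dseries I b l s = (\<Sum>\<^sub>\<infinity>i\<in>I. of_real (b i) * exp (- s * of_real (l i)))"

text \<open>In the parameter t the contour measure ds is i dt, so the usual 1/(2 pi i) becomes 1/(2
  pi); the results below carry the factor 2 pi on the other side. The variable \<open>y\<close>
  stands for log X.\<close>

definition vertical_integral :: "(complex \<Rightarrow> complex) \<Rightarrow> (real \<Rightarrow> real) \<Rightarrow> real \<Rightarrow> real \<Rightarrow> complex" where
  "vertical_integral F f y c =
     (LINT t|lborel. F (Complex c t) * laplace f (Complex c t) * exp (Complex c t * of_real y))"

definition poly_bounded :: "complex set \<Rightarrow> (complex \<Rightarrow> complex) \<Rightarrow> bool" where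
  "poly_bounded S F \<longleftrightarrow> (\<exists>C m. \<forall>s\<in>S. norm (F s) \<le> C * (1 + \<bar>Im s\<bar>) ^ m)"

lemma poly_bounded_laplace:
  assumes "poly_bounded S F" "bump R f" "\<And>s. s \<in> S \<Longrightarrow> \<bar>Re s\<bar> \<le> B"
  obtains K where "\<And>s. s \<in> S \<Longrightarrow> norm (F s * laplace f s) \<le> K / (1 + \<bar>Im s\<bar>)\<^sup>2"
proof -
  obtain C m where C: "\<And>s. s \<in> S \<Longrightarrow> norm (F s) \<le> C * (1 + \<bar>Im s\<bar>) ^ m"
    using assms(1) by (auto simp: poly_bounded_def)
  obtain D where D: "\<And>s. \<bar>Re s\<bar> \<le> B \<Longrightarrow> norm (laplace f s) \<le> D / (1 + \<bar>Im s\<bar>) ^ (m + 2)"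
    using laplace_decay[OF assms(2)] by blast
  show ?thesis
  proof (rule that)
    fix s assume s: "s \<in> S"
    have "norm (F s * laplace f s) \<le> (C * (1 + \<bar>Im s\<bar>) ^ m) * (D / (1 + \<bar>Im s\<bar>) ^ (m + 2))"
      unfolding norm_mult using C[OF s] D[OF assms(3)[OF s]]
      by (intro mult_mono) (auto intro: order_trans[OF norm_ge_zero])
    also have "\<dots> = C * D / (1 + \<bar>Im s\<bar>)\<^sup>2" by (simp add: power_add power2_eq_square)
    finally show "norm (F s * laplace f s) \<le> C * D / (1 + \<bar>Im s\<bar>)\<^sup>2" .
  qed
qed

lemma dseries_uniform_limit:
  assumes "(\<lambda>i. \<bar>b i\<bar> * exp (- c * l i)) summable_on I" "\<And>i. i \<in> I \<Longrightarrow> 0 \<le> l i"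
    "\<And>s. s \<in> S \<Longrightarrow> c \<le> Re s"
  shows "uniform_limit S (\<lambda>Y s. \<Sum>i\<in>Y. of_real (b i) * exp (- s * of_real (l i))) (dseries I b l)
    (finite_subsets_at_top I)"
  unfolding dseries_def
  by (rule Weierstrass_m_test_general[OF _ assms(1)])
    (use assms in \<open>auto simp: norm_mult intro!: mult_left_mono mult_right_mono\<close>)

text \<open>Laplace inversion settles each term: b exp(-s l) integrates to 2 pi b f(l - y). Uniform
  convergence of the partial sums on the line, against the integrable weight \<open>E\<close>, lets
  the limit pass through the integral.\<close>

lemma dseries_smooth_sum:
  assumes f: "bump R f" and sm: "(\<lambda>i. \<bar>b i\<bar> * exp (- c * l i)) summable_on I" and l: "\<And>i. i \<in> I \<Longrightarrow> 0 \<le> l i"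
  shows "((\<lambda>i. of_real (2 * pi) * of_real (b i * f (l i - y))) has_sum vertical_integral (dseries I b l) f y c) I"
proof -
  define D where "D Y s = (\<Sum>i\<in>Y. of_real (b i) * exp (- s * of_real (l i)))" for Y and s :: complex
  define E where "E t = laplace f (Complex c t) * exp (Complex c t * of_real y)" for t
  have ul: "uniform_limit UNIV (\<lambda>Y t. D Y (Complex c t)) (\<lambda>t. dseries I b l (Complex c t)) (finite_subsets_at_top I)"
    using dseries_uniform_limit[OF sm l, of "{s. Re s = c}"]
    unfolding uniform_limit_iff D_def by (force elim!: eventually_mono)
  have contD: "continuous_on UNIV (\<lambda>t. D Y (Complex c t))" for Y
    unfolding D_def Complex_eq by (intro continuous_intros)
  have contE: "continuous_on UNIV E"
    unfolding E_def Complex_eq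
    by (intro continuous_intros continuous_on_compose2[OF laplace_continuous[OF f, of UNIV]]) auto
  have nE: "norm (E t) = norm (laplace f (Complex c t)) * exp (c * y)" for t
    by (simp add: E_def norm_mult)
  have intE: "integrable lborel E"
    by (rule Bochner_Integration.integrable_bound[OF integrable_mult_left[OF laplace_vertical_integrable[OF f, of c], of "of_real (exp (c * y))"]])
      (use contE in \<open>auto simp: nE norm_mult borel_measurable_continuous_onI\<close>)
  have contS: "continuous_on UNIV (\<lambda>t. dseries I b l (Complex c t))"
    by (rule uniform_limit_theorem[OF _ ul]) (auto intro: always_eventually contD)
  have bdint: "integrable lborel (\<lambda>t. G t * E t)" if "continuous_on UNIV G" "\<And>t. norm (G t) \<le> M" for G and M :: real
  proof (rule Bochner_Integration.integrable_bound[OF integrable_mult_right[OF integrable_norm[OF intE], of M]])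
    show "(\<lambda>t. G t * E t) \<in> borel_measurable lborel"
      using that contE by (auto intro!: borel_measurable_continuous_onI continuous_intros)
    show "AE t in lborel. norm (G t * E t) \<le> norm (M * norm (E t))"
    proof (rule AE_I2)
      fix t
      show "norm (G t * E t) \<le> norm (M * norm (E t))"
        unfolding norm_mult[of "G t"] real_norm_def
        by (rule order_trans[OF mult_right_mono[OF that(2) norm_ge_zero] abs_ge_self])
    qed
  qed
  have fin: "(\<Sum>i\<in>Y. of_real (2 * pi) * of_real (b i * f (l i - y))) = (LINT t|lborel. D Y (Complex c t) * E t)" if "finite Y" "Y \<subseteq> I" for Y
  proof -
    have 1: "norm (complex_of_real (b i) * exp (- Complex c t * of_real (l i))) \<le> \<bar>b i\<bar> * exp (- c * l i)" for i t
      by (simp add: norm_mult)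
    have sumI: "(LINT t|lborel. D Y (Complex c t) * E t) = (\<Sum>i\<in>Y. LINT t|lborel. of_real (b i) * exp (- Complex c t * of_real (l i)) * E t)"
      unfolding D_def sum_distrib_right
      by (rule Bochner_Integration.integral_sum, rule bdint[OF _ 1]) (unfold Complex_eq, intro continuous_intros)
    have each: "(LINT t|lborel. of_real (b i) * exp (- Complex c t * of_real (l i)) * E t) = of_real (2 * pi) * of_real (b i * f (l i - y))" for i :: 'a
    proof -
      have "(LINT t|lborel. of_real (b i) * exp (- Complex c t * of_real (l i)) * E t) =
        (LINT t|lborel. of_real (b i) * (laplace f (Complex c t) * exp (- Complex c t * of_real (l i - y))))"
        by (intro Bochner_Integration.integral_cong refl) (simp add: E_def exp_add[symmetric] algebra_simps)
      also have "\<dots> = of_real (b i) * (of_real (2 * pi) * of_real (f (l i - y)))"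
        by (simp only: integral_mult_right_zero laplace_inversion[OF f])
      finally show ?thesis by simp
    qed
    show ?thesis unfolding sumI each ..
  qed
  have "((\<lambda>Y. LINT t|lborel. D Y (Complex c t) * E t) \<longlongrightarrow> (LINT t|lborel. dseries I b l (Complex c t) * E t)) (finite_subsets_at_top I)"
  proof (rule tendstoI)
    fix e :: real assume e: "e > 0"
    \<comment> \<open>The tolerance \<open>e / (K + 1)\<close> used below stays meaningful when this
      mass is 0.\<close>
    define K where "K = (LINT t|lborel. norm (E t))"
    have K: "K \<ge> 0" unfolding K_def by simp
    have "e / (K + 1) > 0" using e K by simp
    then have "\<forall>\<^sub>F Y in finite_subsets_at_top I. \<forall>t. dist (D Y (Complex c t)) (dseries I b l (Complex c t)) < e / (K + 1)"
      using ul unfolding uniform_limit_iff by auto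
    then show "\<forall>\<^sub>F Y in finite_subsets_at_top I. dist (LINT t|lborel. D Y (Complex c t) * E t) (LINT t|lborel. dseries I b l (Complex c t) * E t) < e"
    proof (eventually_elim, goal_cases)
      case (1 Y)
      let ?d = "\<lambda>t. D Y (Complex c t) - dseries I b l (Complex c t)"
      have d: "norm (?d t) \<le> e / (K + 1)" for t using 1[rule_format, of t] by (simp add: dist_norm)
      have intd: "integrable lborel (\<lambda>t. ?d t * E t)" by (rule bdint[OF _ d]) (intro continuous_intros contD contS)
      have "integrable lborel (\<lambda>t. D Y (Complex c t) * E t)"
        by (rule bdint[OF contD, of _ "\<Sum>i\<in>Y. \<bar>b i\<bar> * exp (- c * l i)"])
          (auto simp: D_def norm_mult intro!: sum_norm_le)
      from Bochner_Integration.integrable_diff[OF this intd]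
      have i2: "integrable lborel (\<lambda>t. dseries I b l (Complex c t) * E t)" by (simp add: algebra_simps)
      have "dist (LINT t|lborel. D Y (Complex c t) * E t) (LINT t|lborel. dseries I b l (Complex c t) * E t)
         = norm (LINT t|lborel. ?d t * E t)"
        unfolding dist_norm left_diff_distrib
        by (simp only: Bochner_Integration.integral_diff[OF \<open>integrable lborel (\<lambda>t. D Y (Complex c t) * E t)\<close> i2])
      also have "\<dots> \<le> (LINT t|lborel. norm (?d t * E t))" by (rule integral_norm_bound)
      also have "\<dots> \<le> (LINT t|lborel. e / (K + 1) * norm (E t))"
      proof (rule integral_mono)
        show "integrable lborel (\<lambda>t. norm (?d t * E t))" using intd by (rule integrable_norm)
        show "norm (?d t * E t) \<le> e / (K + 1) * norm (E t)" for t
          unfolding norm_mult by (rule mult_right_mono[OF d norm_ge_zero])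
      qed (use intE in simp)
      also have "\<dots> = e / (K + 1) * K" by (simp add: K_def)
      also have "\<dots> < e" using e K by (simp add: field_simps)
      finally show ?case .
    qed
  qed
  then have "((\<lambda>Y. \<Sum>i\<in>Y. of_real (2 * pi) * of_real (b i * f (l i - y))) \<longlongrightarrow> (LINT t|lborel. dseries I b l (Complex c t) * E t)) (finite_subsets_at_top I)"
    by (rule Lim_transform_eventually) (auto simp: eventually_finite_subsets_at_top fin[symmetric] intro!: exI[of _ "{}"])
  then show ?thesis unfolding has_sum_def vertical_integral_def E_def by (simp only: mult.assoc)
qed

section \<open>The pole at 1 and shifts of the line of integration\<close>

lemma integral_exp_half_line:
  fixes z :: complex
  assumes z: "0 < Re z"
  shows "set_integrable lborel {0<..} (\<lambda>u. exp (- z * of_real u))"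
    and "(LINT u:{0<..}|lborel. exp (- z * of_real u)) = 1 / z"
proof -
  have "((\<lambda>x. exp (- Re z * x)) has_integral exp (- Re z * 0) / Re z) {0..}"
    using has_integral_exp_minus_to_infinity[OF z, of 0] by simp
  then have "(\<lambda>x. exp (- Re z * x)) absolutely_integrable_on {0..}"
    by (intro nonnegative_absolutely_integrable_1) auto
  then have "set_integrable lborel {0..} (\<lambda>x. exp (- Re z * x))"
    unfolding set_integrable_def
    by (subst (asm) integrable_completion) (auto intro!: borel_measurable_continuous_on_indicator continuous_intros)
  then have "set_integrable lborel {0<..} (\<lambda>x. exp (- Re z * x))"
    by (rule set_integrable_subset) auto
  then show si: "set_integrable lborel {0<..} (\<lambda>u. exp (- z * of_real u))"
    unfolding set_integrable_def
    by (rule Bochner_Integration.integrable_bound)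
      (auto simp: indicator_def intro!: borel_measurable_continuous_onI borel_measurable_continuous_on_indicator continuous_intros)
  have "(LBINT u=ereal 0..\<infinity>. exp (- z * of_real u)) = 0 - (- (1 / z))"
  proof (rule interval_integral_FTC_integrable[where F="\<lambda>u. - (1 / z) * exp (- z * of_real u)"])
    show "set_integrable lborel (einterval (ereal 0) \<infinity>) (\<lambda>u. exp (- z * of_real u))"
      using si by (simp add: einterval_def greaterThan_def)
    show "((\<lambda>u. - (1 / z) * exp (- z * of_real u)) has_vector_derivative exp (- z * of_real x)) (at x)" for x
      using z by (auto intro!: derivative_eq_intros has_vector_derivative_real_field)
    have "((\<lambda>u. - (1 / z) * exp (- z * of_real u)) \<longlongrightarrow> - (1 / z) * exp (- z * of_real 0)) (at_right 0)"
      by (intro tendsto_intros)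
    then show "(((\<lambda>u. - (1 / z) * exp (- z * of_real u)) \<circ> real_of_ereal) \<longlongrightarrow> - (1 / z)) (at_right (ereal 0))"
      by (simp add: ereal_tendsto_simps)
    have "((\<lambda>u. exp (- Re z * u)) \<longlongrightarrow> 0) at_top" using z by real_asymp
    then have "((\<lambda>u. exp (- z * of_real u)) \<longlongrightarrow> 0) at_top"
      by (subst tendsto_norm_zero_iff[symmetric]) simp
    then have "((\<lambda>u. - (1 / z) * exp (- z * of_real u)) \<longlongrightarrow> - (1 / z) * 0) at_top"
      by (rule tendsto_mult[OF tendsto_const])
    then show "(((\<lambda>u. - (1 / z) * exp (- z * of_real u)) \<circ> real_of_ereal) \<longlongrightarrow> 0) (at_left \<infinity>)"
      by (simp add: ereal_tendsto_simps)
  qed (auto intro!: continuous_intros)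
  then show "(LINT u:{0<..}|lborel. exp (- z * of_real u)) = 1 / z"
    by (simp add: interval_integral_to_infinity_eq)
qed

text \<open>The residue is found without a contour: 1 / (s - 1) is the integral of exp(-(s - 1) u)
  over u > 0, and after Fubini the inversion formula in t leaves the integral of exp(u) f(u - y)
  over u > 0.\<close>

lemma vertical_integral_pole:
  assumes f: "bump R f" and c: "1 < c" and y: "R \<le> y"
  shows "vertical_integral (\<lambda>s. 1 / (s - 1)) f y c = of_real (2 * pi * exp y) * laplace f 1"
proof -
  define E where "E t = laplace f (Complex c t) * exp (Complex c t * of_real y)" for t
  have contE: "continuous_on UNIV E"
    unfolding E_def Complex_eq
    by (intro continuous_intros continuous_on_compose2[OF laplace_continuous[OF f, of UNIV]]) auto
  have [measurable]: "E \<in> borel_measurable borel" using contE by (rule borel_measurable_continuous_onI)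
  have nE: "norm (E t) = norm (laplace f (Complex c t)) * exp (c * y)" for t
    by (simp add: E_def norm_mult)
  have intE: "integrable lborel E"
    by (rule Bochner_Integration.integrable_bound[OF integrable_mult_left[OF laplace_vertical_integrable[OF f, of c], of "of_real (exp (c * y))"]])
      (auto simp: nE norm_mult)
  define g where "g t u = indicat_real {0<..} u *\<^sub>R exp (- (Complex c t - 1) * of_real u)" for t u
  have ig: "integrable lborel (g t)" "(LINT u|lborel. g t u) = 1 / (Complex c t - 1)" for t
    using integral_exp_half_line[of "Complex c t - 1"] c
    unfolding g_def set_integrable_def set_lebesgue_integral_def by auto
  have ng: "norm (g t u) = norm (g 0 u)" for t u by (simp add: g_def)
  have gm [measurable]: "case_prod g \<in> borel_measurable (lborel \<Otimes>\<^sub>M lborel)"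
    unfolding g_def Complex_eq by measurable
  have [measurable]: "g t \<in> borel_measurable lborel" for t using ig(1) by (rule borel_measurable_integrable)
  let ?F = "\<lambda>t u. g t u * E t"
  have intF: "integrable (lborel \<Otimes>\<^sub>M lborel) (case_prod ?F)"
  proof (rule lborel_pair.Fubini_integrable)
    have nF: "norm (case_prod ?F (t, u)) = norm (g 0 u) * norm (E t)" for t u
      unfolding prod.case norm_mult ng[of t u] ..
    have "(\<lambda>t. LINT u|lborel. norm (case_prod ?F (t, u))) = (\<lambda>t. (LINT u|lborel. norm (g 0 u)) * norm (E t))"
      unfolding nF integral_mult_left_zero ..
    then show "integrable lborel (\<lambda>t. LINT u|lborel. norm (case_prod ?F (t, u)))"
      using intE by simp
    show "AE t in lborel. integrable lborel (\<lambda>u. case_prod ?F (t, u))" using ig(1) by simp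
    have "(\<lambda>p. case_prod g p * E (fst p)) \<in> borel_measurable (lborel \<Otimes>\<^sub>M lborel)" by measurable
    then show "case_prod ?F \<in> borel_measurable (lborel \<Otimes>\<^sub>M lborel)" by (simp add: case_prod_beta)
  qed
  have "vertical_integral (\<lambda>s. 1 / (s - 1)) f y c = (LINT t|lborel. LINT u|lborel. ?F t u)"
    unfolding vertical_integral_def
    by (intro Bochner_Integration.integral_cong refl) (simp only: E_def ig(2) integral_mult_left_zero mult.assoc)
  also have "\<dots> = (LINT u|lborel. LINT t|lborel. ?F t u)"
    by (rule lborel_pair.Fubini_integral[OF intF, symmetric])
  also have "\<dots> = (LINT u|lborel. indicat_real {0<..} u *\<^sub>R (exp (of_real u) * (of_real (2 * pi) * of_real (f (u - y)))))"
  proof (rule Bochner_Integration.integral_cong[OF refl])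
    fix u :: real
    have "(LINT t|lborel. ?F t u) = (LINT t|lborel. (indicat_real {0<..} u *\<^sub>R exp (of_real u)) *
        (laplace f (Complex c t) * exp (- Complex c t * of_real (u - y))))"
      by (intro Bochner_Integration.integral_cong refl)
        (simp add: g_def E_def mult.assoc mult.left_commute[of _ "laplace f _"] exp_add[symmetric] algebra_simps)
    then show "(LINT t|lborel. ?F t u) = indicat_real {0<..} u *\<^sub>R (exp (of_real u) * (of_real (2 * pi) * of_real (f (u - y))))"
      by (simp only: integral_mult_right_zero laplace_inversion[OF f]) simp
  qed
  also have "\<dots> = (LINT u|lborel. of_real (2 * pi) * (of_real (f (u - y)) * exp (of_real u)))"
  proof (rule Bochner_Integration.integral_cong[OF refl])
    fix u :: real
    \<comment> \<open>R <= y puts the support of f(u - y) inside u > 0, so the half line may be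
      replaced by the whole line.\<close>
    have "f (u - y) = 0" if "u \<le> 0" using that y f by (auto simp: bump_def)
    then show "indicat_real {0<..} u *\<^sub>R (exp (of_real u) * (of_real (2 * pi) * of_real (f (u - y)))) = of_real (2 * pi) * (of_real (f (u - y)) * exp (complex_of_real u))"
      by (cases "u \<le> 0") (auto simp: indicator_def)
  qed
  also have "\<dots> = (LINT v|lborel. of_real (2 * pi) * (of_real (f v) * exp (complex_of_real (y + v))))"
    by (subst lborel_integral_real_affine[of 1 _ y]) simp_all
  also have "\<dots> = (LINT v|lborel. of_real (2 * pi * exp y) * (of_real (f v) * exp (1 * complex_of_real v)))"
    by (intro Bochner_Integration.integral_cong refl) (simp add: exp_add exp_of_real)
  also have "\<dots> = of_real (2 * pi * exp y) * laplace f 1"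
    by (simp only: integral_mult_right_zero laplace_def)
  finally show ?thesis .
qed

lemma holomorphic_laplace: "bump R f \<Longrightarrow> laplace f holomorphic_on A"
  by (meson laplace_derivative holomorphic_on_open field_differentiable_at_within
      field_differentiable_def holomorphic_on_def)

lemma integral_symmetric_intervals_tendsto:
  fixes h :: "real \<Rightarrow> complex"
  assumes "integrable lborel h"
  shows "(\<lambda>n. LINT t:{- real n..real n}|lborel. h t) \<longlonglongrightarrow> (LINT t|lborel. h t)"
  unfolding set_lebesgue_integral_def
proof (rule integral_dominated_convergence[where w="\<lambda>t. norm (h t)"])
  have "\<forall>\<^sub>F n in sequentially. indicat_real {- real n..real n} t *\<^sub>R h t = h t" for t
  proof -
    obtain N where "\<bar>t\<bar> \<le> real N" using real_arch_simple by blast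
    then have "indicat_real {- real n..real n} t *\<^sub>R h t = h t" if "n \<ge> N" for n
      using that by (auto simp: indicator_def)
    then show ?thesis by (rule eventually_sequentiallyI)
  qed
  then show "AE t in lborel. (\<lambda>n. indicat_real {- real n..real n} t *\<^sub>R h t) \<longlonglongrightarrow> h t"
    by (auto intro: tendsto_eventually)
qed (use assms in \<open>auto simp: indicator_def\<close>)

text \<open>A strip is convex, so \<open>h\<close> has a primitive \<open>H\<close> there and
  truncated vertical integrals are differences of \<open>H\<close> at their ends. Their discrepancy
  consists of differences of \<open>H\<close> along the two horizontal sides, which are at most K (d
  - c) / (1 + T)^2 and vanish in the limit.\<close>

lemma vertical_shift:
  fixes h :: "complex \<Rightarrow> complex"
  assumes h: "h holomorphic_on S" and S: "open S" "{s. c \<le> Re s \<and> Re s \<le> d} \<subseteq> S" and cd: "c \<le> d"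
    and K: "\<And>s. c \<le> Re s \<Longrightarrow> Re s \<le> d \<Longrightarrow> norm (h s) \<le> K / (1 + \<bar>Im s\<bar>)\<^sup>2"
  shows "(LINT t|lborel. h (Complex c t)) = (LINT t|lborel. h (Complex d t))"
proof -
  define V where "V = {s. c \<le> Re s \<and> Re s \<le> d}"
  have "convex V"
    unfolding V_def using convex_halfspace_Re_ge[of c] convex_halfspace_Re_le[of d]
    by (simp add: Collect_conj_eq convex_Int)
  moreover have hV: "h holomorphic_on V" using h S(2) by (auto simp: V_def intro: holomorphic_on_subset)
  ultimately obtain H where H: "\<And>s. s \<in> V \<Longrightarrow> (H has_field_derivative h s) (at s within V)"
    using holomorphic_convex_primitive[of V "{}" h]
    by (metis Diff_empty finite.emptyI holomorphic_on_imp_continuous_on holomorphic_on_imp_differentiable_at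
        interior_subset holomorphic_on_subset open_interior subsetD)
  have int: "integrable lborel (\<lambda>t. h (Complex a t))"
    "(LINT t:{-T..T}|lborel. h (Complex a t)) = - \<i> * (H (Complex a T) - H (Complex a (-T)))" if a: "c \<le> a" "a \<le> d" "0 \<le> T" for a T
  proof -
    have cont: "continuous_on UNIV (\<lambda>t. h (Complex a t))"
      by (rule continuous_on_compose2[OF holomorphic_on_imp_continuous_on[OF hV]])
        (use a in \<open>auto simp: V_def Complex_eq intro!: continuous_intros\<close>)
    show "integrable lborel (\<lambda>t. h (Complex a t))"
      using cont by (rule continuous_decay_integrable[of _ K]) (use K[of "Complex a _"] a in auto)
    have "((\<lambda>t. h (Complex a t)) has_integral - \<i> * H (Complex a T) - - \<i> * H (Complex a (-T))) {-T..T}"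
    proof (rule fundamental_theorem_of_calculus)
      show "- T \<le> T" using a by simp
      fix t assume "t \<in> {-T..T}"
      have "((\<lambda>t. Complex a t) has_vector_derivative \<i>) (at t within {-T..T})"
        unfolding Complex_eq by (auto intro!: derivative_eq_intros)
      moreover have "(H has_field_derivative h (Complex a t)) (at (Complex a t) within Complex a ` {-T..T})"
        by (rule DERIV_subset[OF H]) (use a in \<open>auto simp: V_def\<close>)
      ultimately have "((H \<circ> Complex a) has_vector_derivative \<i> * h (Complex a t)) (at t within {-T..T})"
        by (rule field_vector_diff_chain_within)
      then have "((\<lambda>t. - \<i> * (H \<circ> Complex a) t) has_vector_derivative - \<i> * (\<i> * h (Complex a t))) (at t within {-T..T})"
        by (rule has_vector_derivative_mult_right)
      then show "((\<lambda>t. - \<i> * H (Complex a t)) has_vector_derivative h (Complex a t)) (at t within {-T..T})"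
        by (simp add: o_def mult.assoc[symmetric])
    qed
    moreover have "set_integrable lborel {-T..T} (\<lambda>t. h (Complex a t))"
      by (intro borel_integrable_atLeastAtMost' continuous_on_subset[OF cont]) auto
    ultimately show "(LINT t:{-T..T}|lborel. h (Complex a t)) = - \<i> * (H (Complex a T) - H (Complex a (-T)))"
      by (simp add: set_borel_integral_eq_integral integral_unique right_diff_distrib)
  qed
  have diff: "norm (H (Complex d t) - H (Complex c t)) \<le> K / (1 + \<bar>t\<bar>)\<^sup>2 * (d - c)" for t
  proof -
    define L where "L = closed_segment (Complex c t) (Complex d t)"
    have L: "L \<subseteq> {s. c \<le> Re s \<and> Re s \<le> d \<and> Im s = t}"
    proof -
      have "c \<le> (1 - u) * c + u * d" "(1 - u) * c + u * d \<le> d" "(1 - u) * t + u * t = t" if "0 \<le> u" "u \<le> 1" for u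
        using cd that mult_left_mono[OF cd, of u] mult_left_mono[OF cd, of "1 - u"] by (auto simp: algebra_simps)
      then show ?thesis by (auto simp: L_def closed_segment_def)
    qed
    have "norm (H (Complex d t) - H (Complex c t)) \<le> K / (1 + \<bar>t\<bar>)\<^sup>2 * norm (Complex d t - Complex c t)"
    proof (rule field_differentiable_bound)
      show "convex L" by (simp add: L_def)
      fix z assume z: "z \<in> L"
      show "(H has_field_derivative h z) (at z within L)"
        by (rule DERIV_subset[OF H]) (use z L in \<open>auto simp: V_def\<close>)
      show "norm (h z) \<le> K / (1 + \<bar>t\<bar>)\<^sup>2" using z L K[of z] by auto
    qed (auto simp: L_def)
    also have "norm (Complex d t - Complex c t) = d - c" using cd by (simp add: complex_diff cmod_def)
    finally show ?thesis .
  qed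
  let ?J = "\<lambda>a n. LINT t:{- real n..real n}|lborel. h (Complex a t)"
  have "norm (?J c n - ?J d n) \<le> 2 * (K / (1 + real n)\<^sup>2 * (d - c))" for n
  proof -
    have "?J c n - ?J d n = \<i> * ((H (Complex d n) - H (Complex c n)) - (H (Complex d (- n)) - H (Complex c (- n))))"
      using cd by (simp add: int(2) algebra_simps)
    then have "norm (?J c n - ?J d n) \<le> norm (H (Complex d n) - H (Complex c n)) + norm (H (Complex d (- n)) - H (Complex c (- n)))"
      by (simp add: norm_mult norm_triangle_ineq4)
    with diff[of n] diff[of "- n"] show ?thesis by simp
  qed
  moreover have "(\<lambda>n. 2 * (K / (1 + real n)\<^sup>2 * (d - c))) \<longlonglongrightarrow> 0" by real_asymp
  ultimately have "(\<lambda>n. ?J c n - ?J d n) \<longlonglongrightarrow> 0" by (rule Lim_null_comparison[OF always_eventually, rule_format])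
  moreover have "(\<lambda>n. ?J c n - ?J d n) \<longlonglongrightarrow> (LINT t|lborel. h (Complex c t)) - (LINT t|lborel. h (Complex d t))"
    using cd by (intro tendsto_diff integral_symmetric_intervals_tendsto int(1)[of _ 0]) auto
  ultimately show ?thesis using LIMSEQ_unique by force
qed

lemma vertical_integral_shift:
  assumes "F holomorphic_on S" "open S" "{s. c \<le> Re s \<and> Re s \<le> d} \<subseteq> S" "c \<le> d"
    and "poly_bounded {s. c \<le> Re s \<and> Re s \<le> d} F" and f: "bump R f"
  shows "vertical_integral F f y c = vertical_integral F f y d"
proof -
  obtain K where K: "\<And>s. c \<le> Re s \<Longrightarrow> Re s \<le> d \<Longrightarrow> norm (F s * laplace f s) \<le> K / (1 + \<bar>Im s\<bar>)\<^sup>2"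
  proof -
    have B: "\<bar>Re s\<bar> \<le> max \<bar>c\<bar> \<bar>d\<bar>" if "s \<in> {s. c \<le> Re s \<and> Re s \<le> d}" for s
      using that by (auto simp: max_def abs_if split: if_splits)
    obtain K where "\<And>s. s \<in> {s. c \<le> Re s \<and> Re s \<le> d} \<Longrightarrow> norm (F s * laplace f s) \<le> K / (1 + \<bar>Im s\<bar>)\<^sup>2"
      using poly_bounded_laplace[OF assms(5) f B] by blast
    then show ?thesis by (intro that[of K]) auto
  qed
  show ?thesis
    unfolding vertical_integral_def
  proof (rule vertical_shift[where h="\<lambda>s. F s * laplace f s * exp (s * of_real y)" and S=S and K="K * exp (max (c * y) (d * y))"])
    show "(\<lambda>s. F s * laplace f s * exp (s * of_real y)) holomorphic_on S"
      using assms(1) holomorphic_laplace[OF f] by (intro holomorphic_intros)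
    fix s assume s: "c \<le> Re s" "Re s \<le> d"
    have "Re s * y \<le> max (c * y) (d * y)"
      using s by (cases "0 \<le> y") (auto simp: le_max_iff_disj mult_right_mono mult_right_mono_neg)
    then have "norm (F s * laplace f s * exp (s * of_real y)) \<le> (K / (1 + \<bar>Im s\<bar>)\<^sup>2) * exp (max (c * y) (d * y))"
      unfolding norm_mult[of "F s * laplace f s"] using K[OF s]
      by (intro mult_mono) (auto intro: order_trans[OF norm_ge_zero])
    then show "norm (F s * laplace f s * exp (s * of_real y)) \<le> K * exp (max (c * y) (d * y)) / (1 + \<bar>Im s\<bar>)\<^sup>2"
      by simp
  qed (use assms in auto)
qed

section \<open>Size of vertical integrals\<close>

lemma vertical_integral_bound:
  assumes "F holomorphic_on S" "open S" "{s. Re s = c} \<subseteq> S"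
    and "poly_bounded {s. Re s = c} F" and f: "bump R f"
  shows "\<exists>C. \<forall>y. norm (vertical_integral F f y c) \<le> C * exp (c * y)"
proof -
  obtain K where K: "\<And>s. Re s = c \<Longrightarrow> norm (F s * laplace f s) \<le> K / (1 + \<bar>Im s\<bar>)\<^sup>2"
    using poly_bounded_laplace[OF assms(4) f, of "\<bar>c\<bar>"] by auto
  have "norm (vertical_integral F f y c) \<le> (LINT t|lborel. K * (1 / (1 + \<bar>t\<bar>)\<^sup>2)) * exp (c * y)" for y
  proof -
    have "norm (vertical_integral F f y c) \<le> (LINT t|lborel. norm (F (Complex c t) * laplace f (Complex c t) * exp (Complex c t * of_real y)))"
      unfolding vertical_integral_def by (rule integral_norm_bound)
    also have "\<dots> \<le> (LINT t|lborel. K * (1 / (1 + \<bar>t\<bar>)\<^sup>2) * exp (c * y))"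
    proof (rule integral_mono')
      show "integrable lborel (\<lambda>t. K * (1 / (1 + \<bar>t\<bar>)\<^sup>2) * exp (c * y))"
        by (intro integrable_mult_left integrable_mult_right integrable_inverse_quadratic)
      fix t
      show b: "norm (F (Complex c t) * laplace f (Complex c t) * exp (Complex c t * of_real y)) \<le> K * (1 / (1 + \<bar>t\<bar>)\<^sup>2) * exp (c * y)" for t
        using mult_right_mono[OF K[of "Complex c t"], of "exp (c * y)"] by (simp add: norm_mult)
      show "0 \<le> K * (1 / (1 + \<bar>t\<bar>)\<^sup>2) * exp (c * y)" by (rule order_trans[OF norm_ge_zero b])
    qed
    also have "\<dots> = (LINT t|lborel. K * (1 / (1 + \<bar>t\<bar>)\<^sup>2)) * exp (c * y)"
      by (rule integral_mult_left_zero)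
    finally show ?thesis .
  qed
  then show ?thesis by blast
qed

text \<open>Translating t by pi / y flips the sign of the oscillating factor, so twice the integral
  is an integral of h(t) - h(t + pi / y), which tends to 0 by continuity and dominated
  convergence.\<close>

lemma riemann_lebesgue:
  fixes h :: "real \<Rightarrow> complex"
  assumes cont: "continuous_on UNIV h" and bd: "\<And>t. norm (h t) \<le> C / (1 + \<bar>t\<bar>)\<^sup>2"
  shows "((\<lambda>y. LINT t|lborel. h t * exp (\<i> * of_real (t * y))) \<longlongrightarrow> 0) at_top"
proof (rule Lim_null_comparison)
  have C: "C \<ge> 0" using order_trans[OF norm_ge_zero bd[of 0]] by simp
  have [measurable]: "h \<in> borel_measurable borel" using cont by (rule borel_measurable_continuous_onI)
  have int: "integrable lborel h" using cont bd by (rule continuous_decay_integrable)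
  have int2: "integrable lborel (\<lambda>t. h t * exp (\<i> * of_real (t * y)))" for y :: real
    by (rule Bochner_Integration.integrable_bound[OF int]) (auto simp: norm_mult)
  have intd: "integrable lborel (\<lambda>t. h (t + d))" for d
    using lborel_integrable_real_affine[OF int, of 1 d] by (simp add: add.commute)
  show "\<forall>\<^sub>F y in at_top. norm (LINT t|lborel. h t * exp (\<i> * of_real (t * y))) \<le> (LINT t|lborel. norm (h t - h (t + pi / y)))"
    using eventually_gt_at_top[of 0]
  proof eventually_elim
    case (elim y)
    define I where "I = (LINT t|lborel. h t * exp (\<i> * of_real (t * y)))"
    have e: "exp (\<i> * of_real ((pi / y + t) * y)) = - exp (\<i> * of_real (t * y))" for t :: real
    proof -
      have "(pi / y + t) * y = pi + t * y" using elim by (simp add: field_simps)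
      then show ?thesis by (simp add: ring_distribs exp_add)
    qed
    have i3: "integrable lborel (\<lambda>t. h (t + pi / y) * exp (\<i> * of_real (t * y)))"
      by (rule Bochner_Integration.integrable_bound[OF intd[of "pi / y"]]) (auto simp: norm_mult)
    have "I = (LINT t|lborel. h (pi / y + t) * exp (\<i> * of_real ((pi / y + t) * y)))"
      unfolding I_def by (subst lborel_integral_real_affine[of 1 _ "pi / y"]) simp_all
    also have "\<dots> = - (LINT t|lborel. h (t + pi / y) * exp (\<i> * of_real (t * y)))"
      by (simp only: e mult_minus_right integral_minus add.commute[of _ "pi / y"])
    finally have "2 * I = (LINT t|lborel. h t * exp (\<i> * of_real (t * y))) - (LINT t|lborel. h (t + pi / y) * exp (\<i> * of_real (t * y)))"
      by (simp add: I_def)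
    also have "\<dots> = (LINT t|lborel. (h t - h (t + pi / y)) * exp (\<i> * of_real (t * y)))"
      unfolding left_diff_distrib by (rule Bochner_Integration.integral_diff[symmetric, OF int2 i3])
    finally have "norm (2 * I) \<le> (LINT t|lborel. norm ((h t - h (t + pi / y)) * exp (\<i> * of_real (t * y))))"
      by (simp only: integral_norm_bound)
    then have "2 * norm I \<le> (LINT t|lborel. norm (h t - h (t + pi / y)))"
      by (simp add: norm_mult)
    moreover have "0 \<le> norm I" by simp
    ultimately show ?case unfolding I_def by linarith
  qed
  \<comment> \<open>\<open>max pi y\<close> keeps the shift at most 1 for every y, so that all
    translates share one dominating function: 1 + |t| <= 2 (1 + |t + shift|) gives the factor 4, and
    the unshifted term makes it 5.\<close>
  have "((\<lambda>y. LINT t|lborel. norm (h t - h (t + pi / max pi y))) \<longlongrightarrow> 0) at_top"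
  proof (rule tendsto_at_topI_sequentially)
    fix X :: "nat \<Rightarrow> real" assume X: "filterlim X at_top sequentially"
    have "(\<lambda>n. LINT t|lborel. norm (h t - h (t + pi / max pi (X n)))) \<longlonglongrightarrow> (LINT t|(lborel::real measure). (0::real))"
    proof (rule integral_dominated_convergence[where w="\<lambda>t. 5 * C * (1 / (1 + \<bar>t\<bar>)\<^sup>2)"])
      show "integrable lborel (\<lambda>t. 5 * C * (1 / (1 + \<bar>t\<bar>)\<^sup>2))" by (intro integrable_mult_right integrable_inverse_quadratic)
      fix n
      have y: "0 < pi / max pi (X n)" "pi / max pi (X n) \<le> 1" 
      proof -
        have m: "0 < max pi (X n)" "pi \<le> max pi (X n)" using pi_gt_zero by (auto simp: less_max_iff_disj)
        then show "0 < pi / max pi (X n)" "pi / max pi (X n) \<le> 1" using pi_gt_zero by (auto simp only: divide_pos_pos divide_le_eq_1_pos)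
      qed
      have "norm (h t - h (t + pi / max pi (X n))) \<le> 5 * C * (1 / (1 + \<bar>t\<bar>)\<^sup>2)" for t
      proof -
        have "1 + \<bar>t\<bar> \<le> 2 * (1 + \<bar>t + pi / max pi (X n)\<bar>)" using y by (auto simp: abs_if split: if_splits)
        then have "(1 + \<bar>t\<bar>)\<^sup>2 \<le> (2 * (1 + \<bar>t + pi / max pi (X n)\<bar>))\<^sup>2" by (intro power_mono) auto
        then have "4 * C / (2 * (1 + \<bar>t + pi / max pi (X n)\<bar>))\<^sup>2 \<le> 4 * C / (1 + \<bar>t\<bar>)\<^sup>2"
          using C by (intro divide_left_mono mult_pos_pos zero_less_power) (auto intro: add_pos_nonneg simp: add_pos_nonneg)
        then have "C / (1 + \<bar>t + pi / max pi (X n)\<bar>)\<^sup>2 \<le> 4 * C / (1 + \<bar>t\<bar>)\<^sup>2"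
          by (simp only: power_mult_distrib) simp
        moreover have "norm (h t - h (t + pi / max pi (X n))) \<le> C / (1 + \<bar>t\<bar>)\<^sup>2 + C / (1 + \<bar>t + pi / max pi (X n)\<bar>)\<^sup>2"
          by (rule order_trans[OF norm_triangle_ineq4]) (intro add_mono bd)
        ultimately show ?thesis by simp
      qed
      then show "AE t in lborel. norm (norm (h t - h (t + pi / max pi (X n)))) \<le> 5 * C * (1 / (1 + \<bar>t\<bar>)\<^sup>2)" by simp
    next
      have "(\<lambda>n. norm (h t - h (t + pi / max pi (X n)))) \<longlonglongrightarrow> 0" for t
      proof -
        have "((\<lambda>y. pi / max pi y) \<longlongrightarrow> 0) at_top" by real_asymp
        then have "(\<lambda>n. pi / max pi (X n)) \<longlonglongrightarrow> 0" using X by (rule filterlim_compose)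
        then have "(\<lambda>n. t + pi / max pi (X n)) \<longlonglongrightarrow> t" by (auto intro: tendsto_eq_intros)
        then have "(\<lambda>n. h (t + pi / max pi (X n))) \<longlonglongrightarrow> h t"
          using cont by (intro isCont_tendsto_compose[of t h]) (auto simp: continuous_on_eq_continuous_at)
        then show ?thesis by (auto intro!: tendsto_eq_intros)
      qed
      then show "AE t in lborel. (\<lambda>n. norm (h t - h (t + pi / max pi (X n)))) \<longlonglongrightarrow> 0" by simp
    qed measurable
    then show "(\<lambda>n. LINT t|lborel. norm (h t - h (t + pi / max pi (X n)))) \<longlonglongrightarrow> 0" by simp
  qed
  then show "((\<lambda>y. LINT t|lborel. norm (h t - h (t + pi / y))) \<longlongrightarrow> 0) at_top"
  proof (rule Lim_transform_eventually)
    show "\<forall>\<^sub>F y in at_top. (LINT t|lborel. norm (h t - h (t + pi / max pi y))) = (LINT t|lborel. norm (h t - h (t + pi / y)))"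
      using eventually_ge_at_top[of pi] by eventually_elim (simp add: max_absorb2)
  qed
qed

text \<open>One integration by parts in t gains 1/y, and the Riemann-Lebesgue lemma for the
  differentiated integrand improves this to o(1/y). The differentiated integrand contains
  \<open>deriv F\<close>, whence the second growth condition.\<close>

lemma vertical_integral_log_saving:
  assumes F: "F holomorphic_on S" and S: "open S" "{s. Re s = 1} \<subseteq> S"
    and pF: "poly_bounded {s. Re s = 1} F" "poly_bounded {s. Re s = 1} (deriv F)" and f: "bump R f"
  shows "((\<lambda>y. of_real (y * exp (- y)) * vertical_integral F f y 1) \<longlongrightarrow> 0) at_top"
proof -
  define H where "H t = F (Complex 1 t) * laplace f (Complex 1 t)" for t
  define H' where "H' t = \<i> * (deriv F (Complex 1 t) * laplace f (Complex 1 t) + F (Complex 1 t) * laplace (\<lambda>u. u * f u) (Complex 1 t))" for t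
  have f1: "bump R (\<lambda>u. u * f u)" by (rule bump_mult_id[OF f])
  obtain K0 where K0: "\<And>s. Re s = 1 \<Longrightarrow> norm (F s * laplace f s) \<le> K0 / (1 + \<bar>Im s\<bar>)\<^sup>2"
    using poly_bounded_laplace[OF pF(1) f, of 1] by auto
  obtain K1 where K1: "\<And>s. Re s = 1 \<Longrightarrow> norm (deriv F s * laplace f s) \<le> K1 / (1 + \<bar>Im s\<bar>)\<^sup>2"
    using poly_bounded_laplace[OF pF(2) f, of 1] by auto
  obtain K2 where K2: "\<And>s. Re s = 1 \<Longrightarrow> norm (F s * laplace (\<lambda>u. u * f u) s) \<le> K2 / (1 + \<bar>Im s\<bar>)\<^sup>2"
    using poly_bounded_laplace[OF pF(1) f1, of 1] by auto
  have bH: "norm (H t) \<le> K0 / (1 + \<bar>t\<bar>)\<^sup>2" for t using K0[of "Complex 1 t"] by (simp add: H_def)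
  have bH': "norm (H' t) \<le> (K1 + K2) / (1 + \<bar>t\<bar>)\<^sup>2" for t
    using norm_triangle_mono[OF K1[of "Complex 1 t"] K2[of "Complex 1 t"]] by (simp add: H'_def norm_mult add_divide_distrib)
  have lineS: "Complex 1 t \<in> S" for t using S(2) by auto
  have cc: "continuous_on UNIV (Complex 1)" unfolding Complex_eq by (intro continuous_intros)
  have cH: "continuous_on UNIV H"
    unfolding H_def using lineS
    by (intro continuous_intros continuous_on_compose2[OF holomorphic_on_imp_continuous_on[OF F] cc]
        continuous_on_compose2[OF laplace_continuous[OF f, of UNIV] cc]) auto
  have cH': "continuous_on UNIV H'"
    unfolding H'_def using lineS
    by (intro continuous_intros continuous_on_compose2[OF holomorphic_on_imp_continuous_on[OF F] cc]
        continuous_on_compose2[OF holomorphic_on_imp_continuous_on[OF holomorphic_deriv[OF F S(1)]] cc]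
        continuous_on_compose2[OF laplace_continuous[OF f, of UNIV] cc]
        continuous_on_compose2[OF laplace_continuous[OF f1, of UNIV] cc]) auto
  have dH: "(H has_vector_derivative H' t) (at t)" for t
  proof -
    have "((\<lambda>t. Complex 1 t) has_vector_derivative \<i>) (at t)"
      unfolding Complex_eq by (auto intro!: derivative_eq_intros)
    moreover have "((\<lambda>s. F s * laplace f s) has_field_derivative
        (deriv F (Complex 1 t) * laplace f (Complex 1 t) + F (Complex 1 t) * laplace (\<lambda>u. u * f u) (Complex 1 t))) (at (Complex 1 t))"
      using DERIV_mult[OF holomorphic_derivI[OF F S(1) lineS] laplace_derivative[OF f]] by (simp add: mult.commute)
    ultimately have "((\<lambda>s. F s * laplace f s) \<circ> Complex 1 has_vector_derivative H' t) (at t)"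
      unfolding H'_def by (rule field_vector_diff_chain_at)
    then show ?thesis by (simp add: H_def[abs_def] o_def)
  qed
  define I where "I y = (LINT t|lborel. H t * exp (\<i> * of_real (t * y)))" for y
  define I' where "I' y = (LINT t|lborel. H' t * exp (\<i> * of_real (t * y)))" for y
  have parts: "\<i> * of_real y * I y = - I' y" for y
  proof -
    have iH: "integrable lborel (\<lambda>t. \<i> * of_real y * (H t * exp (\<i> * of_real (t * y))))"
      by (intro integrable_mult_right continuous_decay_integrable[of _ K0])
        (use bH in \<open>auto simp: norm_mult intro!: continuous_intros cH\<close>)
    have iH': "integrable lborel (\<lambda>t. H' t * exp (\<i> * of_real (t * y)))"
      by (intro continuous_decay_integrable[of _ "K1 + K2"])
        (use bH' in \<open>auto simp: norm_mult intro!: continuous_intros cH'\<close>)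
    let ?g = "\<lambda>t. H' t * exp (\<i> * of_real (t * y)) + \<i> * of_real y * (H t * exp (\<i> * of_real (t * y)))"
    have lim: "((\<lambda>t. H t * exp (\<i> * of_real (t * y))) \<longlongrightarrow> 0) G" if "((\<lambda>t. K0 / (1 + \<bar>t\<bar>)\<^sup>2) \<longlongrightarrow> 0) G" for G
      by (rule Lim_null_comparison[OF _ that]) (use bH in \<open>auto simp: norm_mult\<close>)
    have "(LBINT t=-\<infinity>..\<infinity>. ?g t) = 0 - 0"
    proof (rule interval_integral_FTC_integrable[where F="\<lambda>t. H t * exp (\<i> * of_real (t * y))"])
      fix t :: real
      have "((\<lambda>t. exp (\<i> * of_real (t * y))) has_vector_derivative \<i> * of_real y * exp (\<i> * of_real (t * y))) (at t)"
        by (auto intro!: derivative_eq_intros has_vector_derivative_real_field)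
      from has_vector_derivative_mult[OF dH this]
      show "((\<lambda>t. H t * exp (\<i> * of_real (t * y))) has_vector_derivative ?g t) (at t)"
        by (simp add: algebra_simps)
      have "continuous_on UNIV ?g" by (intro continuous_intros cH cH')
      then show "isCont ?g t" by (simp add: continuous_on_eq_continuous_at)
    next
      show "set_integrable lborel (einterval (-\<infinity>) \<infinity>) ?g"
        using Bochner_Integration.integrable_add[OF iH' iH] by (simp add: set_integrable_def einterval_def)
      show "(((\<lambda>t. H t * exp (\<i> * of_real (t * y))) \<circ> real_of_ereal) \<longlongrightarrow> 0) (at_right (-\<infinity>))"
        unfolding ereal_tendsto_simps by (rule lim) real_asymp
      show "(((\<lambda>t. H t * exp (\<i> * of_real (t * y))) \<circ> real_of_ereal) \<longlongrightarrow> 0) (at_left \<infinity>)"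
        unfolding ereal_tendsto_simps by (rule lim) real_asymp
    qed simp
    then have "(LINT t|lborel. ?g t) = 0"
      by (simp add: interval_lebesgue_integral_def set_lebesgue_integral_def einterval_def)
    then have "I' y + \<i> * of_real y * I y = 0"
      unfolding I_def I'_def Bochner_Integration.integral_add[OF iH' iH] integral_mult_right_zero .
    then show ?thesis by (simp add: eq_neg_iff_add_eq_0 add.commute)
  qed
  have "(I' \<longlongrightarrow> 0) at_top"
    unfolding I'_def by (rule riemann_lebesgue[OF cH' bH'])
  then have "((\<lambda>y. \<i> * I' y) \<longlongrightarrow> \<i> * 0) at_top" by (rule tendsto_mult[OF tendsto_const])
  moreover have "of_real (y * exp (- y)) * vertical_integral F f y 1 = \<i> * I' y" for y
  proof -
    have "vertical_integral F f y 1 = (LINT t|lborel. of_real (exp y) * (H t * exp (\<i> * of_real (t * y))))"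
      unfolding vertical_integral_def
      by (intro Bochner_Integration.integral_cong refl)
        (simp add: H_def Complex_eq ring_distribs exp_add exp_of_real mult_ac)
    then have v: "vertical_integral F f y 1 = of_real (exp y) * I y" by (simp add: I_def)
    have "exp (- y) * exp y = 1" by (simp flip: exp_add)
    then have "of_real (y * exp (- y)) * vertical_integral F f y 1 = of_real y * I y"
      unfolding v by (simp add: mult.assoc flip: of_real_mult)
    also have "\<dots> = \<i> * (- (\<i> * of_real y * I y))" by (simp flip: mult.assoc)
    also have "\<dots> = \<i> * I' y" unfolding parts by simp
    finally show ?thesis .
  qed
  ultimately show ?thesis by simp
qed

subsection \<open>The zeta function and the L-function modulo 4\<close>

lemma poly_bounded_subset: "poly_bounded S F \<Longrightarrow> T \<subseteq> S \<Longrightarrow> poly_bounded T F"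
  unfolding poly_bounded_def by blast

lemma poly_boundedI: "(\<And>s. s \<in> S \<Longrightarrow> norm (F s) \<le> C * (1 + \<bar>Im s\<bar>) ^ m) \<Longrightarrow> poly_bounded S F"
  unfolding poly_bounded_def by blast

text \<open>The factor n^(-Re s - 1) is summable for Re s > 0, locally uniformly, which gives
  holomorphy of the sum. What remains after summing over n in a strip is the quadratic growth in
  s.\<close>

lemma holomorphic_poly_bounded_series:
  fixes t :: "nat \<Rightarrow> complex \<Rightarrow> complex"
  assumes hol: "\<And>n. t n holomorphic_on {s. 0 < Re s}"
    and bd: "\<And>n s. 0 < Re s \<Longrightarrow> norm (t n s) \<le> K * (1 + norm s)\<^sup>2 * real (Suc n) powr (- Re s - 1)"
    and K: "0 \<le> K"
  shows "(\<lambda>s. \<Sum>n. t n s) holomorphic_on {s. 0 < Re s}"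
    and "\<And>d B. 0 < d \<Longrightarrow> poly_bounded {s. d \<le> Re s \<and> Re s \<le> B} (\<lambda>s. \<Sum>n. t n s)"
    and "\<And>s. 0 < Re s \<Longrightarrow> summable (\<lambda>n. norm (t n s))"
proof -
  have sm: "summable (\<lambda>n. C * real (Suc n) powr (- d - 1))" if "0 < d" for d C
    using that summable_Suc_iff[of "\<lambda>n. real n powr (- d - 1)"] by (intro summable_mult) (simp add: summable_real_powr_iff)
  show smn: "summable (\<lambda>n. norm (t n s))" if "0 < Re s" for s
  proof (rule summable_comparison_test'[where N=0])
    show "summable (\<lambda>n. K * (1 + norm s)\<^sup>2 * real (Suc n) powr (- Re s - 1))" by (rule sm[OF that])
    show "norm (norm (t n s)) \<le> K * (1 + norm s)\<^sup>2 * real (Suc n) powr (- Re s - 1)" for n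
      by (simp only: real_norm_def abs_norm_cancel bd[OF that])
  qed
  show "(\<lambda>s. \<Sum>n. t n s) holomorphic_on {s. 0 < Re s}"
  proof (rule holomorphic_uniform_sequence[where f="\<lambda>N s. \<Sum>n<N. t n s"])
    show "open {s. 0 < Re s}" by (rule open_halfspace_Re_gt)
    show "(\<lambda>s. \<Sum>n<N. t n s) holomorphic_on {s. 0 < Re s}" for N by (intro holomorphic_intros hol)
    fix z assume "z \<in> {s. 0 < Re s}"
    then have z: "0 < Re z" by simp
    define r where "r = Re z / 2"
    have r: "0 < r" using z by (simp add: r_def)
    have cb: "r \<le> Re w \<and> norm w \<le> norm z + r" if "w \<in> cball z r" for w
    proof -
      have "norm (z - w) \<le> r" using that by (simp add: dist_norm)
      moreover have "\<bar>Re z - Re w\<bar> \<le> norm (z - w)" using abs_Re_le_cmod[of "z - w"] by simp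
      moreover have "norm w \<le> norm z + norm (z - w)" using norm_triangle_ineq4[of z "z - w"] by simp
      ultimately show ?thesis unfolding r_def by linarith
    qed
    have "uniform_limit (cball z r) (\<lambda>N s. \<Sum>n<N. t n s) (\<lambda>s. \<Sum>n. t n s) sequentially"
    proof (rule Weierstrass_m_test)
      fix n w assume w: "w \<in> cball z r"
      have "norm (t n w) \<le> K * (1 + norm w)\<^sup>2 * real (Suc n) powr (- Re w - 1)"
        using cb[OF w] r by (intro bd) auto
      also have "\<dots> \<le> K * (1 + (norm z + r))\<^sup>2 * real (Suc n) powr (- r - 1)"
        using cb[OF w] K r by (intro mult_mono power_mono powr_mono) auto
      finally show "norm (t n w) \<le> K * (1 + (norm z + r))\<^sup>2 * real (Suc n) powr (- r - 1)" .
    qed (rule sm[OF r])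
    moreover have "cball z r \<subseteq> {s. 0 < Re s}" using cb r by force
    ultimately show "\<exists>d>0. cball z d \<subseteq> {s. 0 < Re s} \<and> uniform_limit (cball z d) (\<lambda>N s. \<Sum>n<N. t n s) (\<lambda>s. \<Sum>n. t n s) sequentially"
      using r by blast
  qed
  fix d B :: real assume d: "0 < d"
  define S where "S = (\<Sum>n. real (Suc n) powr (- d - 1))"
  have smd: "summable (\<lambda>n. real (Suc n) powr (- d - 1))" using sm[OF d, of 1] by simp
  show "poly_bounded {s. d \<le> Re s \<and> Re s \<le> B} (\<lambda>s. \<Sum>n. t n s)"
  proof (rule poly_boundedI)
    fix s assume "s \<in> {s. d \<le> Re s \<and> Re s \<le> B}"
    then have s: "d \<le> Re s" "Re s \<le> B" by auto
    have "norm (\<Sum>n. t n s) \<le> (\<Sum>n. norm (t n s))" using smn[of s] s d by (intro summable_norm) auto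
    also have "\<dots> \<le> (\<Sum>n. K * (1 + norm s)\<^sup>2 * real (Suc n) powr (- d - 1))"
    proof (rule suminf_le)
      fix n
      show "norm (t n s) \<le> K * (1 + norm s)\<^sup>2 * real (Suc n) powr (- d - 1)"
        using s d K by (intro order_trans[OF bd] mult_left_mono powr_mono) auto
    qed (use smn[of s] s d sm[OF d, of "K * (1 + norm s)\<^sup>2"] in auto)
    also have "\<dots> = K * (1 + norm s)\<^sup>2 * S" unfolding S_def by (rule suminf_mult[OF smd])
    also have "\<dots> \<le> K * ((1 + B) * (1 + \<bar>Im s\<bar>))\<^sup>2 * S"
    proof -
      have "norm s \<le> \<bar>Re s\<bar> + \<bar>Im s\<bar>" by (rule cmod_le)
      then have "1 + norm s \<le> (1 + B) + \<bar>Im s\<bar>" using s d by linarith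
      also have "\<dots> \<le> (1 + B) * (1 + \<bar>Im s\<bar>)" using s d by (simp add: algebra_simps)
      finally have "1 + norm s \<le> (1 + B) * (1 + \<bar>Im s\<bar>)" .
      moreover have "0 \<le> S" unfolding S_def by (intro suminf_nonneg smd) auto
      ultimately show ?thesis using K by (intro mult_right_mono mult_left_mono power_mono) auto
    qed
    also have "\<dots> = (K * (1 + B)\<^sup>2 * S) * (1 + \<bar>Im s\<bar>) ^ 2" by (simp only: power_mult_distrib mult_ac)
    finally show "norm (\<Sum>n. t n s) \<le> (K * (1 + B)\<^sup>2 * S) * (1 + \<bar>Im s\<bar>) ^ 2" .
  qed
qed

section \<open>Continuation of zeta and the L-function to Re s > 0 by series of differences\<close>

lemma real_mvt_bound:
  fixes f :: "real \<Rightarrow> complex"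
  assumes "a \<le> b" "\<And>x. a \<le> x \<Longrightarrow> x \<le> b \<Longrightarrow> (f has_vector_derivative f' x) (at x)"
    "\<And>x. a \<le> x \<Longrightarrow> x \<le> b \<Longrightarrow> norm (f' x) \<le> B"
  shows "norm (f b - f a) \<le> B * (b - a)"
proof -
  have "norm (f b - f a) \<le> B * norm (b - a)"
  proof (rule differentiable_bound[of "{a..b}" f "\<lambda>x h. h *\<^sub>R f' x"])
    fix x assume x: "x \<in> {a..b}"
    show "(f has_derivative (\<lambda>h. h *\<^sub>R f' x)) (at x within {a..b})"
      using assms(2)[of x] x unfolding has_vector_derivative_def by (auto intro: has_derivative_at_withinI)
    show "onorm (\<lambda>h. h *\<^sub>R f' x) \<le> B"
      using assms(3)[of x] x by (intro onorm_le) (auto simp: mult.commute[of B] intro: mult_left_mono)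
  qed (use assms(1) in auto)
  then show ?thesis using assms(1) by simp
qed

text \<open>This is x^(-s), in the exponential form of the terms of \<open>dseries\<close>.\<close>

definition npow :: "real \<Rightarrow> complex \<Rightarrow> complex" where
  "npow x s = exp (- s * of_real (ln x))"

lemma norm_npow: "0 < x \<Longrightarrow> norm (npow x s) = x powr (- Re s)"
  by (simp add: npow_def powr_def)

lemma npow_derivative:
  assumes "0 < x"
  shows "((\<lambda>x. npow x s) has_vector_derivative - s * npow x (s + 1)) (at x)"
proof -
  have e: "npow x (s + 1) = npow x s / of_real x"
    using assms by (simp add: npow_def ring_distribs exp_diff exp_of_real)
  have "((\<lambda>x. - s * of_real (ln x)) has_vector_derivative - s * of_real (1 / x)) (at x)"
    by (intro has_vector_derivative_mult_right has_vector_derivative_of_real) (use assms in \<open>auto intro!: derivative_eq_intros\<close>)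
  from field_vector_diff_chain_at[OF this DERIV_exp]
  show ?thesis unfolding e unfolding npow_def by (simp add: o_def mult.commute)
qed

lemma npow_diff_bound:
  assumes "0 < x" "x \<le> y" "0 < Re s"
  shows "norm (npow y s - npow x s) \<le> norm s * x powr (- Re s - 1) * (y - x)"
proof (rule real_mvt_bound[where f'="\<lambda>u. - s * npow u (s + 1)"])
  fix u assume u: "x \<le> u" "u \<le> y"
  then show "((\<lambda>x. npow x s) has_vector_derivative - s * npow u (s + 1)) (at u)"
    using assms by (intro npow_derivative) auto
  have "u powr (- Re s - 1) \<le> x powr (- Re s - 1)" using u assms by (intro powr_mono2') auto
  then show "norm (- s * npow u (s + 1)) \<le> norm s * x powr (- Re s - 1)"
    using u assms by (simp add: norm_mult norm_npow mult_left_mono)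
qed (use assms in auto)

text \<open>With n + 1 in place of the index, this is s - 1 times the difference between n^(-s) and
  the integral of u^(-s) over [n, n + 1]. The integrals add up to 1 / (s - 1), which accounts for
  the summand 1 in \<open>zeta_reg\<close>.\<close>

definition zeta_term :: "nat \<Rightarrow> complex \<Rightarrow> complex" where
  "zeta_term n s = (s - 1) * npow (real (Suc n)) s - npow (real (Suc n)) (s - 1) + npow (real (Suc (Suc n))) (s - 1)"

lemma zeta_term_bound:
  assumes "0 < Re s"
  shows "norm (zeta_term n s) \<le> 1 * (1 + norm s)\<^sup>2 * real (Suc n) powr (- Re s - 1)"
proof -
  let ?n = "real (Suc n)"
  \<comment> \<open>\<open>G\<close> is built so that its increment over [n, n + 1] is the term,
    while its derivative (s - 1) (n^(-s) - u^(-s)) is a difference of nearby powers and so gains a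
    factor 1/n.\<close>
  define G where "G u = of_real u * ((s - 1) * npow ?n s) + npow u (s - 1)" for u
  have "norm (G (?n + 1) - G ?n) \<le> norm (s - 1) * (norm s * ?n powr (- Re s - 1)) * (?n + 1 - ?n)"
  proof (rule real_mvt_bound[where f'="\<lambda>u. (s - 1) * (npow ?n s - npow u s)"])
    fix u assume u: "?n \<le> u" "u \<le> ?n + 1"
    have "((\<lambda>u. of_real u * ((s - 1) * npow ?n s)) has_vector_derivative (s - 1) * npow ?n s) (at u)"
      by (auto intro!: derivative_eq_intros)
    from has_vector_derivative_add[OF this npow_derivative[of u "s - 1"]]
    show "(G has_vector_derivative (s - 1) * (npow ?n s - npow u s)) (at u)"
      using u by (simp add: G_def[abs_def] algebra_simps)
    have "norm (npow u s - npow ?n s) \<le> norm s * ?n powr (- Re s - 1) * (u - ?n)"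
      using u assms by (intro npow_diff_bound) auto
    also have "\<dots> \<le> norm s * ?n powr (- Re s - 1) * 1" using u by (intro mult_left_mono) auto
    finally show "norm ((s - 1) * (npow ?n s - npow u s)) \<le> norm (s - 1) * (norm s * ?n powr (- Re s - 1))"
      by (simp add: norm_mult norm_minus_commute mult_left_mono)
  qed auto
  moreover have "G (?n + 1) - G ?n = zeta_term n s"
    by (simp add: G_def zeta_term_def algebra_simps)
  ultimately have "norm (zeta_term n s) \<le> norm (s - 1) * norm s * ?n powr (- Re s - 1)"
    by (simp add: mult.assoc)
  also have "\<dots> \<le> 1 * (1 + norm s)\<^sup>2 * ?n powr (- Re s - 1)"
  proof (rule mult_right_mono)
    have "norm (s - 1) * norm s \<le> (1 + norm s) * (1 + norm s)"
      using norm_triangle_ineq4[of s 1] by (intro mult_mono) auto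
    then show "norm (s - 1) * norm s \<le> 1 * (1 + norm s)\<^sup>2" by (simp add: power2_eq_square)
  qed auto
  finally show ?thesis .
qed

text \<open>Two consecutive nonzero terms of the alternating series are grouped; their difference
  gains one power of the index, which moves absolute convergence from Re s > 1 to Re s > 0.\<close>

definition beta_term :: "nat \<Rightarrow> complex \<Rightarrow> complex" where
  "beta_term k s = npow (real (4 * k + 1)) s - npow (real (4 * k + 3)) s"

lemma beta_term_bound:
  assumes "0 < Re s"
  shows "norm (beta_term n s) \<le> 2 * (1 + norm s)\<^sup>2 * real (Suc n) powr (- Re s - 1)"
proof -
  have "norm (beta_term n s) \<le> norm s * real (4 * n + 1) powr (- Re s - 1) * (real (4 * n + 3) - real (4 * n + 1))"
    unfolding beta_term_def by (subst norm_minus_commute, rule npow_diff_bound) (use assms in auto)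
  also have "\<dots> = 2 * norm s * real (4 * n + 1) powr (- Re s - 1)" by simp
  also have "\<dots> \<le> 2 * (1 + norm s)\<^sup>2 * real (Suc n) powr (- Re s - 1)"
  proof (intro mult_mono powr_mono2')
    have "norm s \<le> 1 * (1 + norm s)" by simp
    also have "\<dots> \<le> (1 + norm s) * (1 + norm s)" by (intro mult_right_mono) auto
    finally show "norm s \<le> (1 + norm s)\<^sup>2" by (simp add: power2_eq_square)
  qed (use assms in auto)
  finally show ?thesis .
qed

text \<open>\<open>zeta_reg s\<close> is \<open>(s - 1) * zeta s\<close>, and \<open>beta_L\<close> is the Dirichlet \<open>L\<close>-function of the
  non-principal character \<open>chi4\<close> modulo 4.\<close>

definition zeta_reg :: "complex \<Rightarrow> complex" where
  "zeta_reg s = 1 + (\<Sum>n. zeta_term n s)"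

definition beta_L :: "complex \<Rightarrow> complex" where
  "beta_L s = (\<Sum>n. beta_term n s)"

definition chi4 :: "nat \<Rightarrow> real" where
  "chi4 n = (if n mod 4 = 1 then 1 else if n mod 4 = 3 then -1 else 0)"

lemma npow_holomorphic: "(\<lambda>s. npow x (s + c)) holomorphic_on S" "npow x holomorphic_on S" "(\<lambda>s. npow x (s - c)) holomorphic_on S"
  unfolding npow_def by (intro holomorphic_intros)+

lemma zeta_reg_props:
  shows "zeta_reg holomorphic_on {s. 0 < Re s}"
    and "0 < d \<Longrightarrow> poly_bounded {s. d \<le> Re s \<and> Re s \<le> B} zeta_reg"
    and "0 < Re s \<Longrightarrow> summable (\<lambda>n. norm (zeta_term n s))"
proof -
  have h: "zeta_term n holomorphic_on {s. 0 < Re s}" for n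
    unfolding zeta_term_def[abs_def] by (intro holomorphic_intros npow_holomorphic)
  note * = holomorphic_poly_bounded_series[OF h zeta_term_bound, simplified]
  show "zeta_reg holomorphic_on {s. 0 < Re s}"
    unfolding zeta_reg_def[abs_def] by (intro holomorphic_intros *(1))
  show "0 < Re s \<Longrightarrow> summable (\<lambda>n. norm (zeta_term n s))" using *(3) by simp
  assume "0 < d"
  from *(2)[OF this, of B] obtain C m where C: "\<And>s. d \<le> Re s \<Longrightarrow> Re s \<le> B \<Longrightarrow> norm (\<Sum>n. zeta_term n s) \<le> C * (1 + \<bar>Im s\<bar>) ^ m"
    by (auto simp: poly_bounded_def)
  show "poly_bounded {s. d \<le> Re s \<and> Re s \<le> B} zeta_reg"
  proof (rule poly_boundedI)
    fix s assume s: "s \<in> {s. d \<le> Re s \<and> Re s \<le> B}"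
    have "norm (zeta_reg s) \<le> norm (1::complex) + norm (\<Sum>n. zeta_term n s)"
      unfolding zeta_reg_def by (rule norm_triangle_ineq)
    also have "\<dots> \<le> (1 + \<bar>Im s\<bar>) ^ m + C * (1 + \<bar>Im s\<bar>) ^ m"
      using s C[of s] by (intro add_mono) (auto intro: one_le_power)
    finally show "norm (zeta_reg s) \<le> (1 + C) * (1 + \<bar>Im s\<bar>) ^ m" by (simp add: algebra_simps)
  qed
qed

lemma beta_L_props:
  shows "beta_L holomorphic_on {s. 0 < Re s}"
    and "0 < d \<Longrightarrow> poly_bounded {s. d \<le> Re s \<and> Re s \<le> B} beta_L"
    and "0 < Re s \<Longrightarrow> summable (\<lambda>n. norm (beta_term n s))"
proof -
  have h: "beta_term n holomorphic_on {s. 0 < Re s}" for n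
    unfolding beta_term_def[abs_def] by (intro holomorphic_intros npow_holomorphic)
  note * = holomorphic_poly_bounded_series[OF h beta_term_bound, simplified]
  show "beta_L holomorphic_on {s. 0 < Re s}" "0 < d \<Longrightarrow> poly_bounded {s. d \<le> Re s \<and> Re s \<le> B} beta_L"
    "0 < Re s \<Longrightarrow> summable (\<lambda>n. norm (beta_term n s))"
    using * unfolding beta_L_def[abs_def] by simp_all
qed

lemma npow_summable:
  assumes "1 < Re s"
  shows "summable (\<lambda>n. norm (npow (real (Suc n)) s))"
  using assms summable_Suc_iff[of "\<lambda>n. real n powr (- Re s)"] by (simp add: norm_npow summable_real_powr_iff)

lemma zeta_reg_1: "zeta_reg 1 = 1"
proof -
  have "zeta_term n 1 = 0" for n by (simp add: zeta_term_def npow_def)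
  then show ?thesis by (simp add: zeta_reg_def)
qed

lemma bij_Suc: "bij_betw Suc UNIV {0<..}"
  by (rule bij_betwI[where g="\<lambda>n. n - 1"]) auto

lemma zeta_dseries_summable:
  assumes "1 < c"
  shows "(\<lambda>n. 1 * exp (- c * ln (real n))) summable_on {0::nat<..}"
proof -
  have "summable (\<lambda>n. norm (npow (real (Suc n)) (of_real c)))" using assms by (intro npow_summable) simp
  then have "(\<lambda>n. norm (npow (real (Suc n)) (of_real c))) summable_on UNIV"
    by (intro norm_summable_imp_summable_on) simp
  then have "(\<lambda>n. norm (npow (real n) (of_real c))) summable_on {0<..}"
    by (subst summable_on_reindex_bij_betw[OF bij_Suc, symmetric])
  then show ?thesis by (simp add: npow_def)
qed

text \<open>The last two pieces of \<open>zeta_term\<close> telescope. A partial sum keeps only -1,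
  which cancels the 1 in \<open>zeta_reg\<close>, and the boundary term (N + 1)^(1 - s), which tends
  to 0 because Re s > 1.\<close>

lemma zeta_reg_eq:
  assumes s: "1 < Re s"
  shows "zeta_reg s = (s - 1) * dseries {0<..} (\<lambda>_. 1) (\<lambda>n. ln (real n)) s"
proof -
  have sm: "summable (\<lambda>n. norm (npow (real (Suc n)) s))" by (rule npow_summable[OF s])
  have part: "(\<Sum>n<N. zeta_term n s) = (s - 1) * (\<Sum>n<N. npow (real (Suc n)) s) - 1 + npow (real (Suc N)) (s - 1)" for N
    by (induction N) (auto simp: zeta_term_def algebra_simps, simp add: npow_def)
  have "(\<lambda>N. npow (real (Suc N)) (s - 1)) \<longlonglongrightarrow> 0"
  proof (rule tendsto_norm_zero_cancel)
    have "(\<lambda>N. real (Suc N) powr (- (Re s - 1))) \<longlonglongrightarrow> 0" using s by real_asymp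
    then show "(\<lambda>N. norm (npow (real (Suc N)) (s - 1))) \<longlonglongrightarrow> 0" by (simp add: norm_npow)
  qed
  then have "(\<lambda>N. (s - 1) * (\<Sum>n<N. npow (real (Suc n)) s) - 1 + npow (real (Suc N)) (s - 1)) \<longlonglongrightarrow> (s - 1) * (\<Sum>n. npow (real (Suc n)) s) - 1 + 0"
    by (intro tendsto_intros summable_LIMSEQ summable_norm_cancel[OF sm])
  then have "(\<lambda>N. \<Sum>n<N. zeta_term n s) \<longlonglongrightarrow> (s - 1) * (\<Sum>n. npow (real (Suc n)) s) - 1"
    unfolding part by simp
  moreover have "(\<lambda>N. \<Sum>n<N. zeta_term n s) \<longlonglongrightarrow> (\<Sum>n. zeta_term n s)"
    using s zeta_reg_props(3)[of s] by (intro summable_LIMSEQ) (auto intro: summable_norm_cancel)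
  ultimately have "(\<Sum>n. zeta_term n s) = (s - 1) * (\<Sum>n. npow (real (Suc n)) s) - 1"
    by (rule LIMSEQ_unique[rotated])
  moreover have "(\<Sum>n. npow (real (Suc n)) s) = dseries {0<..} (\<lambda>_. 1) (\<lambda>n. ln (real n)) s"
  proof -
    have "((\<lambda>n. npow (real (Suc n)) s) has_sum (\<Sum>n. npow (real (Suc n)) s)) UNIV"
      using sm by (intro norm_summable_imp_has_sum summable_sums) (auto intro: summable_norm_cancel)
    then have "(\<Sum>\<^sub>\<infinity>n. npow (real (Suc n)) s) = (\<Sum>n. npow (real (Suc n)) s)" by (rule infsumI)
    then show ?thesis
      unfolding dseries_def infsum_reindex_bij_betw[OF bij_Suc, of "\<lambda>n. npow (real n) s"] by (simp add: npow_def)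
  qed
  ultimately show ?thesis by (simp add: zeta_reg_def)
qed

lemma beta_L_eq:
  assumes s: "1 < Re s"
  shows "beta_L s = dseries {0<..} chi4 (\<lambda>n. ln (real n)) s"
proof -
  have sm0: "(\<lambda>n. norm (npow (real n) s)) summable_on {0<..}"
    using zeta_dseries_summable[OF s] by (simp add: npow_def)
  have bij: "bij_betw (\<lambda>k. 4 * k + r) UNIV {n::nat. n mod 4 = r}" if "r < 4" for r :: nat
    using that by (intro bij_betwI[where g="\<lambda>n. n div 4"]) auto
  have sub: "{n::nat. n mod 4 = r} \<subseteq> {0<..}" if "0 < r" for r using that by (auto intro: gr0I)
  have sr: "(\<lambda>n. npow (real n) s) summable_on {n. n mod 4 = r}" if "0 < r" for r
    using summable_on_subset_banach[OF abs_summable_summable[OF sm0] sub[OF that]] .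
  have hs: "((\<lambda>n. npow (real n) s) has_sum (\<Sum>\<^sub>\<infinity>k. npow (real (4 * k + r)) s)) {n. n mod 4 = r}" if "0 < r" "r < 4" for r
    unfolding infsum_reindex_bij_betw[OF bij[OF that(2)], of "\<lambda>n. npow (real n) s"]
    by (rule has_sum_infsum[OF sr[OF that(1)]])
  have sk: "(\<lambda>k. npow (real (4 * k + r)) s) summable_on UNIV" if "0 < r" "r < 4" for r
    using sr[OF that(1)] summable_on_reindex_bij_betw[OF bij[OF that(2)], of "\<lambda>n. npow (real n) s"] by simp
  have "beta_L s = (\<Sum>\<^sub>\<infinity>k. beta_term k s)"
    unfolding beta_L_def using beta_L_props(3)[of s] s
    by (intro infsumI[symmetric] norm_summable_imp_has_sum summable_sums) (auto intro: summable_norm_cancel)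
  also have "\<dots> = (\<Sum>\<^sub>\<infinity>k. npow (real (4 * k + 1)) s) + - (\<Sum>\<^sub>\<infinity>k. npow (real (4 * k + 3)) s)"
    unfolding beta_term_def diff_conv_add_uminus infsum_uminus[symmetric]
    by (rule infsum_add) (use sk[of 1] sk[of 3] in \<open>simp_all add: summable_on_uminus\<close>)
  also have "((\<lambda>n. of_real (chi4 n) * npow (real n) s) has_sum \<dots>) ({n. n mod 4 = 1} \<union> {n. n mod 4 = 3})"
  proof (rule has_sum_Un_disjoint)
    show "((\<lambda>n. of_real (chi4 n) * npow (real n) s) has_sum (\<Sum>\<^sub>\<infinity>k. npow (real (4 * k + 1)) s)) {n. n mod 4 = 1}"
      using hs[of 1] by (rule has_sum_cong[THEN iffD1, rotated]) (auto simp: chi4_def)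
    have "((\<lambda>n. - npow (real n) s) has_sum - (\<Sum>\<^sub>\<infinity>k. npow (real (4 * k + 3)) s)) {n. n mod 4 = 3}"
      using hs[of 3] by (simp add: has_sum_uminus)
    then show "((\<lambda>n. of_real (chi4 n) * npow (real n) s) has_sum - (\<Sum>\<^sub>\<infinity>k. npow (real (4 * k + 3)) s)) {n. n mod 4 = 3}"
      by (rule has_sum_cong[THEN iffD1, rotated]) (auto simp: chi4_def)
  qed auto
  then have "((\<lambda>n. of_real (chi4 n) * npow (real n) s) has_sum (\<Sum>\<^sub>\<infinity>k. npow (real (4 * k + 1)) s) + - (\<Sum>\<^sub>\<infinity>k. npow (real (4 * k + 3)) s)) {0<..}"
    by (rule has_sum_cong_neutral[THEN iffD1, rotated -1]) (auto simp: chi4_def intro: gr0I)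
  from infsumI[OF this] show ?thesis using calculation unfolding dseries_def npow_def by simp
qed

text \<open>For real arguments every grouped term is positive. At x = 1 this is the nonvanishing
  L(1) that the inequality for 3 + 4 cos u + cos(2 u) cannot reach.\<close>

lemma beta_L_real_pos:
  assumes "0 < x"
  shows "beta_L (of_real x) \<noteq> 0"
proof -
  have t: "beta_term k (of_real x) = of_real (real (4 * k + 1) powr (- x) - real (4 * k + 3) powr (- x))" for k
    unfolding beta_term_def npow_def powr_def by (simp add: exp_of_real[symmetric])
  let ?g = "\<lambda>k. real (4 * k + 1) powr (- x) - real (4 * k + 3) powr (- x)"
  have pos: "0 < ?g k" for k
    using assms by (simp, intro powr_less_mono2_neg) auto
  have "summable (\<lambda>k. norm (beta_term k (of_real x)))" using assms by (intro beta_L_props(3)) simp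
  then have sm: "summable ?g" by (simp only: t norm_of_real abs_of_pos[OF pos])
  have "beta_L (of_real x) = of_real (\<Sum>k. ?g k)"
    unfolding beta_L_def by (simp only: t suminf_of_real[OF sm])
  moreover have "0 < (\<Sum>k. ?g k)" by (rule suminf_pos[OF sm pos])
  ultimately show ?thesis by (simp only: of_real_eq_0_iff)
qed

subsection \<open>Logarithmic derivatives and non-vanishing on the line\<close>

lemma summable_on_comparison_real:
  fixes f g :: "'a \<Rightarrow> real"
  assumes "f summable_on A" "\<And>x. x \<in> A \<Longrightarrow> 0 \<le> g x" "\<And>x. x \<in> A \<Longrightarrow> g x \<le> f x"
  shows "g summable_on A"
proof -
  have "(\<lambda>x. norm (g x)) summable_on A"
  proof (rule Infinite_Sum.abs_summable_on_comparison_test)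
    show "(\<lambda>x. norm (f x)) summable_on A"
      using assms by (intro summable_on_cong[THEN iffD1, OF _ assms(1)]) (simp add: abs_of_nonneg order_trans[OF assms(2) assms(3)])
    show "norm (g x) \<le> norm (f x)" if "x \<in> A" for x using assms(2,3)[OF that] by simp
  qed
  then show ?thesis by (rule abs_summable_summable)
qed

definition dseries_converges :: "'i set \<Rightarrow> ('i \<Rightarrow> real) \<Rightarrow> ('i \<Rightarrow> real) \<Rightarrow> bool" where
  "dseries_converges I b l \<longleftrightarrow> (\<forall>i\<in>I. 0 \<le> l i) \<and> (\<forall>c>1. (\<lambda>i. \<bar>b i\<bar> * exp (- c * l i)) summable_on I)"

lemma dseries_summable:
  assumes "dseries_converges I b l" "1 < Re s"
  shows "(\<lambda>i. norm (of_real (b i) * exp (- s * of_real (l i)))) summable_on I"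
    and "(\<lambda>i. of_real (b i) * exp (- s * of_real (l i))) summable_on I"
proof -
  show *: "(\<lambda>i. norm (of_real (b i) * exp (- s * of_real (l i)))) summable_on I"
    using assms by (simp add: dseries_converges_def norm_mult)
  show "(\<lambda>i. of_real (b i) * exp (- s * of_real (l i))) summable_on I"
    using * by (rule abs_summable_summable)
qed

lemma dseries_has_sum:
  assumes "dseries_converges I b l" "1 < Re s"
  shows "((\<lambda>i. of_real (b i) * exp (- s * of_real (l i))) has_sum dseries I b l s) I"
  unfolding dseries_def by (rule has_sum_infsum[OF dseries_summable(2)[OF assms]])

lemma dseries_converges_mult_l:
  assumes "dseries_converges I b l"
  shows "dseries_converges I (\<lambda>i. b i * l i) l"
  unfolding dseries_converges_def
proof (intro conjI ballI allI impI)
  show "0 \<le> l i" if "i \<in> I" for i using assms that by (simp add: dseries_converges_def)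
  fix c :: real assume c: "1 < c"
  \<comment> \<open>Half of the distance to 1 pays for the factor \<open>l\<close>, since l <= exp(e
    l) / e; the other half keeps the series convergent.\<close>
  define e where "e = (c - 1) / 2"
  have e: "0 < e" "1 < c - e" using c by (auto simp: e_def field_simps)
  have "(\<lambda>i. (1 / e) * (\<bar>b i\<bar> * exp (- (c - e) * l i))) summable_on I"
    by (intro summable_on_cmult_right assms[unfolded dseries_converges_def, THEN conjunct2, rule_format] e)
  then show "(\<lambda>i. \<bar>b i * l i\<bar> * exp (- c * l i)) summable_on I"
  proof (rule summable_on_comparison_real)
    fix i assume "i \<in> I"
    then have l: "0 \<le> l i" using assms by (simp add: dseries_converges_def)
    have "e * l i \<le> exp (e * l i)" using exp_ge_add_one_self[of "e * l i"] by linarith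
    then have "l i \<le> (1 / e) * exp (e * l i)" using e by (simp add: field_simps)
    then have "\<bar>b i\<bar> * (l i * exp (- c * l i)) \<le> \<bar>b i\<bar> * ((1 / e) * exp (e * l i) * exp (- c * l i))"
      by (intro mult_left_mono mult_right_mono) auto
    also have "\<dots> = (1 / e) * (\<bar>b i\<bar> * exp (- (c - e) * l i))"
      by (simp add: mult.assoc exp_add[symmetric] algebra_simps)
    finally show "\<bar>b i * l i\<bar> * exp (- c * l i) \<le> (1 / e) * (\<bar>b i\<bar> * exp (- (c - e) * l i))"
      using l by (simp add: abs_mult mult.assoc)
  qed auto
qed

lemma dseries_derivative:
  assumes "dseries_converges I b l" and s: "1 < Re s"
  shows "(dseries I b l has_field_derivative - dseries I (\<lambda>i. b i * l i) l s) (at s)"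
proof -
  define r where "r = (Re s - 1) / 2"
  have r: "0 < r" using s by (simp add: r_def)
  have cb: "1 + r \<le> Re w" if "w \<in> cball s r" for w
  proof -
    have "\<bar>Re s - Re w\<bar> \<le> r" using that abs_Re_le_cmod[of "s - w"] by (simp add: dist_norm)
    moreover have "Re s = 1 + 2 * r" by (simp add: r_def field_simps)
    ultimately show ?thesis by linarith
  qed
  let ?f = "\<lambda>Y s. \<Sum>i\<in>Y. of_real (b i) * exp (- s * of_real (l i))"
  let ?f' = "\<lambda>Y s. \<Sum>i\<in>Y. - (of_real (b i * l i) * exp (- s * of_real (l i)))"
  have ul: "uniform_limit (cball s r) ?f (dseries I b l) (finite_subsets_at_top I)"
    by (intro dseries_uniform_limit[where c="1 + r"] cb assms(1)[unfolded dseries_converges_def, THEN conjunct2, rule_format])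
      (use assms r in \<open>auto simp: dseries_converges_def\<close>)
  have "\<forall>\<^sub>F Y in finite_subsets_at_top I. continuous_on (cball s r) (?f Y) \<and>
      (\<forall>w \<in> ball s r. (?f Y has_field_derivative ?f' Y w) (at w))"
  proof (intro always_eventually allI conjI ballI)
    fix Y w
    show "continuous_on (cball s r) (?f Y)" by (intro continuous_intros)
    show "(?f Y has_field_derivative ?f' Y w) (at w)"
      by (rule DERIV_sum) (auto intro!: derivative_eq_intros)
  qed
  from has_complex_derivative_uniform_limit[OF this ul _ r] obtain g' where
    g': "\<And>w. w \<in> ball s r \<Longrightarrow> (dseries I b l has_field_derivative g' w) (at w) \<and> ((\<lambda>Y. ?f' Y w) \<longlongrightarrow> g' w) (finite_subsets_at_top I)"
    by (metis finite_subsets_at_top_neq_bot)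
  have "((\<lambda>i. - (of_real (b i * l i) * exp (- s * of_real (l i)))) has_sum - dseries I (\<lambda>i. b i * l i) l s) I"
    using dseries_has_sum[OF dseries_converges_mult_l[OF assms(1)] s] by (rule has_sum_uminusI)
  then have "((\<lambda>Y. ?f' Y s) \<longlongrightarrow> - dseries I (\<lambda>i. b i * l i) l s) (finite_subsets_at_top I)"
    unfolding has_sum_def .
  moreover have "((\<lambda>Y. ?f' Y s) \<longlongrightarrow> g' s) (finite_subsets_at_top I)" using g'[of s] r by simp
  ultimately have "g' s = - dseries I (\<lambda>i. b i * l i) l s"
    by (rule tendsto_unique[OF finite_subsets_at_top_neq_bot, rotated])
  then show ?thesis using g'[of s] r by simp
qed

section \<open>The logarithmic derivative of a completely multiplicative Dirichlet series\<close>

definition prime_pairs :: "('a::factorial_semiring \<times> nat) set" where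
  "prime_pairs = {(p, k). prime p \<and> 0 < k}"

text \<open>One representative from each nonzero class of associates: the positive integers in the
  rational case, the half-open first quadrant in the Gaussian case, where they stand for the nonzero
  ideals.\<close>

definition normals :: "'a::normalization_semidom set" where
  "normals = {a. a \<noteq> 0 \<and> normalize a = a}"

definition dividing_pairs :: "'a::factorial_semiring \<Rightarrow> ('a \<times> nat) set" where
  "dividing_pairs a = {(p, k). prime p \<and> 0 < k \<and> p ^ k dvd a}"

text \<open>This is the combinatorial core of Lambda convolved with 1 being log: a prime power
  together with a cofactor is the same as their product together with a prime power dividing it.
  Normalisation makes the product canonical.\<close>

lemma bij_dividing_pairs:
  "bij_betw (\<lambda>((p, k), b). (normalize (p ^ k * b), (p, k))) (prime_pairs \<times> normals) (SIGMA a:normals. dividing_pairs (a::'a::factorial_semiring))"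
proof (rule bij_betwI[where g="\<lambda>(a, (p, k)). ((p, k), normalize (a div p ^ k))"])
  show "(\<lambda>((p, k), b). (normalize (p ^ k * b), (p, k))) \<in> prime_pairs \<times> normals \<rightarrow> (SIGMA a:normals. dividing_pairs a)"
    by (auto simp: prime_pairs_def normals_def dividing_pairs_def)
  show "(\<lambda>(a, (p, k)). ((p, k), normalize (a div p ^ k))) \<in> (SIGMA a:normals. dividing_pairs a) \<rightarrow> prime_pairs \<times> normals"
    by (auto simp: prime_pairs_def normals_def dividing_pairs_def dvd_div_eq_0_iff)
next
  fix x :: "('a \<times> nat) \<times> 'a" assume "x \<in> prime_pairs \<times> normals"
  then obtain p k b where x: "x = ((p, k), b)" "prime p" "0 < k" "b \<noteq> 0" "normalize b = b"
    by (auto simp: prime_pairs_def normals_def)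
  have p0: "p \<noteq> 0" using x by auto
  then have pk: "p ^ k \<noteq> 0" by auto
  have "normalize (normalize (p ^ k * b) div p ^ k) = normalize b"
  proof (rule associatedI)
    have "normalize (p ^ k * b) div p ^ k dvd p ^ k * b div p ^ k" by (intro div_dvd_div[THEN iffD2]) auto
    then show "normalize (p ^ k * b) div p ^ k dvd b" using p0 by simp
    have "p ^ k * b div p ^ k dvd normalize (p ^ k * b) div p ^ k" by (intro div_dvd_div[THEN iffD2]) auto
    then show "b dvd normalize (p ^ k * b) div p ^ k" using p0 by simp
  qed
  then show "(\<lambda>(a, (p, k)). ((p, k), normalize (a div p ^ k))) ((\<lambda>((p, k), b). (normalize (p ^ k * b), (p, k))) x) = x"
    using x by simp
next
  fix y :: "'a \<times> 'a \<times> nat" assume "y \<in> (SIGMA a:normals. dividing_pairs a)"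
  then obtain p k a where y: "y = (a, (p, k))" "prime p" "0 < k" "a \<noteq> 0" "normalize a = a" "p ^ k dvd a"
    by (auto simp: dividing_pairs_def normals_def)
  then show "(\<lambda>((p, k), b). (normalize (p ^ k * b), (p, k))) ((\<lambda>(a, (p, k)). ((p, k), normalize (a div p ^ k))) y) = y"
    by simp
qed

text \<open>\<open>c\<close> is a completely multiplicative coefficient and \<open>l\<close> the
  logarithm of the size. The locale serves zeta, the L-function modulo 4 and the Dedekind zeta
  function. The bound \<open>ln 2\<close> keeps the lengths of prime powers away from 0, so that
  logarithmic derivatives can be integrated termwise by dividing by the length.\<close>

locale multiplicative_family =
  fixes c l :: "'a::factorial_semiring \<Rightarrow> real"
  assumes c_mult: "\<And>a b. c (a * b) = c a * c b" and c_normalize: "\<And>a. c (normalize a) = c a" and c_1: "c 1 = 1"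
    and l_mult: "\<And>a b. a \<noteq> 0 \<Longrightarrow> b \<noteq> 0 \<Longrightarrow> l (a * b) = l a + l b"
    and l_normalize: "\<And>a. l (normalize a) = l a"
    and l_prime: "\<And>p. prime p \<Longrightarrow> ln 2 \<le> l p"
    and converges: "dseries_converges normals c l"
begin

lemma l_1: "l 1 = 0"
  using l_mult[of 1 1] by simp

lemma l_power: "a \<noteq> 0 \<Longrightarrow> l (a ^ k) = real k * l a"
  by (induction k) (auto simp: l_1 l_mult algebra_simps)

lemma c_power: "c (a ^ k) = c a ^ k"
  by (induction k) (auto simp: c_1 c_mult)

lemma finite_dividing_pairs:
  assumes "a \<noteq> 0"
  shows "dividing_pairs a = (SIGMA p:prime_factors a. {1..multiplicity p a})"
proof -
  have "p ^ k dvd a \<longleftrightarrow> k \<le> multiplicity p a" if "prime p" for p k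
    using that assms by (intro power_dvd_iff_le_multiplicity) auto
  moreover have "p dvd a" if "0 < k" "p ^ k dvd a" for p k
    using that by (meson dvd_power dvd_trans)
  ultimately show ?thesis
    using assms by (auto simp: dividing_pairs_def in_prime_factors_iff) 
qed

text \<open>A prime p contributes \<open>l p\<close> once for each of its multiplicity many powers
  that divide \<open>a\<close>, and \<open>l\<close> is additive along the factorisation.\<close>

lemma sum_dividing_pairs:
  assumes "a \<noteq> 0"
  shows "finite (dividing_pairs a)" "(\<Sum>(p, k)\<in>dividing_pairs a. l p) = l a"
proof -
  show "finite (dividing_pairs a)" unfolding finite_dividing_pairs[OF assms] by auto
  have prod: "l (\<Prod>p\<in>A. p ^ m p) = (\<Sum>p\<in>A. real (m p) * l p) \<and> (\<Prod>p\<in>A. p ^ m p) \<noteq> 0" if "finite A" "0 \<notin> A" for A and m :: "'a \<Rightarrow> nat"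
    using that by (induction A) (auto simp: l_1 l_mult l_power)
  have "(\<Sum>(p, k)\<in>dividing_pairs a. l p) = (\<Sum>p\<in>prime_factors a. real (multiplicity p a) * l p)"
    unfolding finite_dividing_pairs[OF assms] by (subst sum.Sigma[symmetric]) auto
  also have "\<dots> = (\<Sum>p\<in>prime_factors a. real (count (prime_factorization a) p) * l p)"
    by (intro sum.cong) (auto simp: count_prime_factorization_prime in_prime_factors_iff)
  also have "\<dots> = l (\<Prod>p\<in>prime_factors a. p ^ count (prime_factorization a) p)"
    using prod[of "prime_factors a" "count (prime_factorization a)"] by (auto simp: in_prime_factors_iff)
  also have "\<dots> = l (normalize (prod_mset (prime_factorization a)))" by (simp only: prod_mset_multiplicity l_normalize)
  also have "\<dots> = l a" by (simp only: prod_mset_prime_factorization_weak[OF assms] l_normalize)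
  finally show "(\<Sum>(p, k)\<in>dividing_pairs a. l p) = l a" .
qed

text \<open>The von Mangoldt function at the power p^k, twisted by \<open>c\<close>;
  \<open>pair_len\<close> below is the logarithm of that power.\<close>

definition pair_coeff :: "'a \<times> nat \<Rightarrow> real" where
  "pair_coeff = (\<lambda>(p, k). l p * c p ^ k)"

definition pair_len :: "'a \<times> nat \<Rightarrow> real" where
  "pair_len = (\<lambda>(p, k). real k * l p)"

lemma pair_len_ge: "i \<in> prime_pairs \<Longrightarrow> ln 2 \<le> pair_len i"
proof -
  assume "i \<in> prime_pairs"
  then obtain p k where i: "i = (p, k)" "prime p" "1 \<le> k" by (auto simp: prime_pairs_def)
  have "1 * ln 2 \<le> real k * l p" using i l_prime[of p] by (intro mult_mono) auto
  then show ?thesis by (simp add: i pair_len_def)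
qed

text \<open>The double series is regrouped by the product a = p^k b. In the regrouped order the
  inner sums of absolute values are |c a| \<open>l a\<close> times the exponential, and the
  differentiated series is known to converge absolutely.\<close>

lemma pair_product:
  fixes s :: complex
  assumes s: "1 < Re s"
  defines "x \<equiv> \<lambda>a. of_real (c a) * exp (- s * of_real (l a))"
  defines "m \<equiv> \<lambda>i. of_real (pair_coeff i) * exp (- s * of_real (pair_len i))"
  shows "(\<lambda>(i, b). norm (m i * x b)) summable_on prime_pairs \<times> normals"
    and "(\<Sum>\<^sub>\<infinity>(i, b)\<in>prime_pairs \<times> normals. m i * x b) = dseries normals (\<lambda>a. c a * l a) l s"
proof -
  define h where "h = (\<lambda>(a, (p::'a, k::nat)). of_real (l p) * x a)"
  have lnn: "0 \<le> l a" if "a \<in> normals" for a using converges that by (simp add: dseries_converges_def)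
  have lp: "0 \<le> l p" if "prime p" for p using l_prime[OF that] by (rule order_trans[rotated]) simp
  have eq: "h ((\<lambda>((p, k), b). (normalize (p ^ k * b), (p, k))) y) = (\<lambda>(i, b). m i * x b) y"
    if y: "y \<in> prime_pairs \<times> normals" for y
  proof -
    obtain p k b where y: "y = ((p, k), b)" "prime p" "b \<noteq> 0"
      using y by (auto simp: prime_pairs_def normals_def)
    then have "p \<noteq> 0" "p ^ k \<noteq> 0" by auto
    then show ?thesis
      using y by (simp add: h_def x_def m_def pair_coeff_def pair_len_def c_normalize l_normalize c_mult c_power
          l_mult l_power ring_distribs exp_add exp_diff exp_minus field_simps)
  qed
  have fin: "finite (dividing_pairs a)" "(\<Sum>i\<in>dividing_pairs a. l (fst i)) = l a" if "a \<in> normals" for a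
    using sum_dividing_pairs[of a] that by (auto simp: normals_def case_prod_beta)
  have sumn: "(\<lambda>y. norm (h y)) summable_on (SIGMA a:normals. dividing_pairs a)"
  proof (rule Infinite_Sum.abs_summable_on_Sigma_iff[THEN iffD2], intro conjI ballI)
    show "(\<lambda>y. norm (h (a, y))) summable_on dividing_pairs a" if "a \<in> normals" for a
      by (rule summable_on_finite[OF fin(1)[OF that]])
    have n: "(\<Sum>\<^sub>\<infinity>y\<in>dividing_pairs a. norm (h (a, y))) = norm (of_real (c a * l a) * exp (- s * of_real (l a)))" if "a \<in> normals" for a
    proof -
      have "(\<Sum>\<^sub>\<infinity>y\<in>dividing_pairs a. norm (h (a, y))) = (\<Sum>y\<in>dividing_pairs a. l (fst y) * norm (x a))"
        unfolding infsum_finite[OF fin(1)[OF that]]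
        by (intro sum.cong) (auto simp: h_def norm_mult dividing_pairs_def lp)
      also have "\<dots> = l a * norm (x a)" unfolding sum_distrib_right[symmetric] fin(2)[OF that] ..
      finally show ?thesis using lnn[OF that] by (simp add: x_def norm_mult abs_mult)
    qed
    have "(\<lambda>a. norm (norm (of_real (c a * l a) * exp (- s * of_real (l a))))) summable_on normals"
      using dseries_summable(1)[OF dseries_converges_mult_l[OF converges] s] by simp
    then show "(\<lambda>a. norm (\<Sum>\<^sub>\<infinity>y\<in>dividing_pairs a. norm (h (a, y)))) summable_on normals"
      by (rule summable_on_cong[THEN iffD2, rotated]) (simp only: n)
  qed
  have "(\<lambda>y. norm (h ((\<lambda>((p, k), b). (normalize (p ^ k * b), (p, k))) y))) summable_on prime_pairs \<times> normals"
    using sumn by (subst summable_on_reindex_bij_betw[OF bij_dividing_pairs])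
  then show "(\<lambda>(i, b). norm (m i * x b)) summable_on prime_pairs \<times> normals"
    by (rule summable_on_cong[THEN iffD1, rotated]) (subst eq, auto)
  have "(\<Sum>\<^sub>\<infinity>(i, b)\<in>prime_pairs \<times> normals. m i * x b) = (\<Sum>\<^sub>\<infinity>y\<in>prime_pairs \<times> normals. h ((\<lambda>((p, k), b). (normalize (p ^ k * b), (p, k))) y))"
    by (rule infsum_cong) (simp add: eq)
  also have "\<dots> = infsum h (SIGMA a:normals. dividing_pairs a)"
    by (rule infsum_reindex_bij_betw[OF bij_dividing_pairs])
  also have "\<dots> = (\<Sum>\<^sub>\<infinity>a\<in>normals. \<Sum>\<^sub>\<infinity>y\<in>dividing_pairs a. h (a, y))"
    by (rule infsum_Sigma_banach[symmetric]) (rule abs_summable_summable[OF sumn])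
  also have "\<dots> = (\<Sum>\<^sub>\<infinity>a\<in>normals. of_real (c a * l a) * exp (- s * of_real (l a)))"
  proof (rule infsum_cong)
    fix a :: 'a assume a: "a \<in> normals"
    have "(\<Sum>\<^sub>\<infinity>y\<in>dividing_pairs a. h (a, y)) = (\<Sum>y\<in>dividing_pairs a. of_real (l (fst y)) * x a)"
      unfolding infsum_finite[OF fin(1)[OF a]] by (intro sum.cong) (auto simp: h_def)
    also have "\<dots> = of_real (l a) * x a" unfolding sum_distrib_right[symmetric] of_real_sum[symmetric] fin(2)[OF a] ..
    finally show "(\<Sum>\<^sub>\<infinity>y\<in>dividing_pairs a. h (a, y)) = of_real (c a * l a) * exp (- s * of_real (l a))"
      by (simp add: x_def)
  qed
  finally show "(\<Sum>\<^sub>\<infinity>(i, b)\<in>prime_pairs \<times> normals. m i * x b) = dseries normals (\<lambda>a. c a * l a) l s"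
    unfolding dseries_def .
qed

lemma pair_converges: "dseries_converges prime_pairs pair_coeff pair_len"
  unfolding dseries_converges_def
proof (intro conjI ballI allI impI)
  show "0 \<le> pair_len i" if "i \<in> prime_pairs" for i
    using pair_len_ge[OF that] by (rule order_trans[rotated]) simp
  fix \<sigma> :: real assume "1 < \<sigma>"
  then have s: "1 < Re (of_real \<sigma>)" by simp
  let ?n = "\<lambda>(i, b). norm ((of_real (pair_coeff i) * exp (- of_real \<sigma> * of_real (pair_len i))) * (of_real (c b) * exp (- of_real \<sigma> * complex_of_real (l b))))"
  \<comment> \<open>The prime power series is the subfamily with cofactor 1 of the convergent double
    series.\<close>
  have "?n summable_on ((\<lambda>i. (i, 1)) ` prime_pairs)"
    by (rule summable_on_subset_banach[OF pair_product(1)[OF s]]) (auto simp: normals_def)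
  then have "(?n \<circ> (\<lambda>i. (i, 1))) summable_on prime_pairs"
    by (subst (asm) summable_on_reindex) (auto simp: inj_on_def)
  then show "(\<lambda>i. \<bar>pair_coeff i\<bar> * exp (- \<sigma> * pair_len i)) summable_on prime_pairs"
    by (simp add: o_def c_1 l_1 norm_mult)
qed

text \<open>By absolute convergence the double series is a product of two series, while its
  regrouped value is the negated derivative.\<close>

lemma log_derivative:
  assumes s: "1 < Re s"
  shows "(dseries normals c l has_field_derivative - dseries prime_pairs pair_coeff pair_len s * dseries normals c l s) (at s)"
proof -
  let ?x = "\<lambda>a. of_real (c a) * exp (- s * of_real (l a))" and ?m = "\<lambda>i. of_real (pair_coeff i) * exp (- s * of_real (pair_len i))"
  have "(\<lambda>y. norm ((\<lambda>(i, b). ?m i * ?x b) y)) summable_on prime_pairs \<times> normals"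
    by (rule summable_on_cong[THEN iffD1, OF _ pair_product(1)[OF s]]) auto
  then have sm: "(\<lambda>(i, b). ?m i * ?x b) summable_on prime_pairs \<times> normals" by (rule abs_summable_summable)
  have "dseries normals (\<lambda>a. c a * l a) l s = (\<Sum>\<^sub>\<infinity>(i, b)\<in>prime_pairs \<times> normals. ?m i * ?x b)"
    using pair_product(2)[OF s] ..
  also have "\<dots> = (\<Sum>\<^sub>\<infinity>i\<in>prime_pairs. \<Sum>\<^sub>\<infinity>b\<in>normals. ?m i * ?x b)"
    using infsum_Sigma_banach[OF sm] by simp
  also have "\<dots> = (\<Sum>\<^sub>\<infinity>i\<in>prime_pairs. ?m i * dseries normals c l s)"
    unfolding dseries_def by (intro infsum_cong infsum_cmult_right dseries_summable(2)[OF converges s])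
  also have "\<dots> = dseries prime_pairs pair_coeff pair_len s * dseries normals c l s"
    unfolding dseries_def[of prime_pairs] by (intro infsum_cmult_left dseries_summable(2)[OF pair_converges s])
  finally show ?thesis using dseries_derivative[OF converges s] by simp
qed

end

text \<open>Dividing the coefficients by the lengths gives a primitive of the logarithmic
  derivative. The quotient of \<open>f\<close> by its exponential has derivative 0 on a convex half
  plane, so no branch of the logarithm has to be chosen; the price is the unknown constant
  \<kappa>.\<close>

lemma exp_of_log_derivative:
  assumes conv: "dseries_converges I b l" and l: "\<And>i. i \<in> I \<Longrightarrow> ln 2 \<le> l i"
    and f: "\<And>s. 1 < Re s \<Longrightarrow> (f has_field_derivative - dseries I b l s * f s) (at s)"
  shows "dseries_converges I (\<lambda>i. b i / l i) l"
    and "\<exists>\<kappa>. \<forall>s. 1 < Re s \<longrightarrow> f s = \<kappa> * exp (dseries I (\<lambda>i. b i / l i) l s)"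
proof -
  have l0: "0 < l i" if "i \<in> I" for i using l[OF that] by (rule less_le_trans[rotated]) simp
  show conv': "dseries_converges I (\<lambda>i. b i / l i) l"
    unfolding dseries_converges_def
  proof (intro conjI ballI allI impI)
    show "0 \<le> l i" if "i \<in> I" for i using l0[OF that] by simp
    fix c :: real assume c: "1 < c"
    have "(\<lambda>i. (1 / ln 2) * (\<bar>b i\<bar> * exp (- c * l i))) summable_on I"
      using conv c by (intro summable_on_cmult_right) (simp add: dseries_converges_def)
    then show "(\<lambda>i. \<bar>b i / l i\<bar> * exp (- c * l i)) summable_on I"
    proof (rule summable_on_comparison_real)
      fix i assume i: "i \<in> I"
      have "\<bar>b i\<bar> / l i \<le> \<bar>b i\<bar> / ln 2" using l[OF i] l0[OF i] by (intro divide_left_mono) auto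
      from mult_right_mono[OF this, of "exp (- c * l i)"]
      show "\<bar>b i / l i\<bar> * exp (- c * l i) \<le> (1 / ln 2) * (\<bar>b i\<bar> * exp (- c * l i))"
        using l0[OF i] by simp
    qed auto
  qed
  let ?E = "dseries I (\<lambda>i. b i / l i) l"
  have dE: "(?E has_field_derivative - dseries I b l s) (at s)" if "1 < Re s" for s
  proof -
    have "dseries I (\<lambda>i. b i / l i * l i) l s = dseries I b l s"
      unfolding dseries_def using l0 by (intro infsum_cong) (auto simp: less_le)
    then show ?thesis using dseries_derivative[OF conv' that] by simp
  qed
  have "\<exists>\<kappa>. \<forall>s\<in>{s. 1 < Re s}. f s * exp (- ?E s) = \<kappa>"
  proof (rule has_field_derivative_zero_constant)
    show "convex {s. 1 < Re s}" by (rule convex_halfspace_Re_gt)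
    fix s assume "s \<in> {s. 1 < Re s}"
    then have s: "1 < Re s" by simp
    have "((\<lambda>s. f s * exp (- ?E s)) has_field_derivative 0) (at s)"
      by (rule derivative_eq_intros f[OF s] dE[OF s] refl)+ (simp add: algebra_simps)
    then show "((\<lambda>s. f s * exp (- ?E s)) has_field_derivative 0) (at s within {s. 1 < Re s})"
      by (rule DERIV_subset) simp
  qed
  then obtain \<kappa> where "\<And>s. 1 < Re s \<Longrightarrow> f s * exp (- ?E s) = \<kappa>" by auto
  then have "f s = \<kappa> * exp (?E s)" if "1 < Re s" for s
    using that by (auto simp: exp_minus field_simps)
  then show "\<exists>\<kappa>. \<forall>s. 1 < Re s \<longrightarrow> f s = \<kappa> * exp (?E s)" by blast
qed

text \<open>The inequality \<open>3 + 4 cos u + cos (2 u) \<ge> 0\<close> behind the non-vanishing on the line \<open>Re s = 1\<close>.\<close>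

lemma three_four_one:
  assumes conv: "dseries_converges I b l" and l: "\<And>i. i \<in> I \<Longrightarrow> ln 2 \<le> l i" and b: "\<And>i. i \<in> I \<Longrightarrow> 0 \<le> b i"
    and f: "\<And>s. 1 < Re s \<Longrightarrow> (f has_field_derivative - dseries I b l s * f s) (at s)"
    and nz: "1 < Re s0" "f s0 \<noteq> 0"
  shows "\<exists>c>0. \<forall>\<sigma>>1. \<forall>t. c \<le> norm (f (of_real \<sigma>)) ^ 3 * norm (f (Complex \<sigma> t)) ^ 4 * norm (f (Complex \<sigma> (2 * t)))"
proof -
  let ?E = "dseries I (\<lambda>i. b i / l i) l"
  note E = exp_of_log_derivative[OF conv l f]
  obtain \<kappa> where k: "\<And>s. 1 < Re s \<Longrightarrow> f s = \<kappa> * exp (?E s)" using E(2) by auto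
  have k0: "\<kappa> \<noteq> 0" using k[OF nz(1)] nz by auto
  \<comment> \<open>The exponent 8 is 3 + 4 + 1: each value of \<open>f\<close> carries the unknown
    factor \<kappa> once.\<close>
  have "norm \<kappa> ^ 8 \<le> norm (f (of_real \<sigma>)) ^ 3 * norm (f (Complex \<sigma> t)) ^ 4 * norm (f (Complex \<sigma> (2 * t)))" if "1 < \<sigma>" for \<sigma> t
  proof -
    have h: "((\<lambda>i. Re (of_real (b i / l i) * exp (- s * of_real (l i)))) has_sum Re (?E s)) I" if "1 < Re s" for s
      by (rule has_sum_Re[OF dseries_has_sum[OF E(1) that]])
    have "((\<lambda>i. 3 * Re (of_real (b i / l i) * exp (- of_real \<sigma> * of_real (l i))) + 4 * Re (of_real (b i / l i) * exp (- Complex \<sigma> t * of_real (l i)))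
         + Re (of_real (b i / l i) * exp (- Complex \<sigma> (2 * t) * of_real (l i)))) has_sum
        3 * Re (?E (of_real \<sigma>)) + 4 * Re (?E (Complex \<sigma> t)) + Re (?E (Complex \<sigma> (2 * t)))) I"
      using that by (intro has_sum_add has_sum_cmult_right h) auto
    then have "0 \<le> 3 * Re (?E (of_real \<sigma>)) + 4 * Re (?E (Complex \<sigma> t)) + Re (?E (Complex \<sigma> (2 * t)))"
    proof (rule has_sum_nonneg)
      fix i assume i: "i \<in> I"
      have l0: "0 < l i" using l[OF i] by (rule less_le_trans[rotated]) simp
      define u where "u = t * l i"
      define A where "A = b i / l i * exp (- \<sigma> * l i)"
      have e: "Re (of_real (b i / l i) * exp (- Complex \<sigma> r * of_real (l i))) = A * cos (r * l i)" for r
        by (simp add: Re_exp A_def)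
      have e0: "Re (of_real (b i / l i) * exp (- of_real \<sigma> * of_real (l i))) = A"
        using e[of 0] by (simp add: complex_of_real_def)
      have id: "3 + 4 * cos u + cos (2 * u) = 2 * (1 + cos u)\<^sup>2"
        using cos_double_cos[of u] by (simp add: power2_eq_square algebra_simps)
      have "3 * Re (of_real (b i / l i) * exp (- of_real \<sigma> * of_real (l i))) + 4 * Re (of_real (b i / l i) * exp (- Complex \<sigma> t * of_real (l i)))
         + Re (of_real (b i / l i) * exp (- Complex \<sigma> (2 * t) * of_real (l i))) = A * (3 + 4 * cos u + cos (2 * u))"
        unfolding e e0 by (simp add: u_def algebra_simps)
      also have "\<dots> = b i / l i * exp (- \<sigma> * l i) * (2 * (1 + cos u)\<^sup>2)" unfolding id A_def ..
      also have "\<dots> \<ge> 0" using b[OF i] l0 by simp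
      finally show "0 \<le> 3 * Re (of_real (b i / l i) * exp (- of_real \<sigma> * of_real (l i))) + 4 * Re (of_real (b i / l i) * exp (- Complex \<sigma> t * of_real (l i)))
         + Re (of_real (b i / l i) * exp (- Complex \<sigma> (2 * t) * of_real (l i)))" .
    qed
    then have "1 \<le> exp (3 * Re (?E (of_real \<sigma>)) + 4 * Re (?E (Complex \<sigma> t)) + Re (?E (Complex \<sigma> (2 * t))))" by simp
    then have "norm \<kappa> ^ 8 * 1 \<le> norm \<kappa> ^ 8 * exp (3 * Re (?E (of_real \<sigma>)) + 4 * Re (?E (Complex \<sigma> t)) + Re (?E (Complex \<sigma> (2 * t))))"
      by (intro mult_left_mono) auto
    also have "\<dots> = norm (f (of_real \<sigma>)) ^ 3 * norm (f (Complex \<sigma> t)) ^ 4 * norm (f (Complex \<sigma> (2 * t)))"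
    proof -
      have alg: "K ^ 8 * (x ^ 3 * y ^ 4 * z) = (K * x) ^ 3 * (K * y) ^ 4 * (K * z)" for K x y z :: real
      proof -
        have "K ^ 8 = K ^ 3 * K ^ 4 * K" by (simp add: eval_nat_numeral)
        then show ?thesis by (simp add: power_mult_distrib)
      qed
      have ex: "exp (3 * x + 4 * y + z) = exp x ^ 3 * exp y ^ 4 * exp z" for x y z :: real
        using exp_of_nat_mult[of 3 x] exp_of_nat_mult[of 4 y] by (simp add: exp_add)
      show ?thesis using that by (simp add: k norm_mult ex alg)
    qed
    finally show ?thesis by simp
  qed
  then show ?thesis using k0 by (intro exI[of _ "norm \<kappa> ^ 8"]) auto
qed

lemma normals_nat: "normals = {0::nat<..}"
  by (auto simp: normals_def)

lemma ln_two_le_prime: "prime (p::nat) \<Longrightarrow> ln 2 \<le> ln (real p)"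
  using prime_ge_2_nat[of p] by simp

lemma chi4_mult: "chi4 (a * b) = chi4 a * chi4 b"
proof -
  have "a mod 4 \<in> {0,1,2,3}" "b mod 4 \<in> {0,1,2,3}" by auto
  moreover have "(a * b) mod 4 = (a mod 4) * (b mod 4) mod 4" by (simp add: mod_mult_eq)
  ultimately show ?thesis unfolding chi4_def by auto
qed

lemma chi4_abs_le: "\<bar>chi4 n\<bar> \<le> 1"
  by (simp add: chi4_def)

interpretation zeta: multiplicative_family "\<lambda>_::nat. 1" "\<lambda>n. ln (real n)"
  by unfold_locales
    (use zeta_dseries_summable in \<open>auto simp: ln_mult ln_two_le_prime normals_nat dseries_converges_def ln_ge_zero_iff\<close>)

interpretation beta: multiplicative_family chi4 "\<lambda>n. ln (real n)"
proof unfold_locales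
  show "dseries_converges normals chi4 (\<lambda>n. ln (real n))"
    unfolding dseries_converges_def normals_nat
  proof (intro conjI ballI allI impI)
    show "(\<lambda>i. \<bar>chi4 i\<bar> * exp (- c * ln (real i))) summable_on {0<..}" if "1 < c" for c
      by (rule summable_on_comparison_real[OF zeta_dseries_summable[OF that]])
        (auto intro!: mult_right_mono chi4_abs_le)
  qed auto
qed (auto simp: ln_mult ln_two_le_prime chi4_mult chi4_def[of "Suc 0"])

section \<open>Functions of polynomial growth in vertical strips\<close>

lemma poly_bounded_mult:
  assumes "poly_bounded S F" "poly_bounded S G"
  shows "poly_bounded S (\<lambda>s. F s * G s)"
proof -
  obtain C m D n where "\<forall>s\<in>S. norm (F s) \<le> C * (1 + \<bar>Im s\<bar>) ^ m" "\<forall>s\<in>S. norm (G s) \<le> D * (1 + \<bar>Im s\<bar>) ^ n"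
    using assms unfolding poly_bounded_def by blast
  then have "norm (F s * G s) \<le> (C * D) * (1 + \<bar>Im s\<bar>) ^ (m + n)" if "s \<in> S" for s
  proof -
    have "norm (F s) * norm (G s) \<le> (C * (1 + \<bar>Im s\<bar>) ^ m) * (D * (1 + \<bar>Im s\<bar>) ^ n)"
      using \<open>\<forall>s\<in>S. norm (F s) \<le> _\<close> \<open>\<forall>s\<in>S. norm (G s) \<le> _\<close> that
      by (intro mult_mono) (auto intro: order_trans[OF norm_ge_zero])
    then show ?thesis by (simp add: norm_mult power_add mult_ac)
  qed
  then show ?thesis by (rule poly_boundedI)
qed

lemma poly_bounded_obtain:
  assumes "poly_bounded S F"
  obtains C m where "1 \<le> C" "1 \<le> m" "\<And>s. s \<in> S \<Longrightarrow> norm (F s) \<le> C * (1 + \<bar>Im s\<bar>) ^ m"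
proof -
  obtain C m where C: "\<And>s. s \<in> S \<Longrightarrow> norm (F s) \<le> C * (1 + \<bar>Im s\<bar>) ^ m"
    using assms unfolding poly_bounded_def by blast
  have "norm (F s) \<le> max 1 C * (1 + \<bar>Im s\<bar>) ^ max 1 m" if "s \<in> S" for s
  proof -
    have "C * (1 + \<bar>Im s\<bar>) ^ m \<le> max 1 C * (1 + \<bar>Im s\<bar>) ^ m" by (intro mult_right_mono) auto
    also have "\<dots> \<le> max 1 C * (1 + \<bar>Im s\<bar>) ^ max 1 m" by (intro mult_left_mono power_increasing) auto
    finally show ?thesis using C[OF that] by simp
  qed
  then show ?thesis by (intro that[of "max 1 C" "max 1 m"]) auto
qed

lemma poly_bounded_add:
  assumes "poly_bounded S F" "poly_bounded S G"
  shows "poly_bounded S (\<lambda>s. F s + G s)"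
proof -
  obtain C m where C: "1 \<le> C" "1 \<le> (m::nat)" "\<And>s. s \<in> S \<Longrightarrow> norm (F s) \<le> C * (1 + \<bar>Im s\<bar>) ^ m"
    using poly_bounded_obtain[OF assms(1)] by blast
  obtain D n where D: "1 \<le> D" "1 \<le> (n::nat)" "\<And>s. s \<in> S \<Longrightarrow> norm (G s) \<le> D * (1 + \<bar>Im s\<bar>) ^ n"
    using poly_bounded_obtain[OF assms(2)] by blast
  have "norm (F s + G s) \<le> (C + D) * (1 + \<bar>Im s\<bar>) ^ (m + n)" if "s \<in> S" for s
  proof -
    have "norm (F s + G s) \<le> C * (1 + \<bar>Im s\<bar>) ^ m + D * (1 + \<bar>Im s\<bar>) ^ n"
      by (rule norm_triangle_mono[OF C(3) D(3)]) (use that in auto)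
    also have "\<dots> \<le> C * (1 + \<bar>Im s\<bar>) ^ (m + n) + D * (1 + \<bar>Im s\<bar>) ^ (m + n)"
      using C D by (intro add_mono mult_left_mono power_increasing) auto
    finally show ?thesis by (simp add: algebra_simps)
  qed
  then show ?thesis by (rule poly_boundedI)
qed

lemma poly_bounded_uminus: "poly_bounded S F \<Longrightarrow> poly_bounded S (\<lambda>s. - F s)"
  by (simp add: poly_bounded_def)

lemma poly_bounded_cong: "poly_bounded S F \<Longrightarrow> (\<And>s. s \<in> S \<Longrightarrow> F s = G s) \<Longrightarrow> poly_bounded S G"
  by (simp add: poly_bounded_def)

text \<open>Cauchy's inequality on discs of radius \<open>r\<close>: the strip shrinks by
  \<open>r\<close> on each side, and 1 + |Im w| at most doubles within a disc because r <=
  1.\<close>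

lemma poly_bounded_deriv:
  assumes "F holomorphic_on {s. 0 < Re s}" "poly_bounded {s. a \<le> Re s \<and> Re s \<le> b} F"
    and r: "0 < r" "r \<le> 1" and a: "0 < a" "a \<le> c - r" "d + r \<le> b"
  shows "poly_bounded {s. c \<le> Re s \<and> Re s \<le> d} (deriv F)"
proof -
  obtain C m where C: "1 \<le> C" "1 \<le> (m::nat)" "\<And>s. s \<in> {s. a \<le> Re s \<and> Re s \<le> b} \<Longrightarrow> norm (F s) \<le> C * (1 + \<bar>Im s\<bar>) ^ m"
    using poly_bounded_obtain[OF assms(2)] by blast
  show ?thesis
  proof (rule poly_boundedI)
    fix s assume s: "s \<in> {s. c \<le> Re s \<and> Re s \<le> d}"
    have ball: "a \<le> Re w \<and> Re w \<le> b \<and> \<bar>Im w\<bar> \<le> \<bar>Im s\<bar> + 1" if "norm (s - w) \<le> r" for w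
      using abs_Re_le_cmod[of "s - w"] abs_Im_le_cmod[of "s - w"] that s a r by auto
    have sub: "cball s r \<subseteq> {s. 0 < Re s}"
      using ball a by (force simp: dist_norm)
    have "norm ((deriv ^^ 1) F s) \<le> fact 1 * (C * 2 ^ m * (1 + \<bar>Im s\<bar>) ^ m) / r ^ 1"
    proof (rule Cauchy_inequality)
      show "F holomorphic_on ball s r" using assms(1) sub ball_subset_cball by (blast intro: holomorphic_on_subset)
      show "continuous_on (cball s r) F" using assms(1) sub by (blast intro: holomorphic_on_subset holomorphic_on_imp_continuous_on)
      fix w assume "norm (s - w) = r"
      then have w: "a \<le> Re w \<and> Re w \<le> b \<and> \<bar>Im w\<bar> \<le> \<bar>Im s\<bar> + 1" by (intro ball) simp
      have "norm (F w) \<le> C * (1 + \<bar>Im w\<bar>) ^ m" using w by (intro C) auto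
      also have "\<dots> \<le> C * (2 * (1 + \<bar>Im s\<bar>)) ^ m" using w C by (intro mult_left_mono power_mono) auto
      finally show "norm (F w) \<le> C * 2 ^ m * (1 + \<bar>Im s\<bar>) ^ m" by (simp only: power_mult_distrib mult.assoc)
    qed (use r in auto)
    then show "norm (deriv F s) \<le> (C * 2 ^ m / r) * (1 + \<bar>Im s\<bar>) ^ m" by simp
  qed
qed

text \<open>Up to the pole, \<open>dedekind_reg\<close> is the Dedekind zeta function of the Gaussian field.\<close>

definition dedekind_reg :: "complex \<Rightarrow> complex" where
  "dedekind_reg s = zeta_reg s * beta_L s"

section \<open>A lower bound for the product of zeta and the L-function on 1 <= Re s <= 2\<close>

lemma zeta_D_eq: "1 < Re s \<Longrightarrow> zeta_reg s = (s - 1) * dseries normals (\<lambda>_. 1) (\<lambda>n. ln (real n)) s"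
  using zeta_reg_eq normals_nat by simp

lemma beta_D_eq: "1 < Re s \<Longrightarrow> beta_L s = dseries normals chi4 (\<lambda>n. ln (real n)) s"
  using beta_L_eq normals_nat by simp

text \<open>At (p, k) this is log p times 1 + chi4(p)^k. It is never negative, in contrast to the
  coefficients of the L-function alone, and so qualifies for \<open>three_four_one\<close>.\<close>

definition pair_coeff_sum :: "nat \<times> nat \<Rightarrow> real" where
  "pair_coeff_sum i = zeta.pair_coeff i + beta.pair_coeff i"

lemma dseries_add:
  assumes "dseries_converges I a l" "dseries_converges I b l"
  shows "dseries_converges I (\<lambda>i. a i + b i) l"
    and "1 < Re s \<Longrightarrow> dseries I (\<lambda>i. a i + b i) l s = dseries I a l s + dseries I b l s"
proof -
  show "dseries_converges I (\<lambda>i. a i + b i) l"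
    unfolding dseries_converges_def
  proof (intro conjI ballI allI impI)
    fix c :: real assume "1 < c"
    then have "(\<lambda>i. \<bar>a i\<bar> * exp (- c * l i) + \<bar>b i\<bar> * exp (- c * l i)) summable_on I"
      using assms by (intro summable_on_add) (auto simp: dseries_converges_def)
    then show "(\<lambda>i. \<bar>a i + b i\<bar> * exp (- c * l i)) summable_on I"
      by (rule summable_on_comparison_real) (auto simp flip: distrib_right)
  qed (use assms in \<open>auto simp: dseries_converges_def\<close>)
  assume "1 < Re s"
  from has_sum_add[OF dseries_has_sum[OF assms(1) this] dseries_has_sum[OF assms(2) this]]
  have "((\<lambda>i. of_real (a i + b i) * exp (- s * of_real (l i))) has_sum dseries I a l s + dseries I b l s) I"
    by (simp add: algebra_simps)
  then show "dseries I (\<lambda>i. a i + b i) l s = dseries I a l s + dseries I b l s"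
    unfolding dseries_def[of I "\<lambda>i. a i + b i"] by (rule infsumI)
qed

text \<open>The right-hand side carries the factors s - 1 that remove the pole: three of size
  \<sigma> - 1, four of size at least |t| from \<sigma> + it and one more from \<sigma> + 2it. They
  account for the powers 3 and 5 on the left.\<close>

lemma dedekind_three_four_one:
  obtains c where "0 < c" "c \<le> 1"
    "\<And>\<sigma> t. 1 < \<sigma> \<Longrightarrow> c * (\<sigma> - 1) ^ 3 * \<bar>t\<bar> ^ 5 \<le> norm (dedekind_reg (of_real \<sigma>)) ^ 3 * norm (dedekind_reg (Complex \<sigma> t)) ^ 4 * norm (dedekind_reg (Complex \<sigma> (2 * t)))"
    "\<And>s. 1 < Re s \<Longrightarrow> dedekind_reg s \<noteq> 0"
proof -
  define f where "f s = dseries normals (\<lambda>_. 1) (\<lambda>n. ln (real n)) s * dseries normals chi4 (\<lambda>n. ln (real n)) s" for s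
  have fG: "dedekind_reg s = (s - 1) * f s" if "1 < Re s" for s
    using that by (simp add: dedekind_reg_def f_def zeta_D_eq beta_D_eq)
  have conv: "dseries_converges prime_pairs pair_coeff_sum zeta.pair_len"
    unfolding pair_coeff_sum_def[abs_def] by (intro dseries_add zeta.pair_converges beta.pair_converges)
  have df: "(f has_field_derivative - dseries prime_pairs pair_coeff_sum zeta.pair_len s * f s) (at s)" if "1 < Re s" for s
    unfolding f_def pair_coeff_sum_def[abs_def] dseries_add(2)[OF zeta.pair_converges beta.pair_converges that]
    by (rule derivative_eq_intros zeta.log_derivative[OF that] beta.log_derivative[OF that] refl)+ (simp add: algebra_simps)
  have nn: "0 \<le> pair_coeff_sum i" if "i \<in> prime_pairs" for i
  proof -
    obtain p k where i: "i = (p, k)" "prime p" using \<open>i \<in> prime_pairs\<close> by (auto simp: prime_pairs_def)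
    have "\<bar>chi4 p ^ k\<bar> \<le> 1" using chi4_abs_le by (simp add: power_abs power_le_one)
    then have "0 \<le> ln (real p) * (1 + chi4 p ^ k)" using i prime_ge_1_nat[of p] by (intro mult_nonneg_nonneg) auto
    then show ?thesis by (simp add: i pair_coeff_sum_def zeta.pair_coeff_def beta.pair_coeff_def algebra_simps)
  qed
  \<comment> \<open>One point where \<open>f\<close> is nonzero shows that the constant in front of
    the exponential is not 0. Such a point is found slightly to the right of 1, since
    \<open>zeta_reg\<close> is 1 there and \<open>beta_L\<close> has no positive real zero.\<close>
  have "isCont zeta_reg 1"
    using zeta_reg_props(1) by (intro continuous_on_interior[OF holomorphic_on_imp_continuous_on]) (auto simp: interior_open open_halfspace_Re_gt)
  then obtain e where e: "0 < e" "\<And>y. dist 1 y < e \<Longrightarrow> zeta_reg y \<noteq> 0"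
    using continuous_at_avoid[of 1 zeta_reg 0] zeta_reg_1 by auto
  define s0 where "s0 = complex_of_real (1 + e / 2)"
  have s0: "1 < Re s0" "s0 \<noteq> 1" using e by (auto simp: s0_def complex_eq_iff)
  have "zeta_reg s0 \<noteq> 0" using e by (intro e(2)) (simp add: s0_def dist_norm norm_divide)
  moreover have "beta_L s0 \<noteq> 0" unfolding s0_def using e by (intro beta_L_real_pos) auto
  ultimately have fs0: "f s0 \<noteq> 0" using fG[OF s0(1)] by (auto simp: dedekind_reg_def)
  obtain c where c: "0 < c" "\<And>\<sigma> t. 1 < \<sigma> \<Longrightarrow> c \<le> norm (f (of_real \<sigma>)) ^ 3 * norm (f (Complex \<sigma> t)) ^ 4 * norm (f (Complex \<sigma> (2 * t)))"
    using three_four_one[OF conv zeta.pair_len_ge nn df s0(1) fs0] by blast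
  show ?thesis
  proof (rule that[of "min c 1"])
    show "min c 1 * (\<sigma> - 1) ^ 3 * \<bar>t\<bar> ^ 5 \<le> norm (dedekind_reg (of_real \<sigma>)) ^ 3 * norm (dedekind_reg (Complex \<sigma> t)) ^ 4 * norm (dedekind_reg (Complex \<sigma> (2 * t)))"
      if \<sigma>: "1 < \<sigma>" for \<sigma> t
    proof -
      define P where "P = norm (f (of_real \<sigma>)) ^ 3 * norm (f (Complex \<sigma> t)) ^ 4 * norm (f (Complex \<sigma> (2 * t)))"
      have n0: "norm (of_real \<sigma> - (1::complex)) = \<sigma> - 1"
        using \<sigma> by (metis abs_of_pos diff_gt_0_iff_gt norm_of_real of_real_1 of_real_diff)
      have n1: "\<bar>t\<bar> \<le> norm (Complex \<sigma> t - 1)" using abs_Im_le_cmod[of "Complex \<sigma> t - 1"] by simp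
      have n2: "\<bar>t\<bar> \<le> norm (Complex \<sigma> (2 * t) - 1)" using abs_Im_le_cmod[of "Complex \<sigma> (2 * t) - 1"] by simp
      have "\<bar>t\<bar> ^ 5 = \<bar>t\<bar> ^ 4 * \<bar>t\<bar>" by (simp add: eval_nat_numeral)
      also have "\<dots> \<le> norm (Complex \<sigma> t - 1) ^ 4 * norm (Complex \<sigma> (2 * t) - 1)"
        using n1 n2 by (intro mult_mono power_mono) auto
      finally have "(\<sigma> - 1) ^ 3 * \<bar>t\<bar> ^ 5 \<le> (\<sigma> - 1) ^ 3 * (norm (Complex \<sigma> t - 1) ^ 4 * norm (Complex \<sigma> (2 * t) - 1))"
        using \<sigma> by (intro mult_left_mono) auto
      then have "min c 1 * ((\<sigma> - 1) ^ 3 * \<bar>t\<bar> ^ 5) \<le> P * ((\<sigma> - 1) ^ 3 * (norm (Complex \<sigma> t - 1) ^ 4 * norm (Complex \<sigma> (2 * t) - 1)))"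
        using \<sigma> c c(2)[OF \<sigma>, of t, folded P_def] by (intro mult_mono) auto
      also have "\<dots> = norm (dedekind_reg (of_real \<sigma>)) ^ 3 * norm (dedekind_reg (Complex \<sigma> t)) ^ 4 * norm (dedekind_reg (Complex \<sigma> (2 * t)))"
        using \<sigma> by (simp add: fG norm_mult n0 power_mult_distrib P_def mult_ac)
      finally show ?thesis by (simp add: mult.assoc)
    qed
    show "dedekind_reg s \<noteq> 0" if s: "1 < Re s" for s
    proof -
      obtain \<kappa> where k: "\<And>s. 1 < Re s \<Longrightarrow> f s = \<kappa> * exp (dseries prime_pairs (\<lambda>i. pair_coeff_sum i / zeta.pair_len i) zeta.pair_len s)"
        using exp_of_log_derivative(2)[OF conv zeta.pair_len_ge df] by blast
      then have "\<kappa> \<noteq> 0" using fs0 s0 by auto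
      then show ?thesis using k[OF s] s fG[OF s] by auto
    qed
  qed (use c in auto)
qed

lemma dedekind_props:
  shows "dedekind_reg holomorphic_on {s. 0 < Re s}"
    and "0 < d \<Longrightarrow> poly_bounded {s. d \<le> Re s \<and> Re s \<le> B} dedekind_reg"
  unfolding dedekind_reg_def[abs_def]
  by (intro holomorphic_intros zeta_reg_props beta_L_props poly_bounded_mult; assumption)+

text \<open>At distance \<delta> to the right of Re s = 1 the inequality gives a lower bound of
  order \<delta>^(3/4), up to powers of t. Moving back to the line loses at most \<delta> times a
  bound for the derivative. As 3/4 < 1, a small \<delta> leaves at least half of the lower
  bound.\<close>

lemma dedekind_lower_bound:
  obtains c M where "0 < c" "\<And>s. 1 \<le> Re s \<Longrightarrow> Re s \<le> 2 \<Longrightarrow> c / (1 + \<bar>Im s\<bar>) ^ M \<le> norm (dedekind_reg s)"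
proof -
  let ?G = dedekind_reg
  obtain c where c: "0 < c" "c \<le> 1"
    "\<And>\<sigma> t. 1 < \<sigma> \<Longrightarrow> c * (\<sigma> - 1) ^ 3 * \<bar>t\<bar> ^ 5 \<le> norm (?G (of_real \<sigma>)) ^ 3 * norm (?G (Complex \<sigma> t)) ^ 4 * norm (?G (Complex \<sigma> (2 * t)))"
    and nz: "\<And>s. 1 < Re s \<Longrightarrow> ?G s \<noteq> 0"
    using dedekind_three_four_one by blast
  have pb: "poly_bounded {s. 1/2 \<le> Re s \<and> Re s \<le> 4} ?G" by (rule dedekind_props(2)) simp
  then obtain B m where B: "1 \<le> B" "1 \<le> (m::nat)" "\<And>s. s \<in> {s. 1/2 \<le> Re s \<and> Re s \<le> 4} \<Longrightarrow> norm (?G s) \<le> B * (1 + \<bar>Im s\<bar>) ^ m"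
    by (rule poly_bounded_obtain) blast
  have "poly_bounded {s. 1 \<le> Re s \<and> Re s \<le> 3} (deriv ?G)"
    by (rule poly_bounded_deriv[OF dedekind_props(1) pb, where r="1/2"]) auto
  then obtain D0 m0 where D0: "1 \<le> D0" "1 \<le> (m0::nat)" "\<And>s. s \<in> {s. 1 \<le> Re s \<and> Re s \<le> 3} \<Longrightarrow> norm (deriv ?G s) \<le> D0 * (1 + \<bar>Im s\<bar>) ^ m0"
    by (rule poly_bounded_obtain) blast
  define n where "n = m + m0"
  have n: "1 \<le> n" "m \<le> n" "m0 \<le> n" using B D0 by (auto simp: n_def)
  have Bn: "norm (?G s) \<le> B * (1 + \<bar>Im s\<bar>) ^ n" if "1 \<le> Re s" "Re s \<le> 2" for s
    by (rule order_trans[OF B(3)]) (use that B(1) n in \<open>auto intro!: mult_left_mono power_increasing\<close>)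
  have Dn: "norm (deriv ?G s) \<le> D0 * (1 + \<bar>Im s\<bar>) ^ n" if "1 \<le> Re s" "Re s \<le> 2" for s
    by (rule order_trans[OF D0(3)]) (use that D0(1) n in \<open>auto intro!: mult_left_mono power_increasing\<close>)
  \<comment> \<open>Chosen so that at abscissa 1 + \<delta> the inequality reads |G| >= 2 D0 T^n
    \<delta>, twice the possible loss on the way back. The 16 is the fourth power of this 2; B^4 and
    2^n come from the bounds for the values at \<tau> and \<tau> + 2it.\<close>
  define c3 where "c3 = c / (16 * 2 ^ n * B ^ 4 * D0 ^ 4)"
  have c3: "0 < c3" "c3 \<le> 1"
  proof -
    have "1 \<le> 16 * 2 ^ n * B ^ 4 * D0 ^ 4" using B(1) D0(1)
      by (intro mult_ge1_I) (auto intro: one_le_power mult_ge1_I)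
    then show "0 < c3" "c3 \<le> 1" unfolding c3_def using c by (auto intro: divide_pos_pos simp: divide_le_eq_1)
  qed
  have low: "D0 * T ^ n * (c3 * \<bar>t\<bar> ^ 5 / T ^ (5 * n)) \<le> norm (?G (Complex \<sigma> t))"
    if T: "T = 1 + \<bar>t\<bar>" and \<sigma>: "1 \<le> \<sigma>" "\<sigma> \<le> 2" and t: "t \<noteq> 0" for t \<sigma> T :: real
  proof -
    have T1: "1 \<le> T" "0 < T" using T by auto
    define \<delta> where "\<delta> = c3 * \<bar>t\<bar> ^ 5 / T ^ (5 * n)"
    have \<delta>: "0 < \<delta>" "\<delta> \<le> 1"
    proof -
      show "0 < \<delta>" unfolding \<delta>_def using c3 t T1 by auto
      have "\<bar>t\<bar> ^ 5 \<le> T ^ 5" using T by (intro power_mono) auto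
      also have "\<dots> \<le> T ^ (5 * n)" using T1 n by (intro power_increasing) auto
      finally have "c3 * \<bar>t\<bar> ^ 5 \<le> 1 * T ^ (5 * n)" using c3 by (intro mult_mono) auto
      then show "\<delta> \<le> 1" unfolding \<delta>_def using T1 by simp
    qed
    have main: "16 * D0 ^ 4 * T ^ (4 * n) * \<delta> * (\<tau> - 1) ^ 3 \<le> norm (?G (Complex \<tau> t)) ^ 4" if \<tau>: "1 < \<tau>" "\<tau> \<le> 2" for \<tau>
    proof -
      have g0: "norm (?G (of_real \<tau>)) \<le> B" using Bn[of "of_real \<tau>"] \<tau> by simp
      have g2: "norm (?G (Complex \<tau> (2 * t))) \<le> B * (2 ^ n * T ^ n)"
      proof -
        have "norm (?G (Complex \<tau> (2 * t))) \<le> B * (1 + \<bar>2 * t\<bar>) ^ n" using Bn[of "Complex \<tau> (2 * t)"] \<tau> by simp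
        also have "\<dots> \<le> B * (2 * T) ^ n" using T B(1) by (intro mult_left_mono power_mono) auto
        finally show ?thesis by (simp add: power_mult_distrib)
      qed
      have "c * (\<tau> - 1) ^ 3 * \<bar>t\<bar> ^ 5 \<le> norm (?G (of_real \<tau>)) ^ 3 * norm (?G (Complex \<tau> t)) ^ 4 * norm (?G (Complex \<tau> (2 * t)))"
        by (rule c(3)[OF \<tau>(1)])
      also have "\<dots> \<le> B ^ 3 * norm (?G (Complex \<tau> t)) ^ 4 * (B * (2 ^ n * T ^ n))"
        using g0 g2 B(1) by (intro mult_mono power_mono) auto
      also have "\<dots> = (B ^ 4 * 2 ^ n * T ^ n) * norm (?G (Complex \<tau> t)) ^ 4" by (simp add: eval_nat_numeral)
      finally have "c * (\<tau> - 1) ^ 3 * \<bar>t\<bar> ^ 5 / (B ^ 4 * 2 ^ n * T ^ n) \<le> norm (?G (Complex \<tau> t)) ^ 4"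
        using B(1) T1 by (subst pos_divide_le_eq) (auto simp: mult.commute)
      moreover have "16 * D0 ^ 4 * T ^ (4 * n) * \<delta> * (\<tau> - 1) ^ 3 = c * (\<tau> - 1) ^ 3 * \<bar>t\<bar> ^ 5 / (B ^ 4 * 2 ^ n * T ^ n)"
      proof -
        have "T ^ (5 * n) = T ^ (4 * n) * T ^ n" by (simp flip: power_add)
        moreover have "D0 ^ 4 \<noteq> 0" "T ^ (4 * n) \<noteq> 0" using D0(1) T1 by auto
        ultimately show ?thesis using T1 unfolding \<delta>_def c3_def by (simp add: divide_simps)
      qed
      ultimately show ?thesis by simp
    qed
    have pw: "(2 * (D0 * T ^ n * \<delta>)) ^ 4 = 16 * D0 ^ 4 * T ^ (4 * n) * \<delta> * \<delta> ^ 3"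
    proof -
      have "(T ^ n) ^ 4 = T ^ (4 * n)" by (simp add: power_mult[symmetric] mult.commute)
      moreover have "\<delta> ^ 4 = \<delta> * \<delta> ^ 3" by (simp add: eval_nat_numeral)
      ultimately show ?thesis by (simp add: power_mult_distrib)
    qed
    have fourth_root: "x \<le> y" if "x ^ 4 \<le> y ^ 4" "0 \<le> y" for x y :: real
      using that power_strict_mono[of y x 4] by (cases "x \<le> y") auto
    have "D0 * T ^ n * \<delta> \<le> norm (?G (Complex \<sigma> t))"
    \<comment> \<open>To the right of 1 + \<delta> the inequality applies directly. To its left the
      value at 1 + \<delta> is compared along a horizontal segment.\<close>
    proof (cases "\<sigma> \<le> 1 + \<delta>")
      case False
      have "(2 * (D0 * T ^ n * \<delta>)) ^ 4 \<le> 16 * D0 ^ 4 * T ^ (4 * n) * \<delta> * (\<sigma> - 1) ^ 3"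
        unfolding pw using False \<delta> D0(1) T1 by (intro mult_left_mono power_mono) auto
      also have "\<dots> \<le> norm (?G (Complex \<sigma> t)) ^ 4" using False \<delta> \<sigma> by (intro main) auto
      finally have "2 * (D0 * T ^ n * \<delta>) \<le> norm (?G (Complex \<sigma> t))" by (rule fourth_root) simp
      moreover have "0 \<le> D0 * T ^ n * \<delta>" using \<delta> D0(1) T1 by simp
      ultimately show ?thesis by linarith
    next
      case True
      have "(2 * (D0 * T ^ n * \<delta>)) ^ 4 \<le> norm (?G (Complex (1 + \<delta>) t)) ^ 4"
        unfolding pw using main[of "1 + \<delta>"] \<delta> by simp
      then have g1: "2 * (D0 * T ^ n * \<delta>) \<le> norm (?G (Complex (1 + \<delta>) t))" by (rule fourth_root) simp
      define L where "L = closed_segment (Complex \<sigma> t) (Complex (1 + \<delta>) t)"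
      have L: "L \<subseteq> {s. 1 \<le> Re s \<and> Re s \<le> 2 \<and> Im s = t}"
        unfolding L_def
      proof (rule closed_segment_subset)
        have "convex ({s. 1 \<le> Re s} \<inter> {s. Re s \<le> 2} \<inter> {s. Im s = t})"
          using convex_halfspace_Re_ge[of 1] convex_halfspace_Re_le[of 2] convex_hyperplane[of \<i> t]
          by (intro convex_Int) (auto simp: inner_complex_def)
        also have "{s. 1 \<le> Re s} \<inter> {s. Re s \<le> 2} \<inter> {s. Im s = t} = {s. 1 \<le> Re s \<and> Re s \<le> 2 \<and> Im s = t}" by auto
        finally show "convex {s. 1 \<le> Re s \<and> Re s \<le> 2 \<and> Im s = t}" .
      qed (use \<sigma> True \<delta> in auto)
      have "norm (?G (Complex (1 + \<delta>) t) - ?G (Complex \<sigma> t)) \<le> (D0 * T ^ n) * norm (Complex (1 + \<delta>) t - Complex \<sigma> t)"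
      proof (rule field_differentiable_bound)
        show "convex L" by (simp add: L_def)
        fix z assume z: "z \<in> L"
        have "0 < Re z" using z L by auto
        then have "(?G has_field_derivative deriv ?G z) (at z)"
          using dedekind_props(1) by (intro holomorphic_derivI[of _ "{s. 0 < Re s}"]) (auto simp: open_halfspace_Re_gt)
        then show "(?G has_field_derivative deriv ?G z) (at z within L)" by (rule has_field_derivative_at_within)
        show "norm (deriv ?G z) \<le> D0 * T ^ n" using Dn[of z] z L T by auto
      qed (auto simp: L_def)
      also have "norm (Complex (1 + \<delta>) t - Complex \<sigma> t) = 1 + \<delta> - \<sigma>" using True by (simp add: complex_diff cmod_def)
      also have "(D0 * T ^ n) * (1 + \<delta> - \<sigma>) \<le> (D0 * T ^ n) * \<delta>" using \<sigma> D0(1) T1 by (intro mult_left_mono) auto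
      finally have "norm (?G (Complex (1 + \<delta>) t) - ?G (Complex \<sigma> t)) \<le> D0 * T ^ n * \<delta>" .
      then show ?thesis using g1 norm_triangle_ineq2[of "?G (Complex (1 + \<delta>) t)" "?G (Complex \<sigma> t)"] by linarith
    qed
    then show ?thesis by (simp add: \<delta>_def)
  qed
  have nz1: "?G s \<noteq> 0" if "1 \<le> Re s" "Re s \<le> 2" for s
  proof (cases "Im s = 0")
    case True
    show ?thesis
    proof (cases "Re s = 1")
      case True
      then have "s = 1" using \<open>Im s = 0\<close> by (simp add: complex_eq_iff)
      then show ?thesis using beta_L_real_pos[of 1] by (simp add: dedekind_reg_def zeta_reg_1)
    qed (use that nz in auto)
  next
    case False
    have "0 < D0 * (1 + \<bar>Im s\<bar>) ^ n * (c3 * \<bar>Im s\<bar> ^ 5 / (1 + \<bar>Im s\<bar>) ^ (5 * n))"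
      using D0(1) c3 False by (intro mult_pos_pos divide_pos_pos zero_less_power) auto
    also have "\<dots> \<le> norm (?G (Complex (Re s) (Im s)))" using False that by (intro low) auto
    finally show ?thesis by auto
  qed
  \<comment> \<open>Near the real axis the factor |t|^5 spoils the bound, so the box |Im s| <= 1 is
    treated by compactness and nonvanishing.\<close>
  define Kc where "Kc = cbox (Complex 1 (-1)) (Complex 2 1)"
  have Kin: "s \<in> Kc \<longleftrightarrow> 1 \<le> Re s \<and> Re s \<le> 2 \<and> \<bar>Im s\<bar> \<le> 1" for s
    by (auto simp: Kc_def in_cbox_complex_iff)
  have "compact Kc" "Kc \<noteq> {}" using Kin[of 1] by (auto simp: Kc_def)
  moreover have "continuous_on Kc (\<lambda>s. norm (?G s))"
    using holomorphic_on_imp_continuous_on[OF dedekind_props(1)] Kin by (intro continuous_on_norm) (auto elim!: continuous_on_subset)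
  ultimately obtain s1 where s1: "s1 \<in> Kc" "\<And>s. s \<in> Kc \<Longrightarrow> norm (?G s1) \<le> norm (?G s)"
    using continuous_attains_inf[of Kc "\<lambda>s. norm (?G s)"] by blast
  have mu: "0 < norm (?G s1)" using nz1[of s1] s1(1) Kin by auto
  show ?thesis
  \<comment> \<open>The exponent 4 n is 5 n from \<delta> less n from the factor T^n.\<close>
  proof (rule that[of "min (norm (?G s1)) c3" "4 * n"])
    show "0 < min (norm (?G s1)) c3" using mu c3 by auto
    fix s assume s: "1 \<le> Re s" "Re s \<le> 2"
    define T where "T = 1 + \<bar>Im s\<bar>"
    have T: "1 \<le> T" by (simp add: T_def)
    show "min (norm (?G s1)) c3 / (1 + \<bar>Im s\<bar>) ^ (4 * n) \<le> norm (?G s)"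
    proof (cases "\<bar>Im s\<bar> \<le> 1")
      case True
      have "min (norm (?G s1)) c3 / T ^ (4 * n) \<le> min (norm (?G s1)) c3 / 1"
        using mu c3 T by (intro divide_left_mono) auto
      also have "\<dots> \<le> norm (?G s)" using s1(2)[of s] s True Kin by auto
      finally show ?thesis by (simp add: T_def)
    next
      case False
      have "min (norm (?G s1)) c3 / T ^ (4 * n) \<le> (D0 * (c3 * \<bar>Im s\<bar> ^ 5)) / T ^ (4 * n)"
      proof (rule divide_right_mono)
        have "1 * (c3 * 1) \<le> D0 * (c3 * \<bar>Im s\<bar> ^ 5)"
          using D0(1) c3 False by (intro mult_mono) (auto intro: one_le_power)
        then show "min (norm (?G s1)) c3 \<le> D0 * (c3 * \<bar>Im s\<bar> ^ 5)" by simp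
      qed (use T in auto)
      also have "\<dots> = D0 * T ^ n * (c3 * \<bar>Im s\<bar> ^ 5 / T ^ (5 * n))"
      proof -
        have "T ^ (5 * n) = T ^ (4 * n) * T ^ n" by (simp flip: power_add)
        then show ?thesis using T by (simp add: divide_simps)
      qed
      also have "\<dots> \<le> norm (?G (Complex (Re s) (Im s)))" using s False by (intro low) (auto simp: T_def)
      finally show ?thesis by (simp add: T_def)
    qed
  qed
qed

section \<open>Growth of the logarithmic derivatives\<close>

lemma DERIV_transform_on_open_helper:
  assumes "(f has_field_derivative D) (at x)" "open A" "x \<in> A" "\<And>y. y \<in> A \<Longrightarrow> f y = g y"
  shows "(g has_field_derivative D) (at x)"
proof -
  have "\<forall>\<^sub>F y in nhds x. f y = g y"
    using eventually_nhds_in_open[OF assms(2,3)] by (rule eventually_mono) (rule assms(4))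
  then show ?thesis using assms(1) DERIV_cong_ev[OF refl _ refl] by blast
qed

text \<open>The map w / (2 M - w) sends the half plane Re w < M into the unit disc and fixes 0, so
  the Schwarz lemma applies to its composition with \<open>g\<close>; solving for \<open>g\<close>
  gives the bound.\<close>

lemma borel_caratheodory:
  assumes g: "g holomorphic_on ball 0 1" "g 0 = 0" and M: "0 < M"
    and Re: "\<And>z. norm z < 1 \<Longrightarrow> Re (g z) < M" and z: "norm z < 1"
  shows "norm (g z) \<le> 2 * M * norm z / (1 - norm z)"
proof -
  define \<phi> where "\<phi> z = g z / (2 * of_real M - g z)" for z
  have nz: "2 * of_real M - g z \<noteq> 0" if "norm z < 1" for z
    using Re[OF that] M by (auto simp: complex_eq_iff)
  have lt: "norm (\<phi> z) < 1" if "norm z < 1" for z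
  proof -
    have "(Re (g z))\<^sup>2 < (2 * M - Re (g z))\<^sup>2"
      using Re[OF that] M by (intro power2_strict_mono) auto
    then have "norm (g z) < norm (2 * of_real M - g z)"
      unfolding cmod_def by (intro real_sqrt_less_mono) simp
    then show ?thesis using nz[OF that] by (simp add: \<phi>_def norm_divide divide_less_eq_1)
  qed
  have hol: "\<phi> holomorphic_on ball 0 1"
    unfolding \<phi>_def using g nz by (intro holomorphic_intros) auto
  have le: "norm (\<phi> z) \<le> norm z"
  proof (rule Schwarz_Lemma(1)[OF hol _ lt z])
    show "\<phi> 0 = 0" by (simp add: \<phi>_def g(2))
  qed
  have "g z * (1 + \<phi> z) = 2 * of_real M * \<phi> z"
    using nz[OF z] by (simp add: \<phi>_def field_simps)
  then have "norm (g z) * norm (1 + \<phi> z) = 2 * M * norm (\<phi> z)"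
    using M by (metis abs_of_pos norm_mult norm_numeral norm_of_real)
  note eq = this
  have "1 - norm z \<le> norm (1 + \<phi> z)"
    using norm_triangle_ineq2[of 1 "- \<phi> z"] le by simp
  then have "norm (g z) * (1 - norm z) \<le> norm (g z) * norm (1 + \<phi> z)"
    by (rule mult_left_mono) simp
  also note eq
  also have "2 * M * norm (\<phi> z) \<le> 2 * M * norm z" using le M by (intro mult_left_mono) auto
  finally show ?thesis using z by (simp add: pos_le_divide_eq)
qed

text \<open>On a disc without zeros \<open>B\<close> has a holomorphic logarithm \<open>h\<close>.
  Growth of \<open>B\<close> on the disc and of 1 / B at the centre bounds the real part of
  \<open>h\<close> minus its central value from above, Borel-Caratheodory turns this into a bound
  for the modulus, and Cauchy's inequality into one for the derivative of \<open>h\<close>, which is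
  the logarithmic derivative of \<open>B\<close>.\<close>

lemma log_derivative_poly_bounded:
  assumes B: "B holomorphic_on {s. 0 < Re s}" "\<And>s. 1/2 < Re s \<Longrightarrow> B s \<noteq> 0"
    and pB: "poly_bounded {s. 1/2 \<le> Re s \<and> Re s \<le> 4} B"
    and pI: "poly_bounded {s. Re s = 2} (\<lambda>s. 1 / B s)"
  shows "poly_bounded {s. 3/4 \<le> Re s \<and> Re s \<le> 3/2} (\<lambda>s. deriv B s / B s)"
proof -
  obtain C m where C: "1 \<le> C" "1 \<le> (m::nat)" "\<And>s. s \<in> {s. 1/2 \<le> Re s \<and> Re s \<le> 4} \<Longrightarrow> norm (B s) \<le> C * (1 + \<bar>Im s\<bar>) ^ m"
    using pB by (rule poly_bounded_obtain) blast
  obtain D n where D: "1 \<le> D" "1 \<le> (n::nat)" "\<And>s. s \<in> {s. Re s = 2} \<Longrightarrow> norm (1 / B s) \<le> D * (1 + \<bar>Im s\<bar>) ^ n"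
    using pI by (rule poly_bounded_obtain) blast
  show ?thesis
  proof (rule poly_boundedI)
    fix s assume s: "s \<in> {s. 3/4 \<le> Re s \<and> Re s \<le> 3/2}"
    define T where "T = 1 + \<bar>Im s\<bar>"
    have T: "1 \<le> T" by (simp add: T_def)
    define s0 where "s0 = Complex 2 (Im s)"
    have ss0: "norm (s - s0) \<le> 5/4" using s by (simp add: s0_def cmod_def)
    \<comment> \<open>Radius 3/2 about 2 + i Im s just reaches Re s = 1/2, the edge of the zero-free
      region. The point s is within 5/4 of the centre, and the disc of radius 1/8 about it stays
      within 11/8 < 3/2.\<close>
    define A where "A = ball s0 (3/2)"
    have A: "1/2 < Re w \<and> Re w < 4 \<and> \<bar>Im w\<bar> \<le> \<bar>Im s\<bar> + 3/2" if "w \<in> A" for w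
    proof -
      have "norm (s0 - w) < 3/2" using that by (simp add: A_def dist_norm)
      then show ?thesis using abs_Re_le_cmod[of "s0 - w"] abs_Im_le_cmod[of "s0 - w"] by (auto simp: s0_def)
    qed
    have "A \<subseteq> {s. 0 < Re s}" using A by force
    then have "B holomorphic_on A" by (rule holomorphic_on_subset[OF B(1)])
    moreover have "B w \<noteq> 0" if "w \<in> A" for w using A[OF that] B(2) by auto
    ultimately obtain h where h: "h holomorphic_on A" "\<And>w. w \<in> A \<Longrightarrow> exp (h w) = B w"
      using holomorphic_logarithm_exists[of A B s0] by (auto simp: A_def)
    define Q where "Q = C * 3 ^ m * D * T ^ (m + n)"
    have Q: "1 \<le> Q" unfolding Q_def using C D T by (intro mult_ge1_I one_le_power) auto
    have ReQ: "Re (h w - h s0) < Q" if w: "w \<in> A" for w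
    proof -
      have s0A: "s0 \<in> A" by (simp add: A_def)
      have "exp (Re (h w - h s0)) = norm (B w * (1 / B s0))"
        using h(2)[OF w] h(2)[OF s0A] by (simp only: norm_exp_eq_Re[symmetric] exp_diff) simp
      also have "\<dots> \<le> (C * (3 * T) ^ m) * (D * T ^ n)"
        unfolding norm_mult
      proof (intro mult_mono)
        have "norm (B w) \<le> C * (1 + \<bar>Im w\<bar>) ^ m" using A[OF w] by (intro C) auto
        also have "\<dots> \<le> C * (3 * T) ^ m" using A[OF w] C(1) by (intro mult_left_mono power_mono) (auto simp: T_def)
        finally show "norm (B w) \<le> C * (3 * T) ^ m" .
        show "norm (1 / B s0) \<le> D * T ^ n" using D(3)[of s0] by (simp add: s0_def T_def)
      qed (use C T in auto)
      also have "\<dots> = Q" by (simp add: Q_def power_mult_distrib power_add)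
      finally have "exp (Re (h w - h s0)) \<le> Q" .
      \<comment> \<open>Bounding the real part by Q instead of log Q is wasteful, but polynomial
        growth is all that is asked for.\<close>
      moreover have "Re (h w - h s0) < exp (Re (h w - h s0))"
        using exp_ge_add_one_self[of "Re (h w - h s0)"] by linarith
      ultimately show ?thesis by linarith
    qed
    \<comment> \<open>In units of the radius 3/2 the distance 11/8 is 11/12, and 22 = 2 (11/12) / (1
      - 11/12).\<close>
    have hb: "norm (h w - h s0) \<le> 22 * Q" if w: "norm (w - s0) \<le> 11/8" for w
    proof -
      define z where "z = of_real (2/3) * (w - s0)"
      have z: "norm z \<le> 11/12" by (simp only: z_def norm_mult norm_of_real) (use w in simp)
      let ?g = "\<lambda>z. h (s0 + (3/2) * z) - h s0"
      have inA: "s0 + (3/2) * z \<in> A" if "norm z < 1" for z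
        using that by (simp add: A_def dist_norm norm_mult)
      have "norm (?g z) \<le> 2 * Q * norm z / (1 - norm z)"
      proof (rule borel_caratheodory)
        have "h \<circ> (\<lambda>z. s0 + (3/2) * z) holomorphic_on ball 0 1"
          by (rule holomorphic_on_compose_gen[OF _ h(1)]) (use inA in \<open>auto intro!: holomorphic_intros\<close>)
        then show "?g holomorphic_on ball 0 1" by (intro holomorphic_intros) (simp add: o_def)
        show "Re (?g z) < Q" if "norm z < 1" for z using ReQ[OF inA[OF that]] .
      qed (use Q z in auto)
      also have "\<dots> \<le> 2 * Q * (11/12) / (1 - 11/12)"
        using z Q by (intro frac_le mult_left_mono mult_nonneg_nonneg) auto
      also have "s0 + (3/2) * z = w"
      proof -
        have "(3/2) * z = w - s0" by (simp only: z_def mult.assoc[symmetric]) simp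
        then show ?thesis by (metis add.commute diff_add_cancel)
      qed
      finally show ?thesis by simp
    qed
    have near: "norm (w - s0) \<le> 11/8" if "norm (s - w) \<le> 1/8" for w
      using norm_triangle_ineq[of "w - s" "s - s0"] that ss0 by (simp add: norm_minus_commute)
    have subA: "cball s (1/8) \<subseteq> A"
      using near by (force simp: A_def dist_norm norm_minus_commute)
    have "norm ((deriv ^^ 1) (\<lambda>w. h w - h s0) s) \<le> fact 1 * (22 * Q) / (1/8) ^ 1"
    proof (rule Cauchy_inequality)
      show "(\<lambda>w. h w - h s0) holomorphic_on ball s (1/8)"
        using h(1) subA ball_subset_cball by (intro holomorphic_intros) (blast intro: holomorphic_on_subset)
      show "continuous_on (cball s (1/8)) (\<lambda>w. h w - h s0)"
        using holomorphic_on_imp_continuous_on[OF h(1)] subA by (intro continuous_intros) (blast intro: continuous_on_subset)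
      show "norm (h w - h s0) \<le> 22 * Q" if "norm (s - w) = 1/8" for w using that by (intro hb near) simp
    qed simp
    moreover have "deriv (\<lambda>w. h w - h s0) s = deriv B s / B s"
    proof -
      have sA: "s \<in> A" "open A" using subsetD[OF subA, of s] by (simp_all) (simp add: A_def)
      have dh: "(h has_field_derivative deriv h s) (at s)" by (rule holomorphic_derivI[OF h(1) sA(2,1)])
      have "((\<lambda>w. exp (h w)) has_field_derivative exp (h s) * deriv h s) (at s)"
        by (rule DERIV_fun_exp[OF dh])
      then have "(B has_field_derivative exp (h s) * deriv h s) (at s)"
        by (rule DERIV_transform_on_open_helper[OF _ sA(2,1)]) (simp add: h(2))
      then have "deriv B s = B s * deriv h s" using h(2)[OF sA(1)] by (simp add: DERIV_imp_deriv)
      moreover have "deriv (\<lambda>w. h w - h s0) s = deriv h s"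
        using DERIV_diff[OF dh DERIV_const[of "h s0"]] by (simp add: DERIV_imp_deriv)
      moreover have "B s \<noteq> 0" using h(2)[OF sA(1)] by (metis exp_not_eq_zero)
      ultimately show ?thesis by simp
    qed
    ultimately have "norm (deriv B s / B s) \<le> 176 * Q" by simp
    then show "norm (deriv B s / B s) \<le> (176 * (C * 3 ^ m * D)) * (1 + \<bar>Im s\<bar>) ^ (m + n)"
      by (simp add: Q_def T_def mult.assoc)
  qed
qed

text \<open>The pole at 1 is removed before differentiating: -zeta'/zeta equals
  \<open>zeta_logd s + 1 / (s - 1)\<close>, and \<open>zeta_logd\<close> is holomorphic at
  1.\<close>

definition zeta_logd :: "complex \<Rightarrow> complex" where
  "zeta_logd s = - deriv zeta_reg s / zeta_reg s"

definition beta_logd :: "complex \<Rightarrow> complex" where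
  "beta_logd s = - deriv beta_L s / beta_L s"

definition logd_domain :: "complex set" where
  "logd_domain = {s. 0 < Re s \<and> dedekind_reg s \<noteq> 0}"

lemma open_half_plane: "open {s. (0::real) < Re s}"
  by (rule open_halfspace_Re_gt)

lemma logd_domain_props:
  shows "open logd_domain" and "{s. 1 \<le> Re s \<and> Re s \<le> 3/2} \<subseteq> logd_domain"
    and "zeta_logd holomorphic_on logd_domain" and "beta_logd holomorphic_on logd_domain"
proof -
  have "continuous_on {s. 0 < Re s} dedekind_reg"
    by (rule holomorphic_on_imp_continuous_on[OF dedekind_props(1)])
  then have "open ({s. 0 < Re s} \<inter> dedekind_reg -` (- {0}))"
    by (rule continuous_open_preimage) (auto simp: open_half_plane)
  moreover have "{s. 0 < Re s} \<inter> dedekind_reg -` (- {0}) = logd_domain" by (auto simp: logd_domain_def)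
  ultimately show "open logd_domain" by simp
  obtain c M where c: "0 < c" "\<And>s. 1 \<le> Re s \<Longrightarrow> Re s \<le> 2 \<Longrightarrow> c / (1 + \<bar>Im s\<bar>) ^ M \<le> norm (dedekind_reg s)"
    using dedekind_lower_bound by blast
  have "dedekind_reg s \<noteq> 0" if "1 \<le> Re s" "Re s \<le> 2" for s
  proof -
    have "0 < c / (1 + \<bar>Im s\<bar>) ^ M" using c(1) by (intro divide_pos_pos zero_less_power) auto
    then show ?thesis using c(2)[OF that] by auto
  qed
  then show "{s. 1 \<le> Re s \<and> Re s \<le> 3/2} \<subseteq> logd_domain" by (auto simp: logd_domain_def)
  have sub: "logd_domain \<subseteq> {s. 0 < Re s}" by (auto simp: logd_domain_def)
  have d: "deriv zeta_reg holomorphic_on logd_domain" "deriv beta_L holomorphic_on logd_domain"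
    using holomorphic_deriv[OF zeta_reg_props(1) open_half_plane] holomorphic_deriv[OF beta_L_props(1) open_half_plane] sub
    by (auto intro: holomorphic_on_subset)
  show "zeta_logd holomorphic_on logd_domain"
    unfolding zeta_logd_def[abs_def]
    by (intro holomorphic_on_divide holomorphic_on_minus d holomorphic_on_subset[OF zeta_reg_props(1) sub])
      (auto simp: logd_domain_def dedekind_reg_def)
  show "beta_logd holomorphic_on logd_domain"
    unfolding beta_logd_def[abs_def]
    by (intro holomorphic_on_divide holomorphic_on_minus d holomorphic_on_subset[OF beta_L_props(1) sub])
      (auto simp: logd_domain_def dedekind_reg_def)
qed

text \<open>The inverse of one factor is the other factor times the inverse of the product, so the
  single lower bound for the product serves both.\<close>

lemma inverse_poly_bounded:
  shows "poly_bounded {s. 1 \<le> Re s \<and> Re s \<le> 2} (\<lambda>s. 1 / zeta_reg s)"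
    and "poly_bounded {s. 1 \<le> Re s \<and> Re s \<le> 2} (\<lambda>s. 1 / beta_L s)"
proof -
  obtain c M where c: "0 < c" "\<And>s. 1 \<le> Re s \<Longrightarrow> Re s \<le> 2 \<Longrightarrow> c / (1 + \<bar>Im s\<bar>) ^ M \<le> norm (dedekind_reg s)"
    using dedekind_lower_bound by blast
  have nz: "dedekind_reg s \<noteq> 0" if "1 \<le> Re s" "Re s \<le> 2" for s
  proof -
    have "0 < c / (1 + \<bar>Im s\<bar>) ^ M" using c(1) by (intro divide_pos_pos zero_less_power) auto
    then show ?thesis using c(2)[OF that] by auto
  qed
  have pI: "poly_bounded {s. 1 \<le> Re s \<and> Re s \<le> 2} (\<lambda>s. 1 / dedekind_reg s)"
  proof (rule poly_boundedI)
    fix s assume s: "s \<in> {s. 1 \<le> Re s \<and> Re s \<le> 2}"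
    have p: "0 < (1 + \<bar>Im s\<bar>) ^ M" by (intro zero_less_power) auto
    show "norm (1 / dedekind_reg s) \<le> (1 / c) * (1 + \<bar>Im s\<bar>) ^ M"
      using c(2)[of s] c(1) s nz[of s] p by (simp add: norm_divide field_simps)
  qed
  have z: "poly_bounded {s. 1 \<le> Re s \<and> Re s \<le> 2} zeta_reg" "poly_bounded {s. 1 \<le> Re s \<and> Re s \<le> 2} beta_L"
    by (rule zeta_reg_props beta_L_props; simp)+
  show "poly_bounded {s. 1 \<le> Re s \<and> Re s \<le> 2} (\<lambda>s. 1 / zeta_reg s)"
    by (rule poly_bounded_cong[OF poly_bounded_mult[OF z(2) pI]]) (use nz in \<open>auto simp: dedekind_reg_def\<close>)
  show "poly_bounded {s. 1 \<le> Re s \<and> Re s \<le> 2} (\<lambda>s. 1 / beta_L s)"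
    by (rule poly_bounded_cong[OF poly_bounded_mult[OF z(1) pI]]) (use nz in \<open>auto simp: dedekind_reg_def\<close>)
qed

lemma logd_poly_bounded_aux:
  assumes B: "B holomorphic_on {s. 0 < Re s}" and pB: "\<And>d b. 0 < d \<Longrightarrow> poly_bounded {s. d \<le> Re s \<and> Re s \<le> b} B"
    and pI: "poly_bounded {s. 1 \<le> Re s \<and> Re s \<le> 2} (\<lambda>s. 1 / B s)"
    and nz: "\<And>s. 1 \<le> Re s \<Longrightarrow> Re s \<le> 3/2 \<Longrightarrow> B s \<noteq> 0"
  shows "poly_bounded {s. 1 \<le> Re s \<and> Re s \<le> 3/2} (\<lambda>s. - deriv B s / B s)"
    and "poly_bounded {s. Re s = 1} (deriv (\<lambda>s. - deriv B s / B s))"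
proof -
  have d1: "poly_bounded {s. 3/4 \<le> Re s \<and> Re s \<le> 2} (deriv B)"
    by (rule poly_bounded_deriv[OF B pB[of "1/2" 3], where r="1/4"]) auto
  have B': "deriv B holomorphic_on {s. 0 < Re s}" by (rule holomorphic_deriv[OF B open_half_plane])
  have d2: "poly_bounded {s. 1 \<le> Re s \<and> Re s \<le> 3/2} (deriv (deriv B))"
    by (rule poly_bounded_deriv[OF B' d1, where r="1/4"]) auto
  have l1: "poly_bounded {s. 1 \<le> Re s \<and> Re s \<le> 3/2} (\<lambda>s. deriv B s * (1 / B s))"
    by (intro poly_bounded_mult poly_bounded_subset[OF d1] poly_bounded_subset[OF pI]) auto
  show "poly_bounded {s. 1 \<le> Re s \<and> Re s \<le> 3/2} (\<lambda>s. - deriv B s / B s)"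
    using poly_bounded_uminus[OF l1] by simp
  have "poly_bounded {s. 1 \<le> Re s \<and> Re s \<le> 3/2} (\<lambda>s. - (deriv (deriv B) s * (1 / B s)) + (deriv B s * (1 / B s)) * (deriv B s * (1 / B s)))"
    by (intro poly_bounded_add poly_bounded_uminus poly_bounded_mult l1 d2[THEN poly_bounded_subset] poly_bounded_subset[OF pI] poly_bounded_subset[OF d1]) auto
  then have "poly_bounded {s. Re s = 1} (\<lambda>s. - (deriv (deriv B) s * (1 / B s)) + (deriv B s * (1 / B s)) * (deriv B s * (1 / B s)))"
    by (rule poly_bounded_subset) auto
  then show "poly_bounded {s. Re s = 1} (deriv (\<lambda>s. - deriv B s / B s))"
  proof (rule poly_bounded_cong)
    fix s assume "s \<in> {s. Re s = 1}"
    then have s: "Re s = 1" "s \<in> {s. 0 < Re s}" by auto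
    have "((\<lambda>s. - deriv B s / B s) has_field_derivative
       (- (deriv (deriv B) s * (1 / B s)) + (deriv B s * (1 / B s)) * (deriv B s * (1 / B s)))) (at s)"
      by (rule derivative_eq_intros holomorphic_derivI[OF B open_half_plane s(2)] holomorphic_derivI[OF B' open_half_plane s(2)] refl)+
        (use nz[of s] s in \<open>auto simp: field_simps\<close>)
    then show "- (deriv (deriv B) s * (1 / B s)) + (deriv B s * (1 / B s)) * (deriv B s * (1 / B s)) = deriv (\<lambda>s. - deriv B s / B s) s"
      by (rule DERIV_imp_deriv[symmetric])
  qed
qed

lemma domain_nz: "1 \<le> Re s \<Longrightarrow> Re s \<le> 3/2 \<Longrightarrow> zeta_reg s \<noteq> 0 \<and> beta_L s \<noteq> 0"
  using logd_domain_props(2) by (auto simp: logd_domain_def dedekind_reg_def)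

lemma logd_poly_bounded:
  shows "poly_bounded {s. 1 \<le> Re s \<and> Re s \<le> 3/2} zeta_logd" "poly_bounded {s. Re s = 1} (deriv zeta_logd)"
    and "poly_bounded {s. 1 \<le> Re s \<and> Re s \<le> 3/2} beta_logd" "poly_bounded {s. Re s = 1} (deriv beta_logd)"
  unfolding zeta_logd_def[abs_def] beta_logd_def[abs_def]
  using logd_poly_bounded_aux[OF zeta_reg_props(1,2) inverse_poly_bounded(1)]
    logd_poly_bounded_aux[OF beta_L_props(1,2) inverse_poly_bounded(2)] domain_nz by auto

lemma dedekind_nonzero: "1 < Re s \<Longrightarrow> dedekind_reg s \<noteq> 0"
  by (rule dedekind_three_four_one) blast

lemma logd_poly_bounded_GRH:
  assumes "\<And>s. 1/2 < Re s \<Longrightarrow> Re s < 1 \<Longrightarrow> dedekind_reg s \<noteq> 0"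
  shows "{s. 1/2 < Re s} \<subseteq> logd_domain"
    and "poly_bounded {s. 3/4 \<le> Re s \<and> Re s \<le> 3/2} zeta_logd"
    and "poly_bounded {s. 3/4 \<le> Re s \<and> Re s \<le> 3/2} beta_logd"
proof -
  have nz: "dedekind_reg s \<noteq> 0" if "1/2 < Re s" for s
  proof -
    have "dedekind_reg s \<noteq> 0" if "1 < Re s" using that by (rule dedekind_nonzero)
    moreover have "dedekind_reg s \<noteq> 0" if "Re s = 1" using that domain_nz[of s] by (auto simp: dedekind_reg_def)
    ultimately show ?thesis using assms[OF that] by fastforce
  qed
  then show "{s. 1/2 < Re s} \<subseteq> logd_domain" by (auto simp: logd_domain_def)
  have *: "poly_bounded {s. Re s = 2} (\<lambda>s. 1 / zeta_reg s)" "poly_bounded {s. Re s = 2} (\<lambda>s. 1 / beta_L s)"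
    by (rule poly_bounded_subset[OF inverse_poly_bounded(1)] poly_bounded_subset[OF inverse_poly_bounded(2)]; auto)+
  have "poly_bounded {s. 3/4 \<le> Re s \<and> Re s \<le> 3/2} (\<lambda>s. deriv zeta_reg s / zeta_reg s)"
    by (rule log_derivative_poly_bounded[OF zeta_reg_props(1) _ zeta_reg_props(2) *(1)])
      (use nz in \<open>auto simp: dedekind_reg_def\<close>)
  from poly_bounded_uminus[OF this]
  show "poly_bounded {s. 3/4 \<le> Re s \<and> Re s \<le> 3/2} zeta_logd" by (simp add: zeta_logd_def[abs_def])
  have "poly_bounded {s. 3/4 \<le> Re s \<and> Re s \<le> 3/2} (\<lambda>s. deriv beta_L s / beta_L s)"
    by (rule log_derivative_poly_bounded[OF beta_L_props(1) _ beta_L_props(2) *(2)])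
      (use nz in \<open>auto simp: dedekind_reg_def\<close>)
  from poly_bounded_uminus[OF this]
  show "poly_bounded {s. 3/4 \<le> Re s \<and> Re s \<le> 3/2} beta_logd" by (simp add: beta_logd_def[abs_def])
qed

lemma logd_eq_dseries:
  assumes s: "1 < Re s"
  shows "dseries prime_pairs zeta.pair_coeff zeta.pair_len s = zeta_logd s + 1 / (s - 1)"
    and "dseries prime_pairs beta.pair_coeff zeta.pair_len s = beta_logd s"
proof -
  have nz: "zeta_reg s \<noteq> 0" "beta_L s \<noteq> 0" "s \<noteq> 1"
    using dedekind_nonzero[OF s] s by (auto simp: dedekind_reg_def)
  have o: "open {s. 1 < Re s}" by (rule open_halfspace_Re_gt)
  let ?Z = "dseries normals (\<lambda>_. 1) (\<lambda>n::nat. ln (real n))" and ?B = "dseries normals chi4 (\<lambda>n::nat. ln (real n))"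
  have "((\<lambda>s. (s - 1) * ?Z s) has_field_derivative ?Z s + (s - 1) * (- dseries prime_pairs zeta.pair_coeff zeta.pair_len s * ?Z s)) (at s)"
    by (rule derivative_eq_intros zeta.log_derivative[OF s] refl)+ simp
  then have "(zeta_reg has_field_derivative ?Z s + (s - 1) * (- dseries prime_pairs zeta.pair_coeff zeta.pair_len s * ?Z s)) (at s)"
    by (rule DERIV_transform_on_open_helper[OF _ o]) (use s in \<open>auto simp: zeta_D_eq\<close>)
  then have d: "deriv zeta_reg s = ?Z s + (s - 1) * (- dseries prime_pairs zeta.pair_coeff zeta.pair_len s * ?Z s)"
    by (rule DERIV_imp_deriv)
  have z: "zeta_reg s = (s - 1) * ?Z s" by (rule zeta_D_eq[OF s])
  then have "?Z s \<noteq> 0" using nz by auto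
  then show "dseries prime_pairs zeta.pair_coeff zeta.pair_len s = zeta_logd s + 1 / (s - 1)"
  proof -
    have "M = - (Z + u * (- M * Z)) / (u * Z) + 1 / u" if "u \<noteq> 0" "Z \<noteq> 0" for M Z u :: complex
      using that by (simp add: field_simps)
    from this[of "s - 1" "?Z s"] show ?thesis
      unfolding zeta_logd_def d z using nz \<open>?Z s \<noteq> 0\<close> by simp
  qed
  have "(beta_L has_field_derivative - dseries prime_pairs beta.pair_coeff zeta.pair_len s * ?B s) (at s)"
    by (rule DERIV_transform_on_open_helper[OF beta.log_derivative[OF s] o]) (use s in \<open>auto simp: beta_D_eq\<close>)
  then have "deriv beta_L s = - dseries prime_pairs beta.pair_coeff zeta.pair_len s * beta_L s"
    by (simp add: DERIV_imp_deriv beta_D_eq[OF s])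
  then show "dseries prime_pairs beta.pair_coeff zeta.pair_len s = beta_logd s"
    unfolding beta_logd_def using nz by simp
qed

subsection \<open>Smoothly weighted sums over prime powers\<close>

lemma vertical_integral_add:
  assumes "continuous_on {s. Re s = c} F" "continuous_on {s. Re s = c} G"
    and "poly_bounded {s. Re s = c} F" "poly_bounded {s. Re s = c} G" and f: "bump R f"
  shows "vertical_integral (\<lambda>s. F s + G s) f y c = vertical_integral F f y c + vertical_integral G f y c"
proof -
  have int: "integrable lborel (\<lambda>t. F (Complex c t) * laplace f (Complex c t) * exp (Complex c t * of_real y))"
    if F: "continuous_on {s. Re s = c} F" "poly_bounded {s. Re s = c} F" for F
  proof -
    obtain K where K: "\<And>s. s \<in> {s. Re s = c} \<Longrightarrow> norm (F s * laplace f s) \<le> K / (1 + \<bar>Im s\<bar>)\<^sup>2"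
      using poly_bounded_laplace[OF F(2) f, of "\<bar>c\<bar>"] by auto
    have cc: "continuous_on UNIV (Complex c)" unfolding Complex_eq by (intro continuous_intros)
    show ?thesis
    proof (rule continuous_decay_integrable[of _ "K * exp (c * y)"])
      show "continuous_on UNIV (\<lambda>t. F (Complex c t) * laplace f (Complex c t) * exp (Complex c t * of_real y))"
        by (intro continuous_intros continuous_on_compose2[OF F(1) cc] continuous_on_compose2[OF laplace_continuous[OF f, of UNIV] cc] cc) auto
      fix t
      show "norm (F (Complex c t) * laplace f (Complex c t) * exp (Complex c t * of_real y)) \<le> K * exp (c * y) / (1 + \<bar>t\<bar>)\<^sup>2"
        using mult_right_mono[OF K[of "Complex c t"], of "exp (c * y)"] by (simp add: norm_mult)
    qed
  qed
  show ?thesis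
    unfolding vertical_integral_def distrib_right
    by (rule Bochner_Integration.integral_add[OF int int]) (use assms in auto)
qed

lemma vertical_integral_cong:
  "(\<And>s. Re s = c \<Longrightarrow> F s = G s) \<Longrightarrow> vertical_integral F f y c = vertical_integral G f y c"
  unfolding vertical_integral_def by (intro Bochner_Integration.integral_cong) auto

text \<open>The weight f(log p^k - y) selects prime powers of size about exp(y).
  \<open>zeta.pair_len\<close> serves both coefficient families because the logarithms are the
  same.\<close>

definition pair_sum :: "(nat \<times> nat \<Rightarrow> real) \<Rightarrow> (real \<Rightarrow> real) \<Rightarrow> real \<Rightarrow> real" where
  "pair_sum a f y = (\<Sum>\<^sub>\<infinity>i\<in>prime_pairs. a i * f (zeta.pair_len i - y))"

definition exp_integral :: "(real \<Rightarrow> real) \<Rightarrow> real" where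
  "exp_integral f = (LINT u|lborel. f u * exp u)"

lemma laplace_1: "bump R f \<Longrightarrow> laplace f 1 = of_real (exp_integral f)"
  unfolding laplace_def exp_integral_def
  by (subst integral_complex_of_real[symmetric], rule Bochner_Integration.integral_cong) (auto simp: exp_of_real)

lemma pair_sum_vertical_integral:
  assumes f: "bump R f" and conv: "dseries_converges prime_pairs a zeta.pair_len"
  shows "of_real (2 * pi * pair_sum a f y) = vertical_integral (dseries prime_pairs a zeta.pair_len) f y (3/2)"
    and "(\<lambda>i. a i * f (zeta.pair_len i - y)) summable_on prime_pairs"
proof -
  let ?V = "vertical_integral (dseries prime_pairs a zeta.pair_len) f y (3/2)"
  have hs: "((\<lambda>i. complex_of_real (2 * pi) * of_real (a i * f (zeta.pair_len i - y))) has_sum ?V) prime_pairs"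
  proof (rule dseries_smooth_sum[OF f])
    show "(\<lambda>i. \<bar>a i\<bar> * exp (- (3/2) * zeta.pair_len i)) summable_on prime_pairs"
      by (rule conv[unfolded dseries_converges_def, THEN conjunct2, rule_format]) simp
  qed (use conv in \<open>auto simp: dseries_converges_def\<close>)
  have "((\<lambda>i. Re (complex_of_real (2 * pi) * of_real (a i * f (zeta.pair_len i - y)))) has_sum Re ?V) prime_pairs"
    by (rule has_sum_Re[OF hs])
  then have h2: "((\<lambda>i. (2 * pi) * (a i * f (zeta.pair_len i - y))) has_sum Re ?V) prime_pairs" by simp
  have "((\<lambda>i. (1 / (2 * pi)) * ((2 * pi) * (a i * f (zeta.pair_len i - y)))) has_sum (1 / (2 * pi)) * Re ?V) prime_pairs"
    by (rule has_sum_cmult_right[OF h2])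
  then have h1: "((\<lambda>i. a i * f (zeta.pair_len i - y)) has_sum (1 / (2 * pi)) * Re ?V) prime_pairs" by simp
  then show "(\<lambda>i. a i * f (zeta.pair_len i - y)) summable_on prime_pairs" by (auto simp: summable_on_def)
  have p: "pair_sum a f y = (1 / (2 * pi)) * Re ?V" unfolding pair_sum_def by (rule infsumI[OF h1])
  have "((\<lambda>i. Im (complex_of_real (2 * pi) * of_real (a i * f (zeta.pair_len i - y)))) has_sum Im ?V) prime_pairs"
    by (rule has_sum_Im[OF hs])
  then have "((\<lambda>i::nat \<times> nat. 0::real) has_sum Im ?V) prime_pairs" by simp
  then have "Im ?V = 0" by (metis infsumI infsum_0_simp)
  then show "of_real (2 * pi * pair_sum a f y) = ?V" unfolding p by (simp add: complex_eq_iff)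
qed

lemma pair_sum_eq:
  assumes f: "bump R f"
  shows "R \<le> y \<Longrightarrow> of_real (2 * pi * (pair_sum zeta.pair_coeff f y - exp y * exp_integral f)) = vertical_integral zeta_logd f y (3/2)"
    and "of_real (2 * pi * pair_sum beta.pair_coeff f y) = vertical_integral beta_logd f y (3/2)"
proof -
  have sub: "{s. Re s = 3/2} \<subseteq> logd_domain" using logd_domain_props(2) by auto
  have cz: "continuous_on {s. Re s = 3/2} zeta_logd"
    by (rule holomorphic_on_imp_continuous_on[OF holomorphic_on_subset[OF logd_domain_props(3) sub]])
  have ne: "s \<noteq> 1" if "Re s = 3/2" for s using that by auto
  have cp: "continuous_on {s. Re s = 3/2} (\<lambda>s. 1 / (s - 1))" by (intro continuous_intros) (auto dest: ne)
  have pz: "poly_bounded {s. Re s = 3/2} zeta_logd" by (rule poly_bounded_subset[OF logd_poly_bounded(1)]) auto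
  have pp: "poly_bounded {s. Re s = 3/2} (\<lambda>s. 1 / (s - 1))"
  proof (rule poly_boundedI)
    fix s assume "s \<in> {s. Re s = 3/2}"
    then have "1/2 \<le> norm (s - 1)" using abs_Re_le_cmod[of "s - 1"] by simp
    then have "1 / norm (s - 1) \<le> 1 / (1/2)" by (intro divide_left_mono) auto
    then show "norm (1 / (s - 1)) \<le> 2 * (1 + \<bar>Im s\<bar>) ^ 0" by (simp add: norm_divide)
  qed
  have "of_real (2 * pi * pair_sum zeta.pair_coeff f y) = vertical_integral (\<lambda>s. zeta_logd s + 1 / (s - 1)) f y (3/2)"
    unfolding pair_sum_vertical_integral(1)[OF f zeta.pair_converges]
    by (rule vertical_integral_cong) (simp add: logd_eq_dseries)
  also have "\<dots> = vertical_integral zeta_logd f y (3/2) + vertical_integral (\<lambda>s. 1 / (s - 1)) f y (3/2)"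
    by (rule vertical_integral_add[OF cz cp pz pp f])
  finally have e: "complex_of_real (2 * pi * pair_sum zeta.pair_coeff f y) = vertical_integral zeta_logd f y (3/2) + vertical_integral (\<lambda>s. 1 / (s - 1)) f y (3/2)" .
  show "of_real (2 * pi * (pair_sum zeta.pair_coeff f y - exp y * exp_integral f)) = vertical_integral zeta_logd f y (3/2)" if "R \<le> y"
    using e vertical_integral_pole[OF f _ that, of "3/2"] laplace_1[OF f] by (simp add: algebra_simps)
  show "of_real (2 * pi * pair_sum beta.pair_coeff f y) = vertical_integral beta_logd f y (3/2)"
    unfolding pair_sum_vertical_integral(1)[OF f beta.pair_converges]
    by (rule vertical_integral_cong) (simp add: logd_eq_dseries)
qed

lemma strip_in_domain: "{s. 1 \<le> Re s \<and> Re s \<le> 3/2} \<subseteq> logd_domain" "{s. Re s = 1} \<subseteq> logd_domain"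
  using logd_domain_props(2) by auto

text \<open>The integrals start on Re s = 3/2, where the Dirichlet series converge, and move to Re s
  = 1, where \<open>vertical_integral_log_saving\<close> applies; with the pole split off nothing is
  crossed. The outcome is a smooth prime number theorem, for zeta and for the character modulo 4,
  with a saving of one logarithm.\<close>

lemma pair_sum_asymptotics:
  assumes f: "bump R f"
  shows "((\<lambda>y. y * exp (- y) * (pair_sum zeta.pair_coeff f y - exp y * exp_integral f)) \<longlongrightarrow> 0) at_top"
    and "((\<lambda>y. y * exp (- y) * pair_sum beta.pair_coeff f y) \<longlongrightarrow> 0) at_top"
proof -
  have lim: "(u \<longlongrightarrow> 0) at_top"
    if "((\<lambda>y. of_real (y * exp (- y)) * V y) \<longlongrightarrow> (0::complex)) at_top" "\<forall>\<^sub>F y in at_top. of_real (2 * pi * u y) = of_real (y * exp (- y)) * V y"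
    for u :: "real \<Rightarrow> real" and V
  proof -
    have "((\<lambda>y. complex_of_real (2 * pi * u y)) \<longlongrightarrow> 0) at_top"
      by (rule Lim_transform_eventually[OF that(1)]) (use that(2) in \<open>auto elim: eventually_mono\<close>)
    then have "((\<lambda>y. Re (complex_of_real (2 * pi * u y))) \<longlongrightarrow> Re 0) at_top" by (rule tendsto_Re)
    then have "((\<lambda>y. (1 / (2 * pi)) * (2 * pi * u y)) \<longlongrightarrow> (1 / (2 * pi)) * 0) at_top" by (intro tendsto_mult tendsto_const) simp
    then show ?thesis by simp
  qed
  have z: "vertical_integral zeta_logd f y 1 = vertical_integral zeta_logd f y (3/2)" "vertical_integral beta_logd f y 1 = vertical_integral beta_logd f y (3/2)" for y
    using vertical_integral_shift[OF logd_domain_props(3) logd_domain_props(1) strip_in_domain(1) _ logd_poly_bounded(1) f]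
      vertical_integral_shift[OF logd_domain_props(4) logd_domain_props(1) strip_in_domain(1) _ logd_poly_bounded(3) f] by auto
  have p1: "poly_bounded {s. Re s = 1} zeta_logd" "poly_bounded {s. Re s = 1} beta_logd"
    by (rule poly_bounded_subset[OF logd_poly_bounded(1)] poly_bounded_subset[OF logd_poly_bounded(3)]; auto)+
  show "((\<lambda>y. y * exp (- y) * (pair_sum zeta.pair_coeff f y - exp y * exp_integral f)) \<longlongrightarrow> 0) at_top"
  proof (rule lim[OF vertical_integral_log_saving[OF logd_domain_props(3,1) strip_in_domain(2) p1(1) logd_poly_bounded(2) f]])
    show "\<forall>\<^sub>F y in at_top. of_real (2 * pi * (y * exp (- y) * (pair_sum zeta.pair_coeff f y - exp y * exp_integral f))) =
        of_real (y * exp (- y)) * vertical_integral zeta_logd f y 1"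
      using eventually_ge_at_top[of R]
    proof eventually_elim
      case (elim y)
      show ?case unfolding z pair_sum_eq(1)[OF f elim, symmetric] by simp
    qed
  qed
  show "((\<lambda>y. y * exp (- y) * pair_sum beta.pair_coeff f y) \<longlongrightarrow> 0) at_top"
    by (rule lim[OF vertical_integral_log_saving[OF logd_domain_props(4,1) strip_in_domain(2) p1(2) logd_poly_bounded(4) f]])
      (unfold z pair_sum_eq(2)[OF f, symmetric], simp)
qed

text \<open>Both integrals can be moved on to Re s = 3/4, where exp(s y) has modulus exp(3 y / 4)
  and the growth of the logarithmic derivatives is still polynomial.\<close>

lemma pair_sum_GRH:
  assumes f: "bump R f" and grh: "\<And>s. 1/2 < Re s \<Longrightarrow> Re s < 1 \<Longrightarrow> dedekind_reg s \<noteq> 0"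
  shows "\<exists>C. \<forall>y\<ge>R. \<bar>pair_sum zeta.pair_coeff f y - exp y * exp_integral f\<bar> \<le> C * exp (3/4 * y)"
    and "\<exists>C. \<forall>y. \<bar>pair_sum beta.pair_coeff f y\<bar> \<le> C * exp (3/4 * y)"
proof -
  note g = logd_poly_bounded_GRH[OF grh]
  have sub: "{s. 3/4 \<le> Re s \<and> Re s \<le> 3/2} \<subseteq> logd_domain" "{s. Re s = 3/4} \<subseteq> logd_domain" using g(1) by force+
  have z: "vertical_integral zeta_logd f y (3/4) = vertical_integral zeta_logd f y (3/2)" "vertical_integral beta_logd f y (3/4) = vertical_integral beta_logd f y (3/2)" for y
    using vertical_integral_shift[OF logd_domain_props(3) logd_domain_props(1) sub(1) _ g(2) f]
      vertical_integral_shift[OF logd_domain_props(4) logd_domain_props(1) sub(1) _ g(3) f] by auto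
  have p1: "poly_bounded {s. Re s = 3/4} zeta_logd" "poly_bounded {s. Re s = 3/4} beta_logd"
    by (rule poly_bounded_subset[OF g(2)] poly_bounded_subset[OF g(3)]; auto)+
  have conv: "\<bar>u\<bar> \<le> C / (2 * pi) * E" if "norm (complex_of_real (2 * pi * u)) \<le> C * E" for u C E :: real
  proof -
    have "2 * pi * \<bar>u\<bar> \<le> C * E" using that unfolding norm_of_real by (simp add: abs_mult)
    then show ?thesis by (simp add: field_simps)
  qed
  obtain C where C: "\<And>y. norm (vertical_integral zeta_logd f y (3/4)) \<le> C * exp (3/4 * y)"
    using vertical_integral_bound[OF logd_domain_props(3,1) sub(2) p1(1) f] by blast
  have "\<bar>pair_sum zeta.pair_coeff f y - exp y * exp_integral f\<bar> \<le> C / (2 * pi) * exp (3/4 * y)" if "R \<le> y" for y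
    by (rule conv) (use C[of y] in \<open>simp only: z pair_sum_eq(1)[OF f that]\<close>)
  then show "\<exists>C. \<forall>y\<ge>R. \<bar>pair_sum zeta.pair_coeff f y - exp y * exp_integral f\<bar> \<le> C * exp (3/4 * y)" by blast
  obtain D where D: "\<And>y. norm (vertical_integral beta_logd f y (3/4)) \<le> D * exp (3/4 * y)"
    using vertical_integral_bound[OF logd_domain_props(4,1) sub(2) p1(2) f] by blast
  have "\<bar>pair_sum beta.pair_coeff f y\<bar> \<le> D / (2 * pi) * exp (3/4 * y)" for y
    by (rule conv) (use D[of y] in \<open>simp only: z pair_sum_eq(2)[OF f]\<close>)
  then show "\<exists>C. \<forall>y. \<bar>pair_sum beta.pair_coeff f y\<bar> \<le> C * exp (3/4 * y)" by blast
qed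

subsection \<open>Gaussian integers\<close>

text \<open>The carrier of \<open>gauss_ring\<close> as a type of its own, so that divisibility,
  Euclidean division and unique factorisation come from type classes. The results are transported
  back to ideals of \<open>gauss_ring\<close> through \<open>cpx\<close>.\<close>

typedef gint = "{z::complex. Re z \<in> \<int> \<and> Im z \<in> \<int>}" morphisms cpx Abs_gint
  by (rule exI[of _ 0]) simp

lemma cpx_Ints: "Re (cpx a) \<in> \<int>" "Im (cpx a) \<in> \<int>"
  using cpx[of a] by auto

lemma cpx_Abs: "Re z \<in> \<int> \<Longrightarrow> Im z \<in> \<int> \<Longrightarrow> cpx (Abs_gint z) = z"
  by (simp add: Abs_gint_inverse)

lemma gint_eqI: "cpx a = cpx b \<Longrightarrow> a = b"
  by (simp add: cpx_inject)

section \<open>Ring structure, norm and units\<close>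

instantiation gint :: idom
begin

definition "0 = Abs_gint 0"
definition "1 = Abs_gint 1"
definition "a + b = Abs_gint (cpx a + cpx b)"
definition "a - b = Abs_gint (cpx a - cpx b)"
definition "- a = Abs_gint (- cpx a)"
definition "a * b = Abs_gint (cpx a * cpx b)"

lemma cpx_simps [simp]:
  "cpx 0 = 0" "cpx 1 = 1" "cpx (a + b) = cpx a + cpx b" "cpx (a - b) = cpx a - cpx b"
  "cpx (- a) = - cpx a" "cpx (a * b) = cpx a * cpx b"
  unfolding zero_gint_def one_gint_def plus_gint_def minus_gint_def uminus_gint_def times_gint_def
  by (subst cpx_Abs; simp add: cpx_Ints)+

instance
proof
  fix a b c :: gint
  show "a \<noteq> 0 \<Longrightarrow> b \<noteq> 0 \<Longrightarrow> a * b \<noteq> 0"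
    by (metis cpx_inject cpx_simps(1) cpx_simps(6) mult_eq_0_iff)
  show "(0::gint) \<noteq> 1" by (metis cpx_simps(1,2) zero_neq_one)
qed (rule gint_eqI, simp add: algebra_simps)+

end

lemma cpx_eq_0 [simp]: "cpx a = 0 \<longleftrightarrow> a = 0"
  by (metis cpx_inject cpx_simps(1))

lemma cpx_power [simp]: "cpx (a ^ k) = cpx a ^ k"
  by (induction k) auto

lemma cpx_of_nat [simp]: "cpx (of_nat n) = of_nat n"
  by (induction n) auto

text \<open>The squared modulus is an integer here, so the floor only changes the type.\<close>

definition gnorm :: "gint \<Rightarrow> nat" where
  "gnorm a = nat \<lfloor>(cmod (cpx a))\<^sup>2\<rfloor>"

lemma real_gnorm: "real (gnorm a) = (cmod (cpx a))\<^sup>2"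
proof -
  have "(cmod (cpx a))\<^sup>2 = (Re (cpx a))\<^sup>2 + (Im (cpx a))\<^sup>2" by (rule cmod_power2)
  then have "(cmod (cpx a))\<^sup>2 \<in> \<int>" by (simp add: cpx_Ints)
  then obtain m :: int where "(cmod (cpx a))\<^sup>2 = of_int m" by (auto elim: Ints_cases)
  moreover from this have "0 \<le> m" by (metis of_int_0_le_iff zero_le_power2)
  ultimately show ?thesis by (simp add: gnorm_def)
qed

lemma gnorm_mult: "gnorm (a * b) = gnorm a * gnorm b"
proof -
  have "real (gnorm (a * b)) = real (gnorm a * gnorm b)"
    by (simp add: real_gnorm norm_mult power_mult_distrib)
  then show ?thesis by (simp only: of_nat_eq_iff)
qed

lemma gnorm_0_iff [simp]: "gnorm a = 0 \<longleftrightarrow> a = 0"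
  using real_gnorm[of a] by (metis cpx_eq_0 norm_eq_zero of_nat_eq_0_iff power_eq_0_iff zero_neq_numeral zero_power2)

lemma gnorm_1 [simp]: "gnorm 1 = 1" "gnorm 0 = 0"
  by (simp_all add: gnorm_def)

lemma gnorm_pos: "a \<noteq> 0 \<Longrightarrow> 1 \<le> gnorm a"
  by (metis gnorm_0_iff less_one not_less)

definition gi :: gint where "gi = Abs_gint \<i>"

lemma cpx_gi [simp]: "cpx gi = \<i>"
  unfolding gi_def by (rule cpx_Abs) auto

definition gcnj :: "gint \<Rightarrow> gint" where "gcnj a = Abs_gint (cnj (cpx a))"

lemma cpx_gcnj [simp]: "cpx (gcnj a) = cnj (cpx a)"
  unfolding gcnj_def by (rule cpx_Abs) (auto simp: cpx_Ints)

lemma gint_units: "gnorm a = 1 \<longleftrightarrow> a \<in> {1, -1, gi, - gi}"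
proof
  assume "gnorm a = 1"
  then have n: "(Re (cpx a))\<^sup>2 + (Im (cpx a))\<^sup>2 = 1" using real_gnorm[of a] by (simp add: cmod_power2)
  obtain x y :: int where xy: "Re (cpx a) = of_int x" "Im (cpx a) = of_int y" using cpx_Ints[of a] by (auto elim!: Ints_cases)
  have "of_int (x\<^sup>2 + y\<^sup>2) = (of_int 1 :: real)" using n xy by simp
  then have "x\<^sup>2 + y\<^sup>2 = 1" by (simp only: of_int_eq_iff)
  moreover have "x\<^sup>2 \<le> 1" "y\<^sup>2 \<le> 1" using \<open>x\<^sup>2 + y\<^sup>2 = 1\<close> zero_le_power2[of x] zero_le_power2[of y] by linarith+
  then have "\<bar>x\<bar> \<le> 1" "\<bar>y\<bar> \<le> 1" by (simp_all add: abs_square_le_1)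
  then have "x \<in> {-1,0,1}" "y \<in> {-1,0,1}" by auto
  ultimately have "(x, y) \<in> {(1,0), (-1,0), (0,1), (0,-1)}" by auto
  then have "cpx a \<in> {1, -1, \<i>, -\<i>}" using xy by (auto simp: complex_eq_iff)
  then show "a \<in> {1, -1, gi, - gi}" by (auto intro!: gint_eqI)
next
  assume "a \<in> {1, -1, gi, - gi}"
  then have "real (gnorm a) = 1" by (auto simp: real_gnorm)
  then show "gnorm a = 1" by simp
qed

lemma gint_dvd_1: "(a::gint) dvd 1 \<longleftrightarrow> a \<in> {1, -1, gi, - gi}"
proof
  assume "a dvd 1"
  then obtain b where "1 = a * b" by (auto simp: dvd_def)
  then have "gnorm a * gnorm b = 1" by (metis gnorm_1(1) gnorm_mult)
  then have "gnorm a = 1" by (simp only: nat_mult_eq_1_iff)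
  then show "a \<in> {1, -1, gi, - gi}" by (simp only: gint_units)
next
  assume a: "a \<in> {1, -1, gi, - gi}"
  have "gi * (- gi) = 1" "(- gi) * gi = 1" "(-1) * (-1) = (1::gint)" by (rule gint_eqI, simp)+
  then show "a dvd 1" using a by (metis dvd_triv_left insertE singletonD dvd_refl)
qed

section \<open>Euclidean division and normal forms\<close>

lemma round_Ints: "x \<in> \<int> \<Longrightarrow> of_int (round x) = (x::real)"
  by (auto elim: Ints_cases)

instantiation gint :: normalization_euclidean_semiring
begin

definition divide_gint :: "gint \<Rightarrow> gint \<Rightarrow> gint" where
  "divide_gint a b = Abs_gint (Complex (of_int (round (Re (cpx a / cpx b)))) (of_int (round (Im (cpx a / cpx b)))))"

definition modulo_gint :: "gint \<Rightarrow> gint \<Rightarrow> gint" where "modulo_gint a b = a - a div b * b"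

definition euclidean_size_gint :: "gint \<Rightarrow> nat" where "euclidean_size_gint = gnorm"

text \<open>The unit is the power of i whose rotated copy of the half-open first quadrant contains
  \<open>a\<close>. Normalising multiplies by its conjugate, which is its inverse, and so rotates
  \<open>a\<close> to Re > 0, Im >= 0, the same representative that \<open>ideal_gen\<close>
  selects.\<close>

definition unit_factor_gint :: "gint \<Rightarrow> gint" where
  "unit_factor_gint a = (let x = Re (cpx a); y = Im (cpx a) in
     if a = 0 then 0 else if 0 < x \<and> 0 \<le> y then 1 else if x \<le> 0 \<and> 0 < y then gi
     else if x < 0 \<and> y \<le> 0 then -1 else - gi)"

definition normalize_gint :: "gint \<Rightarrow> gint" where
  "normalize_gint a = a * gcnj (unit_factor a)"

lemma cpx_div: "cpx (a div b) = Complex (of_int (round (Re (cpx a / cpx b)))) (of_int (round (Im (cpx a / cpx b))))"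
  unfolding divide_gint_def by (rule cpx_Abs) auto

instance
proof
  fix a b :: gint
  show "b \<noteq> 0 \<Longrightarrow> a * b div b = a"
  proof -
    assume "b \<noteq> 0"
    then have "cpx (a * b) / cpx b = cpx a" by simp
    then have "cpx (a * b div b) = cpx a" unfolding cpx_div by (simp only:) (simp add: complex_eq_iff round_Ints cpx_Ints)
    then show "a * b div b = a" by (rule gint_eqI)
  qed
  show "a div 0 = 0" by (rule gint_eqI) (simp add: cpx_div complex_eq_iff)
  show "a div b * b + a mod b = a" by (simp add: modulo_gint_def)
  show "euclidean_size (0::gint) = 0" by (simp add: euclidean_size_gint_def)
  show "euclidean_size (a mod b) < euclidean_size b" if b: "b \<noteq> 0"
  proof -
    define q where "q = cpx a / cpx b"
    have "cpx (a mod b) = (q - cpx (a div b)) * cpx b"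
      using b by (simp add: modulo_gint_def q_def field_simps)
    then have n: "real (gnorm (a mod b)) = (cmod (q - cpx (a div b)))\<^sup>2 * real (gnorm b)"
      by (simp add: real_gnorm norm_mult power_mult_distrib)
    \<comment> \<open>Rounding moves each coordinate by at most 1/2, so the squared distance is at
      most 1/4 + 1/4 < 1 and the remainder is smaller than the divisor.\<close>
    have "\<bar>Re q - of_int (round (Re q))\<bar> \<le> 1/2" "\<bar>Im q - of_int (round (Im q))\<bar> \<le> 1/2"
      using of_int_round_abs_le[of "Re q"] of_int_round_abs_le[of "Im q"] by (simp_all add: abs_minus_commute)
    then have "(Re q - of_int (round (Re q)))\<^sup>2 \<le> (1/2)\<^sup>2" "(Im q - of_int (round (Im q)))\<^sup>2 \<le> (1/2)\<^sup>2"
      by (simp_all only: abs_le_square_iff[symmetric] abs_divide abs_one abs_numeral)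
    moreover have "(cmod (q - cpx (a div b)))\<^sup>2 = (Re q - of_int (round (Re q)))\<^sup>2 + (Im q - of_int (round (Im q)))\<^sup>2"
      unfolding cmod_power2 cpx_div q_def by simp
    moreover have "(1/2)\<^sup>2 = (1/4::real)" by (simp add: power2_eq_square)
    ultimately have "(cmod (q - cpx (a div b)))\<^sup>2 \<le> 1/2" by linarith
    then have "real (gnorm (a mod b)) \<le> 1/2 * real (gnorm b)" unfolding n by (rule mult_right_mono) simp
    moreover have "0 < real (gnorm b)" using b gnorm_pos[of b] by simp
    ultimately have "real (gnorm (a mod b)) < real (gnorm b)" by linarith
    then show ?thesis by (simp add: euclidean_size_gint_def)
  qed
  show "euclidean_size a \<le> euclidean_size (a * b)" if "b \<noteq> 0"
    using gnorm_pos[OF that] by (simp add: euclidean_size_gint_def gnorm_mult)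
  show "unit_factor (0::gint) = 0" by (simp add: unit_factor_gint_def)
  show "unit_factor a = a" if "a dvd 1"
    using that by (auto simp: gint_dvd_1 unit_factor_gint_def Let_def)
  show "unit_factor a dvd 1" if "a \<noteq> 0"
    using that by (auto simp: gint_dvd_1 unit_factor_gint_def Let_def)
  show "unit_factor (a * b) = a * unit_factor b" if "a dvd 1"
  proof (cases "b = 0")
    case False
    have nz: "\<not> (Re (cpx b) = 0 \<and> Im (cpx b) = 0)" using False cpx_eq_0[of b] by (simp add: complex_eq_iff)
    have gg: "gi * gi = -1" by (rule gint_eqI) simp
    from that consider "a = 1" | "a = -1" | "a = gi" | "a = - gi" by (auto simp: gint_dvd_1)
    then show ?thesis
    proof cases
      case 3
      then show ?thesis using False nz by (auto simp: unit_factor_gint_def Let_def gg)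
    next
      case 4
      then show ?thesis using False nz by (auto simp: unit_factor_gint_def Let_def gg)
    qed (use False nz in \<open>auto simp: unit_factor_gint_def Let_def\<close>)
  qed (simp add: unit_factor_gint_def)
  show "unit_factor a * normalize a = a"
  proof -
    have "cpx (unit_factor a) * cnj (cpx (unit_factor a)) = 1" if "a \<noteq> 0"
      using that by (auto simp: unit_factor_gint_def Let_def)
    then show ?thesis
      by (cases "a = 0") (auto intro!: gint_eqI simp: normalize_gint_def mult.left_commute)
  qed
  show "normalize (0::gint) = 0" by (simp add: normalize_gint_def)
qed

end

lemma normals_gint: "a \<in> normals \<longleftrightarrow> 0 < Re (cpx a) \<and> 0 \<le> Im (cpx a)"
proof (cases "a = 0")
  case False
  have "normalize a = a \<longleftrightarrow> unit_factor a = 1"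
  proof
    assume n: "normalize a = a"
    have "unit_factor a * a = 1 * a" using unit_factor_mult_normalize[of a] n by simp
    then show "unit_factor a = 1" using False by (metis mult_cancel_right)
  next
    assume "unit_factor a = 1"
    then show "normalize a = a" using unit_factor_mult_normalize[of a] by simp
  qed
  moreover have "(-1::gint) \<noteq> 1"
  proof
    assume "(-1::gint) = 1"
    then have "cpx (-1) = cpx 1" by (rule arg_cong)
    then show False by (simp add: complex_eq_iff)
  qed
  moreover have "gi \<noteq> 1" "- gi \<noteq> 1"
    by (auto dest!: arg_cong[of _ _ cpx] simp: complex_eq_iff)
  ultimately show ?thesis using False by (auto simp: normals_def unit_factor_gint_def Let_def)
qed (simp add: normals_def)

lemma gnorm_normalize [simp]: "gnorm (normalize a) = gnorm a"
proof (cases "a = 0")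
  case False
  then have "gnorm (unit_factor a) = 1" using unit_factor_is_unit[OF False] by (simp only: gint_units gint_dvd_1)
  then show ?thesis using gnorm_mult[of "unit_factor a" "normalize a"] by simp
qed simp

section \<open>Absolute convergence of the sum over Gaussian integers\<close>

lemma summable_on_product_real:
  fixes f g :: "_ \<Rightarrow> real"
  assumes "f summable_on A" "g summable_on B" "\<And>x. x \<in> A \<Longrightarrow> 0 \<le> f x" "\<And>y. y \<in> B \<Longrightarrow> 0 \<le> g y"
  shows "(\<lambda>(x, y). f x * g y) summable_on A \<times> B"
proof -
  let ?h = "\<lambda>p. f (fst p) * g (snd p)"
  have "(\<lambda>p. norm (?h p)) summable_on A \<times> B"
  proof (rule Infinite_Sum.abs_summable_on_Sigma_iff[THEN iffD2], intro conjI ballI)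
    have e: "(\<lambda>y. norm (?h (x, y))) summable_on B \<and> (\<Sum>\<^sub>\<infinity>y\<in>B. norm (?h (x, y))) = f x * infsum g B" if "x \<in> A" for x
    proof -
      have "norm (?h (x, y)) = f x * g y" if "y \<in> B" for y using assms(3)[OF \<open>x \<in> A\<close>] assms(4)[OF that] by simp
      then show ?thesis
        using summable_on_cmult_right[OF assms(2), of "f x"] infsum_cmult_right[of "f x" g B] assms(2)
        by (auto cong: summable_on_cong infsum_cong)
    qed
    then show "(\<lambda>y. norm (?h (x, y))) summable_on B" if "x \<in> A" for x using that by blast
    have "0 \<le> infsum g B" using assms(4) by (rule infsum_nonneg)
    then have "norm (\<Sum>\<^sub>\<infinity>y\<in>B. norm (?h (x, y))) = f x * infsum g B" if "x \<in> A" for x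
      using e[OF that] assms(3)[OF that] by simp
    then show "(\<lambda>x. norm (\<Sum>\<^sub>\<infinity>y\<in>B. norm (?h (x, y)))) summable_on A"
      using summable_on_cmult_left[OF assms(1), of "infsum g B"] by (simp cong: summable_on_cong)
  qed
  then have "?h summable_on A \<times> B" by (rule abs_summable_summable)
  moreover have "?h = (\<lambda>(x, y). f x * g y)" by (auto simp: fun_eq_iff)
  ultimately show ?thesis by (simp only:)
qed

lemma sum_le_twice:
  fixes A B C X :: real
  assumes "X \<le> A" "2 * B \<le> A + C" "0 \<le> A" "0 \<le> C"
  shows "B + X \<le> 2 * (A + C)"
proof -
  have "B + X \<le> (A + C) / 2 + A" using assms(1,2) by (intro add_mono) auto
  also have "\<dots> \<le> 2 * (A + C)" using assms(3,4) by (simp add: field_simps)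
  finally show ?thesis .
qed

text \<open>For coordinates x >= 1 and y >= 0 one has x (y + 1) <= 2 (x^2 + y^2), so the series is
  dominated by 2^c times a product of two copies of the series for zeta(c). The shift to y + 1 is
  forced by the points on the real axis.\<close>

lemma gint_dseries_converges: "dseries_converges normals (\<lambda>_. 1) (\<lambda>a. ln (real (gnorm a)))"
  unfolding dseries_converges_def
proof (intro conjI ballI allI impI)
  show "0 \<le> ln (real (gnorm i))" if "i \<in> normals" for i
    using that gnorm_pos[of i] by (simp add: normals_def)
  fix c :: real assume c: "1 < c"
  define u where "u n = exp (- c * ln (real n))" for n :: nat
  have u: "u summable_on {0<..}" using zeta_dseries_summable[OF c] by (simp add: u_def[abs_def])
  define h where "h a = (nat \<lfloor>Re (cpx a)\<rfloor>, nat \<lfloor>Im (cpx a)\<rfloor> + 1)" for a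
  have h: "real (fst (h a)) = Re (cpx a) \<and> real (snd (h a)) = Im (cpx a) + 1 \<and> h a \<in> {0<..} \<times> {0<..}" if "a \<in> normals" for a
  proof -
    have "0 < Re (cpx a)" "0 \<le> Im (cpx a)" using that by (auto simp: normals_gint)
    moreover obtain x y :: int where "Re (cpx a) = of_int x" "Im (cpx a) = of_int y" using cpx_Ints[of a] by (auto elim!: Ints_cases)
    ultimately show ?thesis by (simp add: h_def)
  qed
  have inj: "inj_on h normals"
  proof (rule inj_onI)
    fix a b assume ab: "a \<in> normals" "b \<in> normals" "h a = h b"
    have "Re (cpx a) = Re (cpx b)" "Im (cpx a) = Im (cpx b)" using h[OF ab(1)] h[OF ab(2)] ab(3) by auto
    then show "a = b" by (intro gint_eqI) (simp add: complex_eq_iff)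
  qed
  have "(\<lambda>(x, y). u x * u y) summable_on {0<..} \<times> {0<..}"
    by (rule summable_on_product_real[OF u u]) (auto simp: u_def)
  then have "(\<lambda>(x, y). u x * u y) summable_on h ` normals"
    by (rule summable_on_subset_banach) (use h in blast)
  then have "(\<lambda>a. 2 powr c * (u (fst (h a)) * u (snd (h a)))) summable_on normals"
    unfolding summable_on_reindex[OF inj] by (intro summable_on_cmult_right) (simp add: o_def case_prod_beta)
  then show "(\<lambda>a. \<bar>1\<bar> * exp (- c * ln (real (gnorm a)))) summable_on normals"
  proof (rule summable_on_comparison_real)
    fix a :: gint assume a: "a \<in> normals"
    define x y where "x = Re (cpx a)" and "y = Im (cpx a)"
    have x1: "1 \<le> x" "0 \<le> y"
    proof -
      obtain m :: int where "x = of_int m" using cpx_Ints[of a] by (auto simp: x_def elim!: Ints_cases)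
      then show "1 \<le> x" "0 \<le> y" using a by (auto simp: normals_gint x_def y_def)
    qed
    have g: "real (gnorm a) = x\<^sup>2 + y\<^sup>2" by (simp add: real_gnorm cmod_power2 x_def y_def)
    have "x * (y + 1) \<le> 2 * (x\<^sup>2 + y\<^sup>2)"
    proof -
      have "x \<le> x\<^sup>2" using mult_left_mono[of 1 x x] x1 by (simp add: power2_eq_square)
      moreover have "2 * (x * y) \<le> x\<^sup>2 + y\<^sup>2" using sum_squares_bound[of x y] by (simp add: mult.assoc)
      ultimately have "x * y + x \<le> 2 * (x\<^sup>2 + y\<^sup>2)" by (intro sum_le_twice) auto
      then show ?thesis by (simp add: algebra_simps)
    qed
    then have "ln (x * (y + 1)) \<le> ln (2 * real (gnorm a))"
      unfolding g using x1 by (intro ln_mono) (auto intro!: mult_pos_pos)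
    then have l: "ln x + ln (y + 1) \<le> ln 2 + ln (real (gnorm a))"
      using x1 gnorm_pos[of a] a by (simp add: ln_mult normals_def)
    have "- c * ln (real (gnorm a)) \<le> c * ln 2 + (- c * ln x + - c * ln (y + 1))"
      using mult_left_mono[OF l, of c] c by (simp add: algebra_simps)
    then have "exp (- c * ln (real (gnorm a))) \<le> exp (c * ln 2) * (exp (- c * ln x) * exp (- c * ln (y + 1)))"
      unfolding exp_add[symmetric] by simp
    then show "\<bar>1\<bar> * exp (- c * ln (real (gnorm a))) \<le> 2 powr c * (u (fst (h a)) * u (snd (h a)))"
      using h[OF a] by (simp add: u_def powr_def x_def y_def)
  qed auto
qed

lemma gnorm_prime_ge: "prime (p::gint) \<Longrightarrow> 2 \<le> gnorm p"
proof -
  assume p: "prime p"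
  then have "\<not> p dvd 1" "p \<noteq> 0" by (auto dest: not_prime_unit)
  then have "gnorm p \<noteq> 1" by (simp only: gint_units gint_dvd_1 not_False_eq_True)
  moreover have "1 \<le> gnorm p" using \<open>p \<noteq> 0\<close> by (rule gnorm_pos)
  ultimately show ?thesis by linarith
qed

interpretation gauss: multiplicative_family "\<lambda>_::gint. 1" "\<lambda>a. ln (real (gnorm a))"
proof unfold_locales
  show "ln (real (gnorm (a * b))) = ln (real (gnorm a)) + ln (real (gnorm b))" if "a \<noteq> 0" "b \<noteq> 0" for a b
    using that by (simp add: gnorm_mult ln_mult)
  show "ln 2 \<le> ln (real (gnorm p))" if "prime p" for p
    using gnorm_prime_ge[OF that] by simp
qed (auto simp: gint_dseries_converges)

section \<open>Classification of the primes of the Gaussian integers\<close>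

instance gint :: ring_char_0
proof
  have "m = n" if "(of_nat m :: gint) = of_nat n" for m n
    using arg_cong[OF that, of cpx] by simp
  then show "inj (of_nat :: nat \<Rightarrow> gint)" by (rule injI)
qed

lemma cpx_numeral [simp]: "cpx (numeral k) = numeral k"
  by (metis cpx_of_nat of_nat_numeral)

lemma gcnj_simps [simp]: "gcnj (a * b) = gcnj a * gcnj b" "gcnj (gcnj a) = a" "gcnj (of_nat n) = of_nat n" "gcnj 1 = 1" "gcnj (a ^ k) = gcnj a ^ k"
  by (rule gint_eqI; simp)+

lemma gnorm_gcnj [simp]: "gnorm (gcnj a) = gnorm a"
  by (simp add: gnorm_def)

lemma mult_gcnj: "a * gcnj a = of_nat (gnorm a)"
proof (rule gint_eqI)
  have "cpx a * cnj (cpx a) = of_real (real (gnorm a))" by (simp only: real_gnorm complex_norm_square[symmetric])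
  then show "cpx (a * gcnj a) = cpx (of_nat (gnorm a))" by simp
qed

lemma gcnj_dvd_iff: "gcnj a dvd gcnj b \<longleftrightarrow> a dvd b"
proof -
  have "gcnj a dvd gcnj b" if "a dvd b" for a b using that by (auto simp: dvd_def)
  from this[of a b] this[of "gcnj a" "gcnj b"] show ?thesis by auto
qed

lemma dvd_gnorm: "a dvd b \<Longrightarrow> gnorm a dvd gnorm b"
  by (auto simp: dvd_def gnorm_mult)

lemma gnorm_of_nat [simp]: "gnorm (of_nat n) = n\<^sup>2"
proof -
  have "real (gnorm (of_nat n)) = real (n\<^sup>2)" by (simp add: real_gnorm)
  then show ?thesis by (simp only: of_nat_eq_iff)
qed

lemma gnorm_numeral [simp]: "gnorm (numeral k) = (numeral k)\<^sup>2"
  by (metis gnorm_of_nat of_nat_numeral)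

lemma dvd_gnorm_eq_imp: "a dvd b \<Longrightarrow> gnorm a = gnorm b \<Longrightarrow> b \<noteq> 0 \<Longrightarrow> normalize a = normalize b"
proof -
  assume "a dvd b" "gnorm a = gnorm b" "b \<noteq> 0"
  then obtain c where c: "b = a * c" by (auto simp: dvd_def)
  have "gnorm a * gnorm c = gnorm a * 1" 
    using \<open>gnorm a = gnorm b\<close> c gnorm_mult[of a c] by (metis mult.right_neutral)
  moreover have "gnorm a \<noteq> 0" using \<open>b \<noteq> 0\<close> c by auto
  ultimately have "gnorm c = 1" by (metis mult_cancel_left)
  then have "c dvd 1" by (simp only: gint_units gint_dvd_1)
  then show ?thesis by (simp add: c)
qed

lemma prime_of_gnorm:
  assumes "prime (gnorm a)"
  shows "prime_elem a"
proof -
  have "irreducible a"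
  proof (rule irreducibleI)
    show "a \<noteq> 0" using assms by auto
    show "\<not> a dvd 1"
    proof
      assume "a dvd 1"
      then have "gnorm a = 1" by (simp only: gint_units gint_dvd_1)
      then show False using assms by simp
    qed
    fix b c assume "a = b * c"
    then have "gnorm a = gnorm b * gnorm c" by (simp add: gnorm_mult)
    then have "gnorm b = 1 \<or> gnorm c = 1" using assms by (metis prime_product)
    then show "b dvd 1 \<or> c dvd 1" by (simp only: gint_units gint_dvd_1)
  qed
  then show ?thesis by (simp add: prime_elem_iff_irreducible)
qed

text \<open>A Gaussian prime divides its norm, a positive rational integer, as the product with its
  conjugate; splitting off rational prime factors one at a time isolates the one that it
  divides.\<close>

lemma prime_gint_dvd_nat:
  assumes "prime (\<pi>::gint)"
  obtains p :: nat where "prime p" "\<pi> dvd of_nat p"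
proof -
  have "\<exists>p. prime p \<and> \<pi> dvd of_nat p" if "0 < n" "\<pi> dvd of_nat n" for n :: nat
    using that
  proof (induction n rule: less_induct)
    case (less n)
    have "n \<noteq> 1" using less.prems assms by (auto dest: not_prime_unit)
    then obtain p where p: "prime p" "p dvd n" by (metis prime_factor_nat)
    then obtain m where m: "n = p * m" by (auto simp: dvd_def)
    have "\<pi> dvd of_nat p * of_nat m" using less.prems by (simp add: m)
    then consider "\<pi> dvd of_nat p" | "\<pi> dvd of_nat m" using assms by (auto simp: prime_dvd_mult_iff)
    then show ?case
    proof cases
      case 2
      have "0 < m" "m < n" using less.prems m prime_gt_1_nat[OF p(1)] by auto
      then show ?thesis using less.IH 2 by blast
    qed (use p in blast)
  qed
  moreover have "0 < gnorm \<pi>" using assms gnorm_prime_ge[OF assms] by simp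
  moreover have "\<pi> dvd of_nat (gnorm \<pi>)" by (metis mult_gcnj dvd_triv_left)
  ultimately show ?thesis using that by blast
qed

text \<open>The norm divides p^2 and is not 1. If it equals p^2, the prime is an associate of p, and
  both are in normal form.\<close>

lemma prime_gint_norm:
  assumes "prime (\<pi>::gint)" "prime p" "\<pi> dvd of_nat p"
  shows "gnorm \<pi> = p \<or> \<pi> = of_nat p"
proof -
  have "gnorm \<pi> dvd p\<^sup>2" using dvd_gnorm[OF assms(3)] by simp
  then obtain i where i: "i \<le> 2" "gnorm \<pi> = p ^ i" using assms(2) by (auto simp: divides_primepow_nat)
  have "i \<noteq> 0" using i gnorm_prime_ge[OF assms(1)] by (cases i) auto
  then consider "i = 1" | "i = 2" using i by linarith
  then show ?thesis
  proof cases
    case 2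
    have "normalize \<pi> = normalize (of_nat p)"
      using assms 2 i by (intro dvd_gnorm_eq_imp) auto
    moreover have "(of_nat p :: gint) \<in> normals" using assms(2) prime_gt_0_nat[OF assms(2)] by (simp add: normals_gint)
    ultimately show ?thesis using assms(1) by (simp add: normals_def)
  qed (use i in simp)
qed

lemma sum_squares_mod_4:
  assumes "prime p" "gnorm a = p"
  shows "p = 2 \<or> p mod 4 = 1"
proof -
  obtain x y :: int where xy: "Re (cpx a) = of_int x" "Im (cpx a) = of_int y" using cpx_Ints[of a] by (auto elim!: Ints_cases)
  have "real p = of_int (x\<^sup>2 + y\<^sup>2)" using assms real_gnorm[of a] by (simp add: cmod_power2 xy)
  then have e: "int p = x\<^sup>2 + y\<^sup>2" by (metis of_int_eq_iff of_int_of_nat_eq)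
  have sq: "z\<^sup>2 mod 4 = 0 \<or> z\<^sup>2 mod 4 = 1" for z :: int
  proof -
    have "z mod 4 \<in> {0,1,2,3}" by auto
    then have "(z mod 4)\<^sup>2 mod 4 = 0 \<or> (z mod 4)\<^sup>2 mod 4 = 1" by auto
    then show ?thesis by (simp add: power_mod)
  qed
  have "int p mod 4 = (x\<^sup>2 mod 4 + y\<^sup>2 mod 4) mod 4" by (simp add: e mod_add_eq)
  then have "int p mod 4 \<noteq> 3" using sq[of x] sq[of y] by auto
  then have "p mod 4 \<noteq> 3" by presburger
  moreover have "odd p \<or> p = 2" using assms(1) primes_dvd_imp_eq two_is_prime_nat by blast
  ultimately show ?thesis by presburger
qed

text \<open>A Gaussian prime factor of q is q itself or has norm q; the latter would write q as a
  sum of two squares, which is impossible for q = 3 mod 4.\<close>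

lemma inert_prime:
  assumes "prime (q::nat)" "q mod 4 = 3"
  shows "prime (of_nat q :: gint)"
proof -
  have n1: "\<not> (of_nat q :: gint) dvd 1"
  proof
    assume "(of_nat q :: gint) dvd 1"
    then have "q\<^sup>2 dvd 1" using dvd_gnorm[of "of_nat q" 1] by simp
    then show False using assms(1) by (auto simp: prime_nat_iff)
  qed
  moreover have "(of_nat q :: gint) \<noteq> 0" using assms(1) prime_gt_0_nat[OF assms(1)] by (metis cpx_of_nat cpx_simps(1) of_nat_eq_0_iff less_irrefl)
  ultimately obtain \<pi> :: gint where p: "\<pi> dvd of_nat q" "prime \<pi>" using prime_divisor_exists by blast
  have "gnorm \<pi> \<noteq> q" using sum_squares_mod_4[OF assms(1), of \<pi>] assms(2) by auto
  then show ?thesis using prime_gint_norm[OF p(2) assms(1) p(1)] p(2) by auto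
qed

lemma neg_one_quad_res:
  assumes "prime (p::nat)" "p mod 4 = 1"
  obtains x :: int where "int p dvd x\<^sup>2 + 1"
proof -
  have p: "2 < p" using assms prime_ge_2_nat[of p] by (cases "p = 2") auto
  have ev: "even ((p - 1) div 2)" using assms(2) by presburger
  have "[Legendre (-1) (int p) = (-1) ^ ((p - 1) div 2)] (mod int p)" by (rule euler_criterion[OF assms(1) p])
  then have c: "[Legendre (-1) (int p) = 1] (mod int p)" using ev by simp
  have "QuadRes (int p) (-1)"
  proof (rule ccontr)
    assume "\<not> QuadRes (int p) (-1)"
    then have "Legendre (-1) (int p) = 0 \<or> Legendre (-1) (int p) = -1" by (auto simp: Legendre_def)
    then have "int p dvd 1 \<or> int p dvd 2" using c by (auto simp: cong_iff_dvd_diff)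
    then have "int p \<le> 2" by (auto dest: zdvd_imp_le)
    then show False using p by simp
  qed
  then obtain x where "[x\<^sup>2 = -1] (mod int p)" by (auto simp: QuadRes_def)
  then have "int p dvd x\<^sup>2 + 1" by (simp add: cong_iff_dvd_diff)
  then show ?thesis by (rule that)
qed

lemma of_nat_dvd_gint:
  assumes "(of_nat p :: gint) dvd a"
  shows "\<exists>m::int. Im (cpx a) = of_int (int p * m)"
proof -
  obtain b where "a = of_nat p * b" using assms by (auto simp: dvd_def)
  moreover obtain m :: int where "Im (cpx b) = of_int m" using cpx_Ints[of b] by (auto elim!: Ints_cases)
  ultimately show ?thesis by (intro exI[of _ m]) simp
qed

text \<open>With p dividing x^2 + 1 = (x + i)(x - i), a prime p would divide one of the factors, but
  their imaginary parts are 1 and -1. So p is not a Gaussian prime, and a prime factor of it has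
  norm p.\<close>

lemma split_prime_exists:
  assumes "prime (p::nat)" "p mod 4 = 1"
  obtains \<pi> :: gint where "prime \<pi>" "gnorm \<pi> = p"
proof -
  obtain x :: int where x: "int p dvd x\<^sup>2 + 1" using neg_one_quad_res[OF assms] by blast
  define a where "a = Abs_gint (Complex (of_int x) 1)"
  have ca: "cpx a = Complex (of_int x) 1" unfolding a_def by (rule cpx_Abs) auto
  have np: "\<not> (of_nat p :: gint) dvd b" if "\<bar>Im (cpx b)\<bar> = 1" for b
  proof
    assume "(of_nat p :: gint) dvd b"
    then obtain m :: int where "Im (cpx b) = of_int (int p * m)" using of_nat_dvd_gint by blast
    then have "\<bar>int p * m\<bar> = 1" using that by (metis of_int_1 of_int_abs of_int_eq_iff)
    then have "int p dvd 1" by (metis dvd_abs_iff dvd_triv_left)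
    then show False using assms(1) by (auto simp: prime_nat_iff)
  qed
  have "\<not> prime_elem (of_nat p :: gint)"
  proof
    assume pe: "prime_elem (of_nat p :: gint)"
    obtain m where m: "x\<^sup>2 + 1 = int p * m" using x by (auto simp: dvd_def)
    then have "0 \<le> m" using prime_gt_0_nat[OF assms(1)] by (metis add_nonneg_nonneg mult_le_cancel_left1 mult_pos_neg not_le of_nat_0_less_iff zero_le_one zero_le_power2)
    then obtain n :: nat where "m = int n" using nonneg_int_cases by blast
    have "real (gnorm a) = of_int (x\<^sup>2 + 1)" by (simp add: real_gnorm cmod_power2 ca)
    then have "real (gnorm a) = real (p * n)" unfolding m \<open>m = int n\<close> by simp
    then have "gnorm a = p * n" by (simp only: of_nat_eq_iff)
    then have "a * gcnj a = of_nat p * of_nat n" by (simp add: mult_gcnj)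
    then have "of_nat p dvd a * gcnj a" by simp
    then have "of_nat p dvd a \<or> of_nat p dvd gcnj a" using pe by (simp add: prime_elem_dvd_mult_iff)
    then show False using np[of a] np[of "gcnj a"] by (simp add: ca)
  qed
  moreover have "(of_nat p :: gint) \<noteq> 0" using prime_gt_0_nat[OF assms(1)] by (metis cpx_of_nat cpx_simps(1) of_nat_eq_0_iff less_irrefl)
  moreover have "\<not> (of_nat p :: gint) dvd 1"
  proof
    assume "(of_nat p :: gint) dvd 1"
    then have "p\<^sup>2 dvd 1" using dvd_gnorm[of "of_nat p" 1] by simp
    then show False using assms(1) by (auto simp: prime_nat_iff)
  qed
  ultimately obtain \<pi> :: gint where p: "\<pi> dvd of_nat p" "prime \<pi>" using prime_divisor_exists by blast
  have "gnorm \<pi> = p" using prime_gint_norm[OF p(2) assms(1) p(1)] p(2) \<open>\<not> prime_elem (of_nat p)\<close> by (auto simp: prime_def)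
  then show ?thesis using that p(2) by blast
qed

definition split_prime :: "nat \<Rightarrow> gint" where
  "split_prime p = (SOME \<pi>. prime \<pi> \<and> gnorm \<pi> = p)"

text \<open>The conjugate prime, rotated back into the first quadrant.\<close>

definition split_prime' :: "nat \<Rightarrow> gint" where
  "split_prime' p = normalize (gcnj (split_prime p))"

lemma prime_gint_normals: "prime (\<pi>::gint) \<Longrightarrow> \<pi> \<in> normals"
  by (auto simp: normals_def)

lemma split_prime:
  assumes "prime (p::nat)" "p mod 4 = 1"
  shows "prime (split_prime p)" "gnorm (split_prime p) = p" "prime (split_prime' p)" "gnorm (split_prime' p) = p"
    and "split_prime p \<noteq> split_prime' p"
    and "prime \<pi> \<Longrightarrow> gnorm \<pi> = p \<Longrightarrow> \<pi> = split_prime p \<or> \<pi> = split_prime' p"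
proof -
  have "\<exists>\<pi>::gint. prime \<pi> \<and> gnorm \<pi> = p" using split_prime_exists[OF assms] by blast
  then have "prime (split_prime p) \<and> gnorm (split_prime p) = p" unfolding split_prime_def by (rule someI_ex)
  then show s: "prime (split_prime p)" "gnorm (split_prime p) = p" by auto
  show n': "gnorm (split_prime' p) = p" by (simp add: split_prime'_def s)
  have "prime_elem (split_prime' p)" by (rule prime_of_gnorm) (simp only: n' assms(1))
  moreover have "normalize (split_prime' p) = split_prime' p" by (simp add: split_prime'_def)
  ultimately show s': "prime (split_prime' p)" by (rule primeI)
  show "\<pi> = split_prime p \<or> \<pi> = split_prime' p" if \<pi>: "prime \<pi>" "gnorm \<pi> = p"
  proof -
    have "\<pi> dvd \<pi> * gcnj \<pi>" by simp
    then have "\<pi> dvd split_prime p * gcnj (split_prime p)" by (simp add: mult_gcnj \<pi> s)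
    then have "\<pi> dvd split_prime p \<or> \<pi> dvd gcnj (split_prime p)" using \<pi>(1) by (simp add: prime_dvd_mult_iff)
    then have "normalize \<pi> = normalize (split_prime p) \<or> normalize \<pi> = normalize (gcnj (split_prime p))"
      using \<pi> s prime_gt_0_nat[OF assms(1)] by (metis dvd_gnorm_eq_imp gnorm_gcnj gnorm_0_iff less_irrefl)
    then show ?thesis using \<pi>(1) s(1) by (simp add: split_prime'_def)
  qed
  show "split_prime p \<noteq> split_prime' p"
  proof
    \<comment> \<open>If they coincide, the prime differs from its conjugate by a unit and therefore
      lies on an axis or on a diagonal. Its norm p is then a square or even.\<close>
    assume eq: "split_prime p = split_prime' p"
    define a where "a = split_prime p"
    have "a = normalize (gcnj a)" using eq by (simp add: a_def split_prime'_def)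
    then have "gcnj a = unit_factor (gcnj a) * a" by (metis unit_factor_mult_normalize)
    moreover have "a \<noteq> 0" using s by (auto simp: a_def)
    then have "unit_factor (gcnj a) dvd 1" by (metis cpx_gcnj complex_cnj_zero_iff cpx_eq_0 unit_factor_is_unit)
    ultimately obtain u where u: "gcnj a = u * a" "u \<in> {1, -1, gi, - gi}" by (auto simp: gint_dvd_1)
    have "cnj (cpx a) = cpx u * cpx a" using arg_cong[OF u(1), of cpx] by simp
    obtain x y :: int where xy: "Re (cpx a) = of_int x" "Im (cpx a) = of_int y" using cpx_Ints[of a] by (auto elim!: Ints_cases)
    have pos: "0 < Re (cpx a)" using prime_gint_normals[OF s(1)] by (simp add: a_def normals_gint)
    have pe: "real p = of_int (x\<^sup>2 + y\<^sup>2)" using s real_gnorm[of a] by (simp add: a_def[symmetric] cmod_power2 xy)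
    then have e: "int p = x\<^sup>2 + y\<^sup>2" by (metis of_int_eq_iff of_int_of_nat_eq)
    from u(2) have "y = 0 \<or> x = 0 \<or> x = - y \<or> x = y"
      using \<open>cnj (cpx a) = cpx u * cpx a\<close> by (auto simp: complex_eq_iff xy)
    then consider "y = 0" | "x\<^sup>2 = y\<^sup>2" using pos xy by (auto simp: power2_eq_square)
    then show False
    proof cases
      case 1
      then have "int p = (int (nat \<bar>x\<bar>))\<^sup>2" using e by simp
      then have "p = (nat \<bar>x\<bar>)\<^sup>2" by (metis of_nat_eq_iff of_nat_power)
      then show False using assms(1) prime_power_iff[of "nat \<bar>x\<bar>" 2] by simp
    next
      case 2
      then have "even (int p)" using e by simp
      then show False using assms(2) by presburger
    qed
  qed
qed

definition split_pairs :: "(gint \<times> nat) set" where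
  "split_pairs = {(\<pi>, k). prime \<pi> \<and> 0 < k \<and> prime (gnorm \<pi>) \<and> gnorm \<pi> mod 4 = 1}"

definition inert_pairs :: "(gint \<times> nat) set" where
  "inert_pairs = {(\<pi>, k). 0 < k \<and> (\<exists>q. prime q \<and> q mod 4 = 3 \<and> \<pi> = of_nat q)}"

definition ramified_prime :: gint where "ramified_prime = 1 + gi"

definition ramified_pairs :: "(gint \<times> nat) set" where
  "ramified_pairs = {ramified_prime} \<times> {0<..}"

lemma ramified_prime: "prime ramified_prime" "gnorm ramified_prime = 2"
proof -
  have "real (gnorm ramified_prime) = real 2" by (simp add: real_gnorm cmod_power2 ramified_prime_def)
  then show n: "gnorm ramified_prime = 2" by (simp only: of_nat_eq_iff)
  have "ramified_prime \<in> normals" by (simp add: normals_gint ramified_prime_def)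
  then have "normalize ramified_prime = ramified_prime" by (simp add: normals_def)
  moreover have "prime_elem ramified_prime" by (rule prime_of_gnorm) (simp add: n)
  ultimately show "prime ramified_prime" by (intro primeI)
qed

lemma prime_gint_norm_2:
  assumes "\<pi> \<in> normals" "gnorm \<pi> = 2"
  shows "\<pi> = ramified_prime"
proof -
  obtain x y :: int where xy: "Re (cpx \<pi>) = of_int x" "Im (cpx \<pi>) = of_int y" using cpx_Ints[of \<pi>] by (auto elim!: Ints_cases)
  have "of_int (x\<^sup>2 + y\<^sup>2) = (of_int 2 :: real)" using assms real_gnorm[of \<pi>] by (simp add: cmod_power2 xy)
  then have e: "x\<^sup>2 + y\<^sup>2 = 2" by (simp only: of_int_eq_iff)
  have p: "0 < x" "0 \<le> y" using assms(1) xy by (auto simp: normals_gint)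
  have "x < 2"
  proof (rule ccontr)
    assume "\<not> x < 2"
    then have "2 * 2 \<le> x * x" by (intro mult_mono) auto
    then show False using e zero_le_power2[of y] unfolding power2_eq_square by linarith
  qed
  then have "x = 1" using p by simp
  then have "y\<^sup>2 = 1" using e by simp
  then have "y = 1" using p by (simp add: power2_eq_1_iff)
  then show ?thesis using xy \<open>x = 1\<close> by (intro gint_eqI) (simp add: complex_eq_iff ramified_prime_def)
qed

lemma prime_pairs_partition:
  "prime_pairs = split_pairs \<union> inert_pairs \<union> ramified_pairs"
  "split_pairs \<inter> inert_pairs = {}" "(split_pairs \<union> inert_pairs) \<inter> ramified_pairs = {}"
proof -
  have "(\<pi>, k) \<in> split_pairs \<union> inert_pairs \<union> ramified_pairs" if \<pi>: "prime \<pi>" "0 < k" for \<pi> k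
  proof -
    obtain p where p: "prime p" "\<pi> dvd of_nat p" using prime_gint_dvd_nat[OF \<pi>(1)] by blast
    consider "p = 2" | "p mod 4 = 1" | "p mod 4 = 3"
    proof -
      have "odd p \<or> p = 2" using p(1) primes_dvd_imp_eq two_is_prime_nat by blast
      then have "p = 2 \<or> p mod 4 = 1 \<or> p mod 4 = 3" by presburger
      then show thesis using that by blast
    qed
    then show ?thesis
    proof cases
      case 1
      have "gnorm \<pi> = 2"
      proof (rule ccontr)
        assume "gnorm \<pi> \<noteq> 2"
        then have "\<pi> = of_nat 2" using prime_gint_norm[OF \<pi>(1) p] 1 by auto
        \<comment> \<open>This factorisation rules out 2 as a Gaussian prime: both factors have norm
          2, while 2 has norm 4.\<close>
        moreover have "(of_nat 2 :: gint) = (1 + gi) * (1 - gi)" by (rule gint_eqI) (simp add: algebra_simps)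
        ultimately have "\<pi> dvd 1 + gi \<or> \<pi> dvd 1 - gi" using \<pi>(1) by (metis dvd_refl prime_dvd_mult_iff)
        moreover have "real (gnorm (1 + gi)) = real 2" "real (gnorm (1 - gi)) = real 2" by (simp_all add: real_gnorm cmod_power2)
        then have "gnorm (1 + gi) = 2" "gnorm (1 - gi) = 2" by (simp_all only: of_nat_eq_iff)
        ultimately have "gnorm \<pi> dvd 2" using dvd_gnorm by metis
        then show False using \<open>\<pi> = of_nat 2\<close> by (auto dest: dvd_imp_le)
      qed
      then show ?thesis using prime_gint_norm_2[OF prime_gint_normals[OF \<pi>(1)]] \<pi> by (simp add: ramified_pairs_def)
    next
      case 2
      have "gnorm \<pi> = p"
      proof (rule ccontr)
        assume "gnorm \<pi> \<noteq> p"
        then have eq: "\<pi> = of_nat p" using prime_gint_norm[OF \<pi>(1) p] by auto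
        have "split_prime p dvd \<pi>" unfolding eq using split_prime(2)[OF p(1) 2] by (metis dvd_triv_left mult_gcnj)
        then have "split_prime p = \<pi>" using split_prime(1)[OF p(1) 2] \<pi>(1) by (simp add: primes_dvd_imp_eq)
        then show False using \<open>gnorm \<pi> \<noteq> p\<close> split_prime(2)[OF p(1) 2] by simp
      qed
      then show ?thesis using 2 p \<pi> by (simp add: split_pairs_def)
    next
      case 3
      then have "gnorm \<pi> \<noteq> p" using sum_squares_mod_4[OF p(1), of \<pi>] by auto
      then have "\<pi> = of_nat p" using prime_gint_norm[OF \<pi>(1) p] by auto
      then show ?thesis using 3 p \<pi> by (auto simp: inert_pairs_def)
    qed
  qed
  then show "prime_pairs = split_pairs \<union> inert_pairs \<union> ramified_pairs"
    by (auto simp: prime_pairs_def split_pairs_def inert_pairs_def ramified_pairs_def inert_prime ramified_prime)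
  show "split_pairs \<inter> inert_pairs = {}"
    by (auto simp: split_pairs_def inert_pairs_def prime_power_iff)
  have "ramified_prime \<noteq> of_nat q" if "prime q" for q
  proof
    assume "ramified_prime = of_nat q"
    then have "q\<^sup>2 = 2" using ramified_prime(2) gnorm_of_nat[of q] by metis
    then show False using prime_ge_2_nat[OF that] power_mono[of 2 q 2] by simp
  qed
  then show "(split_pairs \<union> inert_pairs) \<inter> ramified_pairs = {}"
    by (auto simp: split_pairs_def inert_pairs_def ramified_pairs_def ramified_prime)
qed

section \<open>Factorisation of the Dedekind zeta function\<close>

definition nat_pairs :: "nat \<Rightarrow> (nat \<times> nat) set" where
  "nat_pairs r = {(p, k). prime p \<and> p mod 4 = r \<and> 0 < k}"

text \<open>Exactly two normal primes lie above p; the Boolean tells which one is meant.\<close>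

lemma split_pairs_bij:
  "bij_betw (\<lambda>((p, k), b). (if b then split_prime p else split_prime' p, k)) (nat_pairs 1 \<times> UNIV) split_pairs"
proof (rule bij_betwI[where g="\<lambda>(\<pi>, k). ((gnorm \<pi>, k), \<pi> = split_prime (gnorm \<pi>))"])
  show "(\<lambda>((p, k), b). (if b then split_prime p else split_prime' p, k)) \<in> nat_pairs 1 \<times> UNIV \<rightarrow> split_pairs"
    using split_prime by (auto simp: nat_pairs_def split_pairs_def)
  show "(\<lambda>(\<pi>, k). ((gnorm \<pi>, k), \<pi> = split_prime (gnorm \<pi>))) \<in> split_pairs \<rightarrow> nat_pairs 1 \<times> UNIV"
    by (auto simp: nat_pairs_def split_pairs_def)
next
  fix x assume "x \<in> nat_pairs 1 \<times> (UNIV :: bool set)"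
  then obtain p k b where x: "x = ((p, k), b)" "prime p" "p mod 4 = 1" by (auto simp: nat_pairs_def)
  show "(\<lambda>(\<pi>, k). ((gnorm \<pi>, k), \<pi> = split_prime (gnorm \<pi>))) ((\<lambda>((p, k), b). (if b then split_prime p else split_prime' p, k)) x) = x"
    using split_prime(2,4,5)[OF x(2,3)] by (auto simp: x(1))
next
  fix y assume "y \<in> split_pairs"
  then obtain \<pi> k where y: "y = (\<pi>, k)" "prime \<pi>" "prime (gnorm \<pi>)" "gnorm \<pi> mod 4 = 1" by (auto simp: split_pairs_def)
  show "(\<lambda>((p, k), b). (if b then split_prime p else split_prime' p, k)) ((\<lambda>(\<pi>, k). ((gnorm \<pi>, k), \<pi> = split_prime (gnorm \<pi>))) y) = y"
    using split_prime(6)[OF y(3,4,2) refl] by (auto simp: y(1))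
qed

lemma infsum_split_pairs:
  fixes H :: "nat \<Rightarrow> nat \<Rightarrow> 'b::banach"
  assumes "(\<lambda>(\<pi>, k). H (gnorm \<pi>) k) summable_on split_pairs"
  shows "(\<Sum>\<^sub>\<infinity>(\<pi>, k)\<in>split_pairs. H (gnorm \<pi>) k) = (\<Sum>\<^sub>\<infinity>(p, k)\<in>nat_pairs 1. H p k + H p k)"
proof -
  let ?f = "\<lambda>((p, k), b::bool). (if b then split_prime p else split_prime' p, k)"
  have e: "(\<lambda>(\<pi>, k). H (gnorm \<pi>) k) (?f x) = (\<lambda>((p, k), b). H p k) x" if "x \<in> nat_pairs 1 \<times> UNIV" for x
    using that split_prime(2,4) by (auto simp: nat_pairs_def)
  have "(\<lambda>x. (\<lambda>(\<pi>, k). H (gnorm \<pi>) k) (?f x)) summable_on nat_pairs 1 \<times> UNIV"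
    using assms by (subst summable_on_reindex_bij_betw[OF split_pairs_bij])
  then have sm: "(\<lambda>((p, k), b::bool). H p k) summable_on nat_pairs 1 \<times> UNIV"
    by (rule summable_on_cong[THEN iffD1, rotated]) (rule e)
  have "(\<Sum>\<^sub>\<infinity>(\<pi>, k)\<in>split_pairs. H (gnorm \<pi>) k) = (\<Sum>\<^sub>\<infinity>x\<in>nat_pairs 1 \<times> UNIV. (\<lambda>(\<pi>, k). H (gnorm \<pi>) k) (?f x))"
    by (rule infsum_reindex_bij_betw[OF split_pairs_bij, symmetric])
  also have "\<dots> = (\<Sum>\<^sub>\<infinity>((p, k), b::bool)\<in>nat_pairs 1 \<times> UNIV. H p k)" by (rule infsum_cong) (rule e)
  also have "\<dots> = (\<Sum>\<^sub>\<infinity>i\<in>nat_pairs 1. \<Sum>\<^sub>\<infinity>b\<in>(UNIV::bool set). (\<lambda>((p, k), b::bool). H p k) (i, b))"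
    by (rule infsum_Sigma_banach[OF sm, symmetric])
  also have "\<dots> = (\<Sum>\<^sub>\<infinity>(p, k)\<in>nat_pairs 1. H p k + H p k)"
    by (rule infsum_cong) (auto simp: UNIV_bool)
  finally show ?thesis .
qed

lemma inert_pairs_bij: "bij_betw (\<lambda>(q, k). (of_nat q, k)) (nat_pairs 3) inert_pairs"
proof -
  have "(of_nat q :: gint) = of_nat q' \<longleftrightarrow> q = q'" for q q' by (metis cpx_of_nat of_nat_eq_iff)
  then show ?thesis by (auto simp: bij_betw_def inj_on_def nat_pairs_def inert_pairs_def image_def)
qed

lemma ramified_pairs_bij: "bij_betw (\<lambda>k. (ramified_prime, k)) {0<..} ramified_pairs"
  by (auto simp: bij_betw_def inj_on_def ramified_pairs_def image_def)

lemma nat_prime_pairs_partition: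
  "prime_pairs = nat_pairs 1 \<union> nat_pairs 3 \<union> {2::nat} \<times> {0<..}"
  "nat_pairs 1 \<inter> nat_pairs 3 = {}" "(nat_pairs 1 \<union> nat_pairs 3) \<inter> {2::nat} \<times> {0<..} = {}"
proof -
  have "p mod 4 = 1 \<or> p mod 4 = 3 \<or> p = 2" if "prime p" for p :: nat
  proof -
    have "odd p \<or> p = 2" using that primes_dvd_imp_eq two_is_prime_nat by blast
    then show ?thesis by presburger
  qed
  then show "prime_pairs = nat_pairs 1 \<union> nat_pairs 3 \<union> {2::nat} \<times> {0<..}"
    by (auto simp: prime_pairs_def nat_pairs_def)
qed (auto simp: nat_pairs_def)

text \<open>The coefficient log p times 1 + chi4(p)^k records the splitting of p: it is 2 log p for
  p = 1 mod 4, one log p for each of the two primes above; log 2 for the single prime above 2; and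
  for p = 3 mod 4 it is 2 log p on even k and 0 on odd k.\<close>

lemma gauss_log_derivative_eq:
  assumes s: "1 < Re s"
  shows "dseries prime_pairs gauss.pair_coeff gauss.pair_len s =
    dseries prime_pairs pair_coeff_sum zeta.pair_len s"
proof -
  define H where "H = (\<lambda>n k. complex_of_real (ln (real n)) * exp (- s * of_real (real k * ln (real n))))"
  define h where "h = (\<lambda>i. of_real (pair_coeff_sum i) * exp (- s * of_real (zeta.pair_len i)))"
  have conv: "dseries_converges prime_pairs pair_coeff_sum zeta.pair_len"
    unfolding pair_coeff_sum_def[abs_def] by (intro dseries_add zeta.pair_converges beta.pair_converges)
  have gsum: "(\<lambda>(\<pi>, k). H (gnorm \<pi>) k) summable_on prime_pairs"
    using dseries_summable(2)[OF gauss.pair_converges s]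
    by (rule summable_on_cong[THEN iffD1, rotated]) (auto simp: H_def gauss.pair_coeff_def gauss.pair_len_def)
  have hsum: "h summable_on prime_pairs"
    unfolding h_def by (rule dseries_summable(2)[OF conv s])
  have subs: "A \<subseteq> prime_pairs \<Longrightarrow> (\<lambda>(\<pi>, k). H (gnorm \<pi>) k) summable_on A" for A
    using gsum by (rule summable_on_subset_banach)
  have subh: "A \<subseteq> prime_pairs \<Longrightarrow> h summable_on A" for A
    using hsum by (rule summable_on_subset_banach)
  have "dseries prime_pairs gauss.pair_coeff gauss.pair_len s = (\<Sum>\<^sub>\<infinity>(\<pi>, k)\<in>prime_pairs. H (gnorm \<pi>) k)"
    unfolding dseries_def by (rule infsum_cong) (auto simp: H_def gauss.pair_coeff_def gauss.pair_len_def)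
  also have "\<dots> = (\<Sum>\<^sub>\<infinity>(\<pi>, k)\<in>split_pairs. H (gnorm \<pi>) k) + (\<Sum>\<^sub>\<infinity>(\<pi>, k)\<in>inert_pairs. H (gnorm \<pi>) k) + (\<Sum>\<^sub>\<infinity>(\<pi>, k)\<in>ramified_pairs. H (gnorm \<pi>) k)"
    unfolding prime_pairs_partition(1)
    by (subst infsum_Un_disjoint, (rule subs, simp add: prime_pairs_partition(1) le_supI1)+, rule prime_pairs_partition(3),
        subst infsum_Un_disjoint, (rule subs, simp add: prime_pairs_partition(1) le_supI1)+, rule prime_pairs_partition(2), rule refl)
  also have "(\<Sum>\<^sub>\<infinity>(\<pi>, k)\<in>split_pairs. H (gnorm \<pi>) k) = infsum h (nat_pairs 1)"
  proof -
    have "(\<Sum>\<^sub>\<infinity>(\<pi>, k)\<in>split_pairs. H (gnorm \<pi>) k) = (\<Sum>\<^sub>\<infinity>(p, k)\<in>nat_pairs 1. H p k + H p k)"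
      by (rule infsum_split_pairs, rule subs) (simp add: prime_pairs_partition(1) le_supI1)
    also have "\<dots> = infsum h (nat_pairs 1)"
      by (rule infsum_cong)
        (auto simp: H_def h_def nat_pairs_def pair_coeff_sum_def zeta.pair_coeff_def beta.pair_coeff_def zeta.pair_len_def chi4_def algebra_simps)
    finally show ?thesis .
  qed
  also have "(\<Sum>\<^sub>\<infinity>(\<pi>, k)\<in>ramified_pairs. H (gnorm \<pi>) k) = infsum h ({2} \<times> {0<..})"
  proof -
    have b2: "bij_betw (\<lambda>k. (2::nat, k)) {0::nat<..} ({2} \<times> {0<..})" by (auto simp: bij_betw_def inj_on_def image_def)
    have "(\<Sum>\<^sub>\<infinity>(\<pi>, k)\<in>ramified_pairs. H (gnorm \<pi>) k) = (\<Sum>\<^sub>\<infinity>k\<in>{0<..}. H 2 k)"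
      by (subst infsum_reindex_bij_betw[OF ramified_pairs_bij, symmetric]) (simp add: ramified_prime)
    also have "\<dots> = (\<Sum>\<^sub>\<infinity>k\<in>{0<..}. h (2, k))"
      by (rule infsum_cong) (auto simp: H_def h_def pair_coeff_sum_def zeta.pair_coeff_def beta.pair_coeff_def zeta.pair_len_def chi4_def)
    also have "\<dots> = infsum h ({2} \<times> {0<..})" by (rule infsum_reindex_bij_betw[OF b2])
    finally show ?thesis .
  qed
  also have "(\<Sum>\<^sub>\<infinity>(\<pi>, k)\<in>inert_pairs. H (gnorm \<pi>) k) = infsum h (nat_pairs 3)"
  proof -
    \<comment> \<open>The k-th power of an inert prime of norm q^2 corresponds to the rational power
      q^(2k), with log(q^2) = 2 log q on both sides; odd powers of q carry coefficient 0.\<close>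
    have b3: "bij_betw (\<lambda>(q, k). (q, 2 * k)) (nat_pairs 3) {i \<in> nat_pairs 3. even (snd i)}"
      by (rule bij_betwI[where g="\<lambda>(q, k). (q, k div 2)"]) (auto simp: nat_pairs_def)
    have "(\<Sum>\<^sub>\<infinity>(\<pi>, k)\<in>inert_pairs. H (gnorm \<pi>) k) = (\<Sum>\<^sub>\<infinity>x\<in>nat_pairs 3. (\<lambda>(\<pi>, k). H (gnorm \<pi>) k) (case x of (q, k) \<Rightarrow> (of_nat q, k)))"
      by (rule infsum_reindex_bij_betw[OF inert_pairs_bij, symmetric])
    also have "\<dots> = (\<Sum>\<^sub>\<infinity>x\<in>nat_pairs 3. h (case x of (q, k) \<Rightarrow> (q, 2 * k)))"
    proof (rule infsum_cong)
      fix x assume "x \<in> nat_pairs 3"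
      then obtain q k where x: "x = (q, k)" "prime q" "q mod 4 = 3" by (auto simp: nat_pairs_def)
      have "ln (real (q\<^sup>2)) = 2 * ln (real q)" using prime_gt_0_nat[OF x(2)] by (simp add: ln_realpow)
      then show "(\<lambda>(\<pi>, k). H (gnorm \<pi>) k) (case x of (q, k) \<Rightarrow> (of_nat q, k)) = h (case x of (q, k) \<Rightarrow> (q, 2 * k))"
        using x by (simp add: H_def h_def pair_coeff_sum_def zeta.pair_coeff_def beta.pair_coeff_def zeta.pair_len_def chi4_def mult_ac)
    qed
    also have "\<dots> = infsum h {i \<in> nat_pairs 3. even (snd i)}" by (rule infsum_reindex_bij_betw[OF b3])
    also have "\<dots> = infsum h (nat_pairs 3)"
      by (rule infsum_cong_neutral)
        (auto simp: h_def nat_pairs_def pair_coeff_sum_def zeta.pair_coeff_def beta.pair_coeff_def chi4_def)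
    finally show ?thesis .
  qed
  also have "infsum h (nat_pairs 1) + infsum h (nat_pairs 3) + infsum h ({2} \<times> {0<..}) = infsum h prime_pairs"
    unfolding nat_prime_pairs_partition(1)
    by (subst infsum_Un_disjoint, (rule subh, simp add: nat_prime_pairs_partition(1) le_supI1)+, rule nat_prime_pairs_partition(3),
        subst infsum_Un_disjoint, (rule subh, simp add: nat_prime_pairs_partition(1) le_supI1)+, rule nat_prime_pairs_partition(2), rule refl)
  finally show ?thesis unfolding h_def dseries_def .
qed

text \<open>Both sides have the same logarithmic derivative, so their ratio is constant on Re s > 1.
  For the transfer of zeros only its being nonzero matters.\<close>

lemma gauss_dseries_eq:
  obtains \<kappa> where "\<kappa> \<noteq> 0"
    "\<And>s. 1 < Re s \<Longrightarrow> (s - 1) * dseries normals (\<lambda>_::gint. 1) (\<lambda>a. ln (real (gnorm a))) s = \<kappa> * dedekind_reg s"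
proof -
  let ?D = "dseries normals (\<lambda>_::gint. 1) (\<lambda>a. ln (real (gnorm a)))"
  define f where "f s = dseries normals (\<lambda>_. 1) (\<lambda>n. ln (real n)) s * dseries normals chi4 (\<lambda>n. ln (real n)) s" for s
  have fG: "dedekind_reg s = (s - 1) * f s" if "1 < Re s" for s
    using that by (simp add: dedekind_reg_def f_def zeta_D_eq beta_D_eq)
  have f0: "f s \<noteq> 0" if "1 < Re s" for s using dedekind_nonzero[OF that] fG[OF that] by auto
  have df: "(f has_field_derivative - dseries prime_pairs pair_coeff_sum zeta.pair_len s * f s) (at s)" if "1 < Re s" for s
    unfolding f_def pair_coeff_sum_def[abs_def] dseries_add(2)[OF zeta.pair_converges beta.pair_converges that]
    by (rule derivative_eq_intros zeta.log_derivative[OF that] beta.log_derivative[OF that] refl)+ (simp add: algebra_simps)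
  have dD: "(?D has_field_derivative - dseries prime_pairs pair_coeff_sum zeta.pair_len s * ?D s) (at s)" if "1 < Re s" for s
    using gauss.log_derivative[OF that] by (simp only: gauss_log_derivative_eq[OF that])
  have "\<exists>\<kappa>. \<forall>s\<in>{s. 1 < Re s}. ?D s / f s = \<kappa>"
  proof (rule has_field_derivative_zero_constant)
    show "convex {s. 1 < Re s}" by (rule convex_halfspace_Re_gt)
    fix s assume "s \<in> {s. 1 < Re s}"
    then have s: "1 < Re s" by simp
    have "((\<lambda>s. ?D s / f s) has_field_derivative 0) (at s)"
      using DERIV_divide[OF dD[OF s] df[OF s] f0[OF s]] by (simp add: mult_ac)
    then show "((\<lambda>s. ?D s / f s) has_field_derivative 0) (at s within {s. 1 < Re s})"
      by (rule DERIV_subset) simp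
  qed
  then obtain \<kappa> where k: "\<And>s. 1 < Re s \<Longrightarrow> ?D s / f s = \<kappa>" by auto
  \<comment> \<open>At s = 2 all terms are nonnegative and the term of 1 equals 1, so the series is
    at least 1 and \<kappa> is not 0.\<close>
  have h1: "((\<lambda>a. Re (of_real 1 * exp (- 2 * of_real (ln (real (gnorm a)))))) has_sum Re (?D 2)) normals"
    by (rule has_sum_Re[OF dseries_has_sum[OF gint_dseries_converges]]) simp
  have h2: "((\<lambda>a. Re (of_real 1 * exp (- 2 * of_real (ln (real (gnorm a)))))) has_sum (\<Sum>a\<in>{1}. Re (of_real 1 * exp (- 2 * of_real (ln (real (gnorm a))))))) {1}"
    by (rule has_sum_finite) simp
  have one: "(1::gint) \<in> normals" by (simp add: normals_def)
  have "(\<Sum>a\<in>{1}. Re (of_real 1 * exp (- 2 * of_real (ln (real (gnorm a)))))) \<le> Re (?D 2)"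
  proof (rule has_sum_mono_neutral[OF h2 h1])
    fix x :: gint
    show "0 \<le> Re (of_real 1 * exp (- 2 * of_real (ln (real (gnorm x)))))" by (simp add: Re_exp)
    show "x \<in> {1} - normals \<Longrightarrow> Re (of_real 1 * exp (- 2 * of_real (ln (real (gnorm x))))) \<le> 0" using one by blast
  qed (rule order_refl)
  then have "1 \<le> Re (?D 2)" by simp
  then have "?D 2 \<noteq> 0" by auto
  then have "\<kappa> \<noteq> 0" using k[of 2] f0[of 2] by auto
  moreover have "(s - 1) * ?D s = \<kappa> * dedekind_reg s" if "1 < Re s" for s
  proof -
    have "?D s = \<kappa> * f s" using k[OF that] f0[OF that] by (simp add: field_simps)
    then show ?thesis by (simp add: fG[OF that] mult.left_commute)
  qed
  ultimately show ?thesis by (rule that)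
qed

subsection \<open>Ideals\<close>

lemma gauss_ring_simps [simp]:
  "carrier gauss_ring = range cpx" "x \<otimes>\<^bsub>gauss_ring\<^esub> y = x * y" "x \<oplus>\<^bsub>gauss_ring\<^esub> y = x + y"
  "\<one>\<^bsub>gauss_ring\<^esub> = 1" "\<zero>\<^bsub>gauss_ring\<^esub> = 0"
proof -
  have "z \<in> range cpx" if "Re z \<in> \<int>" "Im z \<in> \<int>" for z
    using cpx_Abs[OF that] by (metis rangeI)
  then show "carrier gauss_ring = range cpx"
    by (auto simp: gauss_ring_def cpx_Ints)
qed (simp_all add: gauss_ring_def)

lemma gauss_cring: "cring gauss_ring"
proof (rule cringI)
  show "abelian_group gauss_ring"
  proof (rule abelian_groupI)
    show "\<exists>y\<in>carrier gauss_ring. y \<oplus>\<^bsub>gauss_ring\<^esub> x = \<zero>\<^bsub>gauss_ring\<^esub>" if x: "x \<in> carrier gauss_ring" for x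
    proof -
      obtain a where "x = cpx a" using x by auto
      then show ?thesis by (intro bexI[of _ "cpx (- a)"]) (simp, simp only: gauss_ring_simps rangeI)
    qed
  qed (auto simp: algebra_simps simp flip: cpx_simps)
  show "Group.comm_monoid gauss_ring"
    by (rule comm_monoidI) (auto simp: algebra_simps simp flip: cpx_simps)
qed (auto simp: algebra_simps)

definition pideal :: "gint \<Rightarrow> complex set" where
  "pideal a = cpx ` {b. a dvd b}"

lemma pideal_eq: "PIdl\<^bsub>gauss_ring\<^esub> (cpx a) = pideal a"
proof -
  have "cpx ` {b. a dvd b} = {x * cpx a |x. x \<in> range cpx}"
    by (auto simp: dvd_def image_def)
  then show ?thesis by (simp add: cgenideal_def pideal_def)
qed

lemma cpx_mem_pideal [simp]: "cpx b \<in> pideal a \<longleftrightarrow> a dvd b"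
  by (auto simp: pideal_def cpx_inject)

lemma pideal_eq_iff: "pideal a = pideal b \<longleftrightarrow> normalize a = normalize b"
proof
  assume "pideal a = pideal b"
  then have "a dvd b" "b dvd a" using cpx_mem_pideal[of a a] cpx_mem_pideal[of b b] by (metis cpx_mem_pideal dvd_refl)+
  then show "normalize a = normalize b" by (rule associatedI)
next
  assume "normalize a = normalize b"
  then have "a dvd b" "b dvd a" by (metis dvd_normalize_iff dvd_refl)+
  then have "a dvd c \<longleftrightarrow> b dvd c" for c by (blast intro: dvd_trans)
  then show "pideal a = pideal b" by (simp add: pideal_def)
qed

lemma pideal_normalize [simp]: "pideal (normalize a) = pideal a"
  by (simp add: pideal_eq_iff)

lemma ideal_pideal: "ideal (pideal a) gauss_ring"
  using cring.cgenideal_ideal[OF gauss_cring, of "cpx a"] by (simp add: pideal_eq)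

lemma ideal_is_pideal:
  assumes "ideal I gauss_ring" "I \<noteq> {0}"
  obtains a where "a \<in> normals" "I = pideal a"
proof -
  interpret I: ideal I gauss_ring by fact
  have sub: "I \<subseteq> range cpx" using I.a_subset by simp
  note add = ideal.axioms(1)[OF assms(1)]
  have z: "0 \<in> I" using additive_subgroup.zero_closed[OF add] by simp
  then obtain b where b: "cpx b \<in> I" "b \<noteq> 0" using assms(2) sub by (metis (no_types, lifting) cpx_eq_0 empty_iff insert_iff rangeE subsetD subsetI subset_antisym)
  then obtain a where a: "cpx a \<in> I" "a \<noteq> 0" "\<And>c. cpx c \<in> I \<Longrightarrow> c \<noteq> 0 \<Longrightarrow> euclidean_size a \<le> euclidean_size c"
    using ex_has_least_nat[of "\<lambda>a. cpx a \<in> I \<and> a \<noteq> 0" b euclidean_size] by blast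
  have "I = pideal a"
  proof
    show "I \<subseteq> pideal a"
    proof
      fix x assume "x \<in> I"
      then obtain c where c: "x = cpx c" "cpx c \<in> I" using sub by auto
      have "cpx (- (c div a)) \<otimes>\<^bsub>gauss_ring\<^esub> cpx a \<in> I"
        by (rule I.I_l_closed[OF a(1)]) (simp only: gauss_ring_simps rangeI)
      then have "cpx c \<oplus>\<^bsub>gauss_ring\<^esub> (cpx (- (c div a)) \<otimes>\<^bsub>gauss_ring\<^esub> cpx a) \<in> I"
        by (rule additive_subgroup.a_closed[OF add c(2)])
      moreover have "cpx c + cpx (- (c div a)) * cpx a = cpx (c mod a)"
        by (simp add: minus_div_mult_eq_mod[symmetric])
      ultimately have "cpx (c mod a) \<in> I" by simp
      moreover have "euclidean_size (c mod a) < euclidean_size a" using a(2) by (rule mod_size_less)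
      ultimately have "c mod a = 0" using a(3)[of "c mod a"] by force
      then have "a dvd c" by (simp add: mod_eq_0_iff_dvd)
      then show "x \<in> pideal a" by (simp add: c)
    qed
    show "pideal a \<subseteq> I"
    proof
      fix x assume "x \<in> pideal a"
      then obtain d where d: "x = cpx d" "a dvd d" by (auto simp: pideal_def)
      then obtain c where "d = a * c" by (auto simp: dvd_def)
      then have "x = cpx c * cpx a" using d by simp
      then show "x \<in> I" using I.I_l_closed[OF a(1), of "cpx c"] by simp
    qed
  qed
  then show ?thesis using that[of "normalize a"] a(2) by (simp add: normals_def)
qed

lemma gauss_ideals_eq: "gauss_ideals = pideal ` normals"
proof
  show "gauss_ideals \<subseteq> pideal ` normals"
    by (auto simp: gauss_ideals_def elim!: ideal_is_pideal)
  have "pideal a \<noteq> {0}" if "a \<in> normals" for a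
  proof
    assume "pideal a = {0}"
    then have "cpx a \<in> {0}" using cpx_mem_pideal[of a a] by (metis dvd_refl)
    then show False using that by (simp add: normals_def)
  qed
  then show "pideal ` normals \<subseteq> gauss_ideals" by (auto simp: gauss_ideals_def ideal_pideal)
qed

lemma inj_pideal: "inj_on pideal normals"
  by (rule inj_onI) (auto simp: pideal_eq_iff normals_def)

lemma Arg_first_quadrant:
  assumes "z \<noteq> 0"
  shows "0 \<le> Arg z \<and> Arg z < pi / 2 \<longleftrightarrow> 0 < Re z \<and> 0 \<le> Im z"
proof -
  have "0 \<le> A \<and> A < pi / 2 \<longleftrightarrow> \<bar>A\<bar> < pi / 2 \<and> (0 \<le> A \<and> A \<le> pi)" for A
    using pi_gt_zero by auto
  from this[of "Arg z"] show ?thesis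
    unfolding Arg_eq_Im_Ln[OF assms] Re_Ln_pos_lt[OF assms] Im_Ln_pos_le[OF assms] .
qed

lemma ideal_gen_pideal:
  assumes "a \<in> normals"
  shows "ideal_gen (pideal a) = cpx a"
  unfolding ideal_gen_def
proof (rule the_equality)
  have a: "a \<noteq> 0" "normalize a = a" using assms by (auto simp: normals_def)
  show "cpx a \<in> carrier gauss_ring \<and> pideal a = PIdl\<^bsub>gauss_ring\<^esub> (cpx a) \<and> 0 \<le> Arg (cpx a) \<and> Arg (cpx a) < pi / 2"
  proof -
    have "0 < Re (cpx a) \<and> 0 \<le> Im (cpx a)" using assms by (simp add: normals_gint)
    then have "0 \<le> Arg (cpx a) \<and> Arg (cpx a) < pi / 2" using Arg_first_quadrant[of "cpx a"] a(1) by (simp only: cpx_eq_0 simp_thms)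
    then show ?thesis by (simp add: pideal_eq)
  qed
  fix \<alpha> assume \<alpha>: "\<alpha> \<in> carrier gauss_ring \<and> pideal a = PIdl\<^bsub>gauss_ring\<^esub> \<alpha> \<and> 0 \<le> Arg \<alpha> \<and> Arg \<alpha> < pi / 2"
  then obtain b where b: "\<alpha> = cpx b" by auto
  then have eq: "pideal a = pideal b" using \<alpha> by (simp add: pideal_eq)
  then have n: "normalize b = a" using a by (simp add: pideal_eq_iff)
  then have "b \<noteq> 0" using a by auto
  then have "b \<in> normals" using \<alpha> b Arg_first_quadrant[of "cpx b"] by (simp add: normals_gint)
  then show "\<alpha> = cpx a" using n b by (simp add: normals_def)
qed

lemma ideal_norm_pideal: "a \<in> normals \<Longrightarrow> ideal_norm (pideal a) = real (gnorm a)"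
  by (simp add: ideal_norm_def ideal_gen_pideal real_gnorm complex_norm_square[symmetric] del: of_real_power)

lemma pideal_prod: "ideal_prod gauss_ring (pideal a) (pideal b) = pideal (a * b)"
proof
  show "ideal_prod gauss_ring (pideal a) (pideal b) \<subseteq> pideal (a * b)"
  proof
    fix x assume "x \<in> ideal_prod gauss_ring (pideal a) (pideal b)"
    then show "x \<in> pideal (a * b)"
    proof (induction rule: ideal_prod.induct)
      case (prod i j)
      then obtain c d where "i = cpx c" "a dvd c" "j = cpx d" "b dvd d" by (auto simp: pideal_def)
      then show ?case by (simp add: mult_dvd_mono flip: cpx_simps)
    next
      case (sum s1 s2)
      then obtain c d where "s1 = cpx c" "a * b dvd c" "s2 = cpx d" "a * b dvd d" by (auto simp: pideal_def)
      then show ?case by (simp flip: cpx_simps)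
    qed
  qed
  show "pideal (a * b) \<subseteq> ideal_prod gauss_ring (pideal a) (pideal b)"
  proof
    fix x assume "x \<in> pideal (a * b)"
    then obtain d where d: "x = cpx d" "a * b dvd d" by (auto simp: pideal_def)
    then obtain c where "d = a * b * c" by (auto simp: dvd_def)
    then have "x = cpx (a * c) * cpx b" using d by (simp add: mult_ac)
    moreover have "cpx (a * c) \<otimes>\<^bsub>gauss_ring\<^esub> cpx b \<in> ideal_prod gauss_ring (pideal a) (pideal b)"
      by (rule ideal_prod.prod) (simp_all only: cpx_mem_pideal dvd_triv_left dvd_refl)
    ultimately show "x \<in> ideal_prod gauss_ring (pideal a) (pideal b)" by simp
  qed
qed

lemma pideal_power: "pideal a [^]\<^bsub>ideals_set gauss_ring\<^esub> (k::nat) = pideal (a ^ k)"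
proof (induction k)
  case 0
  have "pideal 1 = range cpx" by (auto simp: pideal_def)
  then show ?case by (simp add: nat_pow_def ideals_set_def)
next
  case (Suc k)
  have "pideal a [^]\<^bsub>ideals_set gauss_ring\<^esub> Suc k = ideal_prod gauss_ring (pideal a [^]\<^bsub>ideals_set gauss_ring\<^esub> k) (pideal a)"
    by (simp add: nat_pow_def ideals_set_def)
  then show ?case by (simp add: Suc.IH pideal_prod mult.commute)
qed

lemma primeideal_pideal:
  assumes "a \<noteq> 0"
  shows "primeideal (pideal a) gauss_ring \<longleftrightarrow> prime_elem a"
proof
  assume "primeideal (pideal a) gauss_ring"
  then interpret primeideal "pideal a" gauss_ring .
  show "prime_elem a"
  proof (rule prime_elemI[OF assms])
    show "\<not> a dvd 1"
    proof
      assume "a dvd 1"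
      then have "pideal a = range cpx" by (auto simp: pideal_def intro: dvd_trans one_dvd)
      then show False using I_notcarr by simp
    qed
    show "a dvd b \<or> a dvd c" if "a dvd b * c" for b c
      using I_prime[of "cpx b" "cpx c"] that by (simp flip: cpx_simps)
  qed
next
  assume p: "prime_elem a"
  show "primeideal (pideal a) gauss_ring"
  proof (rule primeidealI[OF ideal_pideal gauss_cring])
    show "carrier gauss_ring \<noteq> pideal a"
    proof
      assume "carrier gauss_ring = pideal a"
      then have "cpx 1 \<in> pideal a" by (metis gauss_ring_simps(1) rangeI)
      then show False using p by (simp only: cpx_mem_pideal) (simp add: prime_elem_def)
    qed
    fix x y assume "x \<in> carrier gauss_ring" "y \<in> carrier gauss_ring" "x \<otimes>\<^bsub>gauss_ring\<^esub> y \<in> pideal a"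
    then show "x \<in> pideal a \<or> y \<in> pideal a"
      using p by (auto simp: prime_elem_dvd_mult_iff simp flip: cpx_simps)
  qed
qed

section \<open>The von Mangoldt function on ideals and the resulting form of
  \<open>psi\<close>\<close>

lemma is_power_of_prime_pideal:
  assumes "a \<in> normals"
  shows "is_power_of_prime (pideal a) P \<longleftrightarrow> (\<exists>\<pi> k. prime \<pi> \<and> 0 < k \<and> P = pideal \<pi> \<and> a = normalize (\<pi> ^ k))"
proof
  assume "is_power_of_prime (pideal a) P"
  then obtain r where r: "P \<in> gauss_ideals" "primeideal P gauss_ring" "1 \<le> r" "pideal a = P [^]\<^bsub>ideals_set gauss_ring\<^esub> (r::nat)"
    by (auto simp: is_power_of_prime_def)
  then obtain \<pi> where p: "\<pi> \<in> normals" "P = pideal \<pi>" by (auto simp: gauss_ideals_eq)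
  then have "\<pi> \<noteq> 0" "normalize \<pi> = \<pi>" by (auto simp: normals_def)
  then have pp: "prime \<pi>" using primeideal_pideal[of \<pi>] r p by (simp add: primeI)
  have "a = normalize (\<pi> ^ r)" using r(4) assms unfolding p(2) pideal_power pideal_eq_iff by (simp add: normals_def)
  then show "\<exists>\<pi> k. prime \<pi> \<and> 0 < k \<and> P = pideal \<pi> \<and> a = normalize (\<pi> ^ k)"
    using r(3) p(2) pp by (intro exI[of _ \<pi>] exI[of _ r]) auto
next
  assume "\<exists>\<pi> k. prime \<pi> \<and> 0 < k \<and> P = pideal \<pi> \<and> a = normalize (\<pi> ^ k)"
  then obtain \<pi> k where p: "prime \<pi>" "0 < k" "P = pideal \<pi>" "a = normalize (\<pi> ^ k)" by blast
  then have "primeideal P gauss_ring" using primeideal_pideal[of \<pi>] by (auto simp: prime_def)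
  moreover have "P \<in> gauss_ideals" using p prime_gint_normals[of \<pi>] by (auto simp: gauss_ideals_eq)
  moreover have "pideal a = P [^]\<^bsub>ideals_set gauss_ring\<^esub> k" using p by (simp add: pideal_power)
  ultimately show "is_power_of_prime (pideal a) P"
    unfolding is_power_of_prime_def using p(2) by (intro conjI exI[of _ k]) auto
qed

definition pair_elem :: "gint \<times> nat \<Rightarrow> gint" where
  "pair_elem = (\<lambda>(\<pi>, k). normalize (\<pi> ^ k))"

lemma pair_elem_normals: "i \<in> prime_pairs \<Longrightarrow> pair_elem i \<in> normals"
  by (auto simp: pair_elem_def prime_pairs_def normals_def)

lemma gnorm_power: "gnorm (a ^ k) = gnorm a ^ k"
  by (induction k) (auto simp: gnorm_mult)

lemma prime_power_unique:
  fixes \<pi> \<rho> :: gint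
  assumes "prime \<pi>" "prime \<rho>" "0 < k" "normalize (\<pi> ^ k) = normalize (\<rho> ^ j)"
  shows "\<pi> = \<rho>" "k = j"
proof -
  have "\<pi> dvd \<pi> ^ k" using assms(3) by (simp add: dvd_power)
  then have "\<pi> dvd \<rho> ^ j" using assms(4) by (metis dvd_normalize_iff)
  then have "\<pi> dvd \<rho>" using assms(1) prime_dvd_power by blast
  then show e: "\<pi> = \<rho>" using assms(1,2) by (simp add: primes_dvd_imp_eq)
  have "gnorm (\<pi> ^ k) = gnorm (\<rho> ^ j)" using assms(4) gnorm_normalize by metis
  then have "gnorm \<pi> ^ k = gnorm \<pi> ^ j" by (simp add: gnorm_power e)
  then show "k = j" using gnorm_prime_ge[OF assms(1)] by (simp add: power_inject_exp)
qed

lemma inj_pair_elem: "inj_on pair_elem prime_pairs"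
  by (rule inj_onI) (auto simp: pair_elem_def prime_pairs_def dest: prime_power_unique)

text \<open>A prime power determines its base, so the description in \<open>von_mangoldt\<close> has
  exactly one witness, the ideal of \<pi>.\<close>

lemma von_mangoldt_pair:
  assumes "(\<pi>, k) \<in> prime_pairs"
  shows "von_mangoldt (pideal (pair_elem (\<pi>, k))) = ln (real (gnorm \<pi>))"
proof -
  have p: "prime \<pi>" "0 < k" using assms by (auto simp: prime_pairs_def)
  let ?a = "pair_elem (\<pi>, k)"
  have a: "?a \<in> normals" using assms by (rule pair_elem_normals)
  have iff: "is_power_of_prime (pideal ?a) P \<longleftrightarrow> P = pideal \<pi>" for P
    unfolding is_power_of_prime_pideal[OF a] using p
    by (auto simp: pair_elem_def dest: prime_power_unique)
  then have the: "(THE P. is_power_of_prime (pideal ?a) P) = pideal \<pi>" by (intro the_equality) (simp_all only:)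
  have ex: "\<exists>P. is_power_of_prime (pideal ?a) P" by (simp only: iff) simp
  show ?thesis
    unfolding von_mangoldt_def the using ex prime_gint_normals[OF p(1)] by (simp add: ideal_norm_pideal)
qed

lemma von_mangoldt_not_pair:
  assumes "a \<in> normals" "a \<notin> pair_elem ` prime_pairs"
  shows "von_mangoldt (pideal a) = 0"
  using assms unfolding von_mangoldt_def is_power_of_prime_pideal[OF assms(1)]
  by (force simp: pair_elem_def prime_pairs_def)

text \<open>\<open>von_mangoldt\<close> vanishes off the prime powers, and distinct pairs generate
  distinct ideals, so the sum over ideals can be reindexed by pairs without repetition.\<close>

lemma psi_eq:
  "psi f \<Phi> K X \<theta> = (\<Sum>\<^sub>\<infinity>i\<in>prime_pairs. \<Phi> (real (gnorm (fst i) ^ snd i) / X) * ln (real (gnorm (fst i))) *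
     sector_weight f K (Arg (cpx (pair_elem i)) - \<theta>))"
proof -
  define h where "h I = \<Phi> (ideal_norm I / X) * von_mangoldt I * sector_weight f K (ideal_angle I - \<theta>)" for I
  have inj: "inj_on (pideal \<circ> pair_elem) prime_pairs"
    by (rule comp_inj_on[OF inj_pair_elem]) (rule inj_on_subset[OF inj_pideal], auto intro: pair_elem_normals)
  have sub: "(pideal \<circ> pair_elem) ` prime_pairs \<subseteq> gauss_ideals"
    using pair_elem_normals by (auto simp: gauss_ideals_eq)
  have "psi f \<Phi> K X \<theta> = infsum h gauss_ideals" by (simp add: psi_def h_def[abs_def])
  also have "\<dots> = infsum h ((pideal \<circ> pair_elem) ` prime_pairs)"
  proof (rule infsum_cong_neutral)
    fix I assume "I \<in> gauss_ideals - (pideal \<circ> pair_elem) ` prime_pairs"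
    then obtain a where "a \<in> normals" "I = pideal a" "a \<notin> pair_elem ` prime_pairs" by (auto simp: gauss_ideals_eq)
    then show "h I = 0" by (simp add: h_def von_mangoldt_not_pair)
  qed (use sub in auto)
  also have "\<dots> = infsum (h \<circ> (pideal \<circ> pair_elem)) prime_pairs" by (rule infsum_reindex[OF inj])
  also have "\<dots> = (\<Sum>\<^sub>\<infinity>i\<in>prime_pairs. \<Phi> (real (gnorm (fst i) ^ snd i) / X) * ln (real (gnorm (fst i))) *
     sector_weight f K (Arg (cpx (pair_elem i)) - \<theta>))"
  proof (rule infsum_cong)
    fix i :: "gint \<times> nat" assume i: "i \<in> prime_pairs"
    obtain \<pi> k where ik: "i = (\<pi>, k)" by (cases i)
    have "gnorm (pair_elem i) = gnorm \<pi> ^ k" by (simp add: ik pair_elem_def gnorm_power)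
    then show "(h \<circ> (pideal \<circ> pair_elem)) i = \<Phi> (real (gnorm (fst i) ^ snd i) / X) * ln (real (gnorm (fst i))) *
     sector_weight f K (Arg (cpx (pair_elem i)) - \<theta>)"
      using i pair_elem_normals[OF i] von_mangoldt_pair[of \<pi> k]
      by (simp add: h_def ik ideal_norm_pideal ideal_angle_def ideal_gen_pideal)
  qed
  finally show ?thesis .
qed

section \<open>From the hypothesis on Hecke L-functions to \<open>dedekind_reg\<close>\<close>

lemma hecke_series_0:
  assumes "1 < Re s"
  shows "hecke_series 0 s = dseries normals (\<lambda>_::gint. 1) (\<lambda>a. ln (real (gnorm a))) s"
proof -
  have "hecke_series 0 s = infsum (\<lambda>I. of_real (ideal_norm I) powr (- s)) (pideal ` normals)"
    by (simp add: hecke_series_def hecke_char_def gauss_ideals_eq)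
  also have "\<dots> = infsum ((\<lambda>I. of_real (ideal_norm I) powr (- s)) \<circ> pideal) normals"
    by (rule infsum_reindex[OF inj_pideal])
  also have "\<dots> = dseries normals (\<lambda>_::gint. 1) (\<lambda>a. ln (real (gnorm a))) s"
    unfolding dseries_def
  proof (rule infsum_cong)
    fix a :: gint assume a: "a \<in> normals"
    then have "a \<noteq> 0" by (simp add: normals_def)
    then have "0 < real (gnorm a)" using gnorm_pos[of a] by auto
    then show "((\<lambda>I. of_real (ideal_norm I) powr (- s)) \<circ> pideal) a = of_real 1 * exp (- s * of_real (ln (real (gnorm a))))"
      using a \<open>a \<noteq> 0\<close> by (simp add: ideal_norm_pideal powr_def Ln_of_real del: of_real_of_nat_eq)
  qed
  finally show ?thesis .
qed

text \<open>\<open>hecke_L\<close> is picked by a choice operator, so its properties are available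
  only once some continuation is exhibited; \<kappa> times \<open>dedekind_reg s / (s - 1)\<close>
  is one. The identity theorem on the punctured half plane, which is connected, then identifies the
  chosen function with it.\<close>

lemma GRH_dedekind:
  assumes GRH "1/2 < Re s" "Re s < 1"
  shows "dedekind_reg s \<noteq> 0"
proof -
  obtain \<kappa> where k: "\<kappa> \<noteq> 0"
    "\<And>s. 1 < Re s \<Longrightarrow> (s - 1) * dseries normals (\<lambda>_::gint. 1) (\<lambda>a. ln (real (gnorm a))) s = \<kappa> * dedekind_reg s"
    using gauss_dseries_eq by blast
  define S where "S = {s. 0 < Re s} - {1::complex}"
  define L0 where "L0 s = \<kappa> * dedekind_reg s / (s - 1)" for s
  have "L0 holomorphic_on S"
    unfolding L0_def S_def by (intro holomorphic_intros holomorphic_on_subset[OF dedekind_props(1)]) auto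
  moreover have "L0 s = hecke_series 0 s" if "1 < Re s" for s
  proof -
    have "s \<noteq> 1" using that by auto
    then show ?thesis unfolding L0_def k(2)[OF that, symmetric] by (simp add: hecke_series_0[OF that])
  qed
  ultimately have "\<exists>L. L holomorphic_on S \<and> (\<forall>s. 1 < Re s \<longrightarrow> L s = hecke_series 0 s)" by blast
  then have "hecke_L 0 holomorphic_on S \<and> (\<forall>s. 1 < Re s \<longrightarrow> hecke_L 0 s = hecke_series 0 s)"
    unfolding hecke_L_def S_def by (rule someI_ex)
  then have h: "hecke_L 0 holomorphic_on S" "\<And>s. 1 < Re s \<Longrightarrow> hecke_L 0 s = hecke_series 0 s" by auto
  have "hecke_L 0 s - L0 s = 0"
  proof (rule analytic_continuation_open[of "{s. 1 < Re s}" S "\<lambda>s. hecke_L 0 s - L0 s" "\<lambda>_. 0" s])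
    show "open {s. 1 < Re s}" by (rule open_halfspace_Re_gt)
    show "open S" unfolding S_def by (intro open_Diff open_half_plane) simp
    show "{s. 1 < Re s} \<noteq> {}" by (auto intro: exI[of _ 2])
    show "connected S"
      unfolding S_def by (rule connected_open_delete[OF open_half_plane]) (auto intro: convex_connected convex_halfspace_Re_gt)
    show "{s. 1 < Re s} \<subseteq> S" by (auto simp: S_def)
    show "(\<lambda>s. hecke_L 0 s - L0 s) holomorphic_on S" by (intro holomorphic_on_diff h \<open>L0 holomorphic_on S\<close>)
    show "s \<in> S" using assms(2,3) by (auto simp: S_def)
    show "hecke_L 0 z - L0 z = 0" if "z \<in> {s. 1 < Re s}" for z
      using that h(2) \<open>\<And>s. 1 < Re s \<Longrightarrow> L0 s = hecke_series 0 s\<close> by simp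
  qed auto
  moreover have "hecke_L 0 s \<noteq> 0" using assms unfolding GRH_def by force
  ultimately show ?thesis by (auto simp: L0_def)
qed

subsection \<open>The variance as a sum over equal angles\<close>

text \<open>For |x| <= pi / 2 and |k| >= 2 the distance from x to the k-th centre is at least pi /
  2, so after scaling the argument is at least K, beyond the support of \<open>f\<close>.\<close>

lemma sector_weight_finite:
  assumes f: "\<And>x. R \<le> \<bar>x\<bar> \<Longrightarrow> f x = 0" and K: "2 * R < K" "0 < R" and x: "\<bar>x\<bar> \<le> pi / 2"
  shows "sector_weight f K x = (\<Sum>k\<in>{-1,0,1}. f (K / (pi / 2) * (x - pi / 2 * of_int k)))"
proof -
  have "f (K / (pi / 2) * (x - pi / 2 * of_int k)) = 0" if k: "k \<notin> {-1,0,1}" for k :: int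
  proof (rule f)
    have "2 \<le> \<bar>k\<bar>" using k by auto
    then have "2 \<le> \<bar>real_of_int k\<bar>" by (metis of_int_abs of_int_le_iff of_int_numeral)
    then have "pi / 2 * 2 \<le> pi / 2 * \<bar>real_of_int k\<bar>" by (intro mult_left_mono) auto
    also have "\<dots> = \<bar>pi / 2 * of_int k\<bar>" by (simp add: abs_mult)
    also have "\<dots> \<le> \<bar>x - pi / 2 * of_int k\<bar> + \<bar>x\<bar>" by linarith
    finally have "pi / 2 \<le> \<bar>x - pi / 2 * of_int k\<bar>" using x by simp
    then have "K / (pi / 2) * (pi / 2) \<le> K / (pi / 2) * \<bar>x - pi / 2 * of_int k\<bar>"
      using K by (intro mult_left_mono) auto
    then show "R \<le> \<bar>K / (pi / 2) * (x - pi / 2 * of_int k)\<bar>" using K by (simp add: abs_mult)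
  qed
  then have "sector_weight f K x = (\<Sum>\<^sub>\<infinity>k\<in>{-1,0,1}. f (K / (pi / 2) * (x - pi / 2 * of_int k)))"
    unfolding sector_weight_def by (intro infsum_cong_neutral) auto
  then show ?thesis by simp
qed

text \<open>Each nonzero factor confines its point to a window of half-width pi R / (2 K) about its
  centre; the two half-widths add up.\<close>

lemma sector_weight_apart:
  assumes f: "\<And>x. R \<le> \<bar>x\<bar> \<Longrightarrow> f x = (0::real)" and K: "0 < K"
    and nz: "f (K / (pi / 2) * (x - pi / 2 * of_int k)) * f (K / (pi / 2) * (y - pi / 2 * of_int l)) \<noteq> 0"
  shows "\<bar>x - y - pi / 2 * of_int (k - l)\<bar> < pi * R / K"
proof -
  have lt: "\<bar>z\<bar> < pi * R / (2 * K)" if "f (K / (pi / 2) * z) \<noteq> 0" for z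
  proof -
    have "\<bar>K / (pi / 2) * z\<bar> < R" using f that by (meson not_le)
    then have "K / (pi / 2) * \<bar>z\<bar> < R" using K by (simp add: abs_mult)
    then show ?thesis using K by (simp add: field_simps)
  qed
  have "\<bar>x - pi / 2 * of_int k\<bar> < pi * R / (2 * K)" "\<bar>y - pi / 2 * of_int l\<bar> < pi * R / (2 * K)"
    using lt nz by auto
  note bounds = this
  have "x - y - pi / 2 * of_int (k - l) = (x - pi / 2 * of_int k) - (y - pi / 2 * of_int l)"
    by (simp only: of_int_diff right_diff_distrib)
  then have "\<bar>x - y - pi / 2 * of_int (k - l)\<bar> \<le> \<bar>x - pi / 2 * of_int k\<bar> + \<bar>y - pi / 2 * of_int l\<bar>"
    by (simp only: abs_triangle_ineq4)
  also have "\<dots> < pi * R / (2 * K) + pi * R / (2 * K)" by (rule add_strict_mono[OF bounds])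
  also have "\<dots> = pi * R / K" by simp
  finally show ?thesis .
qed

text \<open>The centres are pi / 2 apart while each translate is supported within a width of pi R /
  K < pi / 2, so products of different translates vanish and squaring acts termwise.\<close>

lemma sector_weight_square:
  assumes f: "\<And>x. R \<le> \<bar>x\<bar> \<Longrightarrow> f x = 0" and K: "2 * R < K" "0 < R" and x: "\<bar>x\<bar> \<le> pi / 2"
  shows "(sector_weight f K x)\<^sup>2 = sector_weight (\<lambda>x. (f x)\<^sup>2) K x"
proof -
  define g where "g k = f (K / (pi / 2) * (x - pi / 2 * of_int k))" for k :: int
  have "g k * g l = 0" if "k \<noteq> l" for k l
  proof (rule ccontr)
    assume "g k * g l \<noteq> 0"
    then have "\<bar>x - x - pi / 2 * of_int (k - l)\<bar> < pi * R / K"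
      unfolding g_def using K by (intro sector_weight_apart[OF f]) auto
    then have "\<bar>pi / 2 * of_int (k - l)\<bar> < pi * R / K" by (simp only: diff_self diff_0 abs_minus_cancel)
    moreover have "\<bar>pi / 2 * of_int (k - l)\<bar> = pi / 2 * \<bar>real_of_int (k - l)\<bar>" by (simp only: abs_mult) simp
    moreover have "1 \<le> \<bar>k - l\<bar>" using that by auto
    then have "1 \<le> \<bar>real_of_int (k - l)\<bar>" by (metis of_int_1 of_int_abs of_int_le_iff)
    then have "pi / 2 * 1 \<le> pi / 2 * \<bar>real_of_int (k - l)\<bar>" by (intro mult_left_mono) auto
    moreover have "pi * R / K < pi / 2" using K by (simp add: field_simps)
    ultimately show False by linarith
  qed
  then have z: "g (-1) * g 0 = 0" "g (-1) * g 1 = 0" "g 0 * g 1 = 0" by auto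
  have sq: "(a + (b + c))\<^sup>2 = a\<^sup>2 + (b\<^sup>2 + c\<^sup>2) + 2 * (a * b) + 2 * (a * c) + 2 * (b * c)" for a b c :: real
    by (simp add: power2_eq_square algebra_simps)
  have "(g (-1) + (g 0 + g 1))\<^sup>2 = (g (-1))\<^sup>2 + ((g 0)\<^sup>2 + (g 1)\<^sup>2)"
    by (simp only: sq z mult_zero_right add_0_right)
  moreover have "sector_weight f K x = (\<Sum>k\<in>{-1,0,1}. g k)"
    unfolding g_def by (rule sector_weight_finite[OF f K x])
  moreover have "sector_weight (\<lambda>x. (f x)\<^sup>2) K x = (\<Sum>k\<in>{-1,0,1}. (g k)\<^sup>2)"
    unfolding g_def by (rule sector_weight_finite[OF _ K x]) (simp add: f)
  ultimately show ?thesis by simp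
qed

lemma abs_angle_diff_le:
  assumes "0 \<le> \<alpha>" "\<alpha> < pi / 2" "\<theta> \<in> {0..pi / 2}"
  shows "\<bar>\<alpha> - \<theta>\<bar> \<le> pi / 2"
  using assms unfolding abs_le_iff atLeastAtMost_iff by linarith

lemma sector_weight_continuous:
  assumes f: "\<And>x. R \<le> \<bar>x\<bar> \<Longrightarrow> f x = 0" "continuous_on UNIV f" and K: "2 * R < K" "0 < R" and \<alpha>: "0 \<le> \<alpha>" "\<alpha> < pi / 2"
  shows "continuous_on {0..pi / 2} (\<lambda>\<theta>. sector_weight f K (\<alpha> - \<theta>))"
proof -
  have "continuous_on {0..pi / 2} (\<lambda>\<theta>. \<Sum>k\<in>{-1,0,1}. f (K / (pi / 2) * ((\<alpha> - \<theta>) - pi / 2 * of_int k)))"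
    by (intro continuous_intros continuous_on_compose2[OF f(2)]) auto
  then show ?thesis
    by (rule continuous_on_eq) (rule sector_weight_finite[OF f(1) K abs_angle_diff_le[OF \<alpha>], symmetric])
qed

text \<open>Unfolding of a periodic sum: over one period the translates together cover the support
  of \<open>f\<close> once. The proof evaluates a primitive \<open>G\<close> on three neighbouring
  translates.\<close>

lemma sector_weight_integral:
  assumes f: "\<And>x. R \<le> \<bar>x\<bar> \<Longrightarrow> f x = 0" "continuous_on UNIV f" and K: "2 * R < K" "0 < R" and \<alpha>: "0 \<le> \<alpha>" "\<alpha> < pi / 2"
  shows "(LINT \<theta>:{0..pi / 2}|lborel. sector_weight f K (\<alpha> - \<theta>)) = (pi / 2) / K * (LINT y|lborel. f y)"
proof -
  define \<kappa> where "\<kappa> = K / (pi / 2)"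
  have \<kappa>: "0 < \<kappa>" "\<kappa> * (pi / 2) = K" using K by (auto simp: \<kappa>_def)
  \<comment> \<open>Large enough for the support of \<open>f\<close> and for all arguments met
    below, which are at most 2 K in absolute value.\<close>
  define M where "M = 4 * K"
  define G where "G x = integral {-M..x} f" for x
  have cf: "continuous_on A f" for A using continuous_on_subset[OF f(2)] by auto
  have dG: "(G has_vector_derivative f x) (at x)" if "\<bar>x\<bar> < M" for x
  proof -
    have "(G has_vector_derivative f x) (at x within {-M..M})"
      unfolding G_def using that by (intro integral_has_vector_derivative cf) auto
    then show ?thesis using that by (subst (asm) at_within_Icc_at) auto
  qed
  have intf: "integral {a..b} f = 0" if "b \<le> - R \<or> R \<le> a" for a b
  proof -
    have "integral {a..b} f = integral {a..b} (\<lambda>_. 0)"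
      by (rule Henstock_Kurzweil_Integration.integral_cong) (use that K f(1) in auto)
    then show ?thesis by simp
  qed
  have fM: "f y = 0" if "y \<notin> {-M..M}" for y
  proof (rule f(1))
    have "M < \<bar>y\<bar>" using that by (auto simp: abs_if)
    then show "R \<le> \<bar>y\<bar>" using K by (simp add: M_def)
  qed
  have Ghi: "G x = (LINT y|lborel. f y)" if "R \<le> x" "x \<le> M" for x
  proof -
    have "G x + integral {x..M} f = integral {-M..M} f"
      unfolding G_def using that K by (intro Henstock_Kurzweil_Integration.integral_combine integrable_continuous_real cf) (auto simp: M_def)
    then have "G x = integral {-M..M} f" using intf[of M x] that by simp
    also have "\<dots> = (LINT y:{-M..M}|lborel. f y)"
      by (intro set_borel_integral_eq_integral(2)[symmetric] borel_integrable_atLeastAtMost' cf)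
    also have "\<dots> = (LINT y|lborel. f y)"
      unfolding set_lebesgue_integral_def
      by (intro Bochner_Integration.integral_cong refl) (use fM in \<open>auto simp: indicator_def\<close>)
    finally show ?thesis .
  qed
  have Glo: "G x = 0" if "x \<le> - R" for x using intf[of x "-M"] that by (simp add: G_def)
  let ?g = "\<lambda>\<theta>. \<Sum>k\<in>{-1,0,1}. f (\<kappa> * ((\<alpha> - \<theta>) - pi / 2 * of_int k))"
  let ?H = "\<lambda>\<theta>. \<Sum>k\<in>{-1,0,1::int}. (- 1 / \<kappa>) * G (\<kappa> * ((\<alpha> - \<theta>) - pi / 2 * of_int k))"
  have "(?g has_integral ?H (pi / 2) - ?H 0) {0..pi / 2}"
  proof (rule fundamental_theorem_of_calculus)
    fix \<theta> assume \<theta>: "\<theta> \<in> {0..pi / 2}"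
    have dk: "((\<lambda>\<theta>. (- 1 / \<kappa>) * G (\<kappa> * ((\<alpha> - \<theta>) - pi / 2 * of_int k))) has_vector_derivative f (\<kappa> * ((\<alpha> - \<theta>) - pi / 2 * of_int k))) (at \<theta>)"
      if k: "k \<in> {-1,0,1}" for k :: int
    proof -
      have "\<bar>(\<alpha> - \<theta>) - pi / 2 * of_int k\<bar> \<le> pi / 2 * 2" using k \<theta> \<alpha> by auto
      then have "\<bar>\<kappa> * ((\<alpha> - \<theta>) - pi / 2 * of_int k)\<bar> \<le> \<kappa> * (pi / 2 * 2)" using \<kappa>(1) by (simp add: abs_mult)
      also have "\<dots> < M" using \<kappa>(2) K by (simp add: M_def)
      finally have d: "(G has_real_derivative f (\<kappa> * ((\<alpha> - \<theta>) - pi / 2 * of_int k))) (at (\<kappa> * ((\<alpha> - \<theta>) - pi / 2 * of_int k)))"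
        using dG by (simp add: has_real_derivative_iff_has_vector_derivative)
      have "((\<lambda>\<theta>. \<kappa> * ((\<alpha> - \<theta>) - pi / 2 * of_int k)) has_real_derivative - \<kappa>) (at \<theta>)"
        by (auto intro!: derivative_eq_intros)
      from DERIV_cmult[OF DERIV_chain2[OF d this], of "- 1 / \<kappa>"]
      show ?thesis using \<kappa>(1) by (simp add: has_real_derivative_iff_has_vector_derivative)
    qed
    show "(?H has_vector_derivative ?g \<theta>) (at \<theta> within {0..pi / 2})"
      by (rule has_vector_derivative_at_within, rule has_vector_derivative_sum, rule dk)
  qed simp
  moreover have "?H (pi / 2) - ?H 0 = (1 / \<kappa>) * (LINT y|lborel. f y)"
  proof -
    \<comment> \<open>Translate k at the right end of the period is translate k + 1 at its left end,
      so all but two values of \<open>G\<close> cancel.\<close>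
    have e: "\<kappa> * (\<alpha> - pi / 2 - pi / 2 * of_int k) = \<kappa> * (\<alpha> - pi / 2 * of_int (k + 1))" for k :: int
      by (simp add: algebra_simps)
    have "?H (pi / 2) - ?H 0 = (1 / \<kappa>) * (G (\<kappa> * (\<alpha> + pi / 2)) - G (\<kappa> * (\<alpha> - pi)))"
      unfolding e by (simp add: algebra_simps diff_divide_distrib)
    also have "G (\<kappa> * (\<alpha> - pi)) = 0"
    proof (rule Glo)
      have "\<kappa> * (\<alpha> - pi) \<le> \<kappa> * (- (pi / 2))" using \<kappa>(1) \<alpha> by (intro mult_left_mono) auto
      then show "\<kappa> * (\<alpha> - pi) \<le> - R" using \<kappa>(2) K by simp
    qed
    also have "G (\<kappa> * (\<alpha> + pi / 2)) = (LINT y|lborel. f y)"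
    proof (rule Ghi)
      have "\<kappa> * (pi / 2) \<le> \<kappa> * (\<alpha> + pi / 2)" using \<kappa>(1) \<alpha> by (intro mult_left_mono) auto
      then show "R \<le> \<kappa> * (\<alpha> + pi / 2)" using \<kappa>(2) K by simp
      have "\<kappa> * (\<alpha> + pi / 2) \<le> \<kappa> * (pi / 2 * 2)" using \<kappa>(1) \<alpha> by (intro mult_left_mono) auto
      then show "\<kappa> * (\<alpha> + pi / 2) \<le> M" using \<kappa>(2) K by (simp add: M_def)
    qed
    finally show ?thesis by simp
  qed
  ultimately have gi: "integral {0..pi / 2} ?g = (1 / \<kappa>) * (LINT y|lborel. f y)" by (simp add: integral_unique)
  have "(LINT \<theta>:{0..pi / 2}|lborel. sector_weight f K (\<alpha> - \<theta>)) = integral {0..pi / 2} (\<lambda>\<theta>. sector_weight f K (\<alpha> - \<theta>))"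
    by (intro set_borel_integral_eq_integral(2) borel_integrable_atLeastAtMost' sector_weight_continuous[OF f K \<alpha>])
  also have "\<dots> = integral {0..pi / 2} ?g"
    unfolding \<kappa>_def
    by (rule Henstock_Kurzweil_Integration.integral_cong) (rule sector_weight_finite[OF f(1) K abs_angle_diff_le[OF \<alpha>]])
  finally show ?thesis unfolding gi by (simp add: \<kappa>_def)
qed

section \<open>Separation of the angles of Gaussian integers\<close>

lemma normals_Arg: "a \<in> normals \<Longrightarrow> 0 \<le> Arg (cpx a)" "a \<in> normals \<Longrightarrow> Arg (cpx a) < pi / 2"
proof -
  assume a: "a \<in> normals"
  then have "cpx a \<noteq> 0" "0 < Re (cpx a) \<and> 0 \<le> Im (cpx a)" by (auto simp: normals_def normals_gint[symmetric])
  then show "0 \<le> Arg (cpx a)" "Arg (cpx a) < pi / 2" using Arg_first_quadrant by blast+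
qed

text \<open>The product of a with the conjugate of b is a Gaussian integer of modulus r <= B whose
  argument is the difference of the angles. Up to rotation by units, r sin w is one of its
  coordinates, hence an integer, and it is below 1 in absolute value, so it vanishes. The multiple
  \<open>m\<close> accounts for the periodicity of the sector weight.\<close>

lemma gint_angle_gap:
  assumes a: "a \<in> normals" "b \<in> normals" "real (gnorm a) \<le> B" "real (gnorm b) \<le> B"
    and lt: "\<bar>Arg (cpx a) - Arg (cpx b) - pi / 2 * of_int m\<bar> < 1 / B" and m: "m \<in> {-2,-1,0,1,2::int}"
  shows "Arg (cpx a) = Arg (cpx b)"
proof -
  define x where "x = Arg (cpx a) - Arg (cpx b)"
  define r where "r = cmod (cpx a) * cmod (cpx b)"
  have nz: "a \<noteq> 0" "b \<noteq> 0" using a by (auto simp: normals_def)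
  have r: "0 < r" unfolding r_def using nz by (intro mult_pos_pos) auto
  have B: "0 < B" using a(3) gnorm_pos[OF nz(1)] by linarith
  have rB: "r \<le> B"
  proof -
    have "r\<^sup>2 = real (gnorm a) * real (gnorm b)" by (simp add: r_def power_mult_distrib real_gnorm)
    also have "\<dots> \<le> B * B" using a B by (intro mult_mono) auto
    finally have "r\<^sup>2 \<le> B\<^sup>2" by (simp only: power2_eq_square)
    then show ?thesis by (rule power2_le_imp_le) (use B in simp)
  qed
  have z: "cpx (a * gcnj b) = rcis r x"
  proof -
    have "cpx a * cnj (cpx b) = rcis (cmod (cpx a)) (Arg (cpx a)) * cnj (rcis (cmod (cpx b)) (Arg (cpx b)))"
      by (simp only: rcis_cmod_Arg)
    also have "\<dots> = rcis r x" by (simp add: rcis_def cis_cnj cis_mult r_def x_def mult_ac)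
    finally show ?thesis by simp
  qed
  have int: "r * cos x \<in> \<int>" "r * sin x \<in> \<int>" using cpx_Ints[of "a * gcnj b"] unfolding z by (simp_all add: Re_rcis Im_rcis)
  define w where "w = x - pi / 2 * of_int m"
  \<comment> \<open>Subtracting a multiple of pi / 2 permutes sine and cosine up to sign, so
    integrality survives.\<close>
  have "sin w \<in> {sin x, - sin x, cos x, - cos x}"
    using m by (auto simp: w_def sin_diff sin_add cos_add algebra_simps)
  then have "r * sin w \<in> \<int>" using int by auto
  moreover have "\<bar>r * sin w\<bar> < 1"
  proof -
    have "\<bar>sin w\<bar> \<le> \<bar>w\<bar>" by (rule abs_sin_x_le_abs_x)
    then have "\<bar>sin w\<bar> < 1 / B" using lt by (simp add: w_def x_def)
    then have "r * \<bar>sin w\<bar> < r * (1 / B)" using r by (rule mult_strict_left_mono)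
    also have "\<dots> \<le> 1" using rB B by simp
    finally show ?thesis using r by (simp add: abs_mult)
  qed
  ultimately have "r * sin w = 0" by (metis Ints_nonzero_abs_less1)
  then have "sin w = 0" using r by simp
  then obtain n :: int where n: "w = of_int n * pi" using sin_zero_iff_int2 by blast
  have x2: "\<bar>x\<bar> < pi / 2"
    unfolding x_def abs_less_iff using normals_Arg[OF a(1)] normals_Arg[OF a(2)] by linarith
  \<comment> \<open>The difference is a multiple of pi / 2, but both angles lie in the half-open
    first quadrant, so it is smaller than pi / 2 in absolute value and must be 0.\<close>
  have "x = pi / 2 * of_int (2 * n + m)" using n by (simp add: w_def algebra_simps)
  then have "\<bar>x\<bar> = pi / 2 * \<bar>real_of_int (2 * n + m)\<bar>" by (simp only: abs_mult) simp
  then have "pi / 2 * \<bar>real_of_int (2 * n + m)\<bar> < pi / 2 * 1" using x2 by (simp only: mult_1_right)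
  then have "\<bar>real_of_int (2 * n + m)\<bar> < 1" by (rule mult_left_less_imp_less) simp
  then have "2 * n + m = 0" by linarith
  then have "x = 0" using \<open>x = pi / 2 * of_int (2 * n + m)\<close> by simp
  then show ?thesis by (simp add: x_def)
qed

lemma sector_weight_orthogonal:
  assumes f: "\<And>x. R \<le> \<bar>x\<bar> \<Longrightarrow> f x = 0" and K: "2 * R < K" "0 < R" "pi * R / K \<le> 1 / B"
    and a: "a \<in> normals" "b \<in> normals" "real (gnorm a) \<le> B" "real (gnorm b) \<le> B" "Arg (cpx a) \<noteq> Arg (cpx b)"
    and \<theta>: "\<theta> \<in> {0..pi / 2}"
  shows "sector_weight f K (Arg (cpx a) - \<theta>) * sector_weight f K (Arg (cpx b) - \<theta>) = 0"
proof -
  have x: "\<bar>Arg (cpx a) - \<theta>\<bar> \<le> pi / 2" "\<bar>Arg (cpx b) - \<theta>\<bar> \<le> pi / 2"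
    by (rule abs_angle_diff_le[OF normals_Arg[OF a(1)] \<theta>], rule abs_angle_diff_le[OF normals_Arg[OF a(2)] \<theta>])
  have z: "f (K / (pi / 2) * ((Arg (cpx a) - \<theta>) - pi / 2 * of_int k)) * f (K / (pi / 2) * ((Arg (cpx b) - \<theta>) - pi / 2 * of_int l)) = 0"
    if "k \<in> {-1,0,1}" "l \<in> {-1,0,1}" for k l :: int
  proof (rule ccontr)
    assume "\<not> ?thesis"
    then have "\<bar>(Arg (cpx a) - \<theta>) - (Arg (cpx b) - \<theta>) - pi / 2 * of_int (k - l)\<bar> < pi * R / K"
      using K by (intro sector_weight_apart[OF f]) auto
    then have "\<bar>Arg (cpx a) - Arg (cpx b) - pi / 2 * of_int (k - l)\<bar> < 1 / B" using K(3) by simp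
    then have "Arg (cpx a) = Arg (cpx b)" by (rule gint_angle_gap[OF a(1-4)]) (use that in auto)
    then show False using a(5) by simp
  qed
  have e: "sector_weight f K (Arg (cpx a) - \<theta>) = (\<Sum>k\<in>{-1,0,1}. f (K / (pi / 2) * ((Arg (cpx a) - \<theta>) - pi / 2 * of_int k)))"
    "sector_weight f K (Arg (cpx b) - \<theta>) = (\<Sum>k\<in>{-1,0,1}. f (K / (pi / 2) * ((Arg (cpx b) - \<theta>) - pi / 2 * of_int k)))"
    by (rule sector_weight_finite[OF f K(1,2)], assumption, rule x)+
  show ?thesis unfolding e sum_product by (intro sum.neutral ballI) (rule z)
qed

lemma finite_gint_norm_le: "finite {a \<in> normals. real (gnorm a) \<le> B}"
  and card_gint_norm_le: "1 \<le> B \<Longrightarrow> real (card {a \<in> normals. real (gnorm a) \<le> B}) \<le> 2 * B"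
proof -
  define n where "n = nat \<lfloor>sqrt B\<rfloor>"
  define h where "h a = (\<lfloor>Re (cpx a)\<rfloor>, \<lfloor>Im (cpx a)\<rfloor>)" for a
  have inj: "inj_on h {a \<in> normals. real (gnorm a) \<le> B}"
  proof (rule inj_onI)
    fix a b assume "h a = h b"
    moreover have "real_of_int \<lfloor>Re (cpx a)\<rfloor> = Re (cpx a)" "real_of_int \<lfloor>Im (cpx a)\<rfloor> = Im (cpx a)" for a
      using cpx_Ints[of a] by (auto elim!: Ints_cases)
    ultimately have "Re (cpx a) = Re (cpx b)" "Im (cpx a) = Im (cpx b)" unfolding h_def by (metis prod.inject)+
    then show "a = b" by (intro gint_eqI) (simp add: complex_eq_iff)
  qed
  have sub: "h ` {a \<in> normals. real (gnorm a) \<le> B} \<subseteq> {1..int n} \<times> {0..int n}"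
  proof (rule image_subsetI)
    fix a assume "a \<in> {a \<in> normals. real (gnorm a) \<le> B}"
    then have a: "a \<in> normals" "real (gnorm a) \<le> B" by auto
    obtain x y :: int where xy: "Re (cpx a) = of_int x" "Im (cpx a) = of_int y" using cpx_Ints[of a] by (auto elim!: Ints_cases)
    have p: "0 < x" "0 \<le> y" using a(1) xy by (auto simp: normals_gint)
    have s: "(real_of_int x)\<^sup>2 + (real_of_int y)\<^sup>2 \<le> B" using a(2) real_gnorm[of a] by (simp add: cmod_power2 xy)
    have le: "z \<le> int n" if "0 \<le> z" "(real_of_int z)\<^sup>2 \<le> B" for z
    proof -
      have "real_of_int z \<le> sqrt B" using that(2) by (rule real_le_rsqrt)
      then have "z \<le> \<lfloor>sqrt B\<rfloor>" by (simp add: le_floor_iff)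
      moreover have "0 \<le> B" using that(2) zero_le_power2 order_trans by blast
      ultimately show ?thesis using that(1) by (simp add: n_def)
    qed
    have "(real_of_int x)\<^sup>2 \<le> B" "(real_of_int y)\<^sup>2 \<le> B"
      using s zero_le_power2[of "real_of_int x"] zero_le_power2[of "real_of_int y"] by linarith+
    then show "h a \<in> {1..int n} \<times> {0..int n}" using p le by (simp add: h_def xy)
  qed
  show "finite {a \<in> normals. real (gnorm a) \<le> B}"
    using finite_subset[OF sub] inj finite_imageD by blast
  assume B: "1 \<le> B"
  have n1: "1 \<le> n" using B by (simp add: n_def le_nat_iff le_floor_iff)
  have "real n \<le> sqrt B" using B by (simp add: n_def)
  then have "real n * real n \<le> sqrt B * sqrt B" using B by (intro mult_mono) auto
  then have n2: "real n * real n \<le> B" using B by simp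
  have "card {a \<in> normals. real (gnorm a) \<le> B} \<le> card ({1..int n} \<times> {0..int n})"
    by (rule card_inj_on_le[OF inj sub]) auto
  also have "\<dots> = n * (n + 1)" by (simp add: card_cartesian_product nat_add_distrib)
  also have "\<dots> \<le> 2 * (n * n)" using n1 by (simp add: algebra_simps)
  finally have "real (card {a \<in> normals. real (gnorm a) \<le> B}) \<le> real (2 * (n * n))" by (simp only: of_nat_le_iff)
  also have "\<dots> \<le> 2 * B" using n2 by simp
  finally show "real (card {a \<in> normals. real (gnorm a) \<le> B}) \<le> 2 * B" .
qed

section \<open>The second moment of the finite sum\<close>

definition pairs_upto :: "real \<Rightarrow> (gint \<times> nat) set" where
  "pairs_upto B = {i \<in> prime_pairs. real (gnorm (fst i) ^ snd i) \<le> B}"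

definition pair_angle :: "gint \<times> nat \<Rightarrow> real" where
  "pair_angle i = Arg (cpx (pair_elem i))"

definition pair_weight :: "(real \<Rightarrow> real) \<Rightarrow> real \<Rightarrow> gint \<times> nat \<Rightarrow> real" where
  "pair_weight \<Phi> X i = \<Phi> (real (gnorm (fst i) ^ snd i) / X) * ln (real (gnorm (fst i)))"

lemma gnorm_pair_elem: "gnorm (pair_elem i) = gnorm (fst i) ^ snd i"
  by (cases i) (simp add: pair_elem_def gnorm_power)

lemma pairs_upto_image: "pair_elem ` pairs_upto B \<subseteq> {a \<in> normals. real (gnorm a) \<le> B}"
  by (auto simp: pairs_upto_def pair_elem_normals gnorm_pair_elem)

lemma inj_pairs_upto: "inj_on pair_elem (pairs_upto B)"
  by (rule inj_on_subset[OF inj_pair_elem]) (auto simp: pairs_upto_def)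

lemma finite_pairs_upto: "finite (pairs_upto B)"
  using finite_subset[OF pairs_upto_image finite_gint_norm_le] inj_pairs_upto finite_imageD by blast

lemma card_pairs_upto: "1 \<le> B \<Longrightarrow> real (card (pairs_upto B)) \<le> 2 * B"
  using card_inj_on_le[OF inj_pairs_upto pairs_upto_image finite_gint_norm_le, of B] card_gint_norm_le[of B] by linarith

lemma psi_finite:
  assumes \<Phi>: "\<And>x. b \<le> x \<Longrightarrow> \<Phi> x = 0" and X: "0 < X"
  shows "psi f \<Phi> K X \<theta> = (\<Sum>i\<in>pairs_upto (b * X). pair_weight \<Phi> X i * sector_weight f K (pair_angle i - \<theta>))"
proof -
  have "psi f \<Phi> K X \<theta> = (\<Sum>\<^sub>\<infinity>i\<in>pairs_upto (b * X). pair_weight \<Phi> X i * sector_weight f K (pair_angle i - \<theta>))"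
    unfolding psi_eq
  proof (rule infsum_cong_neutral)
    fix i assume "i \<in> prime_pairs - pairs_upto (b * X)"
    then have "b * X \<le> real (gnorm (fst i) ^ snd i)" by (auto simp: pairs_upto_def)
    then have "\<Phi> (real (gnorm (fst i) ^ snd i) / X) = 0" using X by (intro \<Phi>) (simp add: pos_le_divide_eq)
    then show "\<Phi> (real (gnorm (fst i) ^ snd i) / X) * ln (real (gnorm (fst i))) * sector_weight f K (Arg (cpx (pair_elem i)) - \<theta>) = 0"
      by simp
  qed (auto simp: pairs_upto_def pair_weight_def pair_angle_def)
  then show ?thesis by (simp add: finite_pairs_upto)
qed

definition equal_angle_sum :: "(real \<Rightarrow> real) \<Rightarrow> real \<Rightarrow> real \<Rightarrow> real" where
  "equal_angle_sum \<Phi> X B = (\<Sum>i\<in>pairs_upto B. \<Sum>j\<in>pairs_upto B.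
     if pair_angle i = pair_angle j then pair_weight \<Phi> X i * pair_weight \<Phi> X j else 0)"

text \<open>Expanding the square gives products of sector weights. Those at different angles vanish
  as soon as pi R / K <= 1 / (b X), which is where the growth of K beyond X enters; those at equal
  angles reduce to the weight of f^2 by \<open>sector_weight_square\<close>. The subtracted term is
  the square of the mean.\<close>

lemma psi_var_eq:
  assumes f: "\<And>x. R \<le> \<bar>x\<bar> \<Longrightarrow> f x = 0" "continuous_on UNIV f" and \<Phi>: "\<And>x. b \<le> x \<Longrightarrow> \<Phi> x = 0"
    and X: "0 < X" and K: "2 * R < K" "0 < R" "pi * R / K \<le> 1 / (b * X)"
  shows "psi_var f \<Phi> K X = (1 / K) * (LINT y|lborel. (f y)\<^sup>2) * equal_angle_sum \<Phi> X (b * X)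
    - ((1 / K) * (LINT y|lborel. f y) * (\<Sum>i\<in>pairs_upto (b * X). pair_weight \<Phi> X i))\<^sup>2"
proof -
  define A where "A = pairs_upto (b * X)"
  define w where "w = pair_weight \<Phi> X"
  define s where "s i \<theta> = sector_weight f K (pair_angle i - \<theta>)" for i \<theta>
  define I where "I g = integral {0..pi / 2} g" for g :: "real \<Rightarrow> real"
  have K0: "0 < K" using K by simp
  have An: "pair_elem i \<in> normals" "real (gnorm (pair_elem i)) \<le> b * X" if "i \<in> A" for i
    using that pairs_upto_image by (auto simp: A_def)
  have ang: "0 \<le> pair_angle i" "pair_angle i < pi / 2" if "i \<in> A" for i
    using normals_Arg[OF An(1)[OF that]] by (auto simp: pair_angle_def)
  have LI: "(LINT \<theta>:{0..pi / 2}|lborel. g \<theta>) = I g" if "continuous_on {0..pi / 2} g" for g :: "real \<Rightarrow> real"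
    unfolding I_def by (intro set_borel_integral_eq_integral(2) borel_integrable_atLeastAtMost' that)
  have cs: "continuous_on {0..pi / 2} (s i)" if "i \<in> A" for i
    unfolding s_def by (rule sector_weight_continuous[OF f K(1,2) ang[OF that]])
  define P where "P \<theta> = (\<Sum>i\<in>A. w i * s i \<theta>)" for \<theta>
  have psiP: "psi f \<Phi> K X = P"
    unfolding P_def A_def w_def s_def using psi_finite[OF \<Phi> X] by (auto simp: fun_eq_iff)
  have cP: "continuous_on {0..pi / 2} P" unfolding P_def by (intro continuous_intros cs)
  have finA: "finite A" by (simp add: A_def finite_pairs_upto)
  have Is: "I (s i) = (pi / 2) / K * (LINT y|lborel. f y)" if "i \<in> A" for i
    using sector_weight_integral[OF f K(1,2) ang[OF that]] LI[OF cs[OF that]] by (simp add: s_def[abs_def])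
  have io: "g integrable_on {0..pi / 2}" if "continuous_on {0..pi / 2} g" for g :: "real \<Rightarrow> real"
    using that by (rule integrable_continuous_real)
  have IP: "I P = (pi / 2) / K * (LINT y|lborel. f y) * (\<Sum>i\<in>A. w i)"
  proof -
    have "I P = (\<Sum>i\<in>A. I (\<lambda>\<theta>. w i * s i \<theta>))"
      unfolding I_def P_def by (rule Henstock_Kurzweil_Integration.integral_sum[OF finA]) (intro io continuous_intros cs)
    also have "\<dots> = (\<Sum>i\<in>A. w i * ((pi / 2) / K * (LINT y|lborel. f y)))"
      by (intro sum.cong refl) (simp only: I_def[symmetric] Is[symmetric], simp add: I_def)
    also have "\<dots> = (\<Sum>i\<in>A. w i) * ((pi / 2) / K * (LINT y|lborel. f y))" by (simp only: sum_distrib_right)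
    finally show ?thesis by (simp only: mult.commute)
  qed
  have Iss: "I (\<lambda>\<theta>. s i \<theta> * s j \<theta>) = (if pair_angle i = pair_angle j then (pi / 2) / K * (LINT y|lborel. (f y)\<^sup>2) else 0)"
    if ij: "i \<in> A" "j \<in> A" for i j
  proof (cases "pair_angle i = pair_angle j")
    case True
    have cf2: "continuous_on UNIV (\<lambda>x. (f x)\<^sup>2)" using f(2) by (intro continuous_intros)
    have f2: "(f x)\<^sup>2 = 0" if "R \<le> \<bar>x\<bar>" for x using f(1)[OF that] by simp
    have "I (\<lambda>\<theta>. s i \<theta> * s j \<theta>) = I (\<lambda>\<theta>. sector_weight (\<lambda>x. (f x)\<^sup>2) K (pair_angle i - \<theta>))"
      unfolding I_def
    proof (rule Henstock_Kurzweil_Integration.integral_cong)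
      fix \<theta> assume "\<theta> \<in> {0..pi / 2}"
      then have "\<bar>pair_angle i - \<theta>\<bar> \<le> pi / 2" by (rule abs_angle_diff_le[OF ang[OF ij(1)]])
      then have "(sector_weight f K (pair_angle i - \<theta>))\<^sup>2 = sector_weight (\<lambda>x. (f x)\<^sup>2) K (pair_angle i - \<theta>)"
        by (intro sector_weight_square[where f = f and R = R and K = K] f(1) K(1,2)) assumption+
      then show "s i \<theta> * s j \<theta> = sector_weight (\<lambda>x. (f x)\<^sup>2) K (pair_angle i - \<theta>)"
        by (simp add: s_def True power2_eq_square)
    qed
    also have "\<dots> = (pi / 2) / K * (LINT y|lborel. (f y)\<^sup>2)"
      using sector_weight_integral[OF f2 cf2 K(1,2) ang[OF ij(1)]] LI[OF sector_weight_continuous[OF f2 cf2 K(1,2) ang[OF ij(1)]]] by simp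
    finally show ?thesis using True by simp
  next
    case False
    have "I (\<lambda>\<theta>. s i \<theta> * s j \<theta>) = I (\<lambda>\<theta>. 0)"
      unfolding I_def s_def pair_angle_def
      by (rule Henstock_Kurzweil_Integration.integral_cong, rule sector_weight_orthogonal[OF f(1) K An(1)[OF ij(1)] An(1)[OF ij(2)] An(2)[OF ij(1)] An(2)[OF ij(2)]])
        (use False in \<open>simp_all add: pair_angle_def\<close>)
    then show ?thesis using False by (simp add: I_def)
  qed
  have IPP: "I (\<lambda>\<theta>. (P \<theta>)\<^sup>2) = (pi / 2) / K * (LINT y|lborel. (f y)\<^sup>2) * equal_angle_sum \<Phi> X (b * X)"
  proof -
    have "I (\<lambda>\<theta>. (P \<theta>)\<^sup>2) = I (\<lambda>\<theta>. \<Sum>i\<in>A. \<Sum>j\<in>A. (w i * w j) * (s i \<theta> * s j \<theta>))"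
      unfolding P_def power2_eq_square sum_product by (simp add: mult_ac)
    also have "\<dots> = (\<Sum>i\<in>A. \<Sum>j\<in>A. I (\<lambda>\<theta>. (w i * w j) * (s i \<theta> * s j \<theta>)))"
      unfolding I_def
      by (subst Henstock_Kurzweil_Integration.integral_sum[OF finA], intro io continuous_intros cs, assumption+,
          intro sum.cong refl, subst Henstock_Kurzweil_Integration.integral_sum[OF finA], intro io continuous_intros cs, assumption+, rule refl)
    also have "\<dots> = (\<Sum>i\<in>A. \<Sum>j\<in>A. (pi / 2) / K * (LINT y|lborel. (f y)\<^sup>2) * (if pair_angle i = pair_angle j then w i * w j else 0))"
    proof (intro sum.cong refl)
      fix i j assume ij: "i \<in> A" "j \<in> A"
      have "I (\<lambda>\<theta>. (w i * w j) * (s i \<theta> * s j \<theta>)) = (w i * w j) * I (\<lambda>\<theta>. s i \<theta> * s j \<theta>)" by (simp add: I_def)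
      then show "I (\<lambda>\<theta>. (w i * w j) * (s i \<theta> * s j \<theta>)) = (pi / 2) / K * (LINT y|lborel. (f y)\<^sup>2) * (if pair_angle i = pair_angle j then w i * w j else 0)"
        unfolding Iss[OF ij] by simp
    qed
    also have "\<dots> = (pi / 2) / K * (LINT y|lborel. (f y)\<^sup>2) * equal_angle_sum \<Phi> X (b * X)"
      unfolding equal_angle_sum_def A_def[symmetric] w_def[symmetric] sum_distrib_left ..
    finally show ?thesis .
  qed
  define \<mu> where "\<mu> = psi_mean f \<Phi> K X"
  have \<mu>: "\<mu> = (2 / pi) * I P" unfolding \<mu>_def psi_mean_def psiP LI[OF cP] by simp
  have "psi_var f \<Phi> K X = (2 / pi) * I (\<lambda>\<theta>. (P \<theta> - \<mu>)\<^sup>2)"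
    unfolding psi_var_def psiP \<mu>_def[symmetric] by (subst LI) (auto intro!: continuous_intros cP)
  also have "I (\<lambda>\<theta>. (P \<theta> - \<mu>)\<^sup>2) = I (\<lambda>\<theta>. (P \<theta>)\<^sup>2 + ((- 2 * \<mu>) * P \<theta> + \<mu>\<^sup>2))"
    by (simp add: power2_eq_square algebra_simps)
  also have "\<dots> = I (\<lambda>\<theta>. (P \<theta>)\<^sup>2) + (I (\<lambda>\<theta>. (- 2 * \<mu>) * P \<theta>) + I (\<lambda>\<theta>. \<mu>\<^sup>2))"
    unfolding I_def
    by (subst Henstock_Kurzweil_Integration.integral_add, (intro io continuous_intros cP)+,
        subst Henstock_Kurzweil_Integration.integral_add, (intro io continuous_intros cP)+, rule refl)
  also have "I (\<lambda>\<theta>. (- 2 * \<mu>) * P \<theta>) = (- 2 * \<mu>) * I P" unfolding I_def by (rule Henstock_Kurzweil_Integration.integral_mult_right)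
  also have "I (\<lambda>\<theta>. \<mu>\<^sup>2) = pi / 2 * \<mu>\<^sup>2" by (simp add: I_def)
  also have "(2 / pi) * (I (\<lambda>\<theta>. (P \<theta>)\<^sup>2) + ((- 2 * \<mu>) * I P + pi / 2 * \<mu>\<^sup>2)) = (2 / pi) * I (\<lambda>\<theta>. (P \<theta>)\<^sup>2) - \<mu>\<^sup>2"
    unfolding \<mu> by (simp add: field_simps power2_eq_square)
  also have "\<dots> = (1 / K) * (LINT y|lborel. (f y)\<^sup>2) * equal_angle_sum \<Phi> X (b * X)
    - ((1 / K) * (LINT y|lborel. f y) * (\<Sum>i\<in>pairs_upto (b * X). pair_weight \<Phi> X i))\<^sup>2"
    unfolding IPP \<mu> IP A_def w_def using K0 by simp
  finally show ?thesis .
qed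

section \<open>Prime powers with equal angles\<close>

definition angle_zero_pairs :: "(gint \<times> nat) set" where
  "angle_zero_pairs = inert_pairs \<union> {i \<in> ramified_pairs. even (snd i)}"

definition odd_ramified_pairs :: "(gint \<times> nat) set" where
  "odd_ramified_pairs = {i \<in> ramified_pairs. odd (snd i)}"

text \<open>Otherwise the prime would be an associate of its conjugate, and the two primes above its
  norm would coincide.\<close>

lemma split_not_dvd_gcnj:
  assumes "prime \<pi>" "prime (gnorm \<pi>)" "gnorm \<pi> mod 4 = 1"
  shows "\<not> \<pi> dvd gcnj \<pi>"
proof
  assume "\<pi> dvd gcnj \<pi>"
  then have n: "normalize \<pi> = normalize (gcnj \<pi>)"
    by (rule dvd_gnorm_eq_imp) (use assms(1) in \<open>auto dest!: arg_cong[of _ _ gnorm]\<close>)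
  then have e: "\<pi> = normalize (gcnj \<pi>)" using assms(1) by simp
  have "\<pi> = split_prime (gnorm \<pi>) \<or> \<pi> = split_prime' (gnorm \<pi>)" using split_prime(6)[OF assms(2,3,1) refl] .
  then show False
  proof
    assume "\<pi> = split_prime (gnorm \<pi>)"
    then show False using e split_prime(5)[OF assms(2,3)] by (simp add: split_prime'_def)
  next
    assume p: "\<pi> = split_prime' (gnorm \<pi>)"
    define \<sigma> where "\<sigma> = split_prime (gnorm \<pi>)"
    have p': "\<pi> = normalize (gcnj \<sigma>)" using p unfolding split_prime'_def \<sigma>_def .
    have "\<pi> dvd gcnj \<pi>" by fact
    moreover have "gcnj \<pi> dvd \<sigma>"
    proof -
      have "\<pi> dvd gcnj \<sigma>" unfolding p' by simp
      then show ?thesis using gcnj_dvd_iff[of \<pi> "gcnj \<sigma>"] by simp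
    qed
    ultimately have "\<pi> dvd \<sigma>" by (rule dvd_trans)
    then have "\<pi> = \<sigma>" using assms(1) split_prime(1)[OF assms(2,3)] by (simp add: primes_dvd_imp_eq \<sigma>_def)
    then show False using p split_prime(5)[OF assms(2,3)] by (simp add: \<sigma>_def)
  qed
qed

text \<open>Equal angles make the product of a with the conjugate of b real, hence equal to its own
  conjugate. In terms of primes, \<pi>^k times the conjugate of \<rho>^m is associated to the
  conjugate of \<pi>^k times \<rho>^m. As \<pi> does not divide its conjugate, it divides \<rho>;
  then \<rho> = \<pi>, and comparing powers of \<pi> forces k = m.\<close>

lemma split_pair_angle_unique:
  assumes i: "i \<in> split_pairs" and j: "j \<in> prime_pairs" and eq: "pair_angle i = pair_angle j"
  shows "i = j"
proof -
  obtain \<pi> k where ik: "i = (\<pi>, k)" "prime \<pi>" "0 < k" "prime (gnorm \<pi>)" "gnorm \<pi> mod 4 = 1" using i by (auto simp: split_pairs_def)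
  obtain \<rho> m where jm: "j = (\<rho>, m)" "prime \<rho>" "0 < m" using j by (auto simp: prime_pairs_def)
  note ndvd = split_not_dvd_gcnj[OF ik(2,4,5)]
  define a b where "a = pair_elem i" and "b = pair_elem j"
  have "cpx a * cnj (cpx b) = rcis (cmod (cpx a)) (Arg (cpx a)) * cnj (rcis (cmod (cpx b)) (Arg (cpx b)))"
    by (simp only: rcis_cmod_Arg)
  also have "Arg (cpx a) = Arg (cpx b)" using eq by (simp add: pair_angle_def a_def b_def)
  finally have "cpx a * cnj (cpx b) = of_real (cmod (cpx a) * cmod (cpx b))"
    by (simp add: rcis_def cis_cnj cis_mult mult_ac) (simp add: mult.assoc[symmetric] cis_mult)?
  then have "cnj (cpx a * cnj (cpx b)) = cpx a * cnj (cpx b)" by (simp only: complex_cnj_complex_of_real)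
  then have ab: "a * gcnj b = gcnj a * b" by (intro gint_eqI) simp
  have ai: "a dvd \<pi> ^ k" "\<pi> ^ k dvd a" by (simp_all add: a_def ik pair_elem_def)
  have bj: "b dvd \<rho> ^ m" "\<rho> ^ m dvd b" by (simp_all add: b_def jm pair_elem_def)
  have d1: "\<pi> ^ k * gcnj \<rho> ^ m dvd gcnj \<pi> ^ k * \<rho> ^ m"
  proof -
    have "gcnj \<rho> ^ m dvd gcnj b" using bj(2) gcnj_dvd_iff[of "\<rho> ^ m" b] by simp
    then have "\<pi> ^ k * gcnj \<rho> ^ m dvd a * gcnj b" using ai(2) by (intro mult_dvd_mono)
    also have "gcnj a dvd gcnj \<pi> ^ k" using ai(1) gcnj_dvd_iff[of a "\<pi> ^ k"] by simp
    then have "a * gcnj b dvd gcnj \<pi> ^ k * \<rho> ^ m" unfolding ab using bj(1) by (intro mult_dvd_mono)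
    finally show ?thesis .
  qed
  have d2: "gcnj \<pi> ^ k * \<rho> ^ m dvd \<pi> ^ k * gcnj \<rho> ^ m"
  proof -
    have "gcnj \<pi> ^ k dvd gcnj a" using ai(2) gcnj_dvd_iff[of "\<pi> ^ k" a] by simp
    then have "gcnj \<pi> ^ k * \<rho> ^ m dvd gcnj a * b" using bj(2) by (intro mult_dvd_mono)
    also have "gcnj b dvd gcnj \<rho> ^ m" using bj(1) gcnj_dvd_iff[of b "\<rho> ^ m"] by simp
    then have "gcnj a * b dvd \<pi> ^ k * gcnj \<rho> ^ m" unfolding ab[symmetric] using ai(1) by (intro mult_dvd_mono)
    finally show ?thesis .
  qed
  have "\<pi> dvd \<pi> ^ k" using ik(3) by (simp add: dvd_power)
  then have "\<pi> dvd gcnj \<pi> ^ k * \<rho> ^ m" using d1 by (meson dvd_mult2 dvd_trans)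
  then have "\<pi> dvd gcnj \<pi> ^ k \<or> \<pi> dvd \<rho> ^ m" using ik(2) by (simp add: prime_dvd_mult_iff)
  then have "\<pi> dvd gcnj \<pi> \<or> \<pi> dvd \<rho>" using ik(2) prime_dvd_power by blast
  then have \<rho>: "\<rho> = \<pi>" using ndvd ik(2) jm(2) by (auto dest: primes_dvd_imp_eq)
  have p0: "\<pi> \<noteq> 0" using ik(2) by auto
  have "k = m"
  proof (rule ccontr)
    assume "k \<noteq> m"
    then consider "m < k" | "k < m" by linarith
    then show False
    proof cases
      case 1
      have "\<pi> ^ k dvd gcnj \<pi> ^ k * \<pi> ^ m" using d1 unfolding \<rho> by (rule dvd_mult_left)
      also have "\<pi> ^ k = \<pi> ^ m * \<pi> ^ (k - m)" using 1 by (simp flip: power_add)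
      finally have "\<pi> ^ (k - m) dvd gcnj \<pi> ^ k" using p0 by (simp add: mult.commute[of "gcnj \<pi> ^ k"])
      then have "\<pi> dvd gcnj \<pi> ^ k" using 1 by (meson dvd_power dvd_trans zero_less_diff)
      then show False using ndvd ik(2) prime_dvd_power by blast
    next
      case 2
      have "\<pi> ^ m dvd \<pi> ^ k * gcnj \<pi> ^ m" using d2 unfolding \<rho> by (rule dvd_mult_right)
      also have "\<pi> ^ m = \<pi> ^ k * \<pi> ^ (m - k)" using 2 by (simp flip: power_add)
      finally have "\<pi> ^ (m - k) dvd gcnj \<pi> ^ m" using p0 by simp
      then have "\<pi> dvd gcnj \<pi> ^ m" using 2 by (meson dvd_power dvd_trans zero_less_diff)
      then show False using ndvd ik(2) prime_dvd_power by blast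
    qed
  qed
  then show ?thesis using ik jm \<rho> by simp
qed

lemma ramified_square: "ramified_prime ^ 2 = of_nat 2 * gi"
  by (rule gint_eqI) (simp add: ramified_prime_def power2_eq_square algebra_simps)

text \<open>Powers of a rational prime are positive integers, and (1 + i)^2 = 2 i makes every even
  power of 1 + i an associate of a power of 2.\<close>

lemma pair_angle_zero: "i \<in> angle_zero_pairs \<Longrightarrow> pair_angle i = 0"
proof -
  have nn: "normalize (of_nat n :: gint) = of_nat n" if "0 < n" for n
  proof -
    have "(of_nat n :: gint) \<in> normals" using that by (simp add: normals_gint)
    then show ?thesis by (simp add: normals_def)
  qed
  have Arg0: "Arg (of_nat n) = 0" for n
    by (metis Arg_of_real of_real_of_nat_eq of_nat_0_le_iff not_le)
  assume "i \<in> angle_zero_pairs"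
  then consider q k where "i = (of_nat q, k)" "prime q" | k where "i = (ramified_prime, 2 * k)"
    by (auto simp: angle_zero_pairs_def inert_pairs_def ramified_pairs_def elim!: evenE)
  then show ?thesis
  proof cases
    case 1
    then have "pair_elem i = of_nat (q ^ k)" using nn[of "q ^ k"] prime_gt_0_nat[of q] by (simp add: pair_elem_def)
    then show ?thesis by (simp only: pair_angle_def cpx_of_nat Arg0)
  next
    case 2
    have "gi dvd 1" by (simp only: gint_dvd_1 insert_iff simp_thms)
    then have u: "gi ^ k dvd 1" by (simp add: is_unit_power_iff)
    have "pair_elem i = normalize (gi ^ k * of_nat (2 ^ k))"
      by (simp only: 2 pair_elem_def prod.case power_mult ramified_square power_mult_distrib mult.commute[of "of_nat 2 ^ k"] of_nat_power)
    also have "\<dots> = of_nat (2 ^ k)" unfolding normalize_mult_unit_left[OF u] by (rule nn) simp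
    finally show ?thesis by (simp only: pair_angle_def cpx_of_nat Arg0)
  qed
qed

lemma pair_angle_odd_ramified: "i \<in> odd_ramified_pairs \<Longrightarrow> pair_angle i = Arg (cpx ramified_prime)"
proof -
  assume "i \<in> odd_ramified_pairs"
  then obtain k where i: "i = (ramified_prime, 2 * k + 1)" by (auto simp: odd_ramified_pairs_def ramified_pairs_def elim!: oddE)
  have "gi dvd 1" by (simp only: gint_dvd_1 insert_iff simp_thms)
    then have u: "gi ^ k dvd 1" by (simp add: is_unit_power_iff)
  have e: "ramified_prime ^ (2 * k + 1) = gi ^ k * (of_nat (2 ^ k) * ramified_prime)"
    by (simp only: power_add power_mult ramified_square power_mult_distrib power_one_right of_nat_power mult.assoc mult.commute[of "of_nat 2 ^ k"] mult.left_commute[of "of_nat 2 ^ k"])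
  have "of_nat (2 ^ k) * ramified_prime \<in> normals" by (simp add: normals_gint ramified_prime_def)
  then have "pair_elem i = of_nat (2 ^ k) * ramified_prime"
    unfolding i pair_elem_def prod.case e normalize_mult_unit_left[OF u] by (simp add: normals_def)
  then have "cpx (pair_elem i) = of_real (2 ^ k) * cpx ramified_prime" by simp
  then show ?thesis unfolding pair_angle_def by (simp only: Arg_times_of_real zero_less_power zero_less_numeral)
qed

lemma ramified_angle: "Arg (cpx ramified_prime) \<noteq> 0"
proof
  assume "Arg (cpx ramified_prime) = 0"
  then have "cpx ramified_prime = rcis (cmod (cpx ramified_prime)) 0" using rcis_cmod_Arg by metis
  then have "Im (cpx ramified_prime) = 0" by (metis Im_rcis mult_zero_right sin_zero)
  then show False by (simp add: ramified_prime_def)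
qed

text \<open>A class of pairs with a common angle contributes the square of its total weight. The
  classes are the single split powers, the class of angle 0, and the odd powers of 1 + i, which all
  share the angle of 1 + i.\<close>

lemma equal_angle_sum_eq:
  "equal_angle_sum \<Phi> X B = (\<Sum>i\<in>pairs_upto B \<inter> split_pairs. (pair_weight \<Phi> X i)\<^sup>2)
     + (\<Sum>i\<in>pairs_upto B \<inter> angle_zero_pairs. pair_weight \<Phi> X i)\<^sup>2
     + (\<Sum>i\<in>pairs_upto B \<inter> odd_ramified_pairs. pair_weight \<Phi> X i)\<^sup>2"
proof -
  define A w where "A = pairs_upto B" and "w = pair_weight \<Phi> X"
  define S Z T where "S = A \<inter> split_pairs" and "Z = A \<inter> angle_zero_pairs" and "T = A \<inter> odd_ramified_pairs"
  define g where "g i = (\<Sum>j\<in>A. if pair_angle i = pair_angle j then w i * w j else 0)" for i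
  have Ap: "A \<subseteq> prime_pairs" by (auto simp: A_def pairs_upto_def)
  have fin: "finite A" "finite S" "finite Z" "finite T" using finite_pairs_upto by (auto simp: A_def S_def Z_def T_def)
  have part: "A = (S \<union> Z) \<union> T"
    using Ap prime_pairs_partition(1) by (auto simp: S_def Z_def T_def angle_zero_pairs_def odd_ramified_pairs_def)
  have disj: "S \<inter> Z = {}" "(S \<union> Z) \<inter> T = {}"
    using prime_pairs_partition(2,3) by (auto simp: S_def Z_def T_def angle_zero_pairs_def odd_ramified_pairs_def)
  have aZ: "pair_angle i = 0" if "i \<in> Z" for i using that pair_angle_zero by (auto simp: Z_def)
  have aO: "pair_angle i = Arg (cpx ramified_prime)" if "i \<in> T" for i using that pair_angle_odd_ramified by (auto simp: T_def)
  have aS: "j = i" if "i \<in> S" "j \<in> A" "pair_angle i = pair_angle j" for i j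
    using split_pair_angle_unique[of i j] that Ap by (auto simp: S_def)
  have gS: "g i = (w i)\<^sup>2" if "i \<in> S" for i
  proof -
    have "g i = (\<Sum>j\<in>{i}. if pair_angle i = pair_angle j then w i * w j else 0)"
      unfolding g_def
    proof (rule sum.mono_neutral_right[OF fin(1)])
      show "{i} \<subseteq> A" using that part by blast
      have "pair_angle i \<noteq> pair_angle j" if "j \<in> A - {i}" for j using aS[OF \<open>i \<in> S\<close>, of j] that by blast
      then show "\<forall>j\<in>A - {i}. (if pair_angle i = pair_angle j then w i * w j else 0) = 0" by simp
    qed
    then show ?thesis by (simp add: power2_eq_square)
  qed
  have gZ: "g i = w i * (\<Sum>j\<in>Z. w j)" if i: "i \<in> Z" for i
  proof -
    have "g i = (\<Sum>j\<in>Z. if pair_angle i = pair_angle j then w i * w j else 0)"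
      unfolding g_def
    proof (rule sum.mono_neutral_right[OF fin(1)])
      show "\<forall>j\<in>A - Z. (if pair_angle i = pair_angle j then w i * w j else 0) = 0"
      proof
        fix j assume j: "j \<in> A - Z"
        have "pair_angle i \<noteq> pair_angle j"
        proof
          assume e: "pair_angle i = pair_angle j"
          from j part consider "j \<in> S" | "j \<in> T" by auto
          then show False
          proof cases
            case 1 then show False using aS[OF 1, of i] e i j part by auto
          next
            case 2 then show False using aO[OF 2] aZ[OF i] e ramified_angle by simp
          qed
        qed
        then show "(if pair_angle i = pair_angle j then w i * w j else 0) = 0" by simp
      qed
    qed (auto simp: Z_def)
    also have "\<dots> = (\<Sum>j\<in>Z. w i * w j)" by (rule sum.cong) (use aZ i in auto)
    finally show ?thesis by (simp add: sum_distrib_left)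
  qed
  have gO: "g i = w i * (\<Sum>j\<in>T. w j)" if i: "i \<in> T" for i
  proof -
    have "g i = (\<Sum>j\<in>T. if pair_angle i = pair_angle j then w i * w j else 0)"
      unfolding g_def
    proof (rule sum.mono_neutral_right[OF fin(1)])
      show "\<forall>j\<in>A - T. (if pair_angle i = pair_angle j then w i * w j else 0) = 0"
      proof
        fix j assume j: "j \<in> A - T"
        have "pair_angle i \<noteq> pair_angle j"
        proof
          assume e: "pair_angle i = pair_angle j"
          from j part consider "j \<in> S" | "j \<in> Z" by auto
          then show False
          proof cases
            case 1 then show False using aS[OF 1, of i] e i j part by auto
          next
            case 2 then show False using aZ[OF 2] aO[OF i] e ramified_angle by simp
          qed
        qed
        then show "(if pair_angle i = pair_angle j then w i * w j else 0) = 0" by simp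
      qed
    qed (auto simp: T_def)
    also have "\<dots> = (\<Sum>j\<in>T. w i * w j)" by (rule sum.cong) (use aO i in auto)
    finally show ?thesis by (simp add: sum_distrib_left)
  qed
  have "equal_angle_sum \<Phi> X B = sum g A" unfolding equal_angle_sum_def g_def A_def w_def ..
  also have "\<dots> = sum g S + sum g Z + sum g T"
    unfolding part using fin disj by (simp add: sum.union_disjoint)
  also have "sum g S = (\<Sum>i\<in>S. (w i)\<^sup>2)" by (rule sum.cong) (auto simp: gS)
  also have "sum g Z = (\<Sum>i\<in>Z. w i)\<^sup>2" unfolding power2_eq_square sum_distrib_right by (rule sum.cong) (auto simp: gZ)
  also have "sum g T = (\<Sum>i\<in>T. w i)\<^sup>2" unfolding power2_eq_square sum_distrib_right by (rule sum.cong) (auto simp: gO)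
  finally show ?thesis by (simp add: S_def Z_def T_def A_def w_def)
qed

subsection \<open>Reduction to rational prime powers\<close>

definition nat_pairs_upto :: "real \<Rightarrow> (nat \<times> nat) set" where
  "nat_pairs_upto B = {i \<in> prime_pairs. real (fst i ^ snd i) \<le> B}"

text \<open>The factor 2 comes from ln p >= ln 2 >= 1/2.\<close>

lemma power_le_imp_exponent_le:
  assumes "2 \<le> (p::nat)" "real (p ^ k) \<le> B"
  shows "real k \<le> 2 * ln B"
proof -
  have p: "0 < real p" "2 \<le> real p" using assms(1) by auto
  have pos: "0 < real (p ^ k)" using p(1) by simp
  have "real k * (1/2) \<le> real k * ln (real p)"
  proof (rule mult_left_mono)
    have "ln 2 \<le> ln (real p)" using p by simp
    then show "1/2 \<le> ln (real p)" using ln2_ge_two_thirds by linarith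
  qed simp
  also have "\<dots> = ln (real (p ^ k))" using p(1) by (simp add: ln_realpow)
  also have "\<dots> \<le> ln B" using pos assms(2) by (simp add: ln_mono)
  finally show ?thesis by simp
qed

lemma finite_nat_pairs_upto: "finite (nat_pairs_upto B)"
proof (rule finite_subset)
  show "nat_pairs_upto B \<subseteq> {..nat \<lfloor>B\<rfloor>} \<times> {..nat \<lfloor>B\<rfloor>}"
  proof
    fix i assume "i \<in> nat_pairs_upto B"
    then obtain p k where i: "i = (p, k)" "prime p" "0 < k" "real (p ^ k) \<le> B"
      by (cases i) (auto simp: nat_pairs_upto_def prime_pairs_def)
    have p: "2 \<le> p" using i(2) by (rule prime_ge_2_nat)
    have "p \<le> p ^ k" using i(3) p by (simp add: self_le_power)
    moreover have "k \<le> p ^ k" using p by (intro less_imp_le power_gt_expt) simp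
    ultimately have "real p \<le> B" "real k \<le> B" using i(4) by (meson of_nat_mono order_trans)+
    then show "i \<in> {..nat \<lfloor>B\<rfloor>} \<times> {..nat \<lfloor>B\<rfloor>}" by (simp add: i(1) le_nat_floor)
  qed
qed simp

text \<open>These are the pairs at which the sums over ideals and their expressions by characters
  may disagree. An exponent above 1 forces p <= sqrt B, and for p = 2 the same follows from B >= 4;
  the exponent is at most 2 ln B.\<close>

lemma card_exceptional_pairs:
  assumes "4 \<le> B"
  shows "real (card {i \<in> nat_pairs_upto B. fst i = 2 \<or> 1 < snd i}) \<le> 2 * (sqrt B * ln B)"
proof -
  define n m where "n = nat \<lfloor>sqrt B\<rfloor>" and "m = nat \<lfloor>2 * ln B\<rfloor>"
  have "{i \<in> nat_pairs_upto B. fst i = 2 \<or> 1 < snd i} \<subseteq> {1..n} \<times> {1..m}"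
  proof
    fix i assume "i \<in> {i \<in> nat_pairs_upto B. fst i = 2 \<or> 1 < snd i}"
    then obtain p k where i: "i = (p, k)" "prime p" "0 < k" "real (p ^ k) \<le> B" "p = 2 \<or> 1 < k"
      by (cases i) (auto simp: nat_pairs_upto_def prime_pairs_def)
    have p: "2 \<le> p" using i(2) by (rule prime_ge_2_nat)
    have "real k \<le> 2 * ln B" using p i(4) by (rule power_le_imp_exponent_le)
    then have k: "k \<le> m" unfolding m_def by (rule le_nat_floor)
    have "(real p)\<^sup>2 \<le> B"
      using i(5)
    proof
      assume "1 < k"
      then have "p ^ 2 \<le> p ^ k" using p by (intro power_increasing) auto
      then have "real (p ^ 2) \<le> real (p ^ k)" by (rule of_nat_mono)
      then show ?thesis using i(4) by simp
    qed (use assms in simp)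
    then have "real p \<le> sqrt B" by (rule real_le_rsqrt)
    then have "p \<le> n" unfolding n_def by (rule le_nat_floor)
    then show "i \<in> {1..n} \<times> {1..m}" using k p i(1,3) by simp
  qed
  then have "card {i \<in> nat_pairs_upto B. fst i = 2 \<or> 1 < snd i} \<le> card ({1..n} \<times> {1..m})" by (intro card_mono) auto
  also have "\<dots> = n * m" by (simp add: card_cartesian_product)
  finally have "real (card {i \<in> nat_pairs_upto B. fst i = 2 \<or> 1 < snd i}) \<le> real (n * m)"
    by (simp only: of_nat_le_iff)
  also have "\<dots> = real n * real m" by simp
  also have "\<dots> \<le> sqrt B * (2 * ln B)"
    using assms by (intro mult_mono) (auto simp: n_def m_def)
  finally show ?thesis by simp
qed

lemma infsum_eq_sum_neutral:
  assumes "finite F" "F \<subseteq> A" "\<And>i. i \<in> A \<Longrightarrow> i \<notin> F \<Longrightarrow> g i = 0"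
  shows "g summable_on A" "infsum g A = sum g F"
proof -
  have "g summable_on F" using assms(1) by simp
  then show "g summable_on A" by (rule summable_on_cong_neutral[THEN iffD1, rotated -1]) (use assms in auto)
  have "infsum g A = infsum g F" by (rule infsum_cong_neutral) (use assms in auto)
  then show "infsum g A = sum g F" using assms(1) by simp
qed

text \<open>Both sums are finite up to \<open>B\<close> and agree at odd primes with exponent 1, so
  only the rare exceptional pairs remain, each with a difference of at most
  \<open>D\<close>.\<close>

lemma exceptional_sum_diff:
  fixes u v :: "nat \<times> nat \<Rightarrow> real"
  assumes B: "4 \<le> B" and D: "0 \<le> D"
    and zero: "\<And>p k. prime p \<Longrightarrow> 0 < k \<Longrightarrow> B < real (p ^ k) \<Longrightarrow> u (p, k) = 0 \<and> v (p, k) = 0"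
    and eq: "\<And>p. prime p \<Longrightarrow> p \<noteq> 2 \<Longrightarrow> u (p, 1) = v (p, 1)"
    and le: "\<And>p k. prime p \<Longrightarrow> 0 < k \<Longrightarrow> real (p ^ k) \<le> B \<Longrightarrow> \<bar>u (p, k) - v (p, k)\<bar> \<le> D"
  shows "\<bar>infsum u prime_pairs - infsum v prime_pairs\<bar> \<le> D * (2 * (sqrt B * ln B))"
proof -
  define F where "F = nat_pairs_upto B"
  define E where "E = {i \<in> F. fst i = 2 \<or> 1 < snd i}"
  have F: "finite F" "F \<subseteq> prime_pairs" unfolding F_def by (rule finite_nat_pairs_upto) (auto simp: nat_pairs_upto_def)
  have z: "u i = 0 \<and> v i = 0" if "i \<in> prime_pairs" "i \<notin> F" for i
    using that zero[of "fst i" "snd i"] by (cases i) (auto simp: F_def nat_pairs_upto_def prime_pairs_def)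
  have "infsum u prime_pairs - infsum v prime_pairs = sum u F - sum v F"
    using infsum_eq_sum_neutral(2)[OF F, of u] infsum_eq_sum_neutral(2)[OF F, of v] z by simp
  also have "\<dots> = (\<Sum>i\<in>F. u i - v i)" by (simp add: sum_subtractf)
  also have "\<dots> = (\<Sum>i\<in>E. u i - v i)"
  proof (rule sum.mono_neutral_right[OF F(1)])
    show "\<forall>i\<in>F - E. u i - v i = 0"
    proof
      fix i assume "i \<in> F - E"
      then obtain p k where "i = (p, k)" "prime p" "p \<noteq> 2" "0 < k" "k \<le> 1"
        by (cases i) (auto simp: E_def F_def nat_pairs_upto_def prime_pairs_def)
      then have "i = (p, 1)" "prime p" "p \<noteq> 2" by auto
      then show "u i - v i = 0" using eq by simp
    qed
  qed (auto simp: E_def)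
  finally have "\<bar>infsum u prime_pairs - infsum v prime_pairs\<bar> = \<bar>\<Sum>i\<in>E. u i - v i\<bar>" by simp
  also have "\<dots> \<le> (\<Sum>i\<in>E. \<bar>u i - v i\<bar>)" by (rule sum_abs)
  also have "\<dots> \<le> (\<Sum>i\<in>E. D)"
  proof (rule sum_mono)
    fix i assume "i \<in> E"
    then show "\<bar>u i - v i\<bar> \<le> D"
      using le[of "fst i" "snd i"] by (cases i) (auto simp: E_def F_def nat_pairs_upto_def prime_pairs_def)
  qed
  also have "\<dots> = D * real (card E)" by simp
  also have "\<dots> \<le> D * (2 * (sqrt B * ln B))"
    using card_exceptional_pairs[OF B] D by (intro mult_left_mono) (auto simp: E_def F_def)
  finally show ?thesis .
qed

lemma exp_pair_len: "prime p \<Longrightarrow> exp (zeta.pair_len (p, k)) = real (p ^ k)"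
  by (simp add: zeta.pair_len_def exp_of_nat_mult prime_gt_0_nat)

lemma pair_sum_finite:
  assumes b: "0 < b" and f: "\<And>u. ln b \<le> u \<Longrightarrow> f u = 0"
  shows "pair_sum a f y = (\<Sum>i\<in>nat_pairs_upto (b * exp y). a i * f (zeta.pair_len i - y))"
  unfolding pair_sum_def
proof (rule infsum_eq_sum_neutral(2)[OF finite_nat_pairs_upto])
  fix i assume i: "i \<in> prime_pairs" "i \<notin> nat_pairs_upto (b * exp y)"
  then obtain p k where pk: "i = (p, k)" "prime p" by (cases i) (auto simp: prime_pairs_def)
  have "b * exp y \<le> exp (zeta.pair_len i)" using i pk by (auto simp: exp_pair_len nat_pairs_upto_def)
  then have "exp (ln b + y) \<le> exp (zeta.pair_len i)" using b by (simp add: exp_add)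
  then have "ln b \<le> zeta.pair_len i - y" by simp
  then show "a i * f (zeta.pair_len i - y) = 0" by (simp add: f)
qed (auto simp: nat_pairs_upto_def)

text \<open>The factor 2 counts the two Gaussian primes above p, which have the same norm and hence
  the same weight.\<close>

lemma split_weight_sum_eq:
  assumes \<Phi>: "\<And>x. b \<le> x \<Longrightarrow> \<Phi> x = 0" and X: "0 < X"
  shows "(\<Sum>i\<in>pairs_upto (b * X) \<inter> split_pairs. (pair_weight \<Phi> X i)\<^sup>2)
    = (\<Sum>\<^sub>\<infinity>(p, k)\<in>prime_pairs. if p mod 4 = 1 then 2 * (\<Phi> (real (p ^ k) / X) * ln (real p))\<^sup>2 else 0)"
proof -
  define H where "H n k = (\<Phi> (real (n ^ k) / X) * ln (real n))\<^sup>2" for n k :: nat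
  have e: "(\<lambda>(\<pi>, k). H (gnorm \<pi>) k) = (\<lambda>i. (pair_weight \<Phi> X i)\<^sup>2)"
    by (auto simp: H_def pair_weight_def fun_eq_iff)
  have z: "(pair_weight \<Phi> X i)\<^sup>2 = 0" if "i \<in> split_pairs" "i \<notin> pairs_upto (b * X) \<inter> split_pairs" for i
  proof -
    have "i \<in> prime_pairs" using that(1) prime_pairs_partition(1) by auto
    then have "b * X \<le> real (gnorm (fst i) ^ snd i)" using that by (auto simp: pairs_upto_def)
    then have "\<Phi> (real (gnorm (fst i) ^ snd i) / X) = 0" using X by (intro \<Phi>) (simp add: pos_le_divide_eq)
    then show ?thesis by (simp add: pair_weight_def)
  qed
  note fin = infsum_eq_sum_neutral[where g="\<lambda>i. (pair_weight \<Phi> X i)\<^sup>2" and A=split_pairs and F="pairs_upto (b * X) \<inter> split_pairs", OF _ _ z]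
  have "(\<Sum>i\<in>pairs_upto (b * X) \<inter> split_pairs. (pair_weight \<Phi> X i)\<^sup>2) = (\<Sum>\<^sub>\<infinity>(\<pi>, k)\<in>split_pairs. H (gnorm \<pi>) k)"
    unfolding e by (rule fin(2)[symmetric]) (auto simp: finite_pairs_upto)
  also have "\<dots> = (\<Sum>\<^sub>\<infinity>(p, k)\<in>nat_pairs 1. H p k + H p k)"
    by (rule infsum_split_pairs, unfold e, rule fin(1)) (auto simp: finite_pairs_upto)
  also have "\<dots> = (\<Sum>\<^sub>\<infinity>(p, k)\<in>prime_pairs. if p mod 4 = 1 then 2 * (\<Phi> (real (p ^ k) / X) * ln (real p))\<^sup>2 else 0)"
    by (rule infsum_cong_neutral) (auto simp: nat_pairs_def prime_pairs_def H_def split: if_splits)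
  finally show ?thesis .
qed

text \<open>An inert prime q has norm q^2: the factor 2 is that of log(q^2) = 2 log q, and \<Phi> is
  evaluated at the square of q^k.\<close>

lemma inert_weight_sum_eq:
  assumes \<Phi>: "\<And>x. b \<le> x \<Longrightarrow> \<Phi> x = 0" and X: "0 < X"
  shows "(\<Sum>i\<in>pairs_upto (b * X) \<inter> inert_pairs. pair_weight \<Phi> X i)
    = (\<Sum>\<^sub>\<infinity>(p, k)\<in>prime_pairs. if p mod 4 = 3 then 2 * (\<Phi> ((real (p ^ k))\<^sup>2 / X) * ln (real p)) else 0)"
proof -
  have z: "pair_weight \<Phi> X i = 0" if "i \<in> inert_pairs" "i \<notin> pairs_upto (b * X) \<inter> inert_pairs" for i
  proof -
    have "i \<in> prime_pairs" using that(1) prime_pairs_partition(1) by auto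
    then have "b * X \<le> real (gnorm (fst i) ^ snd i)" using that by (auto simp: pairs_upto_def)
    then have "\<Phi> (real (gnorm (fst i) ^ snd i) / X) = 0" using X by (intro \<Phi>) (simp add: pos_le_divide_eq)
    then show ?thesis by (simp add: pair_weight_def)
  qed
  have "(\<Sum>i\<in>pairs_upto (b * X) \<inter> inert_pairs. pair_weight \<Phi> X i) = infsum (pair_weight \<Phi> X) inert_pairs"
    by (rule infsum_eq_sum_neutral(2)[symmetric, OF _ _ z]) (auto simp: finite_pairs_upto)
  also have "\<dots> = (\<Sum>\<^sub>\<infinity>i\<in>nat_pairs 3. pair_weight \<Phi> X ((\<lambda>(q, k). (of_nat q, k)) i))"
    by (rule infsum_reindex_bij_betw[OF inert_pairs_bij, symmetric])
  also have "\<dots> = (\<Sum>\<^sub>\<infinity>(p, k)\<in>prime_pairs. if p mod 4 = 3 then 2 * (\<Phi> ((real (p ^ k))\<^sup>2 / X) * ln (real p)) else 0)"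
  proof (rule infsum_cong_neutral)
    fix i assume "i \<in> nat_pairs 3 \<inter> prime_pairs"
    then obtain p k where pk: "i = (p, k)" "prime p" "p mod 4 = 3" by (auto simp: nat_pairs_def)
    have l: "ln ((real p)\<^sup>2) = 2 * ln (real p)" using prime_gt_0_nat[OF pk(2)] by (simp add: ln_realpow)
    have "real ((p\<^sup>2) ^ k) = (real (p ^ k))\<^sup>2" by (simp add: power_mult[symmetric] mult.commute)
    then show "pair_weight \<Phi> X ((\<lambda>(q, k). (of_nat q, k)) i)
        = (case i of (p, k) \<Rightarrow> if p mod 4 = 3 then 2 * (\<Phi> ((real (p ^ k))\<^sup>2 / X) * ln (real p)) else 0)"
      using pk(3) l by (simp add: pk(1) pair_weight_def gnorm_of_nat)
  qed (auto simp: nat_pairs_def prime_pairs_def split: if_splits)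
  finally show ?thesis .
qed

section \<open>Elementary bounds, and the split and inert sums in terms of
  \<open>pair_sum\<close>\<close>

lemma pair_weight_bound:
  assumes M: "\<And>x. \<bar>\<Phi> x\<bar> \<le> M" and i: "i \<in> pairs_upto B"
  shows "\<bar>pair_weight \<Phi> X i\<bar> \<le> M * ln B"
proof -
  have M0: "0 \<le> M" using M[of 0] by linarith
  define n k where "n = gnorm (fst i)" and "k = snd i"
  have p: "prime (fst i)" "0 < k" "real (n ^ k) \<le> B" using i by (auto simp: pairs_upto_def prime_pairs_def n_def k_def)
  have n: "2 \<le> n" using gnorm_prime_ge[OF p(1)] by (simp add: n_def)
  have "n \<le> n ^ k" using p(2) n by (simp add: self_le_power)
  then have "real n \<le> B" using p(3) by (meson of_nat_mono order_trans)
  then have "0 \<le> ln (real n)" "ln (real n) \<le> ln B" using n by (auto intro: ln_mono)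
  then show ?thesis using M M0 unfolding pair_weight_def n_def[symmetric] abs_mult by (intro mult_mono) auto
qed

lemma weight_sum_bound:
  assumes M: "\<And>x. \<bar>\<Phi> x\<bar> \<le> M" and B: "1 \<le> B"
  shows "\<bar>\<Sum>i\<in>pairs_upto B. pair_weight \<Phi> X i\<bar> \<le> (M * ln B) * (2 * B)"
proof -
  have M0: "0 \<le> M" using M[of 0] by linarith
  have "\<bar>\<Sum>i\<in>pairs_upto B. pair_weight \<Phi> X i\<bar> \<le> (\<Sum>i\<in>pairs_upto B. M * ln B)"
    by (rule order_trans[OF sum_abs]) (rule sum_mono, rule pair_weight_bound[OF M])
  also have "\<dots> = (M * ln B) * real (card (pairs_upto B))" by simp
  also have "\<dots> \<le> (M * ln B) * (2 * B)"
    using M0 B card_pairs_upto[OF B] by (intro mult_left_mono) auto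
  finally show ?thesis .
qed

lemma ramified_weight_sum_bound:
  assumes M: "\<And>x. \<bar>\<Phi> x\<bar> \<le> M" and B: "1 \<le> B" and A: "A \<subseteq> ramified_pairs"
  shows "\<bar>\<Sum>i\<in>pairs_upto B \<inter> A. pair_weight \<Phi> X i\<bar> \<le> (M * ln B) * (2 * ln B)"
proof -
  have M0: "0 \<le> M" using M[of 0] by linarith
  define m where "m = nat \<lfloor>2 * ln B\<rfloor>"
  have "pairs_upto B \<inter> A \<subseteq> {ramified_prime} \<times> {1..m}"
  proof
    fix i assume i: "i \<in> pairs_upto B \<inter> A"
    then obtain k where k: "i = (ramified_prime, k)" "0 < k" using A by (auto simp: ramified_pairs_def)
    have "real (2 ^ k) \<le> B" using i k ramified_prime(2) by (simp add: pairs_upto_def)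
    then have "real k \<le> 2 * ln B" by (intro power_le_imp_exponent_le[of 2]) auto
    then have "k \<le> m" unfolding m_def by (rule le_nat_floor)
    then show "i \<in> {ramified_prime} \<times> {1..m}" using k by simp
  qed
  then have "card (pairs_upto B \<inter> A) \<le> card ({ramified_prime} \<times> {1..m})" by (intro card_mono) auto
  then have "card (pairs_upto B \<inter> A) \<le> m" by (simp add: card_cartesian_product)
  then have c: "real (card (pairs_upto B \<inter> A)) \<le> 2 * ln B"
    using B by (simp add: m_def le_nat_iff le_floor_iff)
  have "\<bar>\<Sum>i\<in>pairs_upto B \<inter> A. pair_weight \<Phi> X i\<bar> \<le> (\<Sum>i\<in>pairs_upto B \<inter> A. M * ln B)"
    by (rule order_trans[OF sum_abs]) (rule sum_mono, rule pair_weight_bound[OF M], simp)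
  also have "\<dots> = (M * ln B) * real (card (pairs_upto B \<inter> A))" by simp
  also have "\<dots> \<le> (M * ln B) * (2 * ln B)"
    using M0 B c by (intro mult_left_mono) auto
  finally show ?thesis .
qed

lemma nat_pair_bounds:
  assumes "prime p" "0 < k" "real (p ^ k) \<le> B"
  shows "0 \<le> ln (real p)" "ln (real p) \<le> real k * ln (real p)" "real k * ln (real p) \<le> ln B"
proof -
  have p: "2 \<le> p" using assms(1) by (rule prime_ge_2_nat)
  then show l: "0 \<le> ln (real p)" by simp
  show "ln (real p) \<le> real k * ln (real p)" using mult_right_mono[OF _ l, of 1 "real k"] assms(2) by simp
  have "real k * ln (real p) = ln (real (p ^ k))" using p by (simp add: ln_realpow)
  also have "\<dots> \<le> ln B" using p assms(3) by (intro ln_mono) auto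
  finally show "real k * ln (real p) \<le> ln B" .
qed

lemma chi4_power_bounds: "\<bar>chi4 p ^ k\<bar> \<le> 1"
  unfolding power_abs using chi4_abs_le[of p] by (simp add: power_le_one)

lemma chi4_prime:
  assumes "prime p" "p \<noteq> 2"
  shows "chi4 p = (if p mod 4 = 1 then 1 else - 1)" "p mod 4 = 1 \<or> p mod 4 = 3"
proof -
  have "odd p" using assms primes_dvd_imp_eq two_is_prime_nat by blast
  then show "p mod 4 = 1 \<or> p mod 4 = 3" by presburger
  then show "chi4 p = (if p mod 4 = 1 then 1 else - 1)" by (auto simp: chi4_def)
qed

text \<open>At exponent 1 the factor 1 + chi4 p is 2 for p = 1 mod 4 and 0 for p = 3 mod 4. One of
  the two logarithms is written as y + (log p - y), which yields the weight \<psi>(u) with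
  coefficient y and the weight u \<psi>(u) with coefficient 1.\<close>

lemma split_weight_sum_approx:
  assumes \<Phi>: "\<And>x. b \<le> x \<Longrightarrow> \<Phi> x = 0" and M: "\<And>x. \<bar>\<Phi> x\<bar> \<le> M" and b: "0 < b" "4 \<le> b * exp y"
  defines "\<psi> \<equiv> \<lambda>u. (\<Phi> (exp u))\<^sup>2" and "B \<equiv> b * exp y"
  shows "\<bar>(\<Sum>i\<in>pairs_upto B \<inter> split_pairs. (pair_weight \<Phi> (exp y) i)\<^sup>2)
    - (y * (pair_sum zeta.pair_coeff \<psi> y + pair_sum beta.pair_coeff \<psi> y)
       + (pair_sum zeta.pair_coeff (\<lambda>u. u * \<psi> u) y + pair_sum beta.pair_coeff (\<lambda>u. u * \<psi> u) y))\<bar>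
    \<le> (2 * M\<^sup>2 * (ln B)\<^sup>2) * (2 * (sqrt B * ln B))"
proof -
  define u where "u = (\<lambda>(p, k). if p mod 4 = 1 then 2 * (\<Phi> (real (p ^ k) / exp y) * ln (real p))\<^sup>2 else (0::real))"
  define v where "v i = (zeta.pair_coeff i + beta.pair_coeff i) * zeta.pair_len i * \<psi> (zeta.pair_len i - y)" for i
  have B: "4 \<le> B" using b by (simp add: B_def)
  have \<psi>0: "\<psi> u = 0" if "ln b \<le> u" for u
  proof -
    have "b \<le> exp u" using that b(1) by (metis exp_ln exp_le_cancel_iff)
    then show ?thesis by (simp add: \<psi>_def \<Phi>)
  qed
  have v0: "v i = 0" if i: "i \<in> prime_pairs" "i \<notin> nat_pairs_upto B" for i
  proof -
    obtain p k where pk: "i = (p, k)" "prime p" using i(1) by (cases i) (auto simp: prime_pairs_def)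
    have "exp (ln b + y) \<le> exp (zeta.pair_len i)" using i pk b(1) by (auto simp: exp_pair_len nat_pairs_upto_def B_def exp_add)
    then have "ln b \<le> zeta.pair_len i - y" by simp
    then show ?thesis by (simp add: v_def \<psi>0)
  qed
  have veq: "v (p, k) = (1 + chi4 p ^ k) * (real k * (ln (real p))\<^sup>2) * (\<Phi> (real (p ^ k) / exp y))\<^sup>2" if "prime p" for p k
  proof -
    have "exp (zeta.pair_len (p, k) - y) = real (p ^ k) / exp y" using that by (simp add: exp_diff exp_pair_len)
    then show ?thesis unfolding v_def \<psi>_def
      by (simp add: zeta.pair_coeff_def beta.pair_coeff_def zeta.pair_len_def power2_eq_square algebra_simps)
  qed
  have ps: "pair_sum a \<psi> y = (\<Sum>i\<in>nat_pairs_upto B. a i * \<psi> (zeta.pair_len i - y))"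
    "pair_sum a (\<lambda>u. u * \<psi> u) y = (\<Sum>i\<in>nat_pairs_upto B. a i * ((zeta.pair_len i - y) * \<psi> (zeta.pair_len i - y)))" for a
    unfolding B_def by (rule pair_sum_finite[OF b(1)], simp add: \<psi>0)+
  have "infsum v prime_pairs = sum v (nat_pairs_upto B)"
    by (rule infsum_eq_sum_neutral(2)[OF finite_nat_pairs_upto _ v0]) (auto simp: nat_pairs_upto_def)
  also have "\<dots> = y * (pair_sum zeta.pair_coeff \<psi> y + pair_sum beta.pair_coeff \<psi> y)
       + (pair_sum zeta.pair_coeff (\<lambda>u. u * \<psi> u) y + pair_sum beta.pair_coeff (\<lambda>u. u * \<psi> u) y)"
    unfolding ps sum_distrib_left sum.distrib[symmetric]
    by (rule sum.cong) (simp_all add: v_def algebra_simps)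
  finally have V: "infsum v prime_pairs = \<dots>" .
  have "\<bar>infsum u prime_pairs - infsum v prime_pairs\<bar> \<le> (2 * M\<^sup>2 * (ln B)\<^sup>2) * (2 * (sqrt B * ln B))"
  proof (rule exceptional_sum_diff[OF B])
    fix p k :: nat assume p: "prime p" "0 < k" "B < real (p ^ k)"
    have "\<Phi> (real (p ^ k) / exp y) = 0" using p(3) by (intro \<Phi>) (simp add: B_def pos_le_divide_eq)
    then show "u (p, k) = 0 \<and> v (p, k) = 0" unfolding veq[OF p(1)] by (simp add: u_def)
  next
    fix p :: nat assume p: "prime p" "p \<noteq> 2"
    show "u (p, 1) = v (p, 1)"
      unfolding veq[OF p(1)] using chi4_prime[OF p] by (auto simp: u_def power_mult_distrib)
  next
    fix p k :: nat assume p: "prime p" "0 < k" "real (p ^ k) \<le> B"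
    note nb = nat_pair_bounds[OF p]
    define F where "F = (\<Phi> (real (p ^ k) / exp y))\<^sup>2"
    have "\<bar>\<Phi> t\<bar> \<le> \<bar>M\<bar>" for t using M[of t] by linarith
    then have "F \<le> M\<^sup>2" unfolding F_def abs_le_square_iff[symmetric] .
    moreover have "0 \<le> F" by (simp add: F_def)
    ultimately have F: "0 \<le> F" "F \<le> M\<^sup>2" by simp_all
    have l: "0 \<le> (ln (real p))\<^sup>2" "(ln (real p))\<^sup>2 \<le> real k * (ln (real p))\<^sup>2" "real k * (ln (real p))\<^sup>2 \<le> (ln B)\<^sup>2"
    proof -
      show "(ln (real p))\<^sup>2 \<le> real k * (ln (real p))\<^sup>2" using mult_right_mono[OF nb(2,1)] by (simp add: power2_eq_square mult_ac)
      have "real k * (ln (real p))\<^sup>2 = (real k * ln (real p)) * ln (real p)" by (simp add: power2_eq_square)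
      also have "\<dots> \<le> ln B * ln B" using nb by (intro mult_mono) auto
      finally show "real k * (ln (real p))\<^sup>2 \<le> (ln B)\<^sup>2" by (simp add: power2_eq_square)
    qed simp
    have c: "0 \<le> 1 + chi4 p ^ k" "1 + chi4 p ^ k \<le> 2" using chi4_power_bounds[of p k] by (auto simp: abs_le_iff)
    have v: "0 \<le> v (p, k)" "v (p, k) \<le> 2 * (ln B)\<^sup>2 * M\<^sup>2"
      unfolding veq[OF p(1)] F_def[symmetric] using c l F by (auto intro!: mult_nonneg_nonneg mult_mono order_trans[OF l(2,3)])
    have u: "0 \<le> u (p, k)" "u (p, k) \<le> 2 * (ln B)\<^sup>2 * M\<^sup>2"
    proof -
      have "2 * (ln (real p))\<^sup>2 * F \<le> 2 * (ln B)\<^sup>2 * M\<^sup>2" using l F by (intro mult_mono) auto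
      then show "u (p, k) \<le> 2 * (ln B)\<^sup>2 * M\<^sup>2" by (simp add: u_def F_def power_mult_distrib mult_ac)
    qed (simp add: u_def)
    have "2 * (ln B)\<^sup>2 * M\<^sup>2 = 2 * M\<^sup>2 * (ln B)\<^sup>2" by simp
    then show "\<bar>u (p, k) - v (p, k)\<bar> \<le> 2 * M\<^sup>2 * (ln B)\<^sup>2" using u v by linarith
  qed simp
  moreover have "(\<Sum>i\<in>pairs_upto B \<inter> split_pairs. (pair_weight \<Phi> (exp y) i)\<^sup>2) = infsum u prime_pairs"
    unfolding u_def B_def by (rule split_weight_sum_eq) (simp_all add: \<Phi>)
  ultimately show ?thesis unfolding V by simp
qed

text \<open>At exponent 1 the factor 1 - chi4 p selects p = 3 mod 4 with weight 2. Since the norms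
  are squares, \<Phi>(q^2 / X) depends on 2 (log q - y / 2): the sum lives at scale y / 2, with the
  weight \<psi>(u) = \<Phi>(exp(2 u)).\<close>

lemma inert_weight_sum_approx:
  assumes \<Phi>: "\<And>x. b \<le> x \<Longrightarrow> \<Phi> x = 0" and M: "\<And>x. \<bar>\<Phi> x\<bar> \<le> M" and b: "0 < b" "16 \<le> b * exp y"
  defines "\<psi> \<equiv> \<lambda>u. \<Phi> (exp (2 * u))" and "B \<equiv> sqrt (b * exp y)"
  shows "\<bar>(\<Sum>i\<in>pairs_upto (b * exp y) \<inter> inert_pairs. pair_weight \<Phi> (exp y) i)
    - (pair_sum zeta.pair_coeff \<psi> (y / 2) - pair_sum beta.pair_coeff \<psi> (y / 2))\<bar>
    \<le> (2 * M * ln B) * (2 * (sqrt B * ln B))"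
proof -
  define u where "u = (\<lambda>(p, k). if p mod 4 = 3 then 2 * (\<Phi> ((real (p ^ k))\<^sup>2 / exp y) * ln (real p)) else (0::real))"
  define v where "v i = (zeta.pair_coeff i - beta.pair_coeff i) * \<psi> (zeta.pair_len i - y / 2)" for i
  \<comment> \<open>The hypothesis with 16 becomes B >= 4 after the square root, as the count of
    exceptional pairs requires.\<close>
  have "sqrt (4\<^sup>2) \<le> B" unfolding B_def by (rule real_sqrt_le_mono) (use b in simp)
  then have B: "4 \<le> B" by simp
  have M0: "0 \<le> M" using M[of 0] by linarith
  have Be: "B = sqrt b * exp (y / 2)" 
  proof -
    have "sqrt (exp y) = exp (y / 2)" by (rule real_sqrt_unique) (simp_all add: power2_eq_square exp_add[symmetric])
    then show ?thesis by (simp add: B_def real_sqrt_mult)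
  qed
  have \<psi>0: "\<psi> u = 0" if "ln (sqrt b) \<le> u" for u
  proof -
    have "ln b \<le> 2 * u" using that b(1) by (simp add: ln_sqrt)
    then have "b \<le> exp (2 * u)" using b(1) by (metis exp_ln exp_le_cancel_iff)
    then show ?thesis by (simp add: \<psi>_def \<Phi>)
  qed
  have sb: "0 < sqrt b" using b by simp
  have v0: "v i = 0" if i: "i \<in> prime_pairs" "i \<notin> nat_pairs_upto B" for i
  proof -
    obtain p k where pk: "i = (p, k)" "prime p" using i(1) by (cases i) (auto simp: prime_pairs_def)
    have "exp (ln (sqrt b) + y / 2) \<le> exp (zeta.pair_len i)" using i pk sb by (auto simp: exp_pair_len nat_pairs_upto_def Be exp_add)
    then have "ln (sqrt b) \<le> zeta.pair_len i - y / 2" by simp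
    then show ?thesis by (simp add: v_def \<psi>0)
  qed
  have veq: "v (p, k) = (1 - chi4 p ^ k) * (ln (real p) * \<Phi> ((real (p ^ k))\<^sup>2 / exp y))" if "prime p" for p k
  proof -
    have "exp (2 * (zeta.pair_len (p, k) - y / 2)) = exp (zeta.pair_len (p, k)) ^ 2 / exp y"
      by (simp add: exp_diff right_diff_distrib exp_double)
    then show ?thesis using that
      by (simp add: v_def \<psi>_def exp_pair_len zeta.pair_coeff_def beta.pair_coeff_def algebra_simps)
  qed
  have ps: "pair_sum a \<psi> (y / 2) = (\<Sum>i\<in>nat_pairs_upto B. a i * \<psi> (zeta.pair_len i - y / 2))" for a
    unfolding Be by (rule pair_sum_finite[OF sb]) (rule \<psi>0)
  have "infsum v prime_pairs = sum v (nat_pairs_upto B)"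
    by (rule infsum_eq_sum_neutral(2)[OF finite_nat_pairs_upto _ v0]) (auto simp: nat_pairs_upto_def)
  also have "\<dots> = pair_sum zeta.pair_coeff \<psi> (y / 2) - pair_sum beta.pair_coeff \<psi> (y / 2)"
    unfolding ps sum_subtractf[symmetric]
    by (rule sum.cong) (simp_all add: v_def algebra_simps)
  finally have V: "infsum v prime_pairs = \<dots>" .
  have "\<bar>infsum u prime_pairs - infsum v prime_pairs\<bar> \<le> (2 * M * ln B) * (2 * (sqrt B * ln B))"
  proof (rule exceptional_sum_diff[OF B])
    fix p k :: nat assume p: "prime p" "0 < k" "B < real (p ^ k)"
    have "B\<^sup>2 \<le> (real (p ^ k))\<^sup>2" using p(3) B by (intro power_mono) auto
    then have "b * exp y \<le> (real (p ^ k))\<^sup>2" using b(1) by (simp add: B_def)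
    then have "\<Phi> ((real (p ^ k))\<^sup>2 / exp y) = 0" by (intro \<Phi>) (simp add: pos_le_divide_eq)
    then show "u (p, k) = 0 \<and> v (p, k) = 0" unfolding veq[OF p(1)] by (simp add: u_def)
  next
    fix p :: nat assume p: "prime p" "p \<noteq> 2"
    show "u (p, 1) = v (p, 1)"
      unfolding veq[OF p(1)] using chi4_prime[OF p] by (auto simp: u_def)
  next
    fix p k :: nat assume p: "prime p" "0 < k" "real (p ^ k) \<le> B"
    note nb = nat_pair_bounds[OF p]
    define F where "F = ln (real p) * \<Phi> ((real (p ^ k))\<^sup>2 / exp y)"
    define c where "c = (if p mod 4 = 3 then 2 else 0) - (1 - chi4 p ^ k)"
    have c: "\<bar>c\<bar> \<le> 2" using chi4_power_bounds[of p k] by (auto simp: c_def abs_le_iff)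
    have F: "\<bar>F\<bar> \<le> M * ln B" unfolding F_def abs_mult mult.commute[of M] using nb M by (intro mult_mono) auto
    have "\<bar>u (p, k) - v (p, k)\<bar> = \<bar>c\<bar> * \<bar>F\<bar>"
      unfolding veq[OF p(1)] abs_mult[symmetric] by (simp add: u_def F_def c_def algebra_simps)
    also have "\<dots> \<le> 2 * (M * ln B)" using c F by (intro mult_mono) auto
    finally show "\<bar>u (p, k) - v (p, k)\<bar> \<le> 2 * M * ln B" by simp
  qed (use M0 B in simp)
  moreover have "(\<Sum>i\<in>pairs_upto (b * exp y) \<inter> inert_pairs. pair_weight \<Phi> (exp y) i) = infsum u prime_pairs"
    unfolding u_def by (rule inert_weight_sum_eq) (simp_all add: \<Phi>)
  ultimately show ?thesis unfolding V by simp
qed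

section \<open>Test functions in the exponential variable\<close>

lemma test_function_derivatives:
  "g \<in> test_functions S \<Longrightarrow> ((deriv ^^ n) g has_real_derivative (deriv ^^ Suc n) g x) (at x)"
  by (simp add: test_functions_def smooth_def DERIV_deriv_iff_real_differentiable)

lemma test_function_continuous: "g \<in> test_functions S \<Longrightarrow> continuous_on A g"
  using test_function_derivatives[of g S 0]
  by (intro continuous_at_imp_continuous_on ballI) (auto intro: DERIV_isCont)

lemma in_support: "g x \<noteq> 0 \<Longrightarrow> x \<in> support g"
  unfolding support_def by (rule closure_subset[THEN subsetD]) simp

lemma test_function_support:
  assumes "g \<in> test_functions S"
  shows "\<exists>R>0. \<forall>x. R \<le> \<bar>x\<bar> \<longrightarrow> g x = 0"
proof -
  have "bounded (support g)" using assms by (simp add: test_functions_def compact_imp_bounded)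
  then obtain B where B: "\<And>x. x \<in> support g \<Longrightarrow> norm x \<le> B" unfolding bounded_iff by blast
  have "g x = 0" if "\<bar>B\<bar> + 1 \<le> \<bar>x\<bar>" for x
  proof (rule ccontr)
    assume "g x \<noteq> 0"
    then have "x \<in> support g" by (rule in_support)
    then show False using B[of x] that by simp
  qed
  then show ?thesis by (intro exI[of _ "\<bar>B\<bar> + 1"]) auto
qed

lemma test_function_pos_support:
  assumes g: "g \<in> test_functions {0<..}"
  shows "\<exists>a b. 0 < a \<and> a < b \<and> (\<forall>x. x \<le> a \<or> b \<le> x \<longrightarrow> g x = 0)"
proof (cases "support g = {}")
  case True
  then have "g x = 0" for x using in_support[of g x] by blast
  then show ?thesis by (intro exI[of _ 1] exI[of _ 2]) auto
next
  case False
  have c: "compact (support g)" "support g \<subseteq> {0<..}" using g by (auto simp: test_functions_def)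
  obtain s t where s: "s \<in> support g" "\<And>x. x \<in> support g \<Longrightarrow> s \<le> x"
    and t: "t \<in> support g" "\<And>x. x \<in> support g \<Longrightarrow> x \<le> t"
  proof -
    obtain s where "s \<in> support g" "\<And>x. x \<in> support g \<Longrightarrow> s \<le> x" using compact_attains_inf[OF c(1) False] by blast
    moreover obtain t where "t \<in> support g" "\<And>x. x \<in> support g \<Longrightarrow> x \<le> t" using compact_attains_sup[OF c(1) False] by blast
    ultimately show thesis by (rule that)
  qed
  have s0: "0 < s" using s(1) c(2) by auto
  have "g x = 0" if "x \<le> s / 2 \<or> t + 1 \<le> x" for x
  proof (rule ccontr)
    assume "g x \<noteq> 0"
    then have "x \<in> support g" by (rule in_support)
    then show False using s(2)[of x] t(2)[of x] that s0 by linarith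
  qed
  moreover have "s / 2 < t + 1" using s0 t(2)[OF s(1)] by linarith
  ultimately show ?thesis using s0 by (intro exI[of _ "s / 2"] exI[of _ "t + 1"]) auto
qed

lemma test_function_bounded:
  assumes g: "g \<in> test_functions S"
  shows "\<exists>M. \<forall>x. \<bar>g x\<bar> \<le> M"
proof -
  obtain R where R: "0 < R" "\<And>x. R \<le> \<bar>x\<bar> \<Longrightarrow> g x = 0" using test_function_support[OF g] by auto
  have "bounded (g ` {-R..R})"
    by (intro compact_imp_bounded compact_continuous_image test_function_continuous[OF g]) simp
  then obtain M where M: "\<And>x. x \<in> {-R..R} \<Longrightarrow> norm (g x) \<le> M" unfolding bounded_iff by blast
  have "\<bar>g x\<bar> \<le> \<bar>M\<bar>" for x
  proof (cases "x \<in> {-R..R}")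
    case True
    then show ?thesis using M[OF True] by simp
  next
    case False
    then have "g x = 0" by (intro R(2)) auto
    then show ?thesis by simp
  qed
  then show ?thesis by blast
qed

lemma bump_mult: "bump R f \<Longrightarrow> bump R g \<Longrightarrow> bump R (\<lambda>x. f x * g x)"
  by (simp add: bump_def infdiff_add_mult)

text \<open>The generators are all derivatives of \<open>g\<close> composed with exp(c u), together
  with exp(c u) itself and constants; by the chain rule their derivatives stay in the generated
  algebra. Support away from 0 and from infinity bounds u from below and from above.\<close>

lemma test_function_exp_bump:
  assumes g: "g \<in> test_functions {0<..}" and c: "0 < c"
  shows "\<exists>R. bump R (\<lambda>u. g (exp (c * u)))"
proof -
  obtain a b where ab: "0 < a" "a < b" "\<And>x. x \<le> a \<or> b \<le> x \<Longrightarrow> g x = 0"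
    using test_function_pos_support[OF g] by blast
  define R where "R = (\<bar>ln a\<bar> + \<bar>ln b\<bar>) / c + 1"
  define D where "D n u = (deriv ^^ n) g (exp (c * u))" for n u
  define G where "G = range D \<union> {\<lambda>u. exp (c * u), \<lambda>u. c, \<lambda>u. 0}"
  have e: "((\<lambda>u. exp (c * u)) has_real_derivative c * exp (c * u)) (at u)" for u
    by (auto intro!: derivative_eq_intros)
  have ce: "(\<lambda>u. c * exp (c * u)) \<in> algebra_closure G"
    by (rule algebra_closure.mult; rule algebra_closure.gen) (auto simp: G_def)
  have D0: "infdiff (D 0)"
  proof (rule infdiff_algebra_closure)
    show "D 0 \<in> algebra_closure G" by (rule algebra_closure.gen) (simp add: G_def)
    fix h assume "h \<in> G"
    then consider n where "h = D n" | "h = (\<lambda>u. exp (c * u))" | k where "h = (\<lambda>u. k)" by (auto simp: G_def)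
    then show "\<exists>h' \<in> algebra_closure G. \<forall>x. (h has_real_derivative h' x) (at x)"
    proof cases
      case 1
      have "(\<lambda>u. D (Suc n) u * (c * exp (c * u))) \<in> algebra_closure G"
        by (rule algebra_closure.mult[OF algebra_closure.gen ce]) (simp add: G_def)
      moreover have "(h has_real_derivative D (Suc n) x * (c * exp (c * x))) (at x)" for x
        unfolding 1 D_def by (rule DERIV_chain2[OF test_function_derivatives[OF g] e])
      ultimately show ?thesis by (intro bexI[of _ "\<lambda>u. D (Suc n) u * (c * exp (c * u))"]) auto
    next
      case 2
      show ?thesis unfolding 2 by (intro bexI[OF _ ce] allI e)
    next
      case 3
      have "(\<lambda>u. 0) \<in> algebra_closure G" by (rule algebra_closure.gen) (simp add: G_def)
      moreover have "(h has_real_derivative 0) (at x)" for x unfolding 3 by simp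
      ultimately show ?thesis by (intro bexI[of _ "\<lambda>u. 0"]) auto
    qed
  qed
  have "g (exp (c * u)) = 0" if "R \<le> \<bar>u\<bar>" for u
  proof -
    have "(\<bar>ln a\<bar> + \<bar>ln b\<bar>) / c \<le> \<bar>u\<bar>" using that by (simp add: R_def)
    then have "\<bar>ln a\<bar> + \<bar>ln b\<bar> \<le> c * \<bar>u\<bar>" using c by (simp add: pos_divide_le_eq mult.commute)
    then have "c * u \<le> ln a \<or> ln b \<le> c * u" by (cases "0 \<le> u") auto
    then have "exp (c * u) \<le> exp (ln a) \<or> exp (ln b) \<le> exp (c * u)" by simp
    then show ?thesis using ab by simp
  qed
  moreover have "0 < R" using c by (simp add: R_def add_nonneg_pos)
  moreover have "infdiff (\<lambda>u. g (exp (c * u)))" using D0 by (simp add: D_def[abs_def])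
  ultimately have "bump R (\<lambda>u. g (exp (c * u)))" unfolding bump_def by blast
  then show ?thesis ..
qed

lemma exp_substitution:
  fixes h :: "real \<Rightarrow> real"
  assumes h: "continuous_on {0<..} h" "\<And>x. x \<le> a \<or> b \<le> x \<Longrightarrow> h x = 0" and ab: "0 < a" "a < b" and c: "0 < c"
  shows "(LINT x:{0<..}|lborel. h x) = c * (LINT u|lborel. h (exp (c * u)) * exp (c * u))"
proof -
  define \<alpha> \<beta> where "\<alpha> = ln a / c" and "\<beta> = ln b / c"
  have e: "exp (c * \<alpha>) = a" "exp (c * \<beta>) = b" using ab c by (auto simp: \<alpha>_def \<beta>_def)
  have le: "\<alpha> \<le> \<beta>" using ab c by (simp add: \<alpha>_def \<beta>_def divide_right_mono)
  have "continuous_on {a..b} h" by (rule continuous_on_subset[OF h(1)]) (use ab in auto)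
  then have i: "set_integrable lborel {exp (c * \<alpha>)..exp (c * \<beta>)} h" unfolding e by (rule borel_integrable_atLeastAtMost')
  have s: "(LBINT x. h x * indicator {exp (c * \<alpha>)..exp (c * \<beta>)} x) = (LBINT x. h (exp (c * x)) * (c * exp (c * x)) * indicator {\<alpha>..\<beta>} x)"
    by (rule integral_substitution(2)[OF i _ _ _ le])
      (use c in \<open>auto intro!: derivative_eq_intros continuous_intros\<close>)
  have "(LINT x:{0<..}|lborel. h x) = (LBINT x. h x * indicator {exp (c * \<alpha>)..exp (c * \<beta>)} x)"
    unfolding set_lebesgue_integral_def e
  proof (rule Bochner_Integration.integral_cong)
    fix x show "indicator {0<..} x *\<^sub>R h x = h x * indicator {a..b} x"
      using h(2)[of x] ab by (auto simp: indicator_def)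
  qed simp
  also have "\<dots> = (LBINT x. c * (h (exp (c * x)) * exp (c * x)))"
    unfolding s
  proof (rule Bochner_Integration.integral_cong)
    fix x
    have "h (exp (c * x)) = 0" if "x \<notin> {\<alpha>..\<beta>}"
    proof -
      have "c * x \<le> c * \<alpha> \<or> c * \<beta> \<le> c * x" using that c by (auto simp: not_le)
      then have "exp (c * x) \<le> a \<or> b \<le> exp (c * x)" unfolding e[symmetric] by simp
      then show ?thesis by (rule h(2))
    qed
    then show "h (exp (c * x)) * (c * exp (c * x)) * indicator {\<alpha>..\<beta>} x = c * (h (exp (c * x)) * exp (c * x))"
      by (cases "x \<in> {\<alpha>..\<beta>}") auto
  qed simp
  also have "\<dots> = c * (LINT u|lborel. h (exp (c * u)) * exp (c * u))" by simp
  finally show ?thesis .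
qed

text \<open>The first two follow from x = exp u. For the Mellin transform x = exp(2 u) gives
  x^(-1/2) dx = 2 exp(u) du, matching the weight \<Phi>(exp(2 u)) of the inert sum.\<close>

lemma exp_integral_test_function:
  assumes g: "g \<in> test_functions {0<..}"
  shows "C_norm g = 4 * pi\<^sup>2 * exp_integral (\<lambda>u. (g (exp u))\<^sup>2)"
    and "C_norm' g = 4 * pi\<^sup>2 * exp_integral (\<lambda>u. u * (g (exp u))\<^sup>2)"
    and "mellin g (1 / 2) = 2 * exp_integral (\<lambda>u. g (exp (2 * u)))"
proof -
  obtain a b where ab: "0 < a" "a < b" "\<And>x. x \<le> a \<or> b \<le> x \<Longrightarrow> g x = 0"
    using test_function_pos_support[OF g] by blast
  note cg = test_function_continuous[OF g]
  have "(LINT x:{0<..}|lborel. (g x)\<^sup>2) = 1 * (LINT u|lborel. (g (exp (1 * u)))\<^sup>2 * exp (1 * u))"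
    by (rule exp_substitution[of "\<lambda>x. (g x)\<^sup>2" a b]) (use ab in \<open>auto intro!: continuous_intros cg\<close>)
  then show "C_norm g = 4 * pi\<^sup>2 * exp_integral (\<lambda>u. (g (exp u))\<^sup>2)" by (simp add: C_norm_def exp_integral_def)
  have "(LINT x:{0<..}|lborel. ln x * (g x)\<^sup>2) = 1 * (LINT u|lborel. (ln (exp (1 * u)) * (g (exp (1 * u)))\<^sup>2) * exp (1 * u))"
    by (rule exp_substitution[of "\<lambda>x. ln x * (g x)\<^sup>2" a b]) (use ab in \<open>auto intro!: continuous_intros cg\<close>)
  then show "C_norm' g = 4 * pi\<^sup>2 * exp_integral (\<lambda>u. u * (g (exp u))\<^sup>2)" by (simp add: C_norm'_def exp_integral_def)
  have "(LINT x:{0<..}|lborel. g x * x powr (1/2 - 1)) = 2 * (LINT u|lborel. (g (exp (2 * u)) * exp (2 * u) powr (1/2 - 1)) * exp (2 * u))"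
    by (rule exp_substitution[of "\<lambda>x. g x * x powr (1/2 - 1)" a b]) (use ab in \<open>auto intro!: continuous_intros cg\<close>)
  also have "(\<lambda>u. (g (exp (2 * u)) * exp (2 * u) powr (1/2 - 1)) * exp (2 * u)) = (\<lambda>u. g (exp (2 * u)) * exp u)"
    by (simp add: powr_def mult.assoc exp_add[symmetric])
  finally show "mellin g (1 / 2) = 2 * exp_integral (\<lambda>u. g (exp (2 * u)))" by (simp add: mellin_def exp_integral_def)
qed

subsection \<open>Asymptotics\<close>

text \<open>A class of negligible functions: those tending to \<open>0\<close> unconditionally, those of exponential
  decay under the Riemann hypothesis.\<close>

locale negligible_functions =
  fixes negl :: "(real \<Rightarrow> real) \<Rightarrow> bool"
  assumes add: "negl g \<Longrightarrow> negl h \<Longrightarrow> negl (\<lambda>y. g y + h y)"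
    and dominated: "negl h \<Longrightarrow> \<forall>\<^sub>F y in at_top. \<bar>g y\<bar> \<le> C * \<bar>h y\<bar> \<Longrightarrow> negl g"
    and bounded: "negl g \<Longrightarrow> \<exists>C. \<forall>\<^sub>F y in at_top. \<bar>g y\<bar> \<le> C"
    and exp_negl: "negl (\<lambda>y. exp (- y / 16))"
    and zeta_negl: "bump R f \<Longrightarrow> c = 1 \<or> c = 1 / 2 \<Longrightarrow>
      negl (\<lambda>y. (c * y) * exp (- (c * y)) * (pair_sum zeta.pair_coeff f (c * y) - exp (c * y) * exp_integral f))"
    and beta_negl: "bump R f \<Longrightarrow> c = 1 \<or> c = 1 / 2 \<Longrightarrow>
      negl (\<lambda>y. (c * y) * exp (- (c * y)) * pair_sum beta.pair_coeff f (c * y))"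
begin

lemma cmult: "negl g \<Longrightarrow> negl (\<lambda>y. c * g y)"
  by (rule dominated[of g _ "\<bar>c\<bar>"]) (auto simp: abs_mult)

lemma mult:
  assumes "negl g" "negl h"
  shows "negl (\<lambda>y. g y * h y)"
proof -
  obtain C where "\<forall>\<^sub>F y in at_top. \<bar>g y\<bar> \<le> C" using bounded[OF assms(1)] by blast
  then have "\<forall>\<^sub>F y in at_top. \<bar>g y * h y\<bar> \<le> C * \<bar>h y\<bar>"
    by eventually_elim (simp add: abs_mult mult_right_mono)
  then show ?thesis by (rule dominated[OF assms(2)])
qed

lemma drop_factor:
  assumes "negl (\<lambda>y. (c * y) * exp (- (c * y)) * g y)" "0 < c"
  shows "negl (\<lambda>y. exp (- (c * y)) * g y)"
proof (rule dominated[OF assms(1), where C = "1 / c"])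
  show "\<forall>\<^sub>F y in at_top. \<bar>exp (- (c * y)) * g y\<bar> \<le> 1 / c * \<bar>(c * y) * exp (- (c * y)) * g y\<bar>"
    using eventually_ge_at_top[of 1]
  proof eventually_elim
    case (elim y)
    have "1 * \<bar>exp (- (c * y)) * g y\<bar> \<le> \<bar>y\<bar> * \<bar>exp (- (c * y)) * g y\<bar>" using elim by (intro mult_right_mono) auto
    also have "\<dots> = 1 / c * \<bar>(c * y) * exp (- (c * y)) * g y\<bar>" using assms(2) by (simp add: abs_mult)
    finally show ?case by simp
  qed
qed

lemma poly_exp_negl: "negl (\<lambda>y. y ^ 3 * exp (- y / 4))"
proof (rule dominated[OF exp_negl, where C = 1])
  have "\<forall>\<^sub>F y in at_top. \<bar>y ^ 3 * exp (- y / 4)\<bar> \<le> exp (- y / 16 :: real)" by real_asymp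
  then show "\<forall>\<^sub>F y in at_top. \<bar>y ^ 3 * exp (- y / 4)\<bar> \<le> 1 * \<bar>exp (- y / 16 :: real)\<bar>" by simp
qed

end

lemma eventually_ln_exp_le:
  fixes b :: real
  assumes "0 < b"
  shows "\<forall>\<^sub>F y in at_top. b0 \<le> b * exp y \<and> 1 \<le> b * exp y \<and> 0 \<le> ln (b * exp y) \<and> ln (b * exp y) \<le> 2 * y \<and> 1 \<le> y"
proof -
  have "filterlim (\<lambda>y. b * exp y) at_top at_top" by (rule filterlim_tendsto_pos_mult_at_top[OF tendsto_const assms exp_at_top])
  then have "\<forall>\<^sub>F y in at_top. max 1 b0 \<le> b * exp y" unfolding filterlim_at_top by blast
  then show ?thesis using eventually_ge_at_top[of "max 1 (ln b)"]
  proof eventually_elim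
    case (elim y)
    have "ln (b * exp y) = ln b + y" using assms by (simp add: ln_mult)
    then have "ln (b * exp y) \<le> 2 * y" using elim by simp
    moreover have "0 \<le> ln (b * exp y)" using elim by (intro ln_ge_zero) simp
    ultimately show ?case using elim by simp
  qed
qed

context negligible_functions
begin

text \<open>The exponent 1/4 is set by the inert sum: it is normalised by exp(-y / 2), while its
  exceptional pairs contribute exp(y / 4) times powers of y. The cube is the power of the logarithm
  in the split sum.\<close>

lemma negl_of_bound:
  assumes b: "0 < b"
    and g: "\<And>y. b0 \<le> b * exp y \<Longrightarrow> 1 \<le> b * exp y \<Longrightarrow> 1 \<le> y \<Longrightarrow> 0 \<le> ln (b * exp y) \<Longrightarrow> ln (b * exp y) \<le> 2 * y
      \<Longrightarrow> \<bar>g y\<bar> \<le> D * (y ^ 3 * exp (- y / 4))"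
  shows "negl g"
proof (rule dominated[OF poly_exp_negl])
  show "\<forall>\<^sub>F y in at_top. \<bar>g y\<bar> \<le> D * \<bar>y ^ 3 * exp (- y / 4)\<bar>"
    using eventually_ln_exp_le[OF b, of b0] by eventually_elim (use g in auto)
qed

lemma split_asymptotics:
  assumes \<Phi>: "\<Phi> \<in> test_functions {0<..}" and b: "0 < b" "\<And>x. b \<le> x \<Longrightarrow> \<Phi> x = 0"
  defines "\<psi> \<equiv> \<lambda>u. (\<Phi> (exp u))\<^sup>2"
  shows "negl (\<lambda>y. exp (- y) * (\<Sum>i\<in>pairs_upto (b * exp y) \<inter> split_pairs. (pair_weight \<Phi> (exp y) i)\<^sup>2)
    - (y * exp_integral \<psi> + exp_integral (\<lambda>u. u * \<psi> u)))"
proof -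
  obtain M where M: "\<And>x. \<bar>\<Phi> x\<bar> \<le> M" using test_function_bounded[OF \<Phi>] by blast
  obtain R where "bump R (\<lambda>u. \<Phi> (exp (1 * u)))" using test_function_exp_bump[OF \<Phi> zero_less_one] by blast
  then have \<psi>: "bump R \<psi>" using bump_mult[of R "\<lambda>u. \<Phi> (exp u)" "\<lambda>u. \<Phi> (exp u)"] by (simp add: \<psi>_def power2_eq_square)
  define S where "S y = (\<Sum>i\<in>pairs_upto (b * exp y) \<inter> split_pairs. (pair_weight \<Phi> (exp y) i)\<^sup>2)" for y
  define z where "z f y = pair_sum zeta.pair_coeff f y" for f y
  define t where "t f y = pair_sum beta.pair_coeff f y" for f y
  define \<xi> where "\<xi> u = u * \<psi> u" for u
  have \<xi>: "bump R \<xi>" unfolding \<xi>_def by (rule bump_mult_id[OF \<psi>])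
  define T where "T y = y * (z \<psi> y + t \<psi> y) + (z \<xi> y + t \<xi> y)" for y
  have e0: "negl (\<lambda>y. exp (- y) * (S y - T y))"
  proof (rule negl_of_bound[OF b(1), of 4 _ "32 * M\<^sup>2 * sqrt b"])
    fix y assume y: "4 \<le> b * exp y" "1 \<le> b * exp y" "1 \<le> y" "0 \<le> ln (b * exp y)" "ln (b * exp y) \<le> 2 * y"
    have "sqrt (exp y) = exp (y / 2)" by (rule real_sqrt_unique) (simp_all add: power2_eq_square exp_add[symmetric])
    then have sq: "sqrt (b * exp y) = sqrt b * exp (y / 2)" by (simp add: real_sqrt_mult)
    have "\<bar>S y - T y\<bar> \<le> (2 * M\<^sup>2 * (ln (b * exp y))\<^sup>2) * (2 * (sqrt (b * exp y) * ln (b * exp y)))"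
      using split_weight_sum_approx[of b \<Phi> M y, OF b(2) M b(1) y(1)]
      unfolding S_def T_def z_def t_def \<xi>_def[abs_def] \<psi>_def by simp
    also have "\<dots> = (4 * M\<^sup>2 * sqrt b) * exp (y / 2) * (ln (b * exp y)) ^ 3"
      by (simp add: sq power2_eq_square power3_eq_cube)
    also have "\<dots> \<le> (4 * M\<^sup>2 * sqrt b) * exp (y / 2) * (2 * y) ^ 3"
      using y b(1) by (intro mult_left_mono power_mono) auto
    finally have "exp (- y) * \<bar>S y - T y\<bar> \<le> exp (- y) * ((4 * M\<^sup>2 * sqrt b) * exp (y / 2) * (2 * y) ^ 3)"
      by (rule mult_left_mono) simp
    also have "\<dots> = (32 * M\<^sup>2 * sqrt b) * (y ^ 3 * (exp (- y) * exp (y / 2)))"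
      by (simp add: power3_eq_cube)
    also have "exp (- y) * exp (y / 2) = exp (- y / 2)" by (simp add: exp_add[symmetric])
    also have "(32 * M\<^sup>2 * sqrt b) * (y ^ 3 * exp (- y / 2)) \<le> (32 * M\<^sup>2 * sqrt b) * (y ^ 3 * exp (- y / 4))"
      using y b(1) by (intro mult_left_mono) auto
    finally show "\<bar>exp (- y) * (S y - T y)\<bar> \<le> (32 * M\<^sup>2 * sqrt b) * (y ^ 3 * exp (- y / 4))" by (simp add: abs_mult)
  qed
  \<comment> \<open>Here the saving of a factor y is spent: the sums with weight \<psi> enter
    \<open>T\<close> multiplied by y.\<close>
  have e1: "negl (\<lambda>y. y * exp (- y) * (z \<psi> y - exp y * exp_integral \<psi>))" "negl (\<lambda>y. y * exp (- y) * t \<psi> y)"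
    using zeta_negl[OF \<psi>, of 1] beta_negl[OF \<psi>, of 1] by (simp_all add: z_def t_def)
  have e2: "negl (\<lambda>y. exp (- y) * (z \<xi> y - exp y * exp_integral \<xi>))" "negl (\<lambda>y. exp (- y) * t \<xi> y)"
    using drop_factor[OF zeta_negl[OF \<xi>, of 1]] drop_factor[OF beta_negl[OF \<xi>, of 1]] by (simp_all add: z_def t_def)
  have "negl (\<lambda>y. exp (- y) * (S y - T y) + ((y * exp (- y) * (z \<psi> y - exp y * exp_integral \<psi>) + y * exp (- y) * t \<psi> y)
    + (exp (- y) * (z \<xi> y - exp y * exp_integral \<xi>) + exp (- y) * t \<xi> y)))"
    by (intro add e0 e1 e2)
  also have "(\<lambda>y. exp (- y) * (S y - T y) + ((y * exp (- y) * (z \<psi> y - exp y * exp_integral \<psi>) + y * exp (- y) * t \<psi> y)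
    + (exp (- y) * (z \<xi> y - exp y * exp_integral \<xi>) + exp (- y) * t \<xi> y)))
    = (\<lambda>y. exp (- y) * S y - (y * exp_integral \<psi> + exp_integral \<xi>))"
    by (rule ext) (simp add: T_def exp_minus field_simps)
  finally show ?thesis unfolding S_def \<xi>_def[abs_def] .
qed

text \<open>The prime sums are taken at y / 2, so their main term is exp(y / 2) times the integral,
  half of zeta minus L being the primes 3 mod 4 and the norm logarithm restoring the factor
  2.\<close>

lemma inert_asymptotics:
  assumes \<Phi>: "\<Phi> \<in> test_functions {0<..}" and b: "0 < b" "\<And>x. b \<le> x \<Longrightarrow> \<Phi> x = 0"
  defines "\<psi> \<equiv> \<lambda>u. \<Phi> (exp (2 * u))"
  shows "negl (\<lambda>y. exp (- y / 2) * (\<Sum>i\<in>pairs_upto (b * exp y) \<inter> inert_pairs. pair_weight \<Phi> (exp y) i) - exp_integral \<psi>)"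
proof -
  obtain M where M: "\<And>x. \<bar>\<Phi> x\<bar> \<le> M" using test_function_bounded[OF \<Phi>] by blast
  have M0: "0 \<le> M" using M[of 0] by linarith
  obtain R where \<psi>: "bump R \<psi>" using test_function_exp_bump[OF \<Phi>, of 2] unfolding \<psi>_def by auto
  define S where "S y = (\<Sum>i\<in>pairs_upto (b * exp y) \<inter> inert_pairs. pair_weight \<Phi> (exp y) i)" for y
  define z where "z y = pair_sum zeta.pair_coeff \<psi> y" for y
  define t where "t y = pair_sum beta.pair_coeff \<psi> y" for y
  have e0: "negl (\<lambda>y. exp (- y / 2) * (S y - (z (y / 2) - t (y / 2))))"
  proof (rule negl_of_bound[OF b(1), of 16 _ "4 * M * sqrt (sqrt b)"])
    fix y assume y: "16 \<le> b * exp y" "1 \<le> b * exp y" "1 \<le> y" "0 \<le> ln (b * exp y)" "ln (b * exp y) \<le> 2 * y"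
    define B where "B = sqrt (b * exp y)"
    have se: "sqrt (exp x) = exp (x / 2)" for x :: real by (rule real_sqrt_unique) (simp_all add: power2_eq_square exp_add[symmetric])
    have sq: "sqrt B = sqrt (sqrt b) * exp (y / 4)" by (simp add: B_def real_sqrt_mult se)
    have "ln B = ln (b * exp y) / 2" unfolding B_def using y(2) by (simp only: ln_sqrt less_le_trans[OF zero_less_one])
    then have lB: "0 \<le> ln B" "ln B \<le> y" using y by linarith+
    have "\<bar>S y - (z (y / 2) - t (y / 2))\<bar> \<le> (2 * M * ln B) * (2 * (sqrt B * ln B))"
      using inert_weight_sum_approx[of b \<Phi> M y, OF b(2) M b(1) y(1)]
      unfolding S_def z_def t_def \<psi>_def B_def by simp
    also have "\<dots> = (4 * M * sqrt (sqrt b)) * exp (y / 4) * (ln B)\<^sup>2"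
      by (simp add: sq power2_eq_square)
    also have "\<dots> \<le> (4 * M * sqrt (sqrt b)) * exp (y / 4) * y\<^sup>2"
      using lB M0 b(1) by (intro mult_left_mono power_mono) auto
    also have "\<dots> \<le> (4 * M * sqrt (sqrt b)) * exp (y / 4) * y ^ 3"
      using y M0 b(1) by (intro mult_left_mono power_increasing) auto
    finally have "exp (- y / 2) * \<bar>S y - (z (y / 2) - t (y / 2))\<bar> \<le> exp (- y / 2) * ((4 * M * sqrt (sqrt b)) * exp (y / 4) * y ^ 3)"
      by (rule mult_left_mono) simp
    also have "\<dots> = (4 * M * sqrt (sqrt b)) * (y ^ 3 * (exp (- y / 2) * exp (y / 4)))" by simp
    also have "exp (- y / 2) * exp (y / 4) = exp (- y / 4)" by (simp add: exp_add[symmetric])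
    finally show "\<bar>exp (- y / 2) * (S y - (z (y / 2) - t (y / 2)))\<bar> \<le> (4 * M * sqrt (sqrt b)) * (y ^ 3 * exp (- y / 4))" by (simp add: abs_mult)
  qed
  have e: "negl (\<lambda>y. exp (- y / 2) * (z (y / 2) - exp (y / 2) * exp_integral \<psi>))" "negl (\<lambda>y. exp (- y / 2) * t (y / 2))"
    using drop_factor[OF zeta_negl[OF \<psi>, of "1/2"]] drop_factor[OF beta_negl[OF \<psi>, of "1/2"]] by (simp_all add: z_def t_def)
  have "negl (\<lambda>y. exp (- y / 2) * (S y - (z (y / 2) - t (y / 2)))
      + (exp (- y / 2) * (z (y / 2) - exp (y / 2) * exp_integral \<psi>) + (- 1) * (exp (- y / 2) * t (y / 2))))"
    by (intro add cmult e0 e)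
  also have "(\<lambda>y. exp (- y / 2) * (S y - (z (y / 2) - t (y / 2)))
      + (exp (- y / 2) * (z (y / 2) - exp (y / 2) * exp_integral \<psi>) + (- 1) * (exp (- y / 2) * t (y / 2))))
    = (\<lambda>y. exp (- y / 2) * S y - exp_integral \<psi>)"
    by (rule ext) (simp add: exp_minus field_simps)
  finally show ?thesis unfolding S_def .
qed

lemma ramified_negl:
  assumes \<Phi>: "\<Phi> \<in> test_functions {0<..}" and b: "0 < b" and A: "A \<subseteq> ramified_pairs"
  shows "negl (\<lambda>y. exp (- y / 2) * (\<Sum>i\<in>pairs_upto (b * exp y) \<inter> A. pair_weight \<Phi> (exp y) i))"
proof -
  obtain M where M: "\<And>x. \<bar>\<Phi> x\<bar> \<le> M" using test_function_bounded[OF \<Phi>] by blast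
  have M0: "0 \<le> M" using M[of 0] by linarith
  show ?thesis
  proof (rule negl_of_bound[OF b, of 1 _ "8 * M"])
    fix y assume y: "1 \<le> b * exp y" "1 \<le> y" "0 \<le> ln (b * exp y)" "ln (b * exp y) \<le> 2 * y"
    define S where "S = (\<Sum>i\<in>pairs_upto (b * exp y) \<inter> A. pair_weight \<Phi> (exp y) i)"
    have "\<bar>S\<bar> \<le> (M * ln (b * exp y)) * (2 * ln (b * exp y))"
      unfolding S_def by (rule ramified_weight_sum_bound[OF M y(1) A])
    also have "\<dots> = (2 * M) * (ln (b * exp y))\<^sup>2" by (simp add: power2_eq_square)
    also have "\<dots> \<le> (2 * M) * (2 * y)\<^sup>2" using y M0 by (intro mult_left_mono power_mono) auto
    also have "\<dots> = (8 * M) * y\<^sup>2" by (simp add: power_mult_distrib)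
    also have "\<dots> \<le> (8 * M) * y ^ 3" using y M0 by (intro mult_left_mono power_increasing) auto
    finally have "exp (- y / 2) * \<bar>S\<bar> \<le> exp (- y / 4) * ((8 * M) * y ^ 3)"
      using y by (intro mult_mono) auto
    then show "\<bar>exp (- y / 2) * S\<bar> \<le> (8 * M) * (y ^ 3 * exp (- y / 4))" by (simp add: abs_mult mult_ac)
  qed
qed

text \<open>With I the limit of the normalised inert sum, the class of angle 0 contributes I^2, and
  4 pi^2 I^2 = pi^2 (2 I)^2 is the Mellin term. Even powers of 1 + i only perturb the sum before
  squaring, and odd ones form a negligible square of their own.\<close>

lemma equal_angle_asymptotics:
  assumes \<Phi>: "\<Phi> \<in> test_functions {0<..}" and b: "0 < b" "\<And>x. b \<le> x \<Longrightarrow> \<Phi> x = 0"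
  shows "negl (\<lambda>y. 4 * pi\<^sup>2 * (exp (- y) * equal_angle_sum \<Phi> (exp y) (b * exp y))
    - (C_norm \<Phi> * y + C_norm' \<Phi> + pi\<^sup>2 * (mellin \<Phi> (1 / 2))\<^sup>2))"
proof -
  define I where "I = exp_integral (\<lambda>u. \<Phi> (exp (2 * u)))"
  define m where "m y = y * exp_integral (\<lambda>u. (\<Phi> (exp u))\<^sup>2) + exp_integral (\<lambda>u. u * (\<Phi> (exp u))\<^sup>2)" for y
  define S where "S y = (\<Sum>i\<in>pairs_upto (b * exp y) \<inter> split_pairs. (pair_weight \<Phi> (exp y) i)\<^sup>2)" for y
  define W where "W A y = (\<Sum>i\<in>pairs_upto (b * exp y) \<inter> A. pair_weight \<Phi> (exp y) i)" for A y
  define ev where "ev = {i \<in> ramified_pairs. even (snd i)}"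
  define z where "z y = exp (- y / 2) * W inert_pairs y - I + exp (- y / 2) * W ev y" for y
  define r where "r y = exp (- y / 2) * W odd_ramified_pairs y" for y
  have s: "negl (\<lambda>y. exp (- y) * S y - m y)" unfolding S_def m_def by (rule split_asymptotics[OF \<Phi> b])
  have z: "negl z" unfolding z_def W_def I_def
    by (intro add inert_asymptotics[OF \<Phi> b] ramified_negl[OF \<Phi> b(1)]) (auto simp: ev_def)
  have r: "negl r" unfolding r_def W_def by (rule ramified_negl[OF \<Phi> b(1)]) (auto simp: odd_ramified_pairs_def)
  have Wz: "W angle_zero_pairs y = W inert_pairs y + W ev y" for y
    unfolding W_def angle_zero_pairs_def ev_def[symmetric] Int_Un_distrib
    by (rule sum.union_disjoint) (use prime_pairs_partition(3) in \<open>auto simp: finite_pairs_upto ev_def\<close>)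
  have ex: "exp (- y) = exp (- y / 2) * exp (- y / 2)" for y :: real by (simp add: exp_add[symmetric])
  have main: "exp (- y) * equal_angle_sum \<Phi> (exp y) (b * exp y) = exp (- y) * S y + (I + z y)\<^sup>2 + (r y)\<^sup>2" for y
  proof -
    have "I + z y = exp (- y / 2) * W angle_zero_pairs y" by (simp add: z_def Wz algebra_simps)
    then have "(I + z y)\<^sup>2 = exp (- y) * (W angle_zero_pairs y)\<^sup>2" unfolding ex power2_eq_square by (simp only: mult_ac)
    moreover have "(r y)\<^sup>2 = exp (- y) * (W odd_ramified_pairs y)\<^sup>2" unfolding r_def ex power2_eq_square by (simp only: mult_ac)
    ultimately show ?thesis
      unfolding equal_angle_sum_eq S_def[symmetric] W_def[symmetric] by (simp only: distrib_left)
  qed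
  have c: "C_norm \<Phi> * y + C_norm' \<Phi> + pi\<^sup>2 * (mellin \<Phi> (1 / 2))\<^sup>2 = 4 * pi\<^sup>2 * (m y + I\<^sup>2)" for y
    unfolding exp_integral_test_function[OF \<Phi>] I_def[symmetric] m_def by (simp add: algebra_simps power_mult_distrib)
  have "negl (\<lambda>y. (4 * pi\<^sup>2) * ((exp (- y) * S y - m y) + ((2 * I) * z y + (z y * z y + r y * r y))))"
    by (intro cmult add mult s z r)
  also have "(\<lambda>y. (4 * pi\<^sup>2) * ((exp (- y) * S y - m y) + ((2 * I) * z y + (z y * z y + r y * r y))))
    = (\<lambda>y. 4 * pi\<^sup>2 * (exp (- y) * equal_angle_sum \<Phi> (exp y) (b * exp y))
    - (C_norm \<Phi> * y + C_norm' \<Phi> + pi\<^sup>2 * (mellin \<Phi> (1 / 2))\<^sup>2))"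
    unfolding main c by (rule ext) (simp only: algebra_simps power2_eq_square)
  finally show ?thesis .
qed

end

section \<open>The two classes of negligible functions\<close>

lemma negligible_tendsto: "negligible_functions (\<lambda>g. (g \<longlongrightarrow> 0) at_top)"
proof
  show "((\<lambda>y. g y + h y) \<longlongrightarrow> 0) at_top" if "(g \<longlongrightarrow> 0) at_top" "(h \<longlongrightarrow> 0) at_top" for g h :: "real \<Rightarrow> real"
    using that by (rule tendsto_add_zero)
  show "(g \<longlongrightarrow> 0) at_top" if "(h \<longlongrightarrow> 0) at_top" "\<forall>\<^sub>F y in at_top. \<bar>g y\<bar> \<le> C * \<bar>h y\<bar>" for g h :: "real \<Rightarrow> real" and C
    using that(1) by (rule tendsto_0_le[where K=C]) (use that(2) in \<open>simp add: mult.commute\<close>)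
  show "\<exists>C. \<forall>\<^sub>F y in at_top. \<bar>g y\<bar> \<le> C" if "(g \<longlongrightarrow> 0) at_top" for g :: "real \<Rightarrow> real"
  proof -
    have "\<forall>\<^sub>F y in at_top. dist (g y) 0 < 1" using that zero_less_one by (rule tendstoD)
    then have "\<forall>\<^sub>F y in at_top. \<bar>g y\<bar> \<le> 1" by eventually_elim simp
    then show ?thesis ..
  qed
  show "((\<lambda>y::real. exp (- y / 16)) \<longlongrightarrow> 0) at_top" by real_asymp
  have c: "filterlim (\<lambda>y. c * y) at_top at_top" if "c = 1 \<or> c = 1 / 2" for c :: real
    using that by (intro filterlim_tendsto_pos_mult_at_top[OF tendsto_const] filterlim_ident) auto
  show "((\<lambda>y. (c * y) * exp (- (c * y)) * (pair_sum zeta.pair_coeff f (c * y) - exp (c * y) * exp_integral f)) \<longlongrightarrow> 0) at_top"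
    if "bump R f" "c = 1 \<or> c = 1 / 2" for R f c
    by (rule filterlim_compose[OF pair_sum_asymptotics(1)[OF that(1)] c[OF that(2)]])
  show "((\<lambda>y. (c * y) * exp (- (c * y)) * pair_sum beta.pair_coeff f (c * y)) \<longlongrightarrow> 0) at_top"
    if "bump R f" "c = 1 \<or> c = 1 / 2" for R f c
    by (rule filterlim_compose[OF pair_sum_asymptotics(2)[OF that(1)] c[OF that(2)]])
qed

text \<open>The rate 1/16 comes from the inert sum at scale y / 2: an error exp(3 y / 8) against a
  main term exp(y / 2) leaves exp(-y / 8), and half of this exponent absorbs the extra factor
  y.\<close>

lemma negligible_GRH:
  assumes GRH
  shows "negligible_functions (\<lambda>g. \<exists>C. \<forall>\<^sub>F y in at_top. \<bar>g y\<bar> \<le> C * exp (- y / 16))"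
proof
  note grh = GRH_dedekind[OF assms]
  show "\<exists>C. \<forall>\<^sub>F y in at_top. \<bar>g y + h y\<bar> \<le> C * exp (- y / 16)"
    if gh: "\<exists>C. \<forall>\<^sub>F y in at_top. \<bar>g y\<bar> \<le> C * exp (- y / 16)" "\<exists>C. \<forall>\<^sub>F y in at_top. \<bar>h y\<bar> \<le> C * exp (- y / 16)" for g h :: "real \<Rightarrow> real"
  proof -
    obtain C D where "\<forall>\<^sub>F y in at_top. \<bar>g y\<bar> \<le> C * exp (- y / 16)" "\<forall>\<^sub>F y in at_top. \<bar>h y\<bar> \<le> D * exp (- y / 16)"
      using gh by blast
    then have "\<forall>\<^sub>F y in at_top. \<bar>g y + h y\<bar> \<le> (C + D) * exp (- y / 16)"
    proof eventually_elim
      case (elim y)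
      then show ?case using abs_triangle_ineq[of "g y" "h y"] by (simp only: distrib_right)
    qed
    then show ?thesis ..
  qed
  show "\<exists>C. \<forall>\<^sub>F y in at_top. \<bar>g y\<bar> \<le> C * exp (- y / 16)"
    if gh: "\<exists>C. \<forall>\<^sub>F y in at_top. \<bar>h y\<bar> \<le> C * exp (- y / 16)" "\<forall>\<^sub>F y in at_top. \<bar>g y\<bar> \<le> C * \<bar>h y\<bar>" for g h :: "real \<Rightarrow> real" and C
  proof -
    obtain D where "\<forall>\<^sub>F y in at_top. \<bar>h y\<bar> \<le> D * exp (- y / 16)" using gh(1) by blast
    then have "\<forall>\<^sub>F y in at_top. \<bar>g y\<bar> \<le> (\<bar>C\<bar> * D) * exp (- y / 16)" using gh(2)
    proof eventually_elim
      case (elim y)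
      have "C * \<bar>h y\<bar> \<le> \<bar>C\<bar> * \<bar>h y\<bar>" by (intro mult_right_mono) auto
      also have "\<dots> \<le> \<bar>C\<bar> * (D * exp (- y / 16))" using elim by (intro mult_left_mono) auto
      finally show ?case using elim by simp
    qed
    then show ?thesis ..
  qed
  show "\<exists>C. \<forall>\<^sub>F y in at_top. \<bar>g y\<bar> \<le> C" if g: "\<exists>C. \<forall>\<^sub>F y in at_top. \<bar>g y\<bar> \<le> C * exp (- y / 16)" for g :: "real \<Rightarrow> real"
  proof -
    obtain D where "\<forall>\<^sub>F y in at_top. \<bar>g y\<bar> \<le> D * exp (- y / 16)" using g by blast
    then have "\<forall>\<^sub>F y in at_top. \<bar>g y\<bar> \<le> \<bar>D\<bar>" using eventually_ge_at_top[of 0]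
    proof eventually_elim
      case (elim y)
      have "D * exp (- y / 16) \<le> \<bar>D\<bar> * 1" using elim by (intro mult_mono) auto
      then show ?case using elim by simp
    qed
    then show ?thesis ..
  qed
  show "\<exists>C. \<forall>\<^sub>F y in at_top. \<bar>exp (- y / 16)\<bar> \<le> C * exp (- y / 16 :: real)" by (intro exI[of _ 1]) simp
  have ex: "\<forall>\<^sub>F y in at_top. y * exp (- y / 8) \<le> exp (- y / 16 :: real)" by real_asymp
  have b: "\<exists>C. \<forall>\<^sub>F y in at_top. \<bar>(c * y) * exp (- (c * y)) * h (c * y)\<bar> \<le> C * exp (- y / 16)"
    if h: "\<forall>y\<ge>R. \<bar>h y\<bar> \<le> C * exp (3/4 * y)" and c: "c = 1 \<or> c = 1 / 2" for h :: "real \<Rightarrow> real" and R C c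
  proof -
    have "\<forall>\<^sub>F y in at_top. \<bar>(c * y) * exp (- (c * y)) * h (c * y)\<bar> \<le> \<bar>C\<bar> * exp (- y / 16)"
      using ex eventually_ge_at_top[of "max 0 (2 * R)"]
    proof eventually_elim
      case (elim y)
      have "R \<le> c * y \<and> 0 \<le> c * y \<and> c * y \<le> y \<and> y / 2 \<le> c * y" (is ?P)
        using c
      proof
        assume c: "c = 1 / 2" show ?P unfolding c using elim by simp
      qed (use elim in simp)
      then have cy: "R \<le> c * y" "0 \<le> c * y" "c * y \<le> y" "y / 2 \<le> c * y" by simp_all
      have "C * exp (3/4 * (c * y)) \<le> \<bar>C\<bar> * exp (3/4 * (c * y))" by (intro mult_right_mono) auto
      then have "\<bar>h (c * y)\<bar> \<le> \<bar>C\<bar> * exp (3/4 * (c * y))" using h cy(1) by (meson order_trans)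
      then have "\<bar>(c * y) * exp (- (c * y)) * h (c * y)\<bar> \<le> (c * y) * exp (- (c * y)) * (\<bar>C\<bar> * exp (3/4 * (c * y)))"
        unfolding abs_mult[of "(c * y) * exp (- (c * y))"] using cy(2) by (intro mult_mono) auto
      also have "\<dots> = \<bar>C\<bar> * ((c * y) * (exp (- (c * y)) * exp (3/4 * (c * y))))" by (simp only: mult_ac)
      also have "exp (- (c * y)) * exp (3/4 * (c * y)) = exp (- (c * y) / 4)" by (simp add: exp_add[symmetric])
      also have "\<bar>C\<bar> * ((c * y) * exp (- (c * y) / 4)) \<le> \<bar>C\<bar> * (y * exp (- y / 8))"
        using cy by (intro mult_left_mono mult_mono) auto
      also have "\<dots> \<le> \<bar>C\<bar> * exp (- y / 16)" using elim by (intro mult_left_mono) auto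
      finally show ?case .
    qed
    then show ?thesis ..
  qed
  show "\<exists>C. \<forall>\<^sub>F y in at_top. \<bar>(c * y) * exp (- (c * y)) * (pair_sum zeta.pair_coeff f (c * y) - exp (c * y) * exp_integral f)\<bar> \<le> C * exp (- y / 16)"
    if f: "bump R f" and c: "c = 1 \<or> c = 1 / 2" for R f c
  proof -
    obtain C where "\<forall>y\<ge>R. \<bar>pair_sum zeta.pair_coeff f y - exp y * exp_integral f\<bar> \<le> C * exp (3/4 * y)"
      using pair_sum_GRH(1)[OF f grh] by blast
    then show ?thesis using c by (rule b)
  qed
  show "\<exists>C. \<forall>\<^sub>F y in at_top. \<bar>(c * y) * exp (- (c * y)) * pair_sum beta.pair_coeff f (c * y)\<bar> \<le> C * exp (- y / 16)"
    if f: "bump R f" and c: "c = 1 \<or> c = 1 / 2" for R f c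
  proof -
    obtain C where "\<forall>y. \<bar>pair_sum beta.pair_coeff f y\<bar> \<le> C * exp (3/4 * y)"
      using pair_sum_GRH(2)[OF f grh] by blast
    then have "\<forall>y\<ge>0. \<bar>pair_sum beta.pair_coeff f y\<bar> \<le> C * exp (3/4 * y)" by simp
    then show ?thesis using c by (rule b)
  qed
qed

section \<open>The normalised variance\<close>

lemma test_function_square_integral_pos:
  assumes f: "f \<in> test_functions S" and nz: "f x \<noteq> 0"
  shows "0 < (LINT y|lborel. (f y)\<^sup>2)"
proof -
  obtain R where R: "0 < R" "\<And>x. R \<le> \<bar>x\<bar> \<Longrightarrow> f x = 0" using test_function_support[OF f] by auto
  have c: "continuous_on {-R..R} (\<lambda>y. (f y)\<^sup>2)" by (intro continuous_intros test_function_continuous[OF f])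
  have x: "x \<in> {-R..R}" 
  proof (rule ccontr)
    assume "x \<notin> {-R..R}"
    then have "R \<le> \<bar>x\<bar>" by auto
    then show False using R(2) nz by blast
  qed
  have i: "set_integrable lborel {-R..R} (\<lambda>y. (f y)\<^sup>2)" by (rule borel_integrable_atLeastAtMost'[OF c])
  have "(LINT y|lborel. (f y)\<^sup>2) = (LINT y:{-R..R}|lborel. (f y)\<^sup>2)"
    unfolding set_lebesgue_integral_def
  proof (rule Bochner_Integration.integral_cong)
    fix y show "(f y)\<^sup>2 = indicator {-R..R} y *\<^sub>R (f y)\<^sup>2"
      using R(2)[of y] by (cases "y \<in> {-R..R}") auto
  qed simp
  also have "\<dots> = integral {-R..R} (\<lambda>y. (f y)\<^sup>2)" by (rule set_borel_integral_eq_integral(2)[OF i])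
  finally have e: "(LINT y|lborel. (f y)\<^sup>2) = integral {-R..R} (\<lambda>y. (f y)\<^sup>2)" .
  have "integral {-R..R} (\<lambda>y. (f y)\<^sup>2) \<noteq> 0"
  proof
    assume "integral {-R..R} (\<lambda>y. (f y)\<^sup>2) = 0"
    then have "\<forall>y\<in>{-R..R}. (f y)\<^sup>2 = 0"
      by (subst (asm) integral_eq_0_iff[OF c]) (use R(1) in auto)
    then have "(f x)\<^sup>2 = 0" using x by (rule bspec)
    then show False using nz by simp
  qed
  moreover have "0 \<le> integral {-R..R} (\<lambda>y. (f y)\<^sup>2)" by (rule integral_nonneg[OF integrable_continuous_real[OF c]]) simp
  ultimately show ?thesis unfolding e by simp
qed

lemma powr_ln_square_tendsto:
  fixes \<delta> :: real
  assumes "0 < \<delta>"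
  shows "((\<lambda>X. (ln X)\<^sup>2 * X powr (- \<delta>)) \<longlongrightarrow> 0) at_top"
  using assms by real_asymp

text \<open>The square of the mean is bounded trivially: the total weight is O(X log X), so the mean
  is O(X log X / K), and its square divided by a normalisation of order X / K is O((log X)^2 X /
  K).\<close>

lemma psi_var_normalized:
  assumes f: "f \<in> test_functions UNIV" "f x \<noteq> 0" and \<Phi>: "\<Phi> \<in> test_functions {0<..}"
    and b: "0 < b" "\<And>x. b \<le> x \<Longrightarrow> \<Phi> x = 0" and l: "l > 1"
  shows "\<exists>Q. \<forall>\<^sub>F X in at_top. \<bar>psi_var f \<Phi> (X powr l) X / (C_angle f * X powr (1 - l))
      - 4 * pi\<^sup>2 * (equal_angle_sum \<Phi> X (b * X) / X)\<bar> \<le> Q * ((ln X)\<^sup>2 * X powr (- (l - 1)))"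
proof -
  obtain R where R: "0 < R" "\<And>x. R \<le> \<bar>x\<bar> \<Longrightarrow> f x = 0" using test_function_support[OF f(1)] by auto
  obtain M where M: "\<And>x. \<bar>\<Phi> x\<bar> \<le> M" using test_function_bounded[OF \<Phi>] by blast
  have M0: "0 \<le> M" using M[of 0] by linarith
  define J where "J = (LINT y|lborel. (f y)\<^sup>2)"
  define H where "H = (LINT y|lborel. f y)"
  have J: "0 < J" unfolding J_def by (rule test_function_square_integral_pos[OF f])
  define Q where "Q = 4 * pi\<^sup>2 / J * (H * (4 * M * b))\<^sup>2"
  have g: "filterlim (\<lambda>X. X powr (l - 1)) at_top at_top" "filterlim (\<lambda>X. X powr l) at_top at_top"
    using l by real_asymp+
  have "\<forall>\<^sub>F X in at_top. \<bar>psi_var f \<Phi> (X powr l) X / (C_angle f * X powr (1 - l))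
      - 4 * pi\<^sup>2 * (equal_angle_sum \<Phi> X (b * X) / X)\<bar> \<le> Q * ((ln X)\<^sup>2 * X powr (- (l - 1)))"
    using eventually_ge_at_top[of "max 1 (max b (1 / b))"]
      g(1)[unfolded filterlim_at_top, rule_format, of "pi * R * b"]
      g(2)[unfolded filterlim_at_top_dense, rule_format, of "2 * R"]
  proof eventually_elim
    case (elim X)
    have X: "0 < X" "1 \<le> X" "b \<le> X" "1 / b \<le> X" using elim(1) by auto
    then have bX: "1 \<le> b * X" using b(1) by (simp add: pos_divide_le_eq mult.commute)
    define K where "K = X powr l"
    have K: "0 < K" using X by (simp add: K_def)
    have KX: "K = X * X powr (l - 1)" using X by (simp add: K_def powr_diff)
    have "pi * R * (b * X) \<le> K" unfolding KX using elim(2) X by (simp add: mult_ac)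
    then have cond: "pi * R / K \<le> 1 / (b * X)" using K bX by (simp add: divide_simps mult_ac)
    define E W where "E = equal_angle_sum \<Phi> X (b * X)" and "W = (\<Sum>i\<in>pairs_upto (b * X). pair_weight \<Phi> X i)"
    have var: "psi_var f \<Phi> K X = (1 / K) * J * E - ((1 / K) * H * W)\<^sup>2"
      unfolding J_def H_def E_def W_def
      by (rule psi_var_eq[OF R(2) test_function_continuous[OF f(1)] b(2) X(1) _ R(1) cond]) (use elim(3) in \<open>simp_all add: K_def\<close>)
    have p: "X powr (1 - l) = X / K" using X by (simp add: K_def powr_diff)
    have C: "C_angle f = J / (4 * pi\<^sup>2)" by (simp add: C_angle_def J_def)
    have "psi_var f \<Phi> K X / (C_angle f * X powr (1 - l)) - 4 * pi\<^sup>2 * (E / X) = - (4 * pi\<^sup>2 / J * (H * W)\<^sup>2 / (K * X))"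
      unfolding var p C using J K X by (simp add: field_simps power2_eq_square)
    then have "\<bar>psi_var f \<Phi> K X / (C_angle f * X powr (1 - l)) - 4 * pi\<^sup>2 * (E / X)\<bar> = 4 * pi\<^sup>2 / J * (H * W)\<^sup>2 / (K * X)"
      using J K X by simp
    also have "\<dots> \<le> 4 * pi\<^sup>2 / J * ((H * (4 * M * b))\<^sup>2 * ((ln X)\<^sup>2 * X\<^sup>2)) / (K * X)"
    proof -
      have "ln (b * X) \<le> ln (X * X)" using X b(1) by (intro ln_mono mult_right_mono) auto
      then have lX: "ln (b * X) \<le> 2 * ln X" using X by (simp add: ln_mult)
      have "\<bar>W\<bar> \<le> (M * ln (b * X)) * (2 * (b * X))" unfolding W_def by (rule weight_sum_bound[OF M bX])
      also have "\<dots> \<le> (M * (2 * ln X)) * (2 * (b * X))"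
        using M0 lX bX by (intro mult_right_mono mult_left_mono) auto
      finally have W: "\<bar>W\<bar> \<le> (4 * M * b) * (ln X * X)" by (simp add: mult_ac)
      have "W\<^sup>2 = \<bar>W\<bar>\<^sup>2" by simp
      also have "\<dots> \<le> ((4 * M * b) * (ln X * X))\<^sup>2" using W by (intro power_mono) auto
      finally have "H\<^sup>2 * W\<^sup>2 \<le> H\<^sup>2 * ((4 * M * b) * (ln X * X))\<^sup>2" by (rule mult_left_mono) simp
      then have "(H * W)\<^sup>2 \<le> (H * (4 * M * b))\<^sup>2 * ((ln X)\<^sup>2 * X\<^sup>2)" by (simp add: power_mult_distrib mult_ac)
      then show ?thesis using J K X by (intro divide_right_mono mult_left_mono) auto
    qed
    also have "\<dots> = Q * ((ln X)\<^sup>2 * (X\<^sup>2 / (K * X)))" by (simp add: Q_def)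
    also have "X\<^sup>2 / (K * X) = X powr (- (l - 1))" using p X K by (simp add: power2_eq_square)
    finally show ?case unfolding K_def E_def .
  qed
  then show ?thesis by (rule exI[where x = Q])
qed

text \<open>The order of the quantifiers is the point: \<open>g\<close> depends on \<Phi> alone,
  while f and l affect only the constant \<open>Q\<close> of a term with a power saving. This lets
  the final constant depend on \<Phi> only.\<close>

lemma (in negligible_functions) variance_asymptotics:
  assumes \<Phi>: "\<Phi> \<in> test_functions {0<..}"
  shows "\<exists>g. negl g \<and> (\<forall>f l x. f \<in> test_functions UNIV \<longrightarrow> f x \<noteq> 0 \<longrightarrow> l > 1 \<longrightarrow>
    (\<exists>Q. \<forall>\<^sub>F X in at_top. \<bar>psi_var f \<Phi> (X powr l) X / (C_angle f * X powr (1 - l))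
      - (C_norm \<Phi> * ln X + C_norm' \<Phi> + pi\<^sup>2 * (mellin \<Phi> (1 / 2))\<^sup>2)\<bar>
      \<le> \<bar>g (ln X)\<bar> + Q * ((ln X)\<^sup>2 * X powr (- (l - 1)))))"
proof -
  obtain a b where ab: "0 < a" "a < b" "\<And>x. x \<le> a \<or> b \<le> x \<Longrightarrow> \<Phi> x = 0"
    using test_function_pos_support[OF \<Phi>] by blast
  have b: "0 < b" "\<And>x. b \<le> x \<Longrightarrow> \<Phi> x = 0" using ab by auto
  define g where "g y = 4 * pi\<^sup>2 * (exp (- y) * equal_angle_sum \<Phi> (exp y) (b * exp y))
    - (C_norm \<Phi> * y + C_norm' \<Phi> + pi\<^sup>2 * (mellin \<Phi> (1 / 2))\<^sup>2)" for y
  have g: "negl g" unfolding g_def by (rule equal_angle_asymptotics[OF \<Phi> b])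
  have "\<exists>Q. \<forall>\<^sub>F X in at_top. \<bar>psi_var f \<Phi> (X powr l) X / (C_angle f * X powr (1 - l))
      - (C_norm \<Phi> * ln X + C_norm' \<Phi> + pi\<^sup>2 * (mellin \<Phi> (1 / 2))\<^sup>2)\<bar>
      \<le> \<bar>g (ln X)\<bar> + Q * ((ln X)\<^sup>2 * X powr (- (l - 1)))"
    if fl: "f \<in> test_functions UNIV" "f x \<noteq> 0" "l > 1" for f l x
  proof -
    obtain Q where "\<forall>\<^sub>F X in at_top. \<bar>psi_var f \<Phi> (X powr l) X / (C_angle f * X powr (1 - l))
      - 4 * pi\<^sup>2 * (equal_angle_sum \<Phi> X (b * X) / X)\<bar> \<le> Q * ((ln X)\<^sup>2 * X powr (- (l - 1)))"
      using psi_var_normalized[OF fl(1,2) \<Phi> b fl(3)] by blast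
    then have "\<forall>\<^sub>F X in at_top. \<bar>psi_var f \<Phi> (X powr l) X / (C_angle f * X powr (1 - l))
      - (C_norm \<Phi> * ln X + C_norm' \<Phi> + pi\<^sup>2 * (mellin \<Phi> (1 / 2))\<^sup>2)\<bar>
      \<le> \<bar>g (ln X)\<bar> + Q * ((ln X)\<^sup>2 * X powr (- (l - 1)))"
      using eventually_gt_at_top[of 0]
    proof eventually_elim
      case (elim X)
      have "g (ln X) = 4 * pi\<^sup>2 * (equal_angle_sum \<Phi> X (b * X) / X) - (C_norm \<Phi> * ln X + C_norm' \<Phi> + pi\<^sup>2 * (mellin \<Phi> (1 / 2))\<^sup>2)"
        unfolding g_def exp_minus exp_ln[OF elim(2)] divide_inverse mult.commute[of "inverse X"] ..
      note eq = this
      have le: "\<bar>V - m\<bar> \<le> \<bar>s\<bar> + q" if "\<bar>V - t\<bar> \<le> q" "s = t - m" for V m t q s :: real using that by linarith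
      show ?case by (rule le[OF elim(1) eq])
    qed
    then show ?thesis by (rule exI[where x = Q])
  qed
  then show ?thesis using g by blast
qed

theorem theorem1p1:
  fixes l :: real
  assumes "l > 1"
  shows
    "(\<forall>f \<in> test_functions UNIV. \<forall>\<Phi> \<in> test_functions {0<..}.
        (\<forall>x. f (- x) = f x) \<and> (\<exists>x. f x \<noteq> 0) \<longrightarrow>
        (\<lambda>X. psi_var f \<Phi> (X powr l) X / (C_angle f * X powr (1 - l))
              - (C_norm \<Phi> * ln X + C_norm' \<Phi> + pi\<^sup>2 * (mellin \<Phi> (1 / 2))\<^sup>2))
          \<in> o[at_top](\<lambda>X. 1)) \<and>
     (GRH \<longrightarrow>
        (\<exists>\<epsilon>>0. \<forall>\<Phi> \<in> test_functions {0<..}. \<exists>C. \<forall>f \<in> test_functions UNIV.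
           (\<forall>x. f (- x) = f x) \<and> (\<exists>x. f x \<noteq> 0) \<longrightarrow>
           (\<forall>\<^sub>F X in at_top.
              \<bar>psi_var f \<Phi> (X powr l) X / (C_angle f * X powr (1 - l))
                - (C_norm \<Phi> * ln X + C_norm' \<Phi> + pi\<^sup>2 * (mellin \<Phi> (1 / 2))\<^sup>2)\<bar>
              \<le> C * X powr (- \<epsilon>))))"
proof (intro conjI ballI impI)
  interpret negligible_functions "\<lambda>g. (g \<longlongrightarrow> 0) at_top" by (rule negligible_tendsto)
  fix f \<Phi> assume f: "f \<in> test_functions UNIV" and \<Phi>: "\<Phi> \<in> test_functions {0<..}"
    and nz: "(\<forall>x. f (- x) = f x) \<and> (\<exists>x. f x \<noteq> 0)"
  obtain x where x: "f x \<noteq> 0" using nz by blast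
  obtain g where g: "(g \<longlongrightarrow> 0) at_top" and bound: "\<And>f l x. f \<in> test_functions UNIV \<Longrightarrow> f x \<noteq> 0 \<Longrightarrow> l > 1 \<Longrightarrow>
    \<exists>Q. \<forall>\<^sub>F X in at_top. \<bar>psi_var f \<Phi> (X powr l) X / (C_angle f * X powr (1 - l))
      - (C_norm \<Phi> * ln X + C_norm' \<Phi> + pi\<^sup>2 * (mellin \<Phi> (1 / 2))\<^sup>2)\<bar>
      \<le> \<bar>g (ln X)\<bar> + Q * ((ln X)\<^sup>2 * X powr (- (l - 1)))"
    using variance_asymptotics[OF \<Phi>] by auto
  obtain Q where Q: "\<forall>\<^sub>F X in at_top. \<bar>psi_var f \<Phi> (X powr l) X / (C_angle f * X powr (1 - l))
      - (C_norm \<Phi> * ln X + C_norm' \<Phi> + pi\<^sup>2 * (mellin \<Phi> (1 / 2))\<^sup>2)\<bar>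
      \<le> \<bar>g (ln X)\<bar> + Q * ((ln X)\<^sup>2 * X powr (- (l - 1)))"
    using bound[OF f x assms] by blast
  have "((\<lambda>X. \<bar>g (ln X)\<bar>) \<longlongrightarrow> 0) at_top"
    by (intro tendsto_rabs_zero filterlim_compose[OF g ln_at_top])
  moreover have "((\<lambda>X. Q * ((ln X)\<^sup>2 * X powr (- (l - 1)))) \<longlongrightarrow> 0) at_top"
    by (rule tendsto_mult_right_zero[OF powr_ln_square_tendsto]) (use assms in simp)
  ultimately have "((\<lambda>X. \<bar>g (ln X)\<bar> + Q * ((ln X)\<^sup>2 * X powr (- (l - 1)))) \<longlongrightarrow> 0) at_top"
    by (rule tendsto_add_zero)
  then have "((\<lambda>X. psi_var f \<Phi> (X powr l) X / (C_angle f * X powr (1 - l))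
      - (C_norm \<Phi> * ln X + C_norm' \<Phi> + pi\<^sup>2 * (mellin \<Phi> (1 / 2))\<^sup>2)) \<longlongrightarrow> 0) at_top"
    by (rule Lim_null_comparison[rotated]) (use Q in simp)
  then show "(\<lambda>X. psi_var f \<Phi> (X powr l) X / (C_angle f * X powr (1 - l))
      - (C_norm \<Phi> * ln X + C_norm' \<Phi> + pi\<^sup>2 * (mellin \<Phi> (1 / 2))\<^sup>2)) \<in> o[at_top](\<lambda>X. 1)"
    by (intro smalloI_tendsto) simp_all
next
  assume GRH
  then interpret negligible_functions "\<lambda>g. \<exists>C. \<forall>\<^sub>F y in at_top. \<bar>g y\<bar> \<le> C * exp (- y / 16)" by (rule negligible_GRH)
  \<comment> \<open>1/16 is the decay rate of the negligible class. Only half of l - 1 is claimed,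
    because the other half absorbs a logarithmic factor and a constant.\<close>
  define \<epsilon> where "\<epsilon> = min (1 / 16) ((l - 1) / 2)"
  have \<epsilon>: "0 < \<epsilon>" using assms by (simp add: \<epsilon>_def)
  have \<epsilon>_le: "\<epsilon> \<le> 1 / 16" "\<epsilon> \<le> (l - 1) / 2" by (simp_all only: \<epsilon>_def min.cobounded1 min.cobounded2)
  have "\<exists>C. \<forall>f \<in> test_functions UNIV. (\<forall>x. f (- x) = f x) \<and> (\<exists>x. f x \<noteq> 0) \<longrightarrow>
       (\<forall>\<^sub>F X in at_top. \<bar>psi_var f \<Phi> (X powr l) X / (C_angle f * X powr (1 - l))
          - (C_norm \<Phi> * ln X + C_norm' \<Phi> + pi\<^sup>2 * (mellin \<Phi> (1 / 2))\<^sup>2)\<bar> \<le> C * X powr (- \<epsilon>))"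
    if \<Phi>: "\<Phi> \<in> test_functions {0<..}" for \<Phi>
  proof -
    obtain g where g: "\<exists>C. \<forall>\<^sub>F y in at_top. \<bar>g y\<bar> \<le> C * exp (- y / 16)"
      and bound: "\<And>f l x. f \<in> test_functions UNIV \<Longrightarrow> f x \<noteq> 0 \<Longrightarrow> l > 1 \<Longrightarrow>
      \<exists>Q. \<forall>\<^sub>F X in at_top. \<bar>psi_var f \<Phi> (X powr l) X / (C_angle f * X powr (1 - l))
        - (C_norm \<Phi> * ln X + C_norm' \<Phi> + pi\<^sup>2 * (mellin \<Phi> (1 / 2))\<^sup>2)\<bar>
        \<le> \<bar>g (ln X)\<bar> + Q * ((ln X)\<^sup>2 * X powr (- (l - 1)))"
      using variance_asymptotics[OF \<Phi>] by auto
    obtain C where C: "\<forall>\<^sub>F y in at_top. \<bar>g y\<bar> \<le> C * exp (- y / 16)" using g by blast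
    have C': "\<forall>\<^sub>F X in at_top. \<bar>g (ln X)\<bar> \<le> C * exp (- ln X / 16)" by (rule eventually_compose_filterlim[OF C ln_at_top])
    have "\<forall>\<^sub>F X in at_top. \<bar>psi_var f \<Phi> (X powr l) X / (C_angle f * X powr (1 - l))
          - (C_norm \<Phi> * ln X + C_norm' \<Phi> + pi\<^sup>2 * (mellin \<Phi> (1 / 2))\<^sup>2)\<bar> \<le> (\<bar>C\<bar> + 1) * X powr (- \<epsilon>)"
      if f: "f \<in> test_functions UNIV" and nz: "(\<forall>x. f (- x) = f x) \<and> (\<exists>x. f x \<noteq> 0)" for f
    proof -
      obtain x where x: "f x \<noteq> 0" using nz by blast
      obtain Q where Q: "\<forall>\<^sub>F X in at_top. \<bar>psi_var f \<Phi> (X powr l) X / (C_angle f * X powr (1 - l))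
        - (C_norm \<Phi> * ln X + C_norm' \<Phi> + pi\<^sup>2 * (mellin \<Phi> (1 / 2))\<^sup>2)\<bar>
        \<le> \<bar>g (ln X)\<bar> + Q * ((ln X)\<^sup>2 * X powr (- (l - 1)))"
        using bound[OF f x assms] by blast
      \<comment> \<open>\<open>Q\<close> depends on f, but the final constant must not. Half of the
        exponent l - 1 is spent on making \<open>Q * (ln X)\<^sup>2\<close> less than 1, from some X
        on that may depend on f; this accounts for the 1 in
        \<open>\<bar>C\<bar> + 1\<close>.\<close>
      have "((\<lambda>X. Q * ((ln X)\<^sup>2 * X powr (- ((l - 1) / 2)))) \<longlongrightarrow> 0) at_top"
        by (rule tendsto_mult_right_zero[OF powr_ln_square_tendsto]) (use assms in simp)
      then have "\<forall>\<^sub>F X in at_top. Q * ((ln X)\<^sup>2 * X powr (- ((l - 1) / 2))) < 1"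
        by (rule order_tendstoD) simp
      then show ?thesis using Q C' eventually_ge_at_top[of 1]
      proof eventually_elim
        case (elim X)
        have "C * exp (- ln X / 16) \<le> \<bar>C\<bar> * X powr (- \<epsilon>)"
        proof (rule mult_mono)
          have "\<epsilon> * ln X \<le> 1 / 16 * ln X" using \<epsilon>_le(1) elim(4) by (intro mult_right_mono) auto
          then show "exp (- ln X / 16) \<le> X powr (- \<epsilon>)" using elim(4) by (simp add: powr_def)
        qed auto
        moreover have "Q * ((ln X)\<^sup>2 * X powr (- (l - 1))) \<le> X powr (- \<epsilon>)"
        proof -
          have "X powr (- (l - 1)) = X powr (- ((l - 1) / 2)) * X powr (- ((l - 1) / 2))"
            by (simp add: powr_add[symmetric])
          then have "Q * ((ln X)\<^sup>2 * X powr (- (l - 1)))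
              = (Q * ((ln X)\<^sup>2 * X powr (- ((l - 1) / 2)))) * X powr (- ((l - 1) / 2))" by simp
          also have "\<dots> \<le> 1 * X powr (- ((l - 1) / 2))" using elim(1) by (intro mult_right_mono) auto
          also have "\<dots> \<le> X powr (- \<epsilon>)" using \<epsilon>_le(2) elim(4) by (simp add: powr_mono)
          finally show ?thesis .
        qed
        ultimately show ?case using elim(2,3) by (simp only: distrib_right)
      qed
    qed
    then show ?thesis by blast
  qed
  then show "\<exists>\<epsilon>>0. \<forall>\<Phi> \<in> test_functions {0<..}. \<exists>C. \<forall>f \<in> test_functions UNIV.
           (\<forall>x. f (- x) = f x) \<and> (\<exists>x. f x \<noteq> 0) \<longrightarrow>
           (\<forall>\<^sub>F X in at_top.
              \<bar>psi_var f \<Phi> (X powr l) X / (C_angle f * X powr (1 - l))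
                - (C_norm \<Phi> * ln X + C_norm' \<Phi> + pi\<^sup>2 * (mellin \<Phi> (1 / 2))\<^sup>2)\<bar>
              \<le> C * X powr (- \<epsilon>))"
    using \<epsilon> by blast
qed


end
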